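(* Let $X$ be a compact, reduced and connected complex space, let $L$ be a negative holomorphic line bundle over $X$, let $f:(L,X)\to(Z,z_0)$ be the Grauert blow-down of $L$, and let $k_0$ be the initial order of the dual line bundle $L^*$. Then $f:L\to Z$ is the quadratic transform of $Z$ with center $z_0$ if and only if $k_0L^*$ is very ample and $(k_0+1)L^*$ is globally generated.
   Context: All complex spaces are assumed reduced and connected. For a line bundle $M$ and an integer $k$, $kM$ denotes the tensor power $M^{\otimes k}$. $X$ is identified with the zero section of the total space of $L$, which is also denoted $L$. Negative line bundle and Grauert blow-down: a holomorphic line bundle $L$ on $X$ is called negative (in the sense of Grauert) if the zero section $X$ is exceptional in $L$, i.e. there are a complex space $Z$, a point $z_0\in Z$ and a proper holomorphic map $f:L\to Z$ such that $f(X)=\{z_0\}$, $f:L\setminus X\to Z\setminus\{z_0\}$ is biholomorphic, and for every open $U\subseteq Z$ and every holomorphic function $h$ on $f^{-1}(U)$ there is a holomorphic function $g$ on $U$ with $h=g\circ f$. The pointed space $(Z,z_0)$ is unique up to biholomorphic equivalence, and $f:L\to Z$ is called the Grauert blow-down of $L$. (By Grauert, $L$ is negative if and only if $L^*$ is ample.) Initial order: for a holomorphic line bundle $M$ on a compact complex space, the initial order of $M$ is the minimal positive integer $k_0$ such that $k_0M$ has a non-zero global holomorphic section. Quadratic transform: let $\mathfrak m_{z_0}$ be the maximal ideal of the local ring $\mathcal O_{Z,z_0}$ of germs of holomorphic functions on $Z$ at $z_0$, and let $f_1,\dots,f_N$ generate $\mathfrak m_{z_0}$. The construction is local near $z_0$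 (away from $z_0$ the map is an isomorphism), so one may assume, after shrinking $Z$ around $z_0$, that $f_1,\dots,f_N\in\mathcal O(Z)$ and that they have no common zero other than $z_0$. The quadratic transform of $Z$ with center $z_0$ is the closure $Bl_{z_0}(Z)$ of $\{(z,[f_1(z):\cdots:f_N(z)])\in Z\times\mathbb P^{N-1} : z\in Z,\ z\neq z_0\}$ in $Z\times\mathbb P^{N-1}$, together with the map $\pi:Bl_{z_0}(Z)\to Z$ that is the restriction of the projection $Z\times\mathbb P^{N-1}\to Z$. It does not depend on the choice of generators up to isomorphism over $Z$. Saying that $f:L\to Z$ is the quadratic transform of $Z$ with center $z_0$ means that there is a biholomorphic map $F:L\to Bl_{z_0}(Z)$ with $\pi\circ F=f$. *)

theory Defs
  imports "HOL-Analysis.Analysis"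
begin

section \<open>Spaces with a sheaf of complex-valued functions\<close>

text \<open>
  On a reduced complex space the structure sheaf is a sheaf of complex-valued functions, so a
  reduced complex space is encoded as a topology together with, for each open set, its holomorphic
  functions.  Functions are total in HOL: \<open>h \<in> hol X U\<close> only concerns the values of \<open>h\<close> on the
  open set \<open>U\<close>, and \<open>hol X U\<close> is irrelevant for sets \<open>U\<close> that are not open.
\<close>

record 'a fspace =
  topo :: "'a topology"
  hol :: "'a set \<Rightarrow> ('a \<Rightarrow> complex) set"

definition holomorphic_map :: "'a fspace \<Rightarrow> 'b fspace \<Rightarrow> ('a \<Rightarrow> 'b) \<Rightarrow> bool" where
  "holomorphic_map X Y \<phi> \<longleftrightarrow>
     continuous_map (topo X) (topo Y) \<phi> \<and>
     (\<forall>V h. openin (topo Y) V \<and> h \<in> hol Y V \<longrightarrow>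
        h \<circ> \<phi> \<in> hol X {x \<in> topspace (topo X). \<phi> x \<in> V})"

definition biholomorphic_map :: "'a fspace \<Rightarrow> 'b fspace \<Rightarrow> ('a \<Rightarrow> 'b) \<Rightarrow> bool" where
  "biholomorphic_map X Y \<phi> \<longleftrightarrow>
     holomorphic_map X Y \<phi> \<and>
     (\<exists>\<psi>. holomorphic_map Y X \<psi> \<and>
          (\<forall>x \<in> topspace (topo X). \<psi> (\<phi> x) = x) \<and>
          (\<forall>y \<in> topspace (topo Y). \<phi> (\<psi> y) = y))"

text \<open>
  The reduced structure induced on a subset \<open>A\<close>: functions that are locally restrictions of
  holomorphic functions of the ambient space.  It is used for open subsets and for closed
  analytic subsets.
\<close>

definition sub_fspace :: "'a fspace \<Rightarrow> 'a set \<Rightarrow> 'a fspace" where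
  "sub_fspace X A = \<lparr>
     topo = subtopology (topo X) A,
     hol = (\<lambda>U. {h. \<forall>x \<in> U. \<exists>V g. openin (topo X) V \<and> x \<in> V \<and> V \<inter> A \<subseteq> U \<and>
                        g \<in> hol X V \<and> (\<forall>y \<in> V \<inter> A. h y = g y)}) \<rparr>"

definition closed_embedding :: "'a fspace \<Rightarrow> 'b fspace \<Rightarrow> ('a \<Rightarrow> 'b) \<Rightarrow> bool" where
  "closed_embedding X Y \<phi> \<longleftrightarrow>
     closedin (topo Y) (\<phi> ` topspace (topo X)) \<and>
     biholomorphic_map X (sub_fspace Y (\<phi> ` topspace (topo X))) \<phi>"

text \<open>
  The structure pushed forward along a surjection \<open>q\<close>: the quotient topology, a function being
  holomorphic iff its pull-back along \<open>q\<close> is.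
\<close>

definition quotient_fspace :: "'a fspace \<Rightarrow> ('a \<Rightarrow> 'b) \<Rightarrow> 'b fspace" where
  "quotient_fspace X q = \<lparr>
     topo = topology (\<lambda>V. V \<subseteq> q ` topspace (topo X) \<and>
                          openin (topo X) {x \<in> topspace (topo X). q x \<in> V}),
     hol = (\<lambda>V. {h. h \<circ> q \<in> hol X {x \<in> topspace (topo X). q x \<in> V}}) \<rparr>"

lemma openin_quotient_fspace:
  "openin (topo (quotient_fspace X q)) V \<longleftrightarrow>
     V \<subseteq> q ` topspace (topo X) \<and> openin (topo X) {x \<in> topspace (topo X). q x \<in> V}"
proof -
  let ?P = "\<lambda>V. V \<subseteq> q ` topspace (topo X) \<and> openin (topo X) {x \<in> topspace (topo X). q x \<in> V}"
  have "istopology ?P"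
    unfolding istopology_def
  proof (intro conjI allI impI)
    fix S T assume "?P S" "?P T"
    then show "S \<inter> T \<subseteq> q ` topspace (topo X)"
      and "openin (topo X) {x \<in> topspace (topo X). q x \<in> S \<inter> T}"
      using openin_Int[of "topo X" "{x \<in> topspace (topo X). q x \<in> S}"
          "{x \<in> topspace (topo X). q x \<in> T}"]
      by (auto simp: Collect_conj_eq Int_ac)
  next
    fix \<K> assume K: "\<forall>S \<in> \<K>. ?P S"
    then show "\<Union>\<K> \<subseteq> q ` topspace (topo X)" by blast
    have "{x \<in> topspace (topo X). q x \<in> \<Union>\<K>} =
          (\<Union>S \<in> \<K>. {x \<in> topspace (topo X). q x \<in> S})" by auto
    moreover have "openin (topo X) (\<Union>S \<in> \<K>. {x \<in> topspace (topo X). q x \<in> S})"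
      using K by (intro openin_Union) auto
    ultimately show "openin (topo X) {x \<in> topspace (topo X). q x \<in> \<Union>\<K>}" by simp
  qed
  then show ?thesis
    by (simp add: quotient_fspace_def)
qed

definition sum_fspace :: "('i \<Rightarrow> 'a fspace) \<Rightarrow> 'i set \<Rightarrow> ('i \<times> 'a) fspace" where
  "sum_fspace X I = \<lparr>
     topo = sum_topology (\<lambda>i. topo (X i)) I,
     hol = (\<lambda>W. {h. \<forall>i \<in> I. (\<lambda>x. h (i, x)) \<in> hol (X i) {x. (i, x) \<in> W}}) \<rparr>"


section \<open>Complex Euclidean space, projective space and products\<close>

text \<open>
  \<open>\<complex>\<^sup>n\<close> is the set of complex sequences vanishing from index \<open>n\<close> on; the topology inherited from
  the product topology on \<open>nat \<Rightarrow> complex\<close> is the Euclidean one.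
\<close>

definition Cn :: "nat \<Rightarrow> (nat \<Rightarrow> complex) set" where
  "Cn n = {z. \<forall>i \<ge> n. z i = 0}"

definition vec :: "nat \<Rightarrow> (nat \<Rightarrow> complex) \<Rightarrow> nat \<Rightarrow> complex" where
  "vec n c = (\<lambda>i. if i < n then c i else 0)"

definition complex_differentiable_at ::
    "nat \<Rightarrow> ((nat \<Rightarrow> complex) \<Rightarrow> complex) \<Rightarrow> (nat \<Rightarrow> complex) \<Rightarrow> bool" where
  "complex_differentiable_at n h p \<longleftrightarrow>
     (\<exists>a :: nat \<Rightarrow> complex.
        ((\<lambda>z. (h z - h p - (\<Sum>i<n. a i * (z i - p i))) /
               complex_of_real (L2_set (\<lambda>i. cmod (z i - p i)) {..<n})) \<longlongrightarrow> 0)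
        (at p within Cn n))"

definition Cspace :: "nat \<Rightarrow> (nat \<Rightarrow> complex) fspace" where
  "Cspace n = \<lparr> topo = top_of_set (Cn n),
                hol = (\<lambda>U. {h. \<forall>p \<in> U. complex_differentiable_at n h p}) \<rparr>"

definition Cline :: "complex fspace" where
  "Cline = \<lparr> topo = euclidean, hol = (\<lambda>U. {h. h holomorphic_on U}) \<rparr>"

text \<open>
  The structure sheaf of a product is generated by the pull-backs of holomorphic functions from
  the two factors: a function is holomorphic iff locally it is \<open>G(c\<^sub>0, \<dots>, c\<^sub>n\<^sub>-\<^sub>1)\<close> with \<open>G\<close> holomorphic
  on an open subset of \<open>\<complex>\<^sup>n\<close> and each \<open>c\<^sub>i\<close> pulled back from one of the factors.  Taking for the
  \<open>c\<^sub>i\<close> the coordinates of local embeddings of the factors shows that this is the usual structure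
  given by products of local models.
\<close>

definition prod_fspace :: "'a fspace \<Rightarrow> 'b fspace \<Rightarrow> ('a \<times> 'b) fspace" where
  "prod_fspace X Y = \<lparr>
     topo = prod_topology (topo X) (topo Y),
     hol = (\<lambda>W. {h. \<forall>p \<in> W. \<exists>U V n c D G.
        openin (topo X) U \<and> openin (topo Y) V \<and> p \<in> U \<times> V \<and> U \<times> V \<subseteq> W \<and>
        (\<forall>i < n. c i \<in> {a \<circ> fst | a. a \<in> hol X U} \<union> {b \<circ> snd | b. b \<in> hol Y V}) \<and>
        openin (topo (Cspace n)) D \<and> G \<in> hol (Cspace n) D \<and>
        (\<forall>w \<in> U \<times> V. vec n (\<lambda>i. c i w) \<in> D \<and> h w = G (vec n (\<lambda>i. c i w)))}) \<rparr>"

definition proj_class :: "(nat \<Rightarrow> complex) \<Rightarrow> (nat \<Rightarrow> complex) set" where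
  "proj_class z = {w. \<exists>c. c \<noteq> 0 \<and> w = (\<lambda>i. c * z i)}"

text \<open>The projective space of lines in \<open>\<complex>\<^sup>N\<close>, that is, \<open>\<bbbP>\<^sup>N\<^sup>-\<^sup>1\<close>.\<close>

definition Pspace :: "nat \<Rightarrow> (nat \<Rightarrow> complex) set fspace" where
  "Pspace N = quotient_fspace (sub_fspace (Cspace N) (Cn N - {\<lambda>_. 0})) proj_class"


section \<open>Reduced complex spaces\<close>

text \<open>Local models, carrying the reduced structure induced from \<open>\<complex>\<^sup>n\<close>.\<close>

definition local_model :: "nat \<Rightarrow> (nat \<Rightarrow> complex) set \<Rightarrow> bool" where
  "local_model n A \<longleftrightarrow>
     (\<exists>D F. openin (topo (Cspace n)) D \<and> finite F \<and> F \<subseteq> hol (Cspace n) D \<and>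
            A = {z \<in> D. \<forall>h \<in> F. h z = 0})"

definition function_sheaf :: "'a fspace \<Rightarrow> bool" where
  "function_sheaf X \<longleftrightarrow>
     (\<forall>U h g. openin (topo X) U \<and> h \<in> hol X U \<and> (\<forall>x \<in> U. g x = h x) \<longrightarrow> g \<in> hol X U) \<and>
     (\<forall>U V h. openin (topo X) U \<and> openin (topo X) V \<and> V \<subseteq> U \<and> h \<in> hol X U \<longrightarrow> h \<in> hol X V) \<and>
     (\<forall>\<V> h. (\<forall>V \<in> \<V>. openin (topo X) V \<and> h \<in> hol X V) \<longrightarrow> h \<in> hol X (\<Union>\<V>))"

text \<open>Complex spaces are Hausdorff, and reduced and connected by convention.\<close>

definition complex_space :: "'a fspace \<Rightarrow> bool" where
  "complex_space X \<longleftrightarrow>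
     Hausdorff_space (topo X) \<and> connected_space (topo X) \<and> function_sheaf X \<and>
     (\<forall>p \<in> topspace (topo X). \<exists>U n A \<phi>.
        openin (topo X) U \<and> p \<in> U \<and> local_model n A \<and>
        biholomorphic_map (sub_fspace X U) (sub_fspace (Cspace n) A) \<phi>)"


section \<open>Holomorphic line bundles\<close>

text \<open>
  A line bundle is given by a trivialising open cover \<open>(U\<^sub>i)\<close> and its transition functions \<open>g\<^sub>i\<^sub>j\<close>,
  with the convention that the fibre coordinates satisfy \<open>v\<^sub>i = g\<^sub>i\<^sub>j v\<^sub>j\<close> over \<open>U\<^sub>i \<inter> U\<^sub>j\<close>.
\<close>

record ('i, 'a) line_bundle =
  idx :: "'i set"
  triv :: "'i \<Rightarrow> 'a set"
  trans_fun :: "'i \<Rightarrow> 'i \<Rightarrow> 'a \<Rightarrow> complex"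

definition holomorphic_line_bundle :: "'a fspace \<Rightarrow> ('i, 'a) line_bundle \<Rightarrow> bool" where
  "holomorphic_line_bundle X L \<longleftrightarrow>
     (\<forall>i \<in> idx L. openin (topo X) (triv L i)) \<and>
     (\<Union>i \<in> idx L. triv L i) = topspace (topo X) \<and>
     (\<forall>i \<in> idx L. \<forall>j \<in> idx L.
        trans_fun L i j \<in> hol X (triv L i \<inter> triv L j) \<and>
        (\<forall>x \<in> triv L i \<inter> triv L j. trans_fun L i j x \<noteq> 0)) \<and>
     (\<forall>i \<in> idx L. \<forall>j \<in> idx L. \<forall>k \<in> idx L. \<forall>x \<in> triv L i \<inter> triv L j \<inter> triv L k.
        trans_fun L i j x * trans_fun L j k x = trans_fun L i k x)"

definition dual_bundle :: "('i, 'a) line_bundle \<Rightarrow> ('i, 'a) line_bundle" where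
  "dual_bundle L = L \<lparr> trans_fun := (\<lambda>i j x. inverse (trans_fun L i j x)) \<rparr>"

definition tensor_power :: "nat \<Rightarrow> ('i, 'a) line_bundle \<Rightarrow> ('i, 'a) line_bundle" where
  "tensor_power k L = L \<lparr> trans_fun := (\<lambda>i j x. trans_fun L i j x ^ k) \<rparr>"

text \<open>
  The total space: the disjoint union of the \<open>U\<^sub>i \<times> \<complex>\<close>, glued along the transition functions.
  Its points are the equivalence classes of triples \<open>(i, x, v)\<close>.
\<close>

definition bundle_point ::
    "('i, 'a) line_bundle \<Rightarrow> 'i \<times> 'a \<times> complex \<Rightarrow> ('i \<times> 'a \<times> complex) set" where
  "bundle_point L = (\<lambda>(i, x, v). {(j, x, trans_fun L j i x * v) | j. j \<in> idx L \<and> x \<in> triv L j})"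

definition total_space ::
    "'a fspace \<Rightarrow> ('i, 'a) line_bundle \<Rightarrow> ('i \<times> 'a \<times> complex) set fspace" where
  "total_space X L =
     quotient_fspace
       (sum_fspace (\<lambda>i. prod_fspace (sub_fspace X (triv L i)) Cline) (idx L))
       (bundle_point L)"

definition zero_section :: "('i, 'a) line_bundle \<Rightarrow> ('i \<times> 'a \<times> complex) set set" where
  "zero_section L = {bundle_point L (i, x, 0) | i x. i \<in> idx L \<and> x \<in> triv L i}"

text \<open>A global section is given by its coordinates \<open>s\<^sub>i\<close> in the trivialisations.\<close>

definition global_section ::
    "'a fspace \<Rightarrow> ('i, 'a) line_bundle \<Rightarrow> ('i \<Rightarrow> 'a \<Rightarrow> complex) \<Rightarrow> bool" where
  "global_section X M s \<longleftrightarrow>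
     (\<forall>i \<in> idx M. s i \<in> hol X (triv M i)) \<and>
     (\<forall>i \<in> idx M. \<forall>j \<in> idx M. \<forall>x \<in> triv M i \<inter> triv M j. s i x = trans_fun M i j x * s j x)"

definition has_nonzero_section :: "'a fspace \<Rightarrow> ('i, 'a) line_bundle \<Rightarrow> bool" where
  "has_nonzero_section X M \<longleftrightarrow>
     (\<exists>s. global_section X M s \<and> (\<exists>i \<in> idx M. \<exists>x \<in> triv M i. s i x \<noteq> 0))"

definition initial_order :: "'a fspace \<Rightarrow> ('i, 'a) line_bundle \<Rightarrow> nat" where
  "initial_order X M = (LEAST k. 0 < k \<and> has_nonzero_section X (tensor_power k M))"

text \<open>Global sections span every fibre.\<close>

definition globally_generated :: "'a fspace \<Rightarrow> ('i, 'a) line_bundle \<Rightarrow> bool" where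
  "globally_generated X M \<longleftrightarrow>
     (\<forall>i \<in> idx M. \<forall>x \<in> triv M i. \<forall>v. \<exists>s. global_section X M s \<and> s i x = v)"

text \<open>
  Finitely many global sections \<open>s\<^sub>0, \<dots>, s\<^sub>N\<^sub>-\<^sub>1\<close> without common zeros define a closed embedding
  \<open>x \<mapsto> [s\<^sub>0(x) : \<dots> : s\<^sub>N\<^sub>-\<^sub>1(x)]\<close> (the base space is compact in all applications).
\<close>

definition very_ample :: "'a fspace \<Rightarrow> ('i, 'a) line_bundle \<Rightarrow> bool" where
  "very_ample X M \<longleftrightarrow>
     (\<exists>N s \<Phi>. (\<forall>k < N. global_section X M (s k)) \<and>
        (\<forall>i \<in> idx M. \<forall>x \<in> triv M i.
           (\<exists>k < N. s k i x \<noteq> 0) \<and> \<Phi> x = proj_class (vec N (\<lambda>k. s k i x))) \<and>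
        closed_embedding X (Pspace N) \<Phi>)"


section \<open>Grauert blow-down and quadratic transform\<close>

definition grauert_blow_down ::
    "'a fspace \<Rightarrow> ('i, 'a) line_bundle \<Rightarrow> 'c fspace \<Rightarrow> 'c \<Rightarrow>
     (('i \<times> 'a \<times> complex) set \<Rightarrow> 'c) \<Rightarrow> bool" where
  "grauert_blow_down X L Z z0 f \<longleftrightarrow>
     complex_space Z \<and> z0 \<in> topspace (topo Z) \<and>
     holomorphic_map (total_space X L) Z f \<and>
     proper_map (topo (total_space X L)) (topo Z) f \<and>
     f ` zero_section L = {z0} \<and>
     biholomorphic_map
       (sub_fspace (total_space X L) (topspace (topo (total_space X L)) - zero_section L))
       (sub_fspace Z (topspace (topo Z) - {z0})) f \<and>
     (\<forall>U h. openin (topo Z) U \<and>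
        h \<in> hol (total_space X L) {p \<in> topspace (topo (total_space X L)). f p \<in> U} \<longrightarrow>
        (\<exists>g \<in> hol Z U. \<forall>p \<in> topspace (topo (total_space X L)). f p \<in> U \<longrightarrow> h p = g (f p)))"

text \<open>
  HOL cannot quantify over the type of points of \<open>Z\<close>.  Choosing the type of points of the total
  space is no restriction: \<open>Z\<close> is in bijection with the complement of the zero section together
  with one further point.
\<close>

definition negative_line_bundle :: "'a fspace \<Rightarrow> ('i, 'a) line_bundle \<Rightarrow> bool" where
  "negative_line_bundle X L \<longleftrightarrow>
     (\<exists>(Z :: ('i \<times> 'a \<times> complex) set fspace) z0 f. grauert_blow_down X L Z z0 f)"

text \<open>
  The germs at \<open>z0\<close> of \<open>g 0, \<dots>, g (N - 1) \<in> hol Z W\<close> generate the maximal ideal of the local ring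
  at \<open>z0\<close>, which consists of the germs of holomorphic functions vanishing at \<open>z0\<close>.
\<close>

definition generates_maximal_ideal ::
    "'c fspace \<Rightarrow> 'c \<Rightarrow> 'c set \<Rightarrow> nat \<Rightarrow> (nat \<Rightarrow> 'c \<Rightarrow> complex) \<Rightarrow> bool" where
  "generates_maximal_ideal Z z0 W N g \<longleftrightarrow>
     openin (topo Z) W \<and> z0 \<in> W \<and> (\<forall>k < N. g k \<in> hol Z W \<and> g k z0 = 0) \<and>
     (\<forall>V h. openin (topo Z) V \<and> z0 \<in> V \<and> h \<in> hol Z V \<and> h z0 = 0 \<longrightarrow>
        (\<exists>V' c. openin (topo Z) V' \<and> z0 \<in> V' \<and> V' \<subseteq> V \<inter> W \<and> (\<forall>k < N. c k \<in> hol Z V') \<and>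
           (\<forall>z \<in> V'. h z = (\<Sum>k<N. c k z * g k z))))"

text \<open>
  The closure in \<open>Z \<times> \<bbbP>\<^sup>N\<^sup>-\<^sup>1\<close> of the graph of \<open>z \<mapsto> [g\<^sub>0(z) : \<dots> : g\<^sub>N\<^sub>-\<^sub>1(z)]\<close> on \<open>Z - {z0}\<close>, for
  functions \<open>g\<^sub>k\<close> on \<open>Z\<close> whose only common zero is \<open>z0\<close>; the projection to \<open>Z\<close> is \<open>fst\<close>.
\<close>

definition blow_up ::
    "'c fspace \<Rightarrow> 'c \<Rightarrow> nat \<Rightarrow> (nat \<Rightarrow> 'c \<Rightarrow> complex) \<Rightarrow> ('c \<times> (nat \<Rightarrow> complex) set) fspace" where
  "blow_up Z z0 N g =
     sub_fspace (prod_fspace Z (Pspace N))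
       (topo (prod_fspace Z (Pspace N)) closure_of
          {(z, proj_class (vec N (\<lambda>k. g k z))) | z. z \<in> topspace (topo Z) \<and> z \<noteq> z0})"

text \<open>
  Generators of the maximal ideal only exist near \<open>z0\<close>, so the blow-up is formed over a
  neighbourhood \<open>W\<close> of \<open>z0\<close>, and is extended by the identity of \<open>Z - {z0}\<close>.  A biholomorphic map
  over \<open>Z\<close> onto the resulting space amounts to a biholomorphic map over \<open>W\<close> onto the blow-up of
  \<open>W\<close> together with \<open>f\<close> being biholomorphic over \<open>Z - {z0}\<close>; the two automatically agree over
  \<open>W - {z0}\<close>, where the blow-up is isomorphic to \<open>W - {z0}\<close>.
\<close>

definition is_quadratic_transform :: "'b fspace \<Rightarrow> ('b \<Rightarrow> 'c) \<Rightarrow> 'c fspace \<Rightarrow> 'c \<Rightarrow> bool" where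
  "is_quadratic_transform E f Z z0 \<longleftrightarrow>
     holomorphic_map E Z f \<and>
     biholomorphic_map
       (sub_fspace E {p \<in> topspace (topo E). f p \<noteq> z0})
       (sub_fspace Z (topspace (topo Z) - {z0})) f \<and>
     (\<exists>W N g F.
        generates_maximal_ideal Z z0 W N g \<and>
        (\<forall>z \<in> W. (\<forall>k < N. g k z = 0) \<longrightarrow> z = z0) \<and>
        biholomorphic_map
          (sub_fspace E {p \<in> topspace (topo E). f p \<in> W})
          (blow_up (sub_fspace Z W) z0 N g) F \<and>
        (\<forall>p \<in> topspace (topo E). f p \<in> W \<longrightarrow> fst (F p) = f p))"

end

theory Submission
  imports Defs "HOL-Complex_Analysis.Complex_Analysis"
begin

text \<open>
  A function \<open>h\<close> on \<open>Z\<close> near \<open>z0\<close> pulls back to \<open>L\<close> and expands along the fibres as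
  \<open>h (f (x, v)) = \<Sum>\<^sub>k s\<^sub>k(x) v\<^sup>k\<close>, where \<open>s\<^sub>k\<close> is a section of \<open>kL\<^sup>*\<close>; conversely every section
  of \<open>kL\<^sup>*\<close> with \<open>k > 0\<close> descends to an element of the maximal ideal.  So all generators
  \<open>\<gamma>\<^sub>l\<close> of the maximal ideal vanish to order at least \<open>k0\<close> along the zero section.

  If \<open>f\<close> is the quadratic transform, then some generator divides all others near any point of the
  zero section.  With the descent of leading coefficients this makes the order of vanishing locally
  constant, hence equal to \<open>k0\<close> everywhere since \<open>X\<close> is connected.  So the leading
  coefficients of the \<open>\<gamma>\<^sub>l\<close> generate \<open>k0L\<^sup>*\<close>, and the map to projective space that they define is
  the restriction of the embedding \<open>F\<close> to the zero section.  Differentiating the fibre coordinate,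
  as a function of \<open>F\<close>, along the fibre shows that \<open>(k0 + 1)L\<^sup>*\<close> is generated by the coefficients of
  order \<open>k0 + 1\<close> (by squares of sections if \<open>k0 = 1\<close>).

  Conversely, if \<open>k0L\<^sup>*\<close> is very ample, then \<open>\<gamma>\<^sub>l / v\<^sup>k\<^sup>0\<close> have no common zero and define \<open>F\<close>.  A section
  of \<open>(k0 + d)L\<^sup>*\<close> descends to \<open>\<Sum>\<^sub>l c\<^sub>l \<gamma>\<^sub>l\<close>, so that its product with \<open>v\<^sup>d\<close>, divided by one of the
  \<open>\<gamma>\<^sub>l / v\<^sup>k\<^sup>0\<close>, is a holomorphic function of \<open>F\<close>.  The sections of \<open>k0L\<^sup>*\<close> thus recover the point of
  \<open>X\<close>, and those of \<open>(k0 + 1)L\<^sup>*\<close> recover \<open>v\<close>.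
\<close>

section \<open>Holomorphic functions of several variables\<close>

text \<open>\<open>X\<close> and \<open>Z\<close> may be singular, so no calculus is possible in
  local coordinates of the base. Two devices replace it. Taylor coefficients along the fibres are
  values of iterated divided differences, and their holomorphy in the base point comes from Hadamard
  division in an ambient \<open>Cn n\<close>. Derivatives are taken only along a fibre, where a
  function given by finitely many others obeys the chain rule of \<open>Cn n\<close>. The constancy
  of the order of vanishing is the real obstacle in the first direction: without it the leading
  coefficients would not define a map to projective space. The case k0 = 1 is separate because
  functions on \<open>Z\<close> may then have a nonzero first derivative along the fibres, so that
  the derivative argument says nothing. In the converse direction bijectivity is topological:
  \<open>f\<close> is proper and projective space is Hausdorff, hence \<open>F\<close> is closed,
  its image is the whole closure of the graph, and its inverse is continuous. Holomorphy of the
  inverse is a question about germs, and a real one only on the zero section, since \<open>f\<close>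
  is biholomorphic elsewhere.\<close>

lemma tendsto_fun_coordinatewise:
  fixes f :: "'a \<Rightarrow> 'i \<Rightarrow> 'b::topological_space"
  assumes "\<And>i. ((\<lambda>x. f x i) \<longlongrightarrow> l i) F"
  shows "(f \<longlongrightarrow> l) F"
proof (rule topological_tendstoI)
  fix S :: "('i \<Rightarrow> 'b) set" assume S: "open S" "l \<in> S"
  then have "openin (product_topology (\<lambda>i. euclidean) UNIV) S"
    by (simp add: open_fun_def)
  \<comment> \<open>A basic neighbourhood restricts only finitely many coordinates, so finitely many
    eventualities can be combined.\<close>
  from product_topology_open_contains_basis[OF this S(2)]
  obtain X where X: "l \<in> (\<Pi>\<^sub>E i\<in>UNIV. X i)" "\<And>i. open (X i)" "finite {i. X i \<noteq> UNIV}"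
    "(\<Pi>\<^sub>E i\<in>UNIV. X i) \<subseteq> S" by auto
  have "\<forall>\<^sub>F x in F. \<forall>i \<in> {i. X i \<noteq> UNIV}. f x i \<in> X i"
    using X assms by (intro eventually_ball_finite ballI topological_tendstoD) auto
  then show "\<forall>\<^sub>F x in F. f x \<in> S"
  proof eventually_elim
    case (elim x)
    then have "f x \<in> (\<Pi>\<^sub>E i\<in>UNIV. X i)" by auto
    then show ?case using X(4) by blast
  qed
qed

lemma continuous_coordinatewise:
  fixes f :: "'a::t2_space \<Rightarrow> 'i \<Rightarrow> 'b::topological_space"
  assumes "\<And>i. continuous F (\<lambda>x. f x i)"
  shows "continuous F f"
  using assms unfolding continuous_def by (intro tendsto_fun_coordinatewise)

lemma continuous_coordinate:
  "continuous (at p within S) (\<lambda>z :: nat \<Rightarrow> complex. z i)"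
proof -
  have "continuous_on UNIV (\<lambda>z :: nat \<Rightarrow> complex. z i)"
    using continuous_on_id by (rule continuous_on_product_then_coordinatewise)
  then have "continuous (at p) (\<lambda>z :: nat \<Rightarrow> complex. z i)"
    unfolding continuous_on_eq_continuous_within by (rule bspec) simp
  then show ?thesis by (rule continuous_at_imp_continuous_at_within)
qed

lemma vec_in_Cn [simp]: "vec n c \<in> Cn n"
  by (simp add: vec_def Cn_def)

lemma vec_nth: "i < n \<Longrightarrow> vec n c i = c i"
  by (simp add: vec_def)

lemma vec_Cn: "z \<in> Cn n \<Longrightarrow> vec n z = z"
  by (auto simp: vec_def Cn_def fun_eq_iff not_less)

lemma continuous_vec:
  fixes c :: "nat \<Rightarrow> 'a::t2_space \<Rightarrow> complex"
  assumes "\<And>i. i < n \<Longrightarrow> continuous F (c i)"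
  shows "continuous F (\<lambda>z. vec n (\<lambda>i. c i z))"
proof (rule continuous_coordinatewise)
  fix i show "continuous F (\<lambda>z. vec n (\<lambda>i. c i z) i)"
    using assms by (cases "i < n") (auto simp: vec_def)
qed

text \<open>The sufficient half of Caratheodory's criterion: each \<open>cmod (z i - p i)\<close> is
  at most the Euclidean distance, so the error quotient is bounded by the sum of
  \<open>cmod (\<phi> i z - \<phi> i p)\<close>, which tends to 0.\<close>

lemma complex_differentiable_atI:
  assumes D: "openin (top_of_set (Cn n)) D" "p \<in> D"
    and eq: "\<And>z. z \<in> D \<Longrightarrow> h z = h p + (\<Sum>i<n. \<phi> i z * (z i - p i))"
    and cont: "\<And>i. i < n \<Longrightarrow> continuous (at p within Cn n) (\<phi> i)"
  shows "complex_differentiable_at n h p"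
proof -
  let ?R = "\<lambda>z. L2_set (\<lambda>i. cmod (z i - p i)) {..<n}"
  have pD: "p \<in> Cn n" using D by (meson in_mono openin_imp_subset)
  have lim: "((\<lambda>z. \<Sum>i<n. cmod (\<phi> i z - \<phi> i p)) \<longlongrightarrow> (\<Sum>i<n. cmod (\<phi> i p - \<phi> i p))) (at p within Cn n)"
    using cont by (intro tendsto_intros) (auto simp: continuous_within)
  obtain T where T: "open T" "D = Cn n \<inter> T" using D(1) by (auto simp: openin_open)
  have "\<forall>\<^sub>F z in at p within Cn n. z \<in> D"
    unfolding eventually_at_topological using T D(2) by (intro exI[of _ T]) auto
  moreover have "\<forall>\<^sub>F z in at p within Cn n. z \<noteq> p \<and> z \<in> Cn n"
    by (simp add: eventually_at_filter)
  ultimately have ev: "\<forall>\<^sub>F z in at p within Cn n.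
     norm ((h z - h p - (\<Sum>i<n. \<phi> i p * (z i - p i))) / complex_of_real (?R z)) \<le> (\<Sum>i<n. cmod (\<phi> i z - \<phi> i p))"
  proof eventually_elim
    case (elim z)
    have le: "cmod (z i - p i) \<le> ?R z" if "i < n" for i
      using that by (intro member_le_L2_set) auto
    obtain i where "z i \<noteq> p i" using elim by (auto simp: fun_eq_iff)
    then have "i < n" using elim pD by (auto simp: Cn_def not_less intro: leI)
    then have pos: "?R z > 0" using le[of i] \<open>z i \<noteq> p i\<close> by (smt (verit) zero_less_norm_iff eq_iff_diff_eq_0)
    have "h z - h p - (\<Sum>i<n. \<phi> i p * (z i - p i)) = (\<Sum>i<n. (\<phi> i z - \<phi> i p) * (z i - p i))"
      using eq[of z] elim by (simp add: sum_subtractf algebra_simps sum.distrib)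
    also have "norm \<dots> \<le> (\<Sum>i<n. cmod (\<phi> i z - \<phi> i p) * ?R z)"
      using le by (intro sum_norm_le) (auto simp: norm_mult intro!: mult_left_mono)
    finally have "norm (h z - h p - (\<Sum>i<n. \<phi> i p * (z i - p i))) \<le> (\<Sum>i<n. cmod (\<phi> i z - \<phi> i p)) * ?R z"
      by (simp add: sum_distrib_right)
    then show ?case using pos by (simp add: norm_divide divide_le_eq)
  qed
  have "((\<lambda>z. (h z - h p - (\<Sum>i<n. \<phi> i p * (z i - p i))) / complex_of_real (?R z)) \<longlongrightarrow> 0) (at p within Cn n)"
    by (rule Lim_null_comparison[OF ev]) (use lim in simp)
  then show ?thesis unfolding complex_differentiable_at_def by (rule exI[of _ "\<lambda>i. \<phi> i p"])
qed

text \<open>Caratheodory's form of differentiability, which makes the chain rule immediate.\<close>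

lemma complex_differentiable_at_imp_ex:
  assumes "complex_differentiable_at n h p" "p \<in> Cn n"
  shows "\<exists>\<phi>. (\<forall>z \<in> Cn n. h z = h p + (\<Sum>i<n. \<phi> i z * (z i - p i))) \<and>
    (\<forall>i<n. continuous (at p within Cn n) (\<phi> i))"
proof -
  let ?R = "\<lambda>z. L2_set (\<lambda>i. cmod (z i - p i)) {..<n}"
  from assms(1) obtain a where a: "((\<lambda>z. (h z - h p - (\<Sum>i<n. a i * (z i - p i))) / complex_of_real (?R z)) \<longlongrightarrow> 0) (at p within Cn n)"
    unfolding complex_differentiable_at_def by blast
  define r where "r z = h z - h p - (\<Sum>i<n. a i * (z i - p i))" for z
  \<comment> \<open>The remainder \<open>r z\<close> is distributed over the coordinates. The
    weights are conjugates because the products with \<open>z i - p i\<close> then add up to the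
    squared distance. At z = p the division by zero yields 0, so that
    \<open>\<phi> i p = a i\<close>.\<close>
  define \<phi> where "\<phi> i z = a i + r z / complex_of_real (?R z) * (cnj (z i - p i) / complex_of_real (?R z))" for i z
  show ?thesis
  proof (intro exI[of _ \<phi>] conjI ballI allI impI)
    fix z assume z: "z \<in> Cn n"
    show "h z = h p + (\<Sum>i<n. \<phi> i z * (z i - p i))"
    proof (cases "?R z = 0")
      case True
      then have "z i = p i" if "i < n" for i using that by (simp add: L2_set_eq_0_iff)
      then have "z = p" using z assms(2) by (auto simp: Cn_def fun_eq_iff) (metis leI)
      then show ?thesis by simp
    next
      case False
      have "(\<Sum>i<n. cnj (z i - p i) * (z i - p i)) = complex_of_real (\<Sum>i<n. (cmod (z i - p i))\<^sup>2)"
        unfolding of_real_sum complex_norm_square by (intro sum.cong) (auto simp: mult.commute)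
      also have "(\<Sum>i<n. (cmod (z i - p i))\<^sup>2) = (?R z)\<^sup>2"
        by (simp add: L2_set_def sum_nonneg)
      finally have sq: "(\<Sum>i<n. cnj (z i - p i) * (z i - p i)) = (complex_of_real (?R z))\<^sup>2" by simp
      have gen: "(b + s / R * (c / R)) * d = b * d + s / R\<^sup>2 * (c * d)" for b s R c d :: complex
        by (simp add: distrib_right power2_eq_square)
      have "(\<Sum>i<n. \<phi> i z * (z i - p i)) = (\<Sum>i<n. a i * (z i - p i)) + r z / (complex_of_real (?R z))\<^sup>2 * (\<Sum>i<n. cnj (z i - p i) * (z i - p i))"
        unfolding \<phi>_def sum_distrib_left sum.distrib[symmetric] gen ..
      also have "\<dots> = (\<Sum>i<n. a i * (z i - p i)) + r z" using False unfolding sq by simp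
      finally show ?thesis by (simp add: r_def)
    qed
  next
    fix i assume i: "i < n"
    have bd: "norm (\<phi> i z - a i) \<le> norm (r z / complex_of_real (?R z))" for z
    proof -
      have "cmod (z i - p i) \<le> ?R z" using i by (intro member_le_L2_set) auto
      then have "cmod (z i - p i) / ?R z \<le> 1"
        using L2_set_nonneg[of "\<lambda>i. cmod (z i - p i)" "{..<n}"] unfolding divide_le_eq_1 by argo
      then have "norm (cnj (z i - p i) / complex_of_real (?R z)) \<le> 1"
        by (simp only: norm_divide complex_mod_cnj norm_of_real abs_of_nonneg[OF L2_set_nonneg])
      from mult_left_le[OF this norm_ge_zero] show ?thesis
        unfolding \<phi>_def by (simp only: add_diff_cancel_left' norm_mult)
    qed
    have "(\<phi> i \<longlongrightarrow> a i) (at p within Cn n)"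
      by (rule LIM_zero_cancel, rule Lim_null_comparison[OF always_eventually[rule_format, OF bd]])
        (rule tendsto_norm_zero[OF a[folded r_def]])
    moreover have "\<phi> i p = a i" by (simp add: \<phi>_def r_def)
    ultimately show "continuous (at p within Cn n) (\<phi> i)"
      by (simp add: continuous_within)
  qed
qed

lemma complex_differentiable_at_imp_continuous:
  assumes "complex_differentiable_at n h p" "p \<in> Cn n"
  shows "continuous (at p within Cn n) h"
proof -
  obtain \<phi> where \<phi>: "\<And>z. z \<in> Cn n \<Longrightarrow> h z = h p + (\<Sum>i<n. \<phi> i z * (z i - p i))"
    "\<And>i. i < n \<Longrightarrow> continuous (at p within Cn n) (\<phi> i)"
    using complex_differentiable_at_imp_ex[OF assms] by blast
  have "continuous (at p within Cn n) (\<lambda>z. h p + (\<Sum>i<n. \<phi> i z * (z i - p i)))"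
    using \<phi>(2) by (intro continuous_add continuous_const continuous_sum continuous_mult continuous_diff continuous_coordinate) auto
  then show ?thesis
    by (rule continuous_transform_within[OF _ zero_less_one assms(2)]) (rule \<phi>(1)[symmetric])
qed

lemma complex_differentiable_compose:
  assumes p: "p \<in> Cn m" and c: "\<And>i. i < n \<Longrightarrow> complex_differentiable_at m (c i) p"
    and G: "complex_differentiable_at n G (vec n (\<lambda>i. c i p))"
  shows "complex_differentiable_at m (\<lambda>z. G (vec n (\<lambda>i. c i z))) p"
proof -
  define q where "q = vec n (\<lambda>i. c i p)"
  have qi: "q i = c i p" if "i < n" for i using that by (simp add: q_def vec_nth)
  have "q \<in> Cn n" by (simp add: q_def)
  then obtain \<phi> where \<phi>: "\<And>z. z \<in> Cn n \<Longrightarrow> G z = G q + (\<Sum>i<n. \<phi> i z * (z i - q i))"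
    "\<And>i. i < n \<Longrightarrow> continuous (at q within Cn n) (\<phi> i)"
    using complex_differentiable_at_imp_ex[OF G[folded q_def]] by blast
  have "\<exists>\<psi>. (\<forall>z\<in>Cn m. c i z = c i p + (\<Sum>j<m. \<psi> j z * (z j - p j))) \<and> (\<forall>j<m. continuous (at p within Cn m) (\<psi> j))" if "i < n" for i
    by (rule complex_differentiable_at_imp_ex[OF c[OF that] p])
  then obtain \<psi> where \<psi>: "\<And>i z. i < n \<Longrightarrow> z\<in>Cn m \<Longrightarrow> c i z = c i p + (\<Sum>j<m. \<psi> i j z * (z j - p j))"
    "\<And>i j. i < n \<Longrightarrow> j < m \<Longrightarrow> continuous (at p within Cn m) (\<psi> i j)" by metis
  have cc: "continuous (at p within Cn m) (\<lambda>z. vec n (\<lambda>i. c i z))"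
    using complex_differentiable_at_imp_continuous[OF c p] by (intro continuous_vec)
  show ?thesis
  proof (rule complex_differentiable_atI[of m "Cn m" p _ "\<lambda>j z. \<Sum>i<n. \<phi> i (vec n (\<lambda>i. c i z)) * \<psi> i j z"])
    fix z assume z: "z \<in> Cn m"
    have "G (vec n (\<lambda>i. c i z)) - G q = (\<Sum>i<n. \<phi> i (vec n (\<lambda>i. c i z)) * (c i z - c i p))"
      using \<phi>(1)[of "vec n (\<lambda>i. c i z)"] by (simp add: vec_nth qi)
    also have "\<dots> = (\<Sum>i<n. \<Sum>j<m. \<phi> i (vec n (\<lambda>i. c i z)) * (\<psi> i j z * (z j - p j)))"
      using \<psi>(1)[OF _ z] by (intro sum.cong) (auto simp: sum_distrib_left)
    also have "\<dots> = (\<Sum>j<m. (\<Sum>i<n. \<phi> i (vec n (\<lambda>i. c i z)) * \<psi> i j z) * (z j - p j))"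
      by (subst sum.swap) (simp add: sum_distrib_right mult.assoc)
    finally show "G (vec n (\<lambda>i. c i z)) = G (vec n (\<lambda>i. c i p)) + (\<Sum>j<m. (\<Sum>i<n. \<phi> i (vec n (\<lambda>i. c i z)) * \<psi> i j z) * (z j - p j))"
      by (simp only: diff_eq_eq add.commute flip: q_def)
  next
    fix j assume j: "j < m"
    have "continuous (at p within Cn m) (\<lambda>z. \<phi> i (vec n (\<lambda>i. c i z)))" if "i < n" for i
      by (rule continuous_within_compose2[OF cc], fold q_def) (rule continuous_within_subset[OF \<phi>(2)[OF that]], auto)
    then show "continuous (at p within Cn m) (\<lambda>z. \<Sum>i<n. \<phi> i (vec n (\<lambda>i. c i z)) * \<psi> i j z)"
      using \<psi>(2) j by (intro continuous_sum continuous_mult) auto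
  qed (simp_all add: p)
qed

lemma complex_differentiable_coordinate:
  assumes "p \<in> Cn n" "i < n" "b field_differentiable at (p i)"
  shows "complex_differentiable_at n (\<lambda>z. b (z i)) p"
proof -
  from assms(3) obtain g where g: "\<And>z. b z - b (p i) = g z * (z - p i)" "isCont g (p i)"
    unfolding field_differentiable_def using CARAT_DERIV by metis
  show ?thesis
  proof (rule complex_differentiable_atI[of n "Cn n" p _ "\<lambda>j z. if j = i then g (z i) else 0"])
    fix z
    have "(\<Sum>j<n. (if j = i then g (z i) else 0) * (z j - p j)) = g (z i) * (z i - p i)"
      using assms(2) by (simp add: if_distrib[of "\<lambda>x. x * _"] cong: if_cong)
    moreover have "b (z i) = b (p i) + g (z i) * (z i - p i)"
      using g(1)[of "z i"] by (simp add: algebra_simps)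
    ultimately show "b (z i) = b (p i) + (\<Sum>j<n. (if j = i then g (z i) else 0) * (z j - p j))" by simp
  next
    fix j
    have "continuous (at p within Cn n) (\<lambda>z. g (z i))"
      using g(2) continuous_coordinate by (rule continuous_within_compose3[where f = "\<lambda>z. z i"])
    then show "continuous (at p within Cn n) (\<lambda>z. if j = i then g (z i) else 0)" by (cases "j = i") auto
  qed (simp_all add: assms)
qed

lemma complex_differentiable_const: "p \<in> Cn n \<Longrightarrow> complex_differentiable_at n (\<lambda>z. k) p"
  by (rule complex_differentiable_atI[of n "Cn n" p _ "\<lambda>_ _. 0"]) auto

text \<open>The coefficients \<open>a\<close> are the partial derivatives of \<open>G\<close> at
  \<open>q\<close>, fixed before any curve is given. In particular a curve whose components have
  derivative 0 has an image with derivative 0.\<close>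

lemma complex_differentiable_curve:
  assumes "complex_differentiable_at n G q" "q \<in> Cn n"
  obtains a where "\<And>c d t0. vec n (\<lambda>i. c i t0) = q \<Longrightarrow>
     (\<And>i. i < n \<Longrightarrow> (c i has_field_derivative d i) (at t0)) \<Longrightarrow>
     ((\<lambda>t. G (vec n (\<lambda>i. c i t))) has_field_derivative (\<Sum>i<n. a i * d i)) (at t0)"
proof -
  obtain \<phi> where \<phi>: "\<And>z. z \<in> Cn n \<Longrightarrow> G z = G q + (\<Sum>i<n. \<phi> i z * (z i - q i))"
    "\<And>i. i < n \<Longrightarrow> continuous (at q within Cn n) (\<phi> i)"
    using complex_differentiable_at_imp_ex[OF assms] by blast
  show thesis
  proof (rule that[of "\<lambda>i. \<phi> i q"])
    fix c d and t0 :: complex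
    assume q: "vec n (\<lambda>i. c i t0) = q" and d: "\<And>i. i < n \<Longrightarrow> (c i has_field_derivative d i) (at t0)"
    have "\<exists>g. (\<forall>z. c i z - c i t0 = g z * (z - t0)) \<and> isCont g t0 \<and> g t0 = d i" if "i < n" for i
      using d[OF that] CARAT_DERIV by metis
    then obtain g where g: "\<And>i z. i < n \<Longrightarrow> c i z - c i t0 = g i z * (z - t0)"
      "\<And>i. i < n \<Longrightarrow> isCont (g i) t0" "\<And>i. i < n \<Longrightarrow> g i t0 = d i" by metis
    have cc: "continuous (at t0 within UNIV) (\<lambda>z. vec n (\<lambda>i. c i z))"
      using d by (intro continuous_vec) (auto intro: DERIV_isCont)
    have c\<phi>: "continuous (at t0 within UNIV) (\<lambda>z. \<phi> i (vec n (\<lambda>i. c i z)))" if "i < n" for i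
      by (rule continuous_within_compose2[OF cc], unfold q) (rule continuous_within_subset[OF \<phi>(2)[OF that]], auto)
    have qi: "q i = c i t0" if "i < n" for i using q that by (auto simp: vec_def)
    show "((\<lambda>t. G (vec n (\<lambda>i. c i t))) has_field_derivative (\<Sum>i<n. \<phi> i q * d i)) (at t0)"
      unfolding CARAT_DERIV
    proof (intro exI[of _ "\<lambda>t. \<Sum>i<n. \<phi> i (vec n (\<lambda>i. c i t)) * g i t"] conjI allI)
      fix t
      have "G (vec n (\<lambda>i. c i t)) - G q = (\<Sum>i<n. \<phi> i (vec n (\<lambda>i. c i t)) * (c i t - c i t0))"
        using \<phi>(1)[of "vec n (\<lambda>i. c i t)"] by (simp add: vec_nth qi)
      also have "\<dots> = (\<Sum>i<n. \<phi> i (vec n (\<lambda>i. c i t)) * g i t) * (t - t0)"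
        unfolding sum_distrib_right using g(1) by (intro sum.cong) auto
      finally show "G (vec n (\<lambda>i. c i t)) - G (vec n (\<lambda>i. c i t0)) = (\<Sum>i<n. \<phi> i (vec n (\<lambda>i. c i t)) * g i t) * (t - t0)"
        using q by simp
    next
      show "isCont (\<lambda>t. \<Sum>i<n. \<phi> i (vec n (\<lambda>i. c i t)) * g i t) t0"
        using c\<phi> g(2) by (intro continuous_sum continuous_mult) auto
    next
      show "(\<Sum>i<n. \<phi> i (vec n (\<lambda>i. c i t0)) * g i t0) = (\<Sum>i<n. \<phi> i q * d i)"
        using g(3) q by simp
    qed
  qed
qed

text \<open>With \<zeta> = q + r exp(2 pi i t) one has d\<zeta> = 2 pi i (\<zeta> - q) dt, so this
  is the Cauchy integral of g(\<zeta>) / ((\<zeta> - q)(\<zeta> - w)), the divided difference of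
  \<open>g\<close> at \<open>w\<close> and \<open>q\<close>. As an integral over a fixed interval it
  is open to the theorems on parameter integrals.\<close>

definition cauchy_quotient :: "complex \<Rightarrow> real \<Rightarrow> (complex \<Rightarrow> complex) \<Rightarrow> complex \<Rightarrow> complex" where
  "cauchy_quotient q r g w = integral (cbox 0 1)
     (\<lambda>t. g (q + r * exp (2 * of_real pi * \<i> * of_real t)) / (q + r * exp (2 * of_real pi * \<i> * of_real t) - w))"

lemma circle_point:
  assumes "0 < r" "w \<in> ball q r"
  shows "q + of_real r * exp (2 * of_real pi * \<i> * of_real t) \<in> cball q r"
    "q + of_real r * exp (2 * of_real pi * \<i> * of_real t) - w \<noteq> 0"
proof -
  have n: "norm (exp (2 * of_real pi * \<i> * complex_of_real t)) = 1"
    by (simp add: norm_exp_eq_Re)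
  show "q + of_real r * exp (2 * of_real pi * \<i> * of_real t) \<in> cball q r"
    using assms by (simp add: dist_norm norm_mult n)
  show "q + of_real r * exp (2 * of_real pi * \<i> * of_real t) - w \<noteq> 0"
  proof
    assume "q + of_real r * exp (2 * of_real pi * \<i> * of_real t) - w = 0"
    then have "w = q + of_real r * exp (2 * of_real pi * \<i> * of_real t)" by simp
    then have "dist q w = r" using assms n by (simp add: dist_norm norm_mult)
    then show False using assms by simp
  qed
qed

text \<open>Subtract the Cauchy formula at \<open>q\<close> from the one at \<open>w\<close> and use
  (\<zeta> - q)/(\<zeta> - w) - 1 = (w - q)/(\<zeta> - w).\<close>

lemma cauchy_quotient_eq:
  assumes r: "0 < r" and hol: "g holomorphic_on cball q r" and w: "w \<in> ball q r"
  shows "g w - g q = (w - q) * cauchy_quotient q r g w"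
proof -
  let ?e = "\<lambda>t. q + r * exp (2 * of_real pi * \<i> * of_real t)"
  have F: "((\<lambda>t. g (?e t) * (?e t - q) / (?e t - u)) has_integral g u) {0..1}" if u: "u \<in> ball q r" for u
  proof -
    have "((\<lambda>z. g z / (z - u)) has_contour_integral (2 * of_real pi * \<i> * g u)) (circlepath q r)"
      using Cauchy_integral_circlepath_simple[OF hol, of u] u by (simp add: dist_norm norm_minus_commute)
    then have "((\<lambda>t. g (?e t) / (?e t - u) * (2 * pi * \<i> * r * exp (2 * of_real pi * \<i> * of_real t)))
        has_integral (2 * of_real pi * \<i> * g u)) {0..1}"
      unfolding has_contour_integral_def
      by (rule has_integral_eq[rotated]) (simp add: vector_derivative_circlepath01, simp add: circlepath)
    from has_integral_mult_right[OF this, of "1 / (2 * of_real pi * \<i>)"]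
    show ?thesis by (rule has_integral_eq_rhs[OF has_integral_eq[rotated]]) (auto simp: field_simps)
  qed
  have q: "q \<in> ball q r" using r by simp
  have "((\<lambda>t. (w - q) * (g (?e t) / (?e t - w))) has_integral (g w - g q)) {0..1}"
    by (rule has_integral_eq[rotated, OF has_integral_diff[OF F[OF w] F[OF q]]])
      (use circle_point(2)[OF r w] circle_point(2)[OF r q] in \<open>auto simp: field_simps\<close>)
  from integral_unique[OF this] show ?thesis
    unfolding cauchy_quotient_def by (simp flip: integral_mult_right)
qed

text \<open>The circle avoids the open ball, so the integrand is jointly continuous in
  \<open>y\<close>, \<open>w\<close> and the angle. Joint continuity is what Osgood's lemma asks for
  later.\<close>

lemma continuous_on_cauchy_quotient:
  fixes G :: "'y::topological_space \<Rightarrow> complex \<Rightarrow> complex"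
  assumes r: "0 < r" and cont: "continuous_on (S \<times> cball q r) (\<lambda>(y, w). G y w)"
  shows "continuous_on (S \<times> ball q r) (\<lambda>(y, w). cauchy_quotient q r (G y) w)"
proof -
  let ?e = "\<lambda>t. q + r * exp (2 * of_real pi * \<i> * of_real t)"
  have "continuous_on ((S \<times> ball q r) \<times> cbox 0 1) (\<lambda>x. (\<lambda>(y, w). G y w) (fst (fst x), ?e (snd x)))"
    by (rule continuous_on_compose2[OF cont])
      (use circle_point(1)[OF r] in \<open>auto intro!: continuous_intros\<close>)
  then have "continuous_on ((S \<times> ball q r) \<times> cbox 0 1) (\<lambda>(x, t). G (fst x) (?e t) / (?e t - snd x))"
    using circle_point(2)[OF r]
    by (auto simp: case_prod_unfold intro!: continuous_intros)
  from integral_continuous_on_param[OF this] show ?thesis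
    by (simp add: cauchy_quotient_def case_prod_unfold)
qed

text \<open>Off \<open>q\<close> this is the ordinary difference quotient, and it is continuous at
  \<open>q\<close>; the singularity is removable.\<close>

lemma cauchy_quotient_holomorphic:
  assumes r: "0 < r" and hol: "g holomorphic_on cball q r"
  shows "cauchy_quotient q r g holomorphic_on ball q r"
proof (rule no_isolated_singularity[where K = "{q}"])
  \<comment> \<open>A dummy parameter \<open>y\<close> makes the parametrised continuity lemma
    applicable to a single function.\<close>
  have "continuous_on (UNIV \<times> cball q r) (\<lambda>(y :: complex, w). g w)"
    unfolding case_prod_unfold
    by (rule continuous_on_compose2[OF holomorphic_on_imp_continuous_on[OF hol]]) (auto intro!: continuous_intros)
  from continuous_on_cauchy_quotient[OF r this]
  have "continuous_on ((UNIV :: complex set) \<times> ball q r) (\<lambda>(y, w). cauchy_quotient q r g w)" by simp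
  then have "continuous_on (ball q r) (\<lambda>w. (\<lambda>(y :: complex, w). cauchy_quotient q r g w) (0, w))"
    by (rule continuous_on_compose2) (auto intro!: continuous_intros)
  then show "continuous_on (ball q r) (cauchy_quotient q r g)" by simp
  have "(\<lambda>w. (g w - g q) / (w - q)) holomorphic_on ball q r - {q}"
    using hol by (intro holomorphic_intros) (auto intro: holomorphic_on_subset)
  then show "cauchy_quotient q r g holomorphic_on ball q r - {q}"
    by (rule holomorphic_transform) (use cauchy_quotient_eq[OF r hol] in \<open>auto simp: field_simps\<close>)
qed auto

text \<open>Differentiation under the integral sign without forming a derivative of the integrand:
  its difference quotient is the Cauchy quotient, whose integral is continuous at
  \<open>t0\<close>.\<close>

lemma param_integral_field_differentiable:
  fixes k :: "complex \<Rightarrow> real \<Rightarrow> complex"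
  assumes r: "0 < r" and cont: "continuous_on (cbox 0 1 \<times> cball t0 r) (\<lambda>(s, t). k t s)"
    and hol: "\<And>s. s \<in> cbox 0 1 \<Longrightarrow> (\<lambda>t. k t s) holomorphic_on cball t0 r"
  shows "(\<lambda>t. integral (cbox 0 1) (k t)) field_differentiable at t0"
proof -
  let ?H = "\<lambda>t. integral (cbox 0 1) (\<lambda>s. cauchy_quotient t0 r (\<lambda>t. k t s) t)"
  have int: "k t integrable_on cbox 0 1" if "t \<in> cball t0 r" for t
    by (rule integrable_continuous, rule continuous_on_compose2[OF cont, of _ "\<lambda>s. (s, t)", simplified])
      (use that in \<open>auto intro!: continuous_intros\<close>)
  have cH: "continuous_on (cbox 0 1 \<times> ball t0 r) (\<lambda>(s, t). cauchy_quotient t0 r (\<lambda>t. k t s) t)"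
    by (rule continuous_on_cauchy_quotient[OF r cont])
  have "continuous_on (ball t0 r \<times> cbox 0 1) (\<lambda>x. (\<lambda>(s, t). cauchy_quotient t0 r (\<lambda>t. k t s) t) (snd x, fst x))"
    by (rule continuous_on_compose2[OF cH]) (auto intro!: continuous_intros)
  then have "continuous_on (ball t0 r) ?H"
    by (intro integral_continuous_on_param) (simp add: case_prod_unfold)
  then have cont0: "isCont ?H t0"
    using r by (simp add: continuous_on_eq_continuous_at)
  have eq: "integral (cbox 0 1) (k t) - integral (cbox 0 1) (k t0) = ?H t * (t - t0)" if t: "t \<in> ball t0 r" for t
  proof -
    have "integral (cbox 0 1) (k t) - integral (cbox 0 1) (k t0) = integral (cbox 0 1) (\<lambda>s. k t s - k t0 s)"
      using int[of t] int[of t0] t r by (intro Henstock_Kurzweil_Integration.integral_diff[symmetric]) auto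
    also have "\<dots> = integral (cbox 0 1) (\<lambda>s. (t - t0) * cauchy_quotient t0 r (\<lambda>t. k t s) t)"
      by (rule integral_cong) (rule cauchy_quotient_eq[OF r hol t])
    finally show ?thesis by (simp add: mult.commute)
  qed
  have "((\<lambda>t. (integral (cbox 0 1) (k t) - integral (cbox 0 1) (k t0)) / (t - t0)) \<longlongrightarrow> ?H t0) (at t0)"
  proof (rule Lim_transform_within_open[OF cont0[unfolded isCont_def], of "ball t0 r"])
    fix t assume "t \<in> ball t0 r" "t \<noteq> t0"
    then show "?H t = (integral (cbox 0 1) (k t) - integral (cbox 0 1) (k t0)) / (t - t0)"
      by (simp only: eq nonzero_mult_div_cancel_right right_minus_eq not_False_eq_True)
  qed (simp_all add: r)
  then show ?thesis
    unfolding field_differentiable_def has_field_derivative_iff by (rule exI)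
qed

section \<open>Polydiscs, Osgood's lemma and Hadamard division\<close>

definition polydisc :: "nat \<Rightarrow> (nat \<Rightarrow> complex) \<Rightarrow> real \<Rightarrow> (nat \<Rightarrow> complex) set" where
  "polydisc n p r = {z \<in> Cn n. \<forall>i<n. z i \<in> ball (p i) r}"

lemma polydisc_subset_Cn: "polydisc n p r \<subseteq> Cn n"
  by (auto simp: polydisc_def)

lemma polydisc_mono: "r \<le> s \<Longrightarrow> polydisc n p r \<subseteq> polydisc n p s"
  by (auto simp: polydisc_def)

lemma openin_polydisc: "openin (top_of_set (Cn n)) (polydisc n p r)"
proof -
  have "open (\<Inter>i<n. (\<lambda>z :: nat \<Rightarrow> complex. z i) -` ball (p i) r)"
  proof (intro open_INT ballI)
    fix i
    have "continuous_on UNIV (\<lambda>z :: nat \<Rightarrow> complex. z i)"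
      using continuous_on_id by (rule continuous_on_product_then_coordinatewise)
    then show "open ((\<lambda>z :: nat \<Rightarrow> complex. z i) -` ball (p i) r)" by (rule open_vimage[OF open_ball])
  qed simp
  moreover have "polydisc n p r = Cn n \<inter> (\<Inter>i<n. (\<lambda>z. z i) -` ball (p i) r)"
    by (auto simp: polydisc_def)
  ultimately show ?thesis by (auto simp: openin_open)
qed

lemma centre_in_polydisc: "p \<in> Cn n \<Longrightarrow> 0 < r \<Longrightarrow> p \<in> polydisc n p r"
  by (simp add: polydisc_def)

lemma openin_Cn_contains_polydisc:
  assumes D: "openin (top_of_set (Cn n)) D" and p: "p \<in> D"
  shows "\<exists>r>0. polydisc n p r \<subseteq> D"
proof -
  obtain T where T: "open T" "D = Cn n \<inter> T" using D by (auto simp: openin_open)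
  then have "openin (product_topology (\<lambda>i. euclidean) UNIV) T" by (simp add: open_fun_def)
  from product_topology_open_contains_basis[OF this, of p]
  obtain X where X: "p \<in> (\<Pi>\<^sub>E i\<in>UNIV. X i)" "\<And>i. open (X i)" "finite {i. X i \<noteq> UNIV}"
    "(\<Pi>\<^sub>E i\<in>UNIV. X i) \<subseteq> T" using p T by auto
  have "\<exists>e>0. ball (p i) e \<subseteq> X i" for i using X(1,2) open_contains_ball by (metis PiE_mem UNIV_I)
  then obtain e where e: "\<And>i. e i > 0" "\<And>i. ball (p i) (e i) \<subseteq> X i" by metis
  define r where "r = Min (insert 1 (e ` {i. X i \<noteq> UNIV}))"
  have r: "r > 0" using X(3) e(1) by (auto simp: r_def)
  have "polydisc n p r \<subseteq> D"
  proof
    fix z assume z: "z \<in> polydisc n p r"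
    have "z i \<in> X i" for i
    proof (cases "X i = UNIV")
      case False
      then have "r \<le> e i" using X(3) by (auto simp: r_def)
      moreover have "z i \<in> ball (p i) r"
        using z p T r by (cases "i < n") (auto simp: polydisc_def Cn_def)
      ultimately show ?thesis using e(2)[of i] by auto
    qed auto
    then have "z \<in> T" using X(4) by auto
    then show "z \<in> D" using z T by (auto simp: polydisc_def)
  qed
  with r show ?thesis by blast
qed

lemma at_within_openin:
  assumes "openin (top_of_set S) D" "p \<in> D"
  shows "at p within D = at p within S"
proof -
  obtain T where "open T" "D = S \<inter> T" using assms(1) by (auto simp: openin_open)
  with assms(2) show ?thesis by (intro at_within_nhd[of _ T]) auto
qed

lemma complex_differentiable_imp_continuous_on:
  assumes "openin (top_of_set (Cn n)) D" "\<And>z. z \<in> D \<Longrightarrow> complex_differentiable_at n G z"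
  shows "continuous_on D G"
  unfolding continuous_on_eq_continuous_within
proof
  fix z assume z: "z \<in> D"
  then have "z \<in> Cn n" using assms(1) openin_imp_subset by blast
  from complex_differentiable_at_imp_continuous[OF assms(2)[OF z] this]
  show "continuous (at z within D) G" by (simp add: at_within_openin[OF assms(1) z])
qed

lemma continuous_on_fun_upd:
  fixes f :: "'a::topological_space \<Rightarrow> nat \<Rightarrow> complex"
  assumes "continuous_on S f" "continuous_on S g"
  shows "continuous_on S (\<lambda>x. (f x)(i := g x))"
proof (rule continuous_on_coordinatewise_then_product)
  fix j
  show "continuous_on S (\<lambda>x. ((f x)(i := g x)) j)"
    using assms(2) continuous_on_product_then_coordinatewise[OF assms(1), of j] by (cases "j = i") simp_all
qed

lemma complex_differentiable_slice:
  assumes "complex_differentiable_at n G z" "z \<in> Cn n" "j < n"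
  shows "(\<lambda>t. G (z(j := t))) field_differentiable at (z j)"
proof -
  obtain a where a: "\<And>c d t0. vec n (\<lambda>i. c i t0) = z \<Longrightarrow>
     (\<And>i. i < n \<Longrightarrow> (c i has_field_derivative d i) (at t0)) \<Longrightarrow>
     ((\<lambda>t. G (vec n (\<lambda>i. c i t))) has_field_derivative (\<Sum>i<n. a i * d i)) (at t0)"
    using complex_differentiable_curve[OF assms(1,2)] by blast
  have v: "vec n (\<lambda>i. if i = j then t else z i) = z(j := t)" for t
    using assms(2,3) by (auto simp: vec_def Cn_def fun_eq_iff)
  have "((\<lambda>t. G (vec n (\<lambda>i. if i = j then t else z i))) has_field_derivative (\<Sum>i<n. a i * (if i = j then 1 else 0))) (at (z j))"
    by (rule a) (auto simp: v)
  then show ?thesis unfolding v field_differentiable_def by (rule exI)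
qed

text \<open>Osgood's lemma: the difference \<open>G z - G p\<close> is telescoped along the coordinates.\<close>

lemma osgood:
  assumes r: "0 < r" and p: "p \<in> Cn n" and cont: "continuous_on (polydisc n p r) G"
    and sep: "\<And>z j. z \<in> polydisc n p r \<Longrightarrow> j < n \<Longrightarrow> (\<lambda>t. G (z(j := t))) field_differentiable at (z j)"
  shows "complex_differentiable_at n G p"
proof -
  \<comment> \<open>The first \<open>j\<close> coordinates come from \<open>z\<close>, the others
    from \<open>p\<close>; the chain runs from \<open>p\<close> at j = 0 to \<open>z\<close> at j =
    n.\<close>
  define T where "T j z = (\<lambda>i. if i < j then z i else p i)" for j and z :: "nat \<Rightarrow> complex"
  \<comment> \<open>Half the radius, so that the closed discs of integration stay inside the
    polydisc on which \<open>G\<close> is controlled.\<close>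
  let ?r = "r / 2"
  let ?G = "\<lambda>j y w. G ((T j y)(j := w))"
  define \<phi> where "\<phi> j z = cauchy_quotient (p j) ?r (?G j z) (z j)" for j z
  have T_in: "(T j y)(j := w) \<in> polydisc n p r" if "y \<in> polydisc n p r" "w \<in> cball (p j) ?r" "j < n" for j y w
    using that r p by (auto simp: T_def polydisc_def Cn_def)
  have cT: "continuous_on A (\<lambda>x. T j (f x))" if "continuous_on A f" for A j and f :: "(nat \<Rightarrow> complex) \<times> complex \<Rightarrow> _"
  proof (rule continuous_on_coordinatewise_then_product)
    fix i show "continuous_on A (\<lambda>x. T j (f x) i)"
      using continuous_on_product_then_coordinatewise[OF that, of i] by (cases "i < j") (simp_all add: T_def)
  qed
  have holG: "?G j y holomorphic_on cball (p j) ?r" if "y \<in> polydisc n p r" "j < n" for j y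
    unfolding holomorphic_on_def
  proof
    fix w assume w: "w \<in> cball (p j) ?r"
    have "(\<lambda>t. G (((T j y)(j := w))(j := t))) field_differentiable at (((T j y)(j := w)) j)"
      by (rule sep[OF T_in[OF that(1) w that(2)] that(2)])
    then show "?G j y field_differentiable at w within cball (p j) ?r"
      by (simp add: field_differentiable_at_within)
  qed
  have cG: "continuous_on (polydisc n p r \<times> cball (p j) ?r) (\<lambda>(y, w). ?G j y w)" if "j < n" for j
    unfolding case_prod_unfold
    by (rule continuous_on_compose2[OF cont])
      (use T_in that in \<open>auto intro!: continuous_on_fun_upd cT continuous_on_fst continuous_on_snd continuous_on_id\<close>)
  show ?thesis
  proof (rule complex_differentiable_atI[OF openin_polydisc centre_in_polydisc[OF p]])
    show "0 < ?r" using r by simp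
  next
    fix z assume z: "z \<in> polydisc n p ?r"
    then have z': "z \<in> polydisc n p r" using polydisc_mono[of ?r r] r by auto
    have "z \<in> Cn n" using z by (simp add: polydisc_def)
    then have Tn: "T n z = z" and T0: "T 0 z = p" using p by (auto simp: T_def Cn_def fun_eq_iff)
    have "G z - G p = (\<Sum>j<n. G (T (Suc j) z) - G (T j z))"
      using sum_lessThan_telescope[of "\<lambda>j. G (T j z)" n] by (simp add: Tn T0)
    also have "\<dots> = (\<Sum>j<n. \<phi> j z * (z j - p j))"
    proof (rule sum.cong[OF refl])
      fix j assume "j \<in> {..<n}" then have j: "j < n" by simp
      have "T (Suc j) z = (T j z)(j := z j)" "T j z = (T j z)(j := p j)"
        by (auto simp: T_def fun_eq_iff less_Suc_eq)
      then have "G (T (Suc j) z) - G (T j z) = ?G j z (z j) - ?G j z (p j)" by simp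
      also have "\<dots> = (z j - p j) * \<phi> j z"
        unfolding \<phi>_def by (rule cauchy_quotient_eq[OF _ holG[OF z' j]]) (use r z j in \<open>auto simp: polydisc_def\<close>)
      finally show "G (T (Suc j) z) - G (T j z) = \<phi> j z * (z j - p j)" by (simp add: mult.commute)
    qed
    finally show "G z = G p + (\<Sum>j<n. \<phi> j z * (z j - p j))" by (simp add: diff_eq_eq add.commute)
  next
    fix j assume j: "j < n"
    have r2: "0 < ?r" using r by simp
    have "continuous_on (polydisc n p ?r) (\<lambda>z. (\<lambda>(y, w). cauchy_quotient (p j) ?r (?G j y) w) (z, z j))"
    proof (rule continuous_on_compose2[OF continuous_on_cauchy_quotient[OF r2 cG[OF j]]])
      show "continuous_on (polydisc n p ?r) (\<lambda>z. (z, z j))"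
        using continuous_on_product_then_coordinatewise[OF continuous_on_id, of _ j]
        by (intro continuous_on_Pair continuous_on_id)
      show "(\<lambda>z. (z, z j)) ` polydisc n p ?r \<subseteq> polydisc n p r \<times> ball (p j) ?r"
        using polydisc_mono[of ?r r n p] r j by (auto simp: polydisc_def)
    qed
    then have "continuous_on (polydisc n p ?r) (\<phi> j)" by (simp add: \<phi>_def)
    then have "continuous (at p within polydisc n p ?r) (\<phi> j)"
      using centre_in_polydisc[OF p r2] by (simp add: continuous_on_eq_continuous_within)
    then show "continuous (at p within Cn n) (\<phi> j)"
      by (simp add: at_within_openin[OF openin_polydisc centre_in_polydisc[OF p r2]])
  qed
qed

text \<open>The quotient is the Cauchy quotient in the variable \<open>i\<close>, which is defined
  across \<open>z i = p i\<close>. It is continuous and separately holomorphic, in the variable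
  \<open>i\<close> by removability and in the others by differentiation under the integral, so
  Osgood's lemma applies.\<close>

lemma hadamard:
  assumes D: "openin (top_of_set (Cn n)) D" and hol: "\<And>z. z \<in> D \<Longrightarrow> complex_differentiable_at n G z"
    and p: "p \<in> D" and i: "i < n"
  shows "\<exists>r>0. \<exists>H. polydisc n p r \<subseteq> D \<and> (\<forall>z \<in> polydisc n p r. complex_differentiable_at n H z) \<and>
           (\<forall>z \<in> polydisc n p r. G z - G (z(i := p i)) = (z i - p i) * H z)"
proof -
  have pC: "p \<in> Cn n" using D p openin_imp_subset by blast
  obtain R where R: "R > 0" "polydisc n p R \<subseteq> D" using openin_Cn_contains_polydisc[OF D p] by blast
  define r where "r = R / 2"
  have r: "r > 0" using R by (simp add: r_def)
  define H where "H z = cauchy_quotient (p i) r (\<lambda>w. G (z(i := w))) (z i)" for z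
  have sub: "polydisc n p r \<subseteq> D" using R polydisc_mono[of r R n p] by (auto simp: r_def)
  have upd: "z(i := w) \<in> D" if "z \<in> polydisc n p r" "w \<in> cball (p i) r" for z w
  proof -
    have "z(i := w) \<in> polydisc n p R" using that R(1) i by (auto simp: polydisc_def Cn_def r_def)
    then show ?thesis using R(2) by blast
  qed
  have contG: "continuous_on D G" by (rule complex_differentiable_imp_continuous_on[OF D hol])
  have DC: "D \<subseteq> Cn n" using D openin_imp_subset by blast
  have slice: "(\<lambda>t. G (z(j := t))) field_differentiable at w" if "z(j := w) \<in> D" "j < n" for z j w
    using complex_differentiable_slice[OF hol[OF that(1)] _ that(2)] DC that(1) by auto
  have holG: "(\<lambda>w. G (z(i := w))) holomorphic_on cball (p i) r" if "z \<in> polydisc n p r" for z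
    unfolding holomorphic_on_def using slice upd that i by (auto intro: field_differentiable_at_within)
  have cG: "continuous_on (polydisc n p r \<times> cball (p i) r) (\<lambda>(z, w). G (z(i := w)))"
    unfolding case_prod_unfold
    by (rule continuous_on_compose2[OF contG])
      (use upd in \<open>auto intro!: continuous_on_fun_upd continuous_on_fst continuous_on_snd continuous_on_id\<close>)
  have cH: "continuous_on (polydisc n p r) H"
  proof -
    have "continuous_on (polydisc n p r) (\<lambda>z. (\<lambda>(z, w). cauchy_quotient (p i) r (\<lambda>w. G (z(i := w))) w) (z, z i))"
    proof (rule continuous_on_compose2[OF continuous_on_cauchy_quotient[OF r cG]])
      show "continuous_on (polydisc n p r) (\<lambda>z. (z, z i))"
        using continuous_on_product_then_coordinatewise[OF continuous_on_id, of _ i]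
        by (intro continuous_on_Pair continuous_on_id)
    qed (use i in \<open>auto simp: polydisc_def\<close>)
    then show ?thesis by (simp add: H_def[abs_def])
  qed
  have sepH: "(\<lambda>t. H (z(j := t))) field_differentiable at (z j)" if z: "z \<in> polydisc n p r" and j: "j < n" for z j
  proof (cases "j = i")
    case True
    have "cauchy_quotient (p i) r (\<lambda>w. G (z(i := w))) holomorphic_on ball (p i) r"
      by (rule cauchy_quotient_holomorphic[OF r holG[OF z]])
    then have "cauchy_quotient (p i) r (\<lambda>w. G (z(i := w))) field_differentiable at (z i)"
      using z i by (intro holomorphic_on_imp_differentiable_at) (auto simp: polydisc_def)
    then show ?thesis by (simp add: H_def[abs_def] True)
  next
    case False
    have zi: "z i \<in> ball (p i) r" and zj: "z j \<in> ball (p j) r" using z i j by (auto simp: polydisc_def)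
    \<comment> \<open>For \<open>t\<close> in this disc \<open>z(j := t)\<close> stays in the
      polydisc. Since j differs from i, neither the circle nor the denominator moves with
      \<open>t\<close>.\<close>
    obtain \<rho> where \<rho>: "\<rho> > 0" "cball (z j) \<rho> \<subseteq> ball (p j) r"
      using zj open_ball unfolding open_contains_cball by blast
    define e where "e s = p i + r * exp (2 * of_real pi * \<i> * of_real s)" for s :: real
    have e: "e s \<in> cball (p i) r" "e s - z i \<noteq> 0" for s
      using circle_point[OF r zi, of s] by (simp_all only: e_def not_False_eq_True)
    have zt: "z(j := t) \<in> polydisc n p r" if "t \<in> cball (z j) \<rho>" for t
      using z that \<rho> j by (auto simp: polydisc_def Cn_def)
    have "(\<lambda>t. integral (cbox 0 1) (\<lambda>s. G (z(j := t, i := e s)) / (e s - z i))) field_differentiable at (z j)"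
    proof (rule param_integral_field_differentiable[OF \<rho>(1)])
      have "continuous_on (cbox 0 1 \<times> cball (z j) \<rho>) (\<lambda>x. G (z(j := snd x, i := e (fst x))))"
      proof (rule continuous_on_compose2[OF contG])
        have "continuous_on (cbox 0 1 \<times> cball (z j) \<rho>) (\<lambda>x. e (fst x))"
          unfolding e_def by (intro continuous_intros)
        then show "continuous_on (cbox 0 1 \<times> cball (z j) \<rho>) (\<lambda>x. z(j := snd x, i := e (fst x)))"
          by (intro continuous_on_fun_upd continuous_on_const continuous_on_snd continuous_on_id)
        show "(\<lambda>x. z(j := snd x, i := e (fst x))) ` (cbox 0 1 \<times> cball (z j) \<rho>) \<subseteq> D"
          using upd[OF zt e(1)] by auto
      qed
      moreover have "continuous_on (cbox 0 1 \<times> cball (z j) \<rho>) (\<lambda>x. e (fst x) - z i)"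
        unfolding e_def by (intro continuous_intros)
      ultimately show "continuous_on (cbox 0 1 \<times> cball (z j) \<rho>) (\<lambda>(s, t). G (z(j := t, i := e s)) / (e s - z i))"
        unfolding case_prod_unfold by (rule continuous_on_divide) (use e(2) in simp)
    next
      fix s :: real
      have "(\<lambda>t. G (z(j := t, i := e s))) field_differentiable at t" if t: "t \<in> cball (z j) \<rho>" for t
      proof -
        have eq: "z(j := u, i := e s) = (z(i := e s))(j := u)" for u using False by (simp add: fun_upd_twist)
        show ?thesis unfolding eq
          by (rule slice[OF _ j]) (use upd[OF zt[OF t] e(1)[of s]] in \<open>simp add: eq\<close>)
      qed
      then show "(\<lambda>t. G (z(j := t, i := e s)) / (e s - z i)) holomorphic_on cball (z j) \<rho>"
        using e(2) by (intro holomorphic_intros) (auto simp: holomorphic_on_def intro: field_differentiable_at_within)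
    qed
    moreover have "H (z(j := t)) = integral (cbox 0 1) (\<lambda>s. G (z(j := t, i := e s)) / (e s - z i))" for t
      unfolding H_def cauchy_quotient_def e_def using False by simp
    ultimately show ?thesis by (simp only:)
  qed
  have "complex_differentiable_at n H z" if z: "z \<in> polydisc n p r" for z
  proof -
    obtain s where s: "s > 0" "polydisc n z s \<subseteq> polydisc n p r"
      using openin_Cn_contains_polydisc[OF openin_polydisc z] by blast
    show ?thesis
      by (rule osgood[OF s(1)])
        (use z s sepH polydisc_subset_Cn continuous_on_subset[OF cH s(2)] in blast)+
  qed
  moreover have "G z - G (z(i := p i)) = (z i - p i) * H z" if z: "z \<in> polydisc n p r" for z
    using cauchy_quotient_eq[OF r holG[OF z], of "z i"] z i by (auto simp: H_def polydisc_def)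
  ultimately show ?thesis using r sub by blast
qed

text \<open>The coordinate differences generate the maximal ideal of the local ring of
  \<open>Cn n\<close> at \<open>p\<close>; this is where generators of the maximal ideal of
  \<open>Z\<close> come from.\<close>

lemma hadamard_all:
  assumes D: "openin (top_of_set (Cn n)) D" and hol: "\<And>z. z \<in> D \<Longrightarrow> complex_differentiable_at n G z"
    and p: "p \<in> D"
  shows "\<exists>r>0. \<exists>C. polydisc n p r \<subseteq> D \<and> (\<forall>i<n. \<forall>z \<in> polydisc n p r. complex_differentiable_at n (C i) z) \<and>
           (\<forall>z \<in> polydisc n p r. G z = G p + (\<Sum>i<n. C i z * (z i - p i)))"
proof -
  have pC: "p \<in> Cn n" using D p openin_imp_subset by blast
  have "\<exists>r H. r > 0 \<and> polydisc n p r \<subseteq> D \<and> (\<forall>z \<in> polydisc n p r. complex_differentiable_at n H z) \<and>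
           (\<forall>z \<in> polydisc n p r. G z - G (z(i := p i)) = (z i - p i) * H z)" if "i < n" for i
    using hadamard[OF D hol p that] by blast
  then obtain R H where RH: "\<And>i. i < n \<Longrightarrow> R i > 0" "\<And>i. i < n \<Longrightarrow> polydisc n p (R i) \<subseteq> D"
    "\<And>i z. i < n \<Longrightarrow> z \<in> polydisc n p (R i) \<Longrightarrow> complex_differentiable_at n (H i) z"
    "\<And>i z. i < n \<Longrightarrow> z \<in> polydisc n p (R i) \<Longrightarrow> G z - G (z(i := p i)) = (z i - p i) * H i z"
    by metis
  obtain R0 where R0: "R0 > 0" "polydisc n p R0 \<subseteq> D" using openin_Cn_contains_polydisc[OF D p] by blast
  define r where "r = Min (insert R0 (R ` {..<n}))"
  have r: "r > 0" using R0 RH(1) by (auto simp: r_def)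
  have rle: "r \<le> R i" if "i < n" for i using that by (auto simp: r_def)
  have "r \<le> R0" by (auto simp: r_def)
  then have sub: "polydisc n p r \<subseteq> D" using R0 polydisc_mono by blast
  \<comment> \<open>The first \<open>i\<close> coordinates are moved to \<open>p\<close>, so the
    chain leads from \<open>z\<close> to \<open>p\<close>. Step \<open>i\<close> changes coordinate
    \<open>i\<close> alone and is divided by \<open>hadamard\<close> at the point
    \<open>U i z\<close>.\<close>
  define U where "U i z = vec n (\<lambda>j. if j < i then p j else z j)" for i and z :: "nat \<Rightarrow> complex"
  have U_in: "U i z \<in> polydisc n p r" if "z \<in> polydisc n p r" for i z
    using that r by (auto simp: U_def polydisc_def vec_nth)
  show ?thesis
  proof (intro exI[of _ r] exI[of _ "\<lambda>i z. H i (U i z)"] conjI r sub allI impI ballI)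
    fix i z assume i: "i < n" and z: "z \<in> polydisc n p r"
    have zC: "z \<in> Cn n" using z by (simp add: polydisc_def)
    show "complex_differentiable_at n (\<lambda>z. H i (U i z)) z"
      unfolding U_def
    proof (rule complex_differentiable_compose[OF zC])
      fix j assume "j < n"
      then have "complex_differentiable_at n (\<lambda>z. z j) z"
        using zC by (intro complex_differentiable_coordinate[where b = "\<lambda>x. x"] field_differentiable_ident)
      then show "complex_differentiable_at n (\<lambda>z. if j < i then p j else z j) z"
        using complex_differentiable_const[OF zC] by (cases "j < i") auto
    next
      show "complex_differentiable_at n (H i) (vec n (\<lambda>j. if j < i then p j else z j))"
        using RH(3)[OF i] U_in[OF z, of i] polydisc_mono[OF rle[OF i], of n p] by (auto simp: U_def)
    qed
  next
    fix z assume z: "z \<in> polydisc n p r"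
    have zC: "z \<in> Cn n" using z by (simp add: polydisc_def)
    have U0: "U 0 z = z" and Un: "U n z = p"
      using zC pC by (auto simp: U_def vec_def Cn_def fun_eq_iff)
    have "G p - G z = (\<Sum>i<n. G (U (Suc i) z) - G (U i z))"
      using sum_lessThan_telescope[of "\<lambda>i. G (U i z)" n] by (simp add: U0 Un)
    also have "\<dots> = (\<Sum>i<n. - (H i (U i z) * (z i - p i)))"
    proof (rule sum.cong[OF refl])
      fix i assume "i \<in> {..<n}" then have i: "i < n" by simp
      have "U (Suc i) z = (U i z)(i := p i)" using i by (auto simp: U_def vec_def fun_eq_iff less_Suc_eq)
      moreover have "G (U i z) - G ((U i z)(i := p i)) = (U i z i - p i) * H i (U i z)"
        using RH(4)[OF i] U_in[OF z, of i] polydisc_mono[OF rle[OF i], of n p] by auto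
      moreover have "U i z i = z i" using i by (simp add: U_def vec_nth)
      ultimately show "G (U (Suc i) z) - G (U i z) = - (H i (U i z) * (z i - p i))"
        by (simp add: algebra_simps)
    qed
    finally show "G z = G p + (\<Sum>i<n. H i (U i z) * (z i - p i))"
      by (simp add: sum_negf minus_equation_iff diff_eq_eq)
  qed
qed

section \<open>Sheaves closed under holomorphic substitution\<close>

text \<open>These two properties are all that is used of the local models of a complex space.  Unlike
  being locally a model, they pass to products, quotients and arbitrary subspaces at once.\<close>

definition analytic_fspace :: "'a fspace \<Rightarrow> bool" where
  "analytic_fspace X \<longleftrightarrow> function_sheaf X \<and>
     (\<forall>U h T. openin (topo X) U \<and> h \<in> hol X U \<and> open T \<longrightarrow> openin (topo X) {x \<in> U. h x \<in> T}) \<and>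
     (\<forall>U n c D G. openin (topo X) U \<and> (\<forall>i<n. c i \<in> hol X U) \<and> openin (topo (Cspace n)) D \<and>
        G \<in> hol (Cspace n) D \<and> (\<forall>x \<in> U. vec n (\<lambda>i. c i x) \<in> D) \<longrightarrow>
        (\<lambda>x. G (vec n (\<lambda>i. c i x))) \<in> hol X U)"

lemma function_sheaf_cong:
  assumes "function_sheaf X" "openin (topo X) U" "h \<in> hol X U" "\<And>x. x \<in> U \<Longrightarrow> g x = h x"
  shows "g \<in> hol X U"
  using assms(1)[unfolded function_sheaf_def, THEN conjunct1, rule_format, of U h g] assms(2-) by simp

lemma function_sheaf_mono:
  assumes "function_sheaf X" "openin (topo X) U" "openin (topo X) V" "V \<subseteq> U" "h \<in> hol X U"
  shows "h \<in> hol X V"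
  using assms(1)[unfolded function_sheaf_def, THEN conjunct2, THEN conjunct1, rule_format, of U V h] assms(2-) by simp

lemma function_sheaf_glue:
  assumes "function_sheaf X" "\<And>V. V \<in> \<V> \<Longrightarrow> openin (topo X) V" "\<And>V. V \<in> \<V> \<Longrightarrow> h \<in> hol X V"
  shows "h \<in> hol X (\<Union>\<V>)"
  using assms(1)[unfolded function_sheaf_def, THEN conjunct2, THEN conjunct2, rule_format, of \<V> h] assms(2-) by simp

lemma function_sheaf_localI:
  assumes X: "function_sheaf X"
    and loc: "\<And>x. x \<in> U \<Longrightarrow> \<exists>V g. openin (topo X) V \<and> x \<in> V \<and> V \<subseteq> U \<and> g \<in> hol X V \<and> (\<forall>y \<in> V. h y = g y)"
  shows "h \<in> hol X U"
proof -
  let ?\<V> = "{V. openin (topo X) V \<and> V \<subseteq> U \<and> h \<in> hol X V}"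
  have "h \<in> hol X (\<Union>?\<V>)" by (rule function_sheaf_glue[OF X]) auto
  moreover have "\<Union>?\<V> = U"
  proof
    show "U \<subseteq> \<Union>?\<V>"
    proof
      fix x assume "x \<in> U"
      from loc[OF this] obtain V g where V: "openin (topo X) V" "x \<in> V" "V \<subseteq> U" "g \<in> hol X V" "\<forall>y \<in> V. h y = g y"
        by blast
      then have "h \<in> hol X V" using function_sheaf_cong[OF X V(1,4)] by blast
      then show "x \<in> \<Union>?\<V>" using V by blast
    qed
  qed blast
  ultimately show ?thesis by (simp only:)
qed

lemma analytic_sheaf: "analytic_fspace X \<Longrightarrow> function_sheaf X"
  by (simp add: analytic_fspace_def)

lemma analytic_openin:
  assumes "analytic_fspace X" "openin (topo X) U" "h \<in> hol X U" "open T"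
  shows "openin (topo X) {x \<in> U. h x \<in> T}"
  using assms(1)[unfolded analytic_fspace_def, THEN conjunct2, THEN conjunct1, rule_format, of U h T] assms(2-) by simp

lemma hol_compose:
  assumes "analytic_fspace X" "openin (topo X) U" "\<And>i. i < n \<Longrightarrow> c i \<in> hol X U"
    "openin (topo (Cspace n)) D" "G \<in> hol (Cspace n) D" "\<And>x. x \<in> U \<Longrightarrow> vec n (\<lambda>i. c i x) \<in> D"
  shows "(\<lambda>x. G (vec n (\<lambda>i. c i x))) \<in> hol X U"
proof -
  note * = assms(1)[unfolded analytic_fspace_def, THEN conjunct2, THEN conjunct2, rule_format, of U n c D G]
  show ?thesis
    by (rule *, intro conjI allI impI ballI) (rule assms | assumption)+
qed

text \<open>Only preimages under single coordinates are assumed open, so that this also serves for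
  the generators of a product sheaf before that sheaf is known to be analytic.\<close>

lemma openin_vec_preimage:
  assumes U: "openin T U" and op: "\<And>i B. i < n \<Longrightarrow> open B \<Longrightarrow> openin T {x \<in> U. c i x \<in> B}"
    and D: "openin (topo (Cspace n)) D"
  shows "openin T {x \<in> U. vec n (\<lambda>i. c i x) \<in> D}"
proof (subst openin_subopen, intro ballI)
  fix x assume x: "x \<in> {x \<in> U. vec n (\<lambda>i. c i x) \<in> D}"
  let ?p = "vec n (\<lambda>i. c i x)"
  obtain r where r: "r > 0" "polydisc n ?p r \<subseteq> D"
    using openin_Cn_contains_polydisc[of n D ?p] D x by (auto simp: Cspace_def)
  let ?V = "U \<inter> (\<Inter>i \<in> {..<n}. {y \<in> U. c i y \<in> ball (c i x) r})"
  have "openin T ?V"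
  proof (cases "n = 0")
    case False
    then show ?thesis using op U by (intro openin_Int openin_INT2) (auto simp del: mem_ball)
  qed (simp add: U)
  moreover have "x \<in> ?V" using x r by auto
  moreover have "?V \<subseteq> {x \<in> U. vec n (\<lambda>i. c i x) \<in> D}"
  proof
    fix y assume y: "y \<in> ?V"
    then have "vec n (\<lambda>i. c i y) \<in> polydisc n ?p r" by (auto simp: polydisc_def vec_nth)
    then show "y \<in> {x \<in> U. vec n (\<lambda>i. c i x) \<in> D}" using y r by blast
  qed
  ultimately show "\<exists>V. openin T V \<and> x \<in> V \<and> V \<subseteq> {x \<in> U. vec n (\<lambda>i. c i x) \<in> D}" by blast
qed

lemma openin_hol_vec_preimage:
  assumes "analytic_fspace X" "openin (topo X) U" "\<And>i. i < n \<Longrightarrow> c i \<in> hol X U" "openin (topo (Cspace n)) D"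
  shows "openin (topo X) {x \<in> U. vec n (\<lambda>i. c i x) \<in> D}"
  using assms by (intro openin_vec_preimage analytic_openin) auto

section \<open>The sheaf of \<open>Cn n\<close> and the algebra operations on holomorphic
  functions\<close>

lemma topo_Cspace [simp]: "topo (Cspace n) = top_of_set (Cn n)"
  by (simp add: Cspace_def)

lemma hol_Cspace: "h \<in> hol (Cspace n) U \<longleftrightarrow> (\<forall>p \<in> U. complex_differentiable_at n h p)"
  by (simp add: Cspace_def)

lemma openin_Cspace_coordinate: "open T \<Longrightarrow> openin (topo (Cspace n)) {z \<in> Cn n. z i \<in> T}"
proof -
  assume T: "open T"
  have "continuous_on UNIV (\<lambda>z :: nat \<Rightarrow> complex. z i)"
    using continuous_on_id by (rule continuous_on_product_then_coordinatewise)
  then have "open ((\<lambda>z :: nat \<Rightarrow> complex. z i) -` T)" by (rule open_vimage[OF T])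
  then show ?thesis by (auto simp: openin_open)
qed

lemma complex_differentiable_cong_open:
  assumes "complex_differentiable_at n h p" "openin (top_of_set (Cn n)) D" "p \<in> D" "\<And>z. z \<in> D \<Longrightarrow> g z = h z"
  shows "complex_differentiable_at n g p"
proof -
  have pC: "p \<in> Cn n" using assms(2,3) openin_imp_subset by blast
  obtain \<phi> where \<phi>: "\<And>z. z \<in> Cn n \<Longrightarrow> h z = h p + (\<Sum>i<n. \<phi> i z * (z i - p i))"
    "\<And>i. i < n \<Longrightarrow> continuous (at p within Cn n) (\<phi> i)"
    using complex_differentiable_at_imp_ex[OF assms(1) pC] by blast
  have sub: "D \<subseteq> Cn n" using assms(2) openin_imp_subset by blast
  show ?thesis
  proof (rule complex_differentiable_atI[OF assms(2,3) _ \<phi>(2)])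
    fix z assume "z \<in> D"
    then show "g z = g p + (\<Sum>i<n. \<phi> i z * (z i - p i))"
      using \<phi>(1)[of z] assms(3,4) sub by auto
  qed
qed

lemma analytic_Cspace: "analytic_fspace (Cspace n)"
  unfolding analytic_fspace_def
proof (intro conjI allI impI)
  show "function_sheaf (Cspace n)"
    unfolding function_sheaf_def
  proof (intro conjI allI impI)
    fix U and h g :: "(nat \<Rightarrow> complex) \<Rightarrow> complex"
    assume "openin (topo (Cspace n)) U \<and> h \<in> hol (Cspace n) U \<and> (\<forall>x \<in> U. g x = h x)"
    then show "g \<in> hol (Cspace n) U"
      using complex_differentiable_cong_open[of n h _ U g] by (simp add: hol_Cspace)
  next
    fix U V and h :: "(nat \<Rightarrow> complex) \<Rightarrow> complex"
    assume "openin (topo (Cspace n)) U \<and> openin (topo (Cspace n)) V \<and> V \<subseteq> U \<and> h \<in> hol (Cspace n) U"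
    then show "h \<in> hol (Cspace n) V" unfolding hol_Cspace by blast
  next
    fix \<V> and h :: "(nat \<Rightarrow> complex) \<Rightarrow> complex"
    assume "\<forall>V\<in>\<V>. openin (topo (Cspace n)) V \<and> h \<in> hol (Cspace n) V"
    then show "h \<in> hol (Cspace n) (\<Union>\<V>)" unfolding hol_Cspace by blast
  qed
next
  fix U and T :: "complex set" and h :: "(nat \<Rightarrow> complex) \<Rightarrow> complex"
  assume A: "openin (topo (Cspace n)) U \<and> h \<in> hol (Cspace n) U \<and> open T"
  then have "continuous_on U h"
    by (intro complex_differentiable_imp_continuous_on[of n]) (auto simp: hol_Cspace)
  then have "openin (top_of_set U) (U \<inter> h -` T)" using A by (simp add: continuous_openin_preimage_gen)
  from openin_trans[OF this, of "Cn n"] A have "openin (topo (Cspace n)) (U \<inter> h -` T)" by simp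
  then show "openin (topo (Cspace n)) {x \<in> U. h x \<in> T}" by (simp only: vimage_def Int_def mem_Collect_eq)
next
  fix U m D and c :: "nat \<Rightarrow> (nat \<Rightarrow> complex) \<Rightarrow> complex" and G
  assume A: "openin (topo (Cspace n)) U \<and> (\<forall>i<m. c i \<in> hol (Cspace n) U) \<and> openin (topo (Cspace m)) D \<and>
        G \<in> hol (Cspace m) D \<and> (\<forall>x \<in> U. vec m (\<lambda>i. c i x) \<in> D)"
  then have "U \<subseteq> Cn n" using openin_imp_subset by auto
  then show "(\<lambda>x. G (vec m (\<lambda>i. c i x))) \<in> hol (Cspace n) U"
    using A by (auto simp: hol_Cspace intro!: complex_differentiable_compose)
qed

lemma coordinate_hol_Cspace: "U \<subseteq> Cn n \<Longrightarrow> i < n \<Longrightarrow> (\<lambda>z. z i) \<in> hol (Cspace n) U"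
  unfolding hol_Cspace
  by (intro ballI complex_differentiable_coordinate[where b = "\<lambda>x. x"] field_differentiable_ident) auto

context
  fixes X :: "'a fspace" and U :: "'a set"
  assumes X: "analytic_fspace X" and U: "openin (topo X) U"
begin

text \<open>Substitution of the empty tuple into a constant function of zero variables.\<close>

lemma hol_const: "(\<lambda>x. k) \<in> hol X U"
  using hol_compose[OF X U, of 0 "\<lambda>_ _. 0" "Cn 0" "\<lambda>_. k"]
  by (simp add: hol_Cspace complex_differentiable_const)

lemma hol_holomorphic:
  assumes "b holomorphic_on T" "open T" "c \<in> hol X U" "\<And>x. x \<in> U \<Longrightarrow> c x \<in> T"
  shows "(\<lambda>x. b (c x)) \<in> hol X U"
proof -
  have "(\<lambda>z. b (z 0)) \<in> hol (Cspace 1) {z \<in> Cn 1. z 0 \<in> T}"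
    using assms holomorphic_on_imp_differentiable_at
    by (auto simp: hol_Cspace intro!: complex_differentiable_coordinate)
  from hol_compose[OF X U _ openin_Cspace_coordinate[OF assms(2)] this, of "\<lambda>_. c"] assms
  show ?thesis by (simp add: vec_nth)
qed

lemma hol_add:
  assumes "g \<in> hol X U" "h \<in> hol X U"
  shows "(\<lambda>x. g x + h x) \<in> hol X U"
proof -
  have "(\<lambda>z. z 0 + z 1) \<in> hol (Cspace 2) (Cn 2)"
    unfolding hol_Cspace
    by (intro ballI complex_differentiable_atI[where D = "Cn 2" and \<phi> = "\<lambda>_ _. 1"]) (auto simp: numeral_2_eq_2)
  from hol_compose[OF X U _ _ this, of "\<lambda>i. if i = 0 then g else h"] assms
  show ?thesis by (simp add: vec_nth)
qed

lemma hol_mult: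
  assumes "g \<in> hol X U" "h \<in> hol X U"
  shows "(\<lambda>x. g x * h x) \<in> hol X U"
proof -
  have "(\<lambda>z. z 0 * z 1) \<in> hol (Cspace 2) (Cn 2)"
    unfolding hol_Cspace
  proof
    fix p assume p: "p \<in> Cn 2"
    \<comment> \<open>The coefficient functions are read off from z0 z1 - p0 p1 = z1 (z0 - p0) + p0
      (z1 - p1).\<close>
    have "continuous (at p within Cn 2) (\<lambda>z. if i = 0 then z 1 else p 0)" for i :: nat
      using continuous_coordinate[of p "Cn 2" 1] by (cases "i = 0") auto
    then show "complex_differentiable_at 2 (\<lambda>z. z 0 * z 1) p"
      using p by (intro complex_differentiable_atI[where D = "Cn 2" and \<phi> = "\<lambda>i z. if i = 0 then z 1 else p 0"])
        (auto simp: numeral_2_eq_2 algebra_simps)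
  qed
  from hol_compose[OF X U _ _ this, of "\<lambda>i. if i = 0 then g else h"] assms
  show ?thesis by (simp add: vec_nth)
qed

lemma hol_diff:
  assumes "g \<in> hol X U" "h \<in> hol X U"
  shows "(\<lambda>x. g x - h x) \<in> hol X U"
  using hol_add[OF assms(1) hol_mult[OF hol_const[of "-1"] assms(2)]] by simp

lemma hol_divide:
  assumes "g \<in> hol X U" "h \<in> hol X U" "\<And>x. x \<in> U \<Longrightarrow> h x \<noteq> 0"
  shows "(\<lambda>x. g x / h x) \<in> hol X U"
proof -
  have "(\<lambda>x. inverse (h x)) \<in> hol X U"
    by (rule hol_holomorphic[of inverse "-{0}"]) (use assms in \<open>auto intro!: holomorphic_intros\<close>)
  from hol_mult[OF assms(1) this] show ?thesis by (simp add: divide_inverse)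
qed

lemma hol_sum: "(\<And>i. i \<in> I \<Longrightarrow> g i \<in> hol X U) \<Longrightarrow> (\<lambda>x. \<Sum>i\<in>I. g i x) \<in> hol X U"
  by (induction I rule: infinite_finite_induct) (auto intro: hol_const hol_add)

end

lemma analytic_Cline: "analytic_fspace Cline"
  unfolding analytic_fspace_def
proof (intro conjI allI impI)
  show "function_sheaf Cline"
    unfolding function_sheaf_def
  proof (intro conjI allI impI)
    fix \<V> and h :: "complex \<Rightarrow> complex"
    assume "\<forall>V\<in>\<V>. openin (topo Cline) V \<and> h \<in> hol Cline V"
    then have "h field_differentiable at x" if "x \<in> V" "V \<in> \<V>" for x V
      using that by (intro holomorphic_on_imp_differentiable_at[of h V]) (auto simp: Cline_def)
    then show "h \<in> hol Cline (\<Union>\<V>)"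
      by (auto simp: Cline_def holomorphic_on_def intro: field_differentiable_at_within)
  qed (auto simp: Cline_def intro: holomorphic_transform holomorphic_on_subset)
next
  fix U and T :: "complex set" and h :: "complex \<Rightarrow> complex"
  assume A: "openin (topo Cline) U \<and> h \<in> hol Cline U \<and> open T"
  then have "continuous_on U h" "open U" by (auto simp: Cline_def holomorphic_on_imp_continuous_on)
  then have "open (U \<inter> h -` T)" using A by (simp add: continuous_open_preimage)
  then show "openin (topo Cline) {x \<in> U. h x \<in> T}"
    by (simp add: Cline_def vimage_def Int_def)
next
  fix U m D and c :: "nat \<Rightarrow> complex \<Rightarrow> complex" and G
  assume A: "openin (topo Cline) U \<and> (\<forall>i<m. c i \<in> hol Cline U) \<and> openin (topo (Cspace m)) D \<and>
        G \<in> hol (Cspace m) D \<and> (\<forall>x \<in> U. vec m (\<lambda>i. c i x) \<in> D)"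
  have U: "open U" using A by (simp add: Cline_def)
  have "(\<lambda>x. G (vec m (\<lambda>i. c i x))) field_differentiable (at x)" if x: "x \<in> U" for x
  proof -
    have "complex_differentiable_at m G (vec m (\<lambda>i. c i x))" using A x by (simp add: hol_Cspace)
    from complex_differentiable_curve[OF this vec_in_Cn] obtain a where
      a: "\<And>c' d t0. vec m (\<lambda>i. c' i t0) = vec m (\<lambda>i. c i x) \<Longrightarrow>
     (\<And>i. i < m \<Longrightarrow> (c' i has_field_derivative d i) (at t0)) \<Longrightarrow>
     ((\<lambda>t. G (vec m (\<lambda>i. c' i t))) has_field_derivative (\<Sum>i<m. a i * d i)) (at t0)" by blast
    have "(c i has_field_derivative deriv (c i) x) (at x)" if "i < m" for i
      using A that x U by (intro holomorphic_derivI[of _ U]) (auto simp: Cline_def)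
    from a[OF refl this] show ?thesis unfolding field_differentiable_def by blast
  qed
  then show "(\<lambda>x. G (vec m (\<lambda>i. c i x))) \<in> hol Cline U"
    by (auto simp: Cline_def holomorphic_on_def intro: field_differentiable_at_within)
qed

section \<open>Subspaces, holomorphic maps and complex spaces\<close>

lemma hol_sub_fspaceD:
  assumes "h \<in> hol (sub_fspace X A) U" "x \<in> U"
  shows "\<exists>V g. openin (topo X) V \<and> x \<in> V \<and> V \<inter> A \<subseteq> U \<and> g \<in> hol X V \<and> (\<forall>y \<in> V \<inter> A. h y = g y)"
  using assms by (simp add: sub_fspace_def)

lemma hol_sub_fspaceI:
  assumes "\<And>x. x \<in> U \<Longrightarrow> \<exists>V g. openin (topo X) V \<and> x \<in> V \<and> V \<inter> A \<subseteq> U \<and> g \<in> hol X V \<and> (\<forall>y \<in> V \<inter> A. h y = g y)"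
  shows "h \<in> hol (sub_fspace X A) U"
  using assms by (simp add: sub_fspace_def)

lemma topo_sub_fspace [simp]: "topo (sub_fspace X A) = subtopology (topo X) A"
  by (simp add: sub_fspace_def)

text \<open>Sections are by definition locally restrictions, so finitely many of them extend to a
  common ambient open set, where substitution is possible. The set \<open>A\<close> is arbitrary,
  which covers open sets, analytic sets and the closure of a graph alike.\<close>

lemma analytic_sub_fspace:
  assumes X: "analytic_fspace X"
  shows "analytic_fspace (sub_fspace X A)"
  unfolding analytic_fspace_def
proof (intro conjI allI impI)
  show "function_sheaf (sub_fspace X A)"
    unfolding function_sheaf_def
  proof (intro conjI allI impI)
    fix U and h g :: "'a \<Rightarrow> complex"
    assume H: "openin (topo (sub_fspace X A)) U \<and> h \<in> hol (sub_fspace X A) U \<and> (\<forall>x \<in> U. g x = h x)"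
    show "g \<in> hol (sub_fspace X A) U"
    proof (rule hol_sub_fspaceI)
      fix x assume "x \<in> U"
      obtain V k where "openin (topo X) V" "x \<in> V" "V \<inter> A \<subseteq> U" "k \<in> hol X V" "\<forall>y \<in> V \<inter> A. h y = k y"
        using hol_sub_fspaceD[OF conjunct1[OF conjunct2[OF H]] \<open>x \<in> U\<close>] by blast
      then show "\<exists>V k. openin (topo X) V \<and> x \<in> V \<and> V \<inter> A \<subseteq> U \<and> k \<in> hol X V \<and> (\<forall>y \<in> V \<inter> A. g y = k y)"
        using H by (intro exI[of _ V] exI[of _ k]) auto
    qed
  next
    fix U V and h :: "'a \<Rightarrow> complex"
    assume H: "openin (topo (sub_fspace X A)) U \<and> openin (topo (sub_fspace X A)) V \<and> V \<subseteq> U \<and> h \<in> hol (sub_fspace X A) U"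
    then obtain T where T: "openin (topo X) T" "V = T \<inter> A" by (auto simp: openin_subtopology)
    show "h \<in> hol (sub_fspace X A) V"
    proof (rule hol_sub_fspaceI)
      fix x assume x: "x \<in> V"
      with H have "h \<in> hol (sub_fspace X A) U" "x \<in> U" by auto
      from hol_sub_fspaceD[OF this]
      obtain W k where W: "openin (topo X) W" "x \<in> W" "W \<inter> A \<subseteq> U" "k \<in> hol X W" "\<forall>y \<in> W \<inter> A. h y = k y"
        by blast
      have "k \<in> hol X (W \<inter> T)"
        using function_sheaf_mono[OF analytic_sheaf[OF X] W(1) _ _ W(4)] W(1) T(1) by auto
      then show "\<exists>W k. openin (topo X) W \<and> x \<in> W \<and> W \<inter> A \<subseteq> V \<and> k \<in> hol X W \<and> (\<forall>y \<in> W \<inter> A. h y = k y)"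
        using W T x by (intro exI[of _ "W \<inter> T"] exI[of _ k]) auto
    qed
  next
    fix \<V> and h :: "'a \<Rightarrow> complex"
    assume H: "\<forall>V\<in>\<V>. openin (topo (sub_fspace X A)) V \<and> h \<in> hol (sub_fspace X A) V"
    show "h \<in> hol (sub_fspace X A) (\<Union>\<V>)"
    proof (rule hol_sub_fspaceI)
      fix x assume "x \<in> \<Union>\<V>"
      then obtain V where "V \<in> \<V>" "x \<in> V" by blast
      with H have "h \<in> hol (sub_fspace X A) V" by auto
      from hol_sub_fspaceD[OF this \<open>x \<in> V\<close>]
      obtain W k where W: "openin (topo X) W" "x \<in> W" "W \<inter> A \<subseteq> V" "k \<in> hol X W" "\<forall>y \<in> W \<inter> A. h y = k y"
        by blast
      then show "\<exists>W k. openin (topo X) W \<and> x \<in> W \<and> W \<inter> A \<subseteq> \<Union>\<V> \<and> k \<in> hol X W \<and> (\<forall>y \<in> W \<inter> A. h y = k y)"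
        using \<open>V \<in> \<V>\<close> by (intro exI[of _ W] exI[of _ k]) auto
    qed
  qed
next
  fix U and T :: "complex set" and h :: "'a \<Rightarrow> complex"
  assume H: "openin (topo (sub_fspace X A)) U \<and> h \<in> hol (sub_fspace X A) U \<and> open T"
  show "openin (topo (sub_fspace X A)) {x \<in> U. h x \<in> T}"
  proof (subst openin_subopen, intro ballI)
    fix x assume x: "x \<in> {x \<in> U. h x \<in> T}"
    then have xA: "x \<in> A" using H openin_subset by fastforce
    have "h \<in> hol (sub_fspace X A) U" "x \<in> U" using H x by auto
    from hol_sub_fspaceD[OF this]
    obtain W k where W: "openin (topo X) W" "x \<in> W" "W \<inter> A \<subseteq> U" "k \<in> hol X W" "\<forall>y \<in> W \<inter> A. h y = k y"
      by blast
    have "openin (topo X) {y \<in> W. k y \<in> T}" using analytic_openin[OF X W(1,4)] H by blast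
    then show "\<exists>V. openin (topo (sub_fspace X A)) V \<and> x \<in> V \<and> V \<subseteq> {x \<in> U. h x \<in> T}"
      using W xA x by (intro exI[of _ "{y \<in> W. k y \<in> T} \<inter> A"]) (auto simp: openin_subtopology)
  qed
next
  fix U n D and c :: "nat \<Rightarrow> 'a \<Rightarrow> complex" and G
  assume H: "openin (topo (sub_fspace X A)) U \<and> (\<forall>i<n. c i \<in> hol (sub_fspace X A) U) \<and> openin (topo (Cspace n)) D \<and>
        G \<in> hol (Cspace n) D \<and> (\<forall>x \<in> U. vec n (\<lambda>i. c i x) \<in> D)"
  show "(\<lambda>x. G (vec n (\<lambda>i. c i x))) \<in> hol (sub_fspace X A) U"
  proof (rule hol_sub_fspaceI)
    fix x assume x: "x \<in> U"
    obtain O' where O': "openin (topo X) O'" "U = O' \<inter> A" using H by (auto simp: openin_subtopology)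
    have "\<exists>V g. openin (topo X) V \<and> x \<in> V \<and> V \<inter> A \<subseteq> U \<and> g \<in> hol X V \<and> (\<forall>y \<in> V \<inter> A. c i y = g y)" if "i < n" for i
      using H that x by (intro hol_sub_fspaceD) auto
    then obtain V g where V: "\<And>i. i < n \<Longrightarrow> openin (topo X) (V i)" "\<And>i. i < n \<Longrightarrow> x \<in> V i"
      "\<And>i. i < n \<Longrightarrow> g i \<in> hol X (V i)" "\<And>i y. i < n \<Longrightarrow> y \<in> V i \<inter> A \<Longrightarrow> c i y = g i y" by metis
    define W where "W = O' \<inter> (\<Inter>i \<in> {..<n}. V i)"
    have W: "openin (topo X) W"
    proof (cases "n = 0")
      case False
      then show ?thesis unfolding W_def using V(1) O'(1) by (intro openin_Int openin_INT2) auto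
    qed (simp add: W_def O')
    have g: "g i \<in> hol X W" if "i < n" for i
      by (rule function_sheaf_mono[OF analytic_sheaf[OF X] V(1)[OF that] W _ V(3)[OF that]]) (use that in \<open>auto simp: W_def\<close>)
    \<comment> \<open>Away from \<open>A\<close> the extensions need not take values in
      \<open>D\<close>, so the ambient set is shrunk once more.\<close>
    define W' where "W' = {y \<in> W. vec n (\<lambda>i. g i y) \<in> D}"
    have W': "openin (topo X) W'"
      unfolding W'_def by (rule openin_hol_vec_preimage[OF X W g]) (use H in auto)
    have g': "g i \<in> hol X W'" if "i < n" for i
      by (rule function_sheaf_mono[OF analytic_sheaf[OF X] W W' _ g[OF that]]) (auto simp: W'_def)
    have eq: "vec n (\<lambda>i. c i y) = vec n (\<lambda>i. g i y)" if "y \<in> W" "y \<in> A" for y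
      using that V(4) by (auto simp: vec_def W_def fun_eq_iff)
    have "(\<lambda>y. G (vec n (\<lambda>i. g i y))) \<in> hol X W'"
      by (rule hol_compose[OF X W' g']) (use H in \<open>auto simp: W'_def\<close>)
    moreover have "x \<in> W'"
    proof -
      have "x \<in> W" "x \<in> A" using x O' V(2) by (auto simp: W_def)
      moreover have "vec n (\<lambda>i. c i x) \<in> D" using H x by blast
      ultimately show ?thesis using eq[of x] by (simp add: W'_def)
    qed
    moreover have "W' \<inter> A \<subseteq> U" by (auto simp: W'_def W_def O')
    ultimately show "\<exists>V g. openin (topo X) V \<and> x \<in> V \<and> V \<inter> A \<subseteq> U \<and> g \<in> hol X V \<and> (\<forall>y \<in> V \<inter> A. G (vec n (\<lambda>i. c i y)) = g y)"
      using W' eq by (intro exI[of _ W'] exI[of _ "\<lambda>y. G (vec n (\<lambda>i. g i y))"]) (simp add: W'_def)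
  qed
qed

lemma hol_sub_fspace_open:
  assumes X: "function_sheaf X" and A: "openin (topo X) A" and U: "openin (topo X) U" "U \<subseteq> A"
  shows "hol (sub_fspace X A) U = hol X U"
proof
  show "hol X U \<subseteq> hol (sub_fspace X A) U"
    using U by (intro subsetI hol_sub_fspaceI) blast
  show "hol (sub_fspace X A) U \<subseteq> hol X U"
  proof
    fix h assume h: "h \<in> hol (sub_fspace X A) U"
    show "h \<in> hol X U"
    proof (rule function_sheaf_localI[OF X])
      fix x assume x: "x \<in> U"
      obtain V g where V: "openin (topo X) V" "x \<in> V" "V \<inter> A \<subseteq> U" "g \<in> hol X V" "\<forall>y \<in> V \<inter> A. h y = g y"
        using hol_sub_fspaceD[OF h x] by blast
      have "g \<in> hol X (V \<inter> A)" by (rule function_sheaf_mono[OF X V(1) _ _ V(4)]) (use V A in auto)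
      then show "\<exists>V g. openin (topo X) V \<and> x \<in> V \<and> V \<subseteq> U \<and> g \<in> hol X V \<and> (\<forall>y\<in>V. h y = g y)"
        using V A U x by (intro exI[of _ "V \<inter> A"] exI[of _ g]) auto
    qed
  qed
qed

lemma openin_sub_fspace_open:
  "openin (topo X) A \<Longrightarrow> openin (topo (sub_fspace X A)) U \<longleftrightarrow> openin (topo X) U \<and> U \<subseteq> A"
  by (simp add: openin_open_subtopology)

lemma holomorphic_map_hol:
  assumes "holomorphic_map X Y \<phi>" "openin (topo Y) V" "h \<in> hol Y V"
  shows "(\<lambda>x. h (\<phi> x)) \<in> hol X {x \<in> topspace (topo X). \<phi> x \<in> V}"
  using assms(1)[unfolded holomorphic_map_def, THEN conjunct2, rule_format, of V h] assms(2,3)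
  by (simp add: comp_def)

lemma holomorphic_map_openin:
  assumes "holomorphic_map X Y \<phi>" "openin (topo Y) V"
  shows "openin (topo X) {x \<in> topspace (topo X). \<phi> x \<in> V}"
  using assms by (simp add: holomorphic_map_def continuous_map_def)

lemma holomorphic_map_in:
  assumes "holomorphic_map X Y \<phi>" "x \<in> topspace (topo X)"
  shows "\<phi> x \<in> topspace (topo Y)"
  using assms by (auto simp: holomorphic_map_def continuous_map_def)

lemma holomorphic_mapI:
  assumes "\<phi> \<in> topspace (topo X) \<rightarrow> topspace (topo Y)"
    and "\<And>V. openin (topo Y) V \<Longrightarrow> openin (topo X) {x \<in> topspace (topo X). \<phi> x \<in> V}"
    and "\<And>V h. openin (topo Y) V \<Longrightarrow> h \<in> hol Y V \<Longrightarrow> (\<lambda>x. h (\<phi> x)) \<in> hol X {x \<in> topspace (topo X). \<phi> x \<in> V}"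
  shows "holomorphic_map X Y \<phi>"
  using assms unfolding holomorphic_map_def continuous_map_def comp_def by blast

lemma holomorphic_map_compose:
  assumes X: "function_sheaf X" and \<phi>: "holomorphic_map X Y \<phi>" and \<psi>: "holomorphic_map Y Z \<psi>"
  shows "holomorphic_map X Z (\<lambda>x. \<psi> (\<phi> x))"
proof -
  have eq: "{x \<in> topspace (topo X). \<psi> (\<phi> x) \<in> V} = {x \<in> topspace (topo X). \<phi> x \<in> {y \<in> topspace (topo Y). \<psi> y \<in> V}}" for V
    using holomorphic_map_in[OF \<phi>] by auto
  show ?thesis
  proof (rule holomorphic_mapI)
    show "(\<lambda>x. \<psi> (\<phi> x)) \<in> topspace (topo X) \<rightarrow> topspace (topo Z)"
      using holomorphic_map_in[OF \<phi>] holomorphic_map_in[OF \<psi>] by auto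
  next
    fix V assume V: "openin (topo Z) V"
    show "openin (topo X) {x \<in> topspace (topo X). \<psi> (\<phi> x) \<in> V}"
      unfolding eq by (intro holomorphic_map_openin[OF \<phi>] holomorphic_map_openin[OF \<psi>] V)
  next
    fix V h assume V: "openin (topo Z) V" "h \<in> hol Z V"
    show "(\<lambda>x. h (\<psi> (\<phi> x))) \<in> hol X {x \<in> topspace (topo X). \<psi> (\<phi> x) \<in> V}"
      unfolding eq
      by (rule holomorphic_map_hol[OF \<phi>, of _ "\<lambda>y. h (\<psi> y)"])
        (intro holomorphic_map_openin[OF \<psi>] holomorphic_map_hol[OF \<psi>] V)+
  qed
qed

text \<open>Both closure properties are local and speak only of functions and open sets, so they are
  carried to the model by \<psi> and back by \<phi>.\<close>

lemma analytic_transfer: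
  assumes X: "function_sheaf X"
    and loc: "\<And>p. p \<in> topspace (topo X) \<Longrightarrow> \<exists>U (Y :: 'b fspace) \<phi>. openin (topo X) U \<and> p \<in> U \<and>
        analytic_fspace Y \<and> biholomorphic_map (sub_fspace X U) Y \<phi>"
  shows "analytic_fspace X"
proof -
  have chart: "\<exists>U (Y :: 'b fspace) \<phi> \<psi>. openin (topo X) U \<and> p \<in> U \<and> analytic_fspace Y \<and>
      holomorphic_map (sub_fspace X U) Y \<phi> \<and> holomorphic_map Y (sub_fspace X U) \<psi> \<and>
      (\<forall>x \<in> U. \<psi> (\<phi> x) = x)" if p: "p \<in> topspace (topo X)" for p
  proof -
    obtain U and Y :: "'b fspace" and \<phi> where U: "openin (topo X) U" "p \<in> U" "analytic_fspace Y" "biholomorphic_map (sub_fspace X U) Y \<phi>"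
      using loc[OF p] by blast
    from U(4) obtain \<psi> where "holomorphic_map (sub_fspace X U) Y \<phi>" "holomorphic_map Y (sub_fspace X U) \<psi>"
      "\<forall>x \<in> topspace (topo (sub_fspace X U)). \<psi> (\<phi> x) = x"
      unfolding biholomorphic_map_def by blast
    moreover have "topspace (topo (sub_fspace X U)) = U" using openin_subset[OF U(1)] by auto
    ultimately show ?thesis using U by (intro exI[of _ U] exI[of _ Y] exI[of _ \<phi>] exI[of _ \<psi>]) simp
  qed
  show ?thesis
    unfolding analytic_fspace_def
  proof (intro conjI allI impI X)
    fix U0 and T :: "complex set" and h
    assume H: "openin (topo X) U0 \<and> h \<in> hol X U0 \<and> open T"
    show "openin (topo X) {x \<in> U0. h x \<in> T}"
    proof (subst openin_subopen, intro ballI)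
      fix x assume x: "x \<in> {x \<in> U0. h x \<in> T}"
      then have "x \<in> topspace (topo X)" using H openin_subset by blast
      from chart[OF this] obtain U and Y :: "'b fspace" and \<phi> \<psi> where U: "openin (topo X) U" "x \<in> U" "analytic_fspace Y"
        "holomorphic_map (sub_fspace X U) Y \<phi>" "holomorphic_map Y (sub_fspace X U) \<psi>" "\<And>x. x \<in> U \<Longrightarrow> \<psi> (\<phi> x) = x"
        by blast
      have ts: "topspace (topo (sub_fspace X U)) = U" using openin_subset[OF U(1)] by auto
      let ?W = "U \<inter> U0"
      let ?W' = "{y \<in> topspace (topo Y). \<psi> y \<in> ?W}"
      have W: "openin (topo X) ?W" using U(1) H by blast
      then have Ws: "openin (topo (sub_fspace X U)) ?W" by (simp add: openin_sub_fspace_open[OF U(1)] del: topo_sub_fspace)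
      have "h \<in> hol X ?W" using function_sheaf_mono[OF X _ W] H by blast
      then have "h \<in> hol (sub_fspace X U) ?W" using hol_sub_fspace_open[OF X U(1) W] by simp
      from analytic_openin[OF U(3) holomorphic_map_openin[OF U(5) Ws] holomorphic_map_hol[OF U(5) Ws this]] H
      have "openin (topo Y) {y \<in> ?W'. h (\<psi> y) \<in> T}" by blast
      from holomorphic_map_openin[OF U(4) this]
      have "openin (topo X) {y \<in> U. \<phi> y \<in> {y \<in> ?W'. h (\<psi> y) \<in> T}}"
        unfolding ts openin_sub_fspace_open[OF U(1)] by blast
      moreover have "{y \<in> U. \<phi> y \<in> {y \<in> ?W'. h (\<psi> y) \<in> T}} = {x \<in> ?W. h x \<in> T}"
        using holomorphic_map_in[OF U(4), unfolded ts] U(6) by auto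
      ultimately have "openin (topo X) {x \<in> ?W. h x \<in> T}" by simp
      then show "\<exists>V. openin (topo X) V \<and> x \<in> V \<and> V \<subseteq> {x \<in> U0. h x \<in> T}"
        using x U(2) by (intro exI[of _ "{x \<in> ?W. h x \<in> T}"]) auto
    qed
  next
    fix U0 n D c G
    assume H: "openin (topo X) U0 \<and> (\<forall>i<n. c i \<in> hol X U0) \<and> openin (topo (Cspace n)) D \<and>
        G \<in> hol (Cspace n) D \<and> (\<forall>x \<in> U0. vec n (\<lambda>i. c i x) \<in> D)"
    show "(\<lambda>x. G (vec n (\<lambda>i. c i x))) \<in> hol X U0"
    proof (rule function_sheaf_localI[OF X])
      fix x assume x: "x \<in> U0"
      then have "x \<in> topspace (topo X)" using H openin_subset by blast
      from chart[OF this] obtain U and Y :: "'b fspace" and \<phi> \<psi> where U: "openin (topo X) U" "x \<in> U" "analytic_fspace Y"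
        "holomorphic_map (sub_fspace X U) Y \<phi>" "holomorphic_map Y (sub_fspace X U) \<psi>" "\<And>x. x \<in> U \<Longrightarrow> \<psi> (\<phi> x) = x"
        by blast
      have ts: "topspace (topo (sub_fspace X U)) = U" using openin_subset[OF U(1)] by auto
      let ?W = "U \<inter> U0"
      let ?W' = "{y \<in> topspace (topo Y). \<psi> y \<in> ?W}"
      have W: "openin (topo X) ?W" using U(1) H by blast
      then have Ws: "openin (topo (sub_fspace X U)) ?W" by (simp add: openin_sub_fspace_open[OF U(1)] del: topo_sub_fspace)
      have "c i \<in> hol (sub_fspace X U) ?W" if "i < n" for i
      proof -
        have "c i \<in> hol X ?W" using function_sheaf_mono[OF X _ W, of U0 "c i"] H that by blast
        then show ?thesis using hol_sub_fspace_open[OF X U(1) W] by simp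
      qed
      then have "(\<lambda>y. c i (\<psi> y)) \<in> hol Y ?W'" if "i < n" for i
        using holomorphic_map_hol[OF U(5) Ws] that by blast
      then have "(\<lambda>y. G (vec n (\<lambda>i. c i (\<psi> y)))) \<in> hol Y ?W'"
        using H by (intro hol_compose[OF U(3) holomorphic_map_openin[OF U(5) Ws], of n "\<lambda>i y. c i (\<psi> y)" D]) auto
      from holomorphic_map_hol[OF U(4) holomorphic_map_openin[OF U(5) Ws] this]
      have "(\<lambda>x. G (vec n (\<lambda>i. c i (\<psi> (\<phi> x))))) \<in> hol (sub_fspace X U) {x \<in> U. \<phi> x \<in> ?W'}" unfolding ts .
      moreover have "{x \<in> U. \<phi> x \<in> ?W'} = ?W"
        using holomorphic_map_in[OF U(4), unfolded ts] U(6) by auto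
      ultimately have "(\<lambda>x. G (vec n (\<lambda>i. c i (\<psi> (\<phi> x))))) \<in> hol X ?W"
        using hol_sub_fspace_open[OF X U(1) W] by simp
      then show "\<exists>V g. openin (topo X) V \<and> x \<in> V \<and> V \<subseteq> U0 \<and> g \<in> hol X V \<and> (\<forall>y\<in>V. G (vec n (\<lambda>i. c i y)) = g y)"
        using W x U(2,6) by (intro exI[of _ ?W] exI[of _ "\<lambda>x. G (vec n (\<lambda>i. c i (\<psi> (\<phi> x))))"]) simp
    qed
  qed
qed

text \<open>Apart from the construction of generators at \<open>z0\<close>, this is the only place
  where the charts of a complex space are opened.\<close>

lemma complex_space_analytic:
  assumes "complex_space X"
  shows "analytic_fspace X"
proof (rule analytic_transfer)
  show "function_sheaf X" using assms by (simp add: complex_space_def)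
  fix p assume "p \<in> topspace (topo X)"
  then obtain U n A \<phi> where "openin (topo X) U" "p \<in> U" "biholomorphic_map (sub_fspace X U) (sub_fspace (Cspace n) A) \<phi>"
    using assms unfolding complex_space_def by blast
  then show "\<exists>U (Y :: (nat \<Rightarrow> complex) fspace) \<phi>. openin (topo X) U \<and> p \<in> U \<and>
        analytic_fspace Y \<and> biholomorphic_map (sub_fspace X U) Y \<phi>"
    using analytic_sub_fspace[OF analytic_Cspace] by blast
qed

section \<open>Products\<close>

definition prod_generators :: "'a fspace \<Rightarrow> 'b fspace \<Rightarrow> 'a set \<Rightarrow> 'b set \<Rightarrow> ('a \<times> 'b \<Rightarrow> complex) set" where
  "prod_generators X Y U V = {a \<circ> fst | a. a \<in> hol X U} \<union> {b \<circ> snd | b. b \<in> hol Y V}"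

lemma topo_prod_fspace [simp]: "topo (prod_fspace X Y) = prod_topology (topo X) (topo Y)"
  by (simp add: prod_fspace_def)

lemma hol_prod_fspaceD:
  assumes "h \<in> hol (prod_fspace X Y) W" "p \<in> W"
  shows "\<exists>U V n c D G. openin (topo X) U \<and> openin (topo Y) V \<and> p \<in> U \<times> V \<and> U \<times> V \<subseteq> W \<and>
    (\<forall>i<n. c i \<in> prod_generators X Y U V) \<and> openin (topo (Cspace n)) D \<and> G \<in> hol (Cspace n) D \<and>
    (\<forall>w \<in> U \<times> V. vec n (\<lambda>i. c i w) \<in> D \<and> h w = G (vec n (\<lambda>i. c i w)))"
  using assms unfolding prod_fspace_def prod_generators_def by simp

lemma hol_prod_fspaceI:
  assumes "\<And>p. p \<in> W \<Longrightarrow> \<exists>U V n c D G. openin (topo X) U \<and> openin (topo Y) V \<and> p \<in> U \<times> V \<and> U \<times> V \<subseteq> W \<and>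
    (\<forall>i<n. c i \<in> prod_generators X Y U V) \<and> openin (topo (Cspace n)) D \<and> G \<in> hol (Cspace n) D \<and>
    (\<forall>w \<in> U \<times> V. vec n (\<lambda>i. c i w) \<in> D \<and> h w = G (vec n (\<lambda>i. c i w)))"
  shows "h \<in> hol (prod_fspace X Y) W"
  using assms unfolding prod_fspace_def prod_generators_def by simp

context
  fixes X :: "'a fspace" and Y :: "'b fspace"
  assumes X: "analytic_fspace X" and Y: "analytic_fspace Y"
begin

lemma prod_generators_mono:
  assumes "openin (topo X) U" "openin (topo Y) V" "openin (topo X) U'" "openin (topo Y) V'" "U' \<subseteq> U" "V' \<subseteq> V"
  shows "prod_generators X Y U V \<subseteq> prod_generators X Y U' V'"
  using function_sheaf_mono[OF analytic_sheaf[OF X] assms(1,3,5)] function_sheaf_mono[OF analytic_sheaf[OF Y] assms(2,4,6)]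
  unfolding prod_generators_def by blast

lemma prod_generators_openin:
  assumes "openin (topo X) U" "openin (topo Y) V" "c \<in> prod_generators X Y U V" "open B"
  shows "openin (prod_topology (topo X) (topo Y)) {w \<in> U \<times> V. c w \<in> B}"
  using assms(3) unfolding prod_generators_def
proof (elim UnE CollectE exE conjE)
  fix a assume a: "c = a \<circ> fst" "a \<in> hol X U"
  have "{w \<in> U \<times> V. c w \<in> B} = {x \<in> U. a x \<in> B} \<times> V" using a(1) by auto
  then show ?thesis using analytic_openin[OF X assms(1) a(2) assms(4)] assms(2) by (simp add: openin_prod_Times_iff)
next
  fix b assume b: "c = b \<circ> snd" "b \<in> hol Y V"
  have "{w \<in> U \<times> V. c w \<in> B} = U \<times> {y \<in> V. b y \<in> B}" using b(1) by auto
  then show ?thesis using analytic_openin[OF Y assms(2) b(2) assms(4)] assms(1) by (simp add: openin_prod_Times_iff)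
qed

text \<open>Each function comes with its own neighbourhood and list of generators. Concatenating the
  lists lets finitely many functions be written over one list, so that a function of them is again a
  function of that list.\<close>

lemma hol_prod_common:
  fixes m :: nat
  assumes W: "openin (topo (prod_fspace X Y)) W" and p: "p \<in> W"
    and h: "\<And>i. i < m \<Longrightarrow> h i \<in> hol (prod_fspace X Y) W"
  shows "\<exists>U V n c. openin (topo X) U \<and> openin (topo Y) V \<and> p \<in> U \<times> V \<and> U \<times> V \<subseteq> W \<and>
    (\<forall>i<n. c i \<in> prod_generators X Y U V) \<and>
    (\<forall>i<m. \<exists>D G. openin (topo (Cspace n)) D \<and> G \<in> hol (Cspace n) D \<and>
       (\<forall>w \<in> U \<times> V. vec n (\<lambda>i. c i w) \<in> D \<and> h i w = G (vec n (\<lambda>i. c i w))))"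
  using h
proof (induction m)
  case 0
  obtain U V where "openin (topo X) U" "openin (topo Y) V" "p \<in> U \<times> V" "U \<times> V \<subseteq> W"
    using W p unfolding topo_prod_fspace openin_prod_topology_alt by (metis mem_Sigma_iff surj_pair)
  then show ?case by (intro exI[of _ U] exI[of _ V] exI[of _ 0]) auto
next
  case (Suc m)
  then obtain U V n c where 1: "openin (topo X) U" "openin (topo Y) V" "p \<in> U \<times> V" "U \<times> V \<subseteq> W"
    "\<forall>i<n. c i \<in> prod_generators X Y U V"
    "\<forall>i<m. \<exists>D G. openin (topo (Cspace n)) D \<and> G \<in> hol (Cspace n) D \<and>
       (\<forall>w \<in> U \<times> V. vec n (\<lambda>i. c i w) \<in> D \<and> h i w = G (vec n (\<lambda>i. c i w)))" by force
  have "h m \<in> hol (prod_fspace X Y) W" using Suc.prems by simp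
  from hol_prod_fspaceD[OF this p] obtain U' V' n' c' D' G' where
    2: "openin (topo X) U'" "openin (topo Y) V'" "p \<in> U' \<times> V'" "U' \<times> V' \<subseteq> W"
    "\<forall>i<n'. c' i \<in> prod_generators X Y U' V'" "openin (topo (Cspace n')) D'" "G' \<in> hol (Cspace n') D'"
    "\<forall>w \<in> U' \<times> V'. vec n' (\<lambda>i. c' i w) \<in> D' \<and> h m w = G' (vec n' (\<lambda>i. c' i w))" by blast
  let ?U = "U \<inter> U'" and ?V = "V \<inter> V'" and ?n = "n + n'" and ?c = "\<lambda>i. if i < n then c i else c' (i - n)"
  have op: "openin (topo X) ?U" "openin (topo Y) ?V" using 1 2 by auto
  have gen: "prod_generators X Y U V \<subseteq> prod_generators X Y ?U ?V" "prod_generators X Y U' V' \<subseteq> prod_generators X Y ?U ?V"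
    using 1 2 op by (intro prod_generators_mono; blast)+
  \<comment> \<open>A function of \<open>k\<close> variables is read as one of \<open>?n\<close>
    variables that uses only the block of indices starting at \<open>s\<close>.\<close>
  have sub: "openin (topo (Cspace ?n)) {z \<in> Cn ?n. vec k (\<lambda>i. z (s + i)) \<in> D} \<and>
      (\<lambda>z. G (vec k (\<lambda>i. z (s + i)))) \<in> hol (Cspace ?n) {z \<in> Cn ?n. vec k (\<lambda>i. z (s + i)) \<in> D}"
    if "s + k \<le> ?n" "openin (topo (Cspace k)) D" "G \<in> hol (Cspace k) D" for s k D G
  proof -
    have op: "openin (topo (Cspace ?n)) {z \<in> Cn ?n. vec k (\<lambda>i. z (s + i)) \<in> D}"
      using that by (intro openin_hol_vec_preimage[OF analytic_Cspace] coordinate_hol_Cspace) auto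
    have "(\<lambda>z. G (vec k (\<lambda>i. z (s + i)))) \<in> hol (Cspace ?n) {z \<in> Cn ?n. vec k (\<lambda>i. z (s + i)) \<in> D}"
      using that by (intro hol_compose[OF analytic_Cspace op, where D = D] coordinate_hol_Cspace) auto
    with op show ?thesis by blast
  qed
  show ?case
  proof (intro exI[of _ ?U] exI[of _ ?V] exI[of _ ?n] exI[of _ ?c] conjI op allI impI)
    show "p \<in> ?U \<times> ?V" "?U \<times> ?V \<subseteq> W" using 1 2 by auto
    show "?c i \<in> prod_generators X Y ?U ?V" if "i < ?n" for i
      using that 1(5) 2(5) gen by (cases "i < n") auto
    show "\<exists>D G. openin (topo (Cspace ?n)) D \<and> G \<in> hol (Cspace ?n) D \<and>
       (\<forall>w \<in> ?U \<times> ?V. vec ?n (\<lambda>i. ?c i w) \<in> D \<and> h i w = G (vec ?n (\<lambda>i. ?c i w)))" if "i < Suc m" for i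
    proof (cases "i = m")
      case True
      have eq: "vec n' (\<lambda>i. vec ?n (\<lambda>i. ?c i w) (n + i)) = vec n' (\<lambda>i. c' i w)" for w
        by (auto simp: vec_def fun_eq_iff)
      have "vec ?n (\<lambda>i. ?c i w) \<in> {z \<in> Cn ?n. vec n' (\<lambda>i. z (n + i)) \<in> D'} \<and>
          h i w = G' (vec n' (\<lambda>i. vec ?n (\<lambda>i. ?c i w) (n + i)))" if "w \<in> ?U \<times> ?V" for w
        unfolding mem_Collect_eq eq True using 2(8) that vec_in_Cn by blast
      then show ?thesis
        using sub[OF order_refl 2(6,7)]
        by (intro exI[of _ "{z \<in> Cn ?n. vec n' (\<lambda>i. z (n + i)) \<in> D'}"] exI[of _ "\<lambda>z. G' (vec n' (\<lambda>i. z (n + i)))"]) blast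
    next
      case False
      then have "i < m" using \<open>i < Suc m\<close> by simp
      then obtain D G where DG: "openin (topo (Cspace n)) D" "G \<in> hol (Cspace n) D"
       "\<forall>w \<in> U \<times> V. vec n (\<lambda>i. c i w) \<in> D \<and> h i w = G (vec n (\<lambda>i. c i w))" using 1(6) by blast
      have eq: "vec n (\<lambda>i. vec ?n (\<lambda>i. ?c i w) (0 + i)) = vec n (\<lambda>i. c i w)" for w
        by (auto simp: vec_def fun_eq_iff)
      have "vec ?n (\<lambda>i. ?c i w) \<in> {z \<in> Cn ?n. vec n (\<lambda>i. z (0 + i)) \<in> D} \<and>
          h i w = G (vec n (\<lambda>i. vec ?n (\<lambda>i. ?c i w) (0 + i)))" if "w \<in> ?U \<times> ?V" for w
        unfolding mem_Collect_eq eq using DG(3) that vec_in_Cn by blast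
      moreover have "0 + n \<le> ?n" by simp
      ultimately show ?thesis
        using sub[OF _ DG(1,2), of 0]
        by (intro exI[of _ "{z \<in> Cn ?n. vec n (\<lambda>i. z (0 + i)) \<in> D}"] exI[of _ "\<lambda>z. G (vec n (\<lambda>i. z (0 + i)))"]) blast
    qed
  qed
qed

lemma analytic_prod_fspace: "analytic_fspace (prod_fspace X Y)"
  unfolding analytic_fspace_def
proof (intro conjI allI impI)
  show "function_sheaf (prod_fspace X Y)"
    unfolding function_sheaf_def
  proof (intro conjI allI impI)
    fix W h g
    assume H: "openin (topo (prod_fspace X Y)) W \<and> h \<in> hol (prod_fspace X Y) W \<and> (\<forall>x \<in> W. g x = h x)"
    show "g \<in> hol (prod_fspace X Y) W"
    proof (rule hol_prod_fspaceI)
      fix p assume p: "p \<in> W"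
      from hol_prod_fspaceD[OF conjunct1[OF conjunct2[OF H]] p] obtain U V n c D G where
        "openin (topo X) U" "openin (topo Y) V" "p \<in> U \<times> V" "U \<times> V \<subseteq> W" "\<forall>i<n. c i \<in> prod_generators X Y U V"
        "openin (topo (Cspace n)) D" "G \<in> hol (Cspace n) D"
        "\<forall>w \<in> U \<times> V. vec n (\<lambda>i. c i w) \<in> D \<and> h w = G (vec n (\<lambda>i. c i w))" by blast
      then show "\<exists>U V n c D G. openin (topo X) U \<and> openin (topo Y) V \<and> p \<in> U \<times> V \<and> U \<times> V \<subseteq> W \<and>
        (\<forall>i<n. c i \<in> prod_generators X Y U V) \<and> openin (topo (Cspace n)) D \<and> G \<in> hol (Cspace n) D \<and>
        (\<forall>w \<in> U \<times> V. vec n (\<lambda>i. c i w) \<in> D \<and> g w = G (vec n (\<lambda>i. c i w)))"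
        using H by (intro exI[of _ U] exI[of _ V] exI[of _ n] exI[of _ c] exI[of _ D] exI[of _ G]) auto
    qed
  next
    fix W W' h
    assume H: "openin (topo (prod_fspace X Y)) W \<and> openin (topo (prod_fspace X Y)) W' \<and> W' \<subseteq> W \<and> h \<in> hol (prod_fspace X Y) W"
    show "h \<in> hol (prod_fspace X Y) W'"
    proof (rule hol_prod_fspaceI)
      fix p assume p: "p \<in> W'"
      with H have "p \<in> W" "h \<in> hol (prod_fspace X Y) W" by auto
      from hol_prod_fspaceD[OF this(2,1)] obtain U V n c D G where
        1: "openin (topo X) U" "openin (topo Y) V" "p \<in> U \<times> V" "U \<times> V \<subseteq> W" "\<forall>i<n. c i \<in> prod_generators X Y U V"
        "openin (topo (Cspace n)) D" "G \<in> hol (Cspace n) D"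
        "\<forall>w \<in> U \<times> V. vec n (\<lambda>i. c i w) \<in> D \<and> h w = G (vec n (\<lambda>i. c i w))" by blast
      obtain U' V' where 2: "openin (topo X) U'" "openin (topo Y) V'" "p \<in> U' \<times> V'" "U' \<times> V' \<subseteq> W'"
        using H p unfolding topo_prod_fspace openin_prod_topology_alt by (metis mem_Sigma_iff surj_pair)
      have "prod_generators X Y U V \<subseteq> prod_generators X Y (U \<inter> U') (V \<inter> V')"
        by (rule prod_generators_mono) (use 1 2 in auto)
      then show "\<exists>U V n c D G. openin (topo X) U \<and> openin (topo Y) V \<and> p \<in> U \<times> V \<and> U \<times> V \<subseteq> W' \<and>
        (\<forall>i<n. c i \<in> prod_generators X Y U V) \<and> openin (topo (Cspace n)) D \<and> G \<in> hol (Cspace n) D \<and>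
        (\<forall>w \<in> U \<times> V. vec n (\<lambda>i. c i w) \<in> D \<and> h w = G (vec n (\<lambda>i. c i w)))"
        using 1 2 by (intro exI[of _ "U \<inter> U'"] exI[of _ "V \<inter> V'"] exI[of _ n] exI[of _ c] exI[of _ D] exI[of _ G]) auto
    qed
  next
    fix \<V> h
    assume H: "\<forall>V\<in>\<V>. openin (topo (prod_fspace X Y)) V \<and> h \<in> hol (prod_fspace X Y) V"
    show "h \<in> hol (prod_fspace X Y) (\<Union>\<V>)"
    proof (rule hol_prod_fspaceI)
      fix p assume "p \<in> \<Union>\<V>"
      then obtain W where W: "W \<in> \<V>" "p \<in> W" by blast
      with H have "h \<in> hol (prod_fspace X Y) W" by blast
      from hol_prod_fspaceD[OF this W(2)] obtain U V n c D G where
        "openin (topo X) U" "openin (topo Y) V" "p \<in> U \<times> V" "U \<times> V \<subseteq> W" "\<forall>i<n. c i \<in> prod_generators X Y U V"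
        "openin (topo (Cspace n)) D" "G \<in> hol (Cspace n) D"
        "\<forall>w \<in> U \<times> V. vec n (\<lambda>i. c i w) \<in> D \<and> h w = G (vec n (\<lambda>i. c i w))" by blast
      then show "\<exists>U V n c D G. openin (topo X) U \<and> openin (topo Y) V \<and> p \<in> U \<times> V \<and> U \<times> V \<subseteq> \<Union>\<V> \<and>
        (\<forall>i<n. c i \<in> prod_generators X Y U V) \<and> openin (topo (Cspace n)) D \<and> G \<in> hol (Cspace n) D \<and>
        (\<forall>w \<in> U \<times> V. vec n (\<lambda>i. c i w) \<in> D \<and> h w = G (vec n (\<lambda>i. c i w)))"
        using W by (intro exI[of _ U] exI[of _ V] exI[of _ n] exI[of _ c] exI[of _ D] exI[of _ G]) auto
    qed
  qed
next
  fix W and T :: "complex set" and h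
  assume H: "openin (topo (prod_fspace X Y)) W \<and> h \<in> hol (prod_fspace X Y) W \<and> open T"
  show "openin (topo (prod_fspace X Y)) {x \<in> W. h x \<in> T}"
  proof (subst openin_subopen, intro ballI)
    fix p assume p: "p \<in> {x \<in> W. h x \<in> T}"
    with H have "p \<in> W" "h \<in> hol (prod_fspace X Y) W" by auto
    from hol_prod_fspaceD[OF this(2,1)] obtain U V n c D G where
      1: "openin (topo X) U" "openin (topo Y) V" "p \<in> U \<times> V" "U \<times> V \<subseteq> W" "\<forall>i<n. c i \<in> prod_generators X Y U V"
      "openin (topo (Cspace n)) D" "G \<in> hol (Cspace n) D"
      "\<forall>w \<in> U \<times> V. vec n (\<lambda>i. c i w) \<in> D \<and> h w = G (vec n (\<lambda>i. c i w))" by blast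
    have "openin (topo (Cspace n)) {z \<in> D. G z \<in> T}"
      using analytic_openin[OF analytic_Cspace 1(6,7)] H by blast
    then have "openin (topo (prod_fspace X Y)) {w \<in> U \<times> V. vec n (\<lambda>i. c i w) \<in> {z \<in> D. G z \<in> T}}"
      using 1 by (intro openin_vec_preimage) (auto intro: prod_generators_openin simp: openin_prod_Times_iff)
    then show "\<exists>V. openin (topo (prod_fspace X Y)) V \<and> p \<in> V \<and> V \<subseteq> {x \<in> W. h x \<in> T}"
      using 1 p by (intro exI[of _ "{w \<in> U \<times> V. vec n (\<lambda>i. c i w) \<in> {z \<in> D. G z \<in> T}}"]) auto
  qed
next
  fix W m D and h :: "nat \<Rightarrow> 'a \<times> 'b \<Rightarrow> complex" and G
  assume H: "openin (topo (prod_fspace X Y)) W \<and> (\<forall>i<m. h i \<in> hol (prod_fspace X Y) W) \<and> openin (topo (Cspace m)) D \<and>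
        G \<in> hol (Cspace m) D \<and> (\<forall>x \<in> W. vec m (\<lambda>i. h i x) \<in> D)"
  show "(\<lambda>x. G (vec m (\<lambda>i. h i x))) \<in> hol (prod_fspace X Y) W"
  proof (rule hol_prod_fspaceI)
    fix p assume p: "p \<in> W"
    obtain U V n c where 1: "openin (topo X) U" "openin (topo Y) V" "p \<in> U \<times> V" "U \<times> V \<subseteq> W"
      "\<forall>i<n. c i \<in> prod_generators X Y U V"
      "\<forall>i<m. \<exists>D G. openin (topo (Cspace n)) D \<and> G \<in> hol (Cspace n) D \<and>
       (\<forall>w \<in> U \<times> V. vec n (\<lambda>i. c i w) \<in> D \<and> h i w = G (vec n (\<lambda>i. c i w)))"
      using hol_prod_common[of W p m h] H p by blast
    then obtain D' G' where 2: "\<And>i. i < m \<Longrightarrow> openin (topo (Cspace n)) (D' i)" "\<And>i. i < m \<Longrightarrow> G' i \<in> hol (Cspace n) (D' i)"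
      "\<And>i w. i < m \<Longrightarrow> w \<in> U \<times> V \<Longrightarrow> vec n (\<lambda>i. c i w) \<in> D' i \<and> h i w = G' i (vec n (\<lambda>i. c i w))" by metis
    \<comment> \<open>A common domain of the inner functions \<open>G' i\<close>; the factor
      \<open>Cn n\<close> provides it when m = 0.\<close>
    define E where "E = Cn n \<inter> (\<Inter>i \<in> {..<m}. D' i)"
    have E: "openin (topo (Cspace n)) E"
    proof (cases "m = 0")
      case False
      then show ?thesis unfolding E_def using 2(1) by (intro openin_Int openin_INT2) auto
    qed (simp add: E_def)
    have G'E: "G' i \<in> hol (Cspace n) E" if "i < m" for i
      using 2(2)[OF that] that by (auto simp: hol_Cspace E_def)
    define E' where "E' = {z \<in> E. vec m (\<lambda>i. G' i z) \<in> D}"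
    have E': "openin (topo (Cspace n)) E'"
      unfolding E'_def by (rule openin_hol_vec_preimage[OF analytic_Cspace E G'E]) (use H in auto)
    have "(\<lambda>z. G (vec m (\<lambda>i. G' i z))) \<in> hol (Cspace n) E'"
    proof (rule hol_compose[OF analytic_Cspace E'])
      show "G' i \<in> hol (Cspace n) E'" if "i < m" for i using G'E[OF that] by (auto simp: hol_Cspace E'_def)
    qed (use H in \<open>auto simp: E'_def\<close>)
    moreover have "vec n (\<lambda>i. c i w) \<in> E' \<and> G (vec m (\<lambda>i. h i w)) = G (vec m (\<lambda>i. G' i (vec n (\<lambda>i. c i w))))" if w: "w \<in> U \<times> V" for w
    proof -
      have eq: "vec m (\<lambda>i. h i w) = vec m (\<lambda>i. G' i (vec n (\<lambda>i. c i w)))"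
        using 2(3)[OF _ w] by (auto simp: vec_def fun_eq_iff)
      have "vec m (\<lambda>i. h i w) \<in> D" using H w 1(4) by blast
      then show ?thesis using 2(3)[OF _ w] by (simp add: eq E'_def E_def)
    qed
    ultimately show "\<exists>U V n c D G'. openin (topo X) U \<and> openin (topo Y) V \<and> p \<in> U \<times> V \<and> U \<times> V \<subseteq> W \<and>
        (\<forall>i<n. c i \<in> prod_generators X Y U V) \<and> openin (topo (Cspace n)) D \<and> G' \<in> hol (Cspace n) D \<and>
        (\<forall>w \<in> U \<times> V. vec n (\<lambda>i. c i w) \<in> D \<and> G (vec m (\<lambda>i. h i w)) = G' (vec n (\<lambda>i. c i w)))"
      using 1(1-5) E' by (intro exI[of _ U] exI[of _ V] exI[of _ n] exI[of _ c] exI[of _ E'] exI[of _ "\<lambda>z. G (vec m (\<lambda>i. G' i z))"]) blast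
  qed
qed

lemma hol_prod_fst:
  assumes "openin (topo X) U" "openin (topo Y) V" "a \<in> hol X U"
  shows "(\<lambda>w. a (fst w)) \<in> hol (prod_fspace X Y) (U \<times> V)"
proof (rule hol_prod_fspaceI)
  fix p assume "p \<in> U \<times> V"
  then show "\<exists>U' V' n c D G. openin (topo X) U' \<and> openin (topo Y) V' \<and> p \<in> U' \<times> V' \<and> U' \<times> V' \<subseteq> U \<times> V \<and>
        (\<forall>i<n. c i \<in> prod_generators X Y U' V') \<and> openin (topo (Cspace n)) D \<and> G \<in> hol (Cspace n) D \<and>
        (\<forall>w \<in> U' \<times> V'. vec n (\<lambda>i. c i w) \<in> D \<and> a (fst w) = G (vec n (\<lambda>i. c i w)))"
    using assms coordinate_hol_Cspace[of "Cn 1" 1 0]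
    by (intro exI[of _ U] exI[of _ V] exI[of _ 1] exI[of _ "\<lambda>_. a \<circ> fst"] exI[of _ "Cn 1"] exI[of _ "\<lambda>z. z 0"])
      (auto simp: prod_generators_def vec_nth)
qed

lemma hol_prod_snd:
  assumes "openin (topo X) U" "openin (topo Y) V" "b \<in> hol Y V"
  shows "(\<lambda>w. b (snd w)) \<in> hol (prod_fspace X Y) (U \<times> V)"
proof (rule hol_prod_fspaceI)
  fix p assume "p \<in> U \<times> V"
  then show "\<exists>U' V' n c D G. openin (topo X) U' \<and> openin (topo Y) V' \<and> p \<in> U' \<times> V' \<and> U' \<times> V' \<subseteq> U \<times> V \<and>
        (\<forall>i<n. c i \<in> prod_generators X Y U' V') \<and> openin (topo (Cspace n)) D \<and> G \<in> hol (Cspace n) D \<and>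
        (\<forall>w \<in> U' \<times> V'. vec n (\<lambda>i. c i w) \<in> D \<and> b (snd w) = G (vec n (\<lambda>i. c i w)))"
    using assms coordinate_hol_Cspace[of "Cn 1" 1 0]
    by (intro exI[of _ U] exI[of _ V] exI[of _ 1] exI[of _ "\<lambda>_. b \<circ> snd"] exI[of _ "Cn 1"] exI[of _ "\<lambda>z. z 0"])
      (auto simp: prod_generators_def vec_nth)
qed

end

section \<open>Disjoint sums and quotients\<close>

lemma topo_sum_fspace [simp]: "topo (sum_fspace X I) = sum_topology (\<lambda>i. topo (X i)) I"
  by (simp add: sum_fspace_def)

lemma hol_sum_fspace: "h \<in> hol (sum_fspace X I) W \<longleftrightarrow> (\<forall>i \<in> I. (\<lambda>x. h (i, x)) \<in> hol (X i) {x. (i, x) \<in> W})"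
  by (simp add: sum_fspace_def)

lemma analytic_sum_fspace:
  assumes X: "\<And>i. i \<in> I \<Longrightarrow> analytic_fspace (X i)"
  shows "analytic_fspace (sum_fspace X I)"
proof -
  have op: "openin (topo (X i)) {x. (i, x) \<in> W}" if "openin (topo (sum_fspace X I)) W" "i \<in> I" for i W
    using that by (simp add: openin_sum_topology)
  show ?thesis
    unfolding analytic_fspace_def
  proof (intro conjI allI impI)
    show "function_sheaf (sum_fspace X I)"
      unfolding function_sheaf_def
    proof (intro conjI allI impI)
      fix U h g
      assume H: "openin (topo (sum_fspace X I)) U \<and> h \<in> hol (sum_fspace X I) U \<and> (\<forall>x \<in> U. g x = h x)"
      show "g \<in> hol (sum_fspace X I) U"
        unfolding hol_sum_fspace
      proof
        fix i assume i: "i \<in> I"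
        show "(\<lambda>x. g (i, x)) \<in> hol (X i) {x. (i, x) \<in> U}"
          by (rule function_sheaf_cong[OF analytic_sheaf[OF X[OF i]] op[OF _ i], of U "\<lambda>x. h (i, x)"])
            (use H i in \<open>auto simp: hol_sum_fspace\<close>)
      qed
    next
      fix U V h
      assume H: "openin (topo (sum_fspace X I)) U \<and> openin (topo (sum_fspace X I)) V \<and> V \<subseteq> U \<and> h \<in> hol (sum_fspace X I) U"
      show "h \<in> hol (sum_fspace X I) V"
        unfolding hol_sum_fspace
      proof
        fix i assume i: "i \<in> I"
        show "(\<lambda>x. h (i, x)) \<in> hol (X i) {x. (i, x) \<in> V}"
          by (rule function_sheaf_mono[OF analytic_sheaf[OF X[OF i]] op[OF _ i, of U] op[OF _ i]])
            (use H i in \<open>auto simp: hol_sum_fspace\<close>)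
      qed
    next
      fix \<V> h
      assume H: "\<forall>V\<in>\<V>. openin (topo (sum_fspace X I)) V \<and> h \<in> hol (sum_fspace X I) V"
      show "h \<in> hol (sum_fspace X I) (\<Union>\<V>)"
        unfolding hol_sum_fspace
      proof
        fix i assume i: "i \<in> I"
        have "(\<lambda>x. h (i, x)) \<in> hol (X i) (\<Union>V \<in> \<V>. {x. (i, x) \<in> V})"
          by (rule function_sheaf_glue[OF analytic_sheaf[OF X[OF i]]])
            (use H i op in \<open>auto simp: hol_sum_fspace\<close>)
        moreover have "(\<Union>V \<in> \<V>. {x. (i, x) \<in> V}) = {x. (i, x) \<in> \<Union>\<V>}" by auto
        ultimately show "(\<lambda>x. h (i, x)) \<in> hol (X i) {x. (i, x) \<in> \<Union>\<V>}" by (simp only:)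
      qed
    qed
  next
    fix U and T :: "complex set" and h
    assume H: "openin (topo (sum_fspace X I)) U \<and> h \<in> hol (sum_fspace X I) U \<and> open T"
    have "openin (topo (X i)) {x \<in> {x. (i, x) \<in> U}. h (i, x) \<in> T}" if i: "i \<in> I" for i
      by (rule analytic_openin[OF X[OF i] op[OF _ i]]) (use H i in \<open>auto simp: hol_sum_fspace\<close>)
    then show "openin (topo (sum_fspace X I)) {x \<in> U. h x \<in> T}"
      using H by (auto simp: openin_sum_topology)
  next
    fix U n D c G
    assume H: "openin (topo (sum_fspace X I)) U \<and> (\<forall>i<n. c i \<in> hol (sum_fspace X I) U) \<and> openin (topo (Cspace n)) D \<and>
        G \<in> hol (Cspace n) D \<and> (\<forall>x \<in> U. vec n (\<lambda>i. c i x) \<in> D)"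
    show "(\<lambda>x. G (vec n (\<lambda>i. c i x))) \<in> hol (sum_fspace X I) U"
      unfolding hol_sum_fspace
    proof
      fix i assume i: "i \<in> I"
      show "(\<lambda>x. G (vec n (\<lambda>k. c k (i, x)))) \<in> hol (X i) {x. (i, x) \<in> U}"
        by (rule hol_compose[OF X[OF i] op[OF _ i], of U n "\<lambda>k x. c k (i, x)" D])
          (use H i in \<open>auto simp: hol_sum_fspace\<close>)
    qed
  qed
qed

lemma hol_quotient_fspace:
  "h \<in> hol (quotient_fspace X q) V \<longleftrightarrow> (\<lambda>x. h (q x)) \<in> hol X {x \<in> topspace (topo X). q x \<in> V}"
  by (simp add: quotient_fspace_def comp_def)

lemma topspace_quotient_fspace: "topspace (topo (quotient_fspace X q)) = q ` topspace (topo X)"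
proof
  show "topspace (topo (quotient_fspace X q)) \<subseteq> q ` topspace (topo X)"
    using openin_topspace[of "topo (quotient_fspace X q)"] unfolding openin_quotient_fspace by blast
  have "openin (topo (quotient_fspace X q)) (q ` topspace (topo X))"
    unfolding openin_quotient_fspace by (auto intro: openin_subopen[THEN iffD2] exI[of _ "topspace (topo X)"])
  then show "q ` topspace (topo X) \<subseteq> topspace (topo (quotient_fspace X q))" by (rule openin_subset)
qed

lemma analytic_quotient_fspace:
  assumes X: "analytic_fspace X"
  shows "analytic_fspace (quotient_fspace X q)"
proof -
  let ?p = "\<lambda>V. {x \<in> topspace (topo X). q x \<in> V}"
  have op: "openin (topo X) (?p V)" if "openin (topo (quotient_fspace X q)) V" for V
    using that by (simp add: openin_quotient_fspace)
  show ?thesis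
    unfolding analytic_fspace_def
  proof (intro conjI allI impI)
    show "function_sheaf (quotient_fspace X q)"
      unfolding function_sheaf_def
    proof (intro conjI allI impI)
      fix U h g
      assume H: "openin (topo (quotient_fspace X q)) U \<and> h \<in> hol (quotient_fspace X q) U \<and> (\<forall>x \<in> U. g x = h x)"
      show "g \<in> hol (quotient_fspace X q) U"
        unfolding hol_quotient_fspace
        by (rule function_sheaf_cong[OF analytic_sheaf[OF X] op, of U "\<lambda>x. h (q x)"])
          (use H in \<open>auto simp: hol_quotient_fspace\<close>)
    next
      fix U V h
      assume H: "openin (topo (quotient_fspace X q)) U \<and> openin (topo (quotient_fspace X q)) V \<and> V \<subseteq> U \<and> h \<in> hol (quotient_fspace X q) U"
      show "h \<in> hol (quotient_fspace X q) V"
        unfolding hol_quotient_fspace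
        by (rule function_sheaf_mono[OF analytic_sheaf[OF X] op[of U] op])
          (use H in \<open>auto simp: hol_quotient_fspace\<close>)
    next
      fix \<V> h
      assume H: "\<forall>V\<in>\<V>. openin (topo (quotient_fspace X q)) V \<and> h \<in> hol (quotient_fspace X q) V"
      have "(\<lambda>x. h (q x)) \<in> hol X (\<Union>V \<in> \<V>. ?p V)"
        by (rule function_sheaf_glue[OF analytic_sheaf[OF X]])
          (use H op in \<open>auto simp: hol_quotient_fspace\<close>)
      moreover have "(\<Union>V \<in> \<V>. ?p V) = ?p (\<Union>\<V>)" by auto
      ultimately show "h \<in> hol (quotient_fspace X q) (\<Union>\<V>)" unfolding hol_quotient_fspace by (simp only:)
    qed
  next
    fix U and T :: "complex set" and h
    assume H: "openin (topo (quotient_fspace X q)) U \<and> h \<in> hol (quotient_fspace X q) U \<and> open T"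
    have "openin (topo X) {x \<in> ?p U. h (q x) \<in> T}"
      by (rule analytic_openin[OF X op]) (use H in \<open>auto simp: hol_quotient_fspace\<close>)
    moreover have "{x \<in> ?p U. h (q x) \<in> T} = {x \<in> topspace (topo X). q x \<in> {x \<in> U. h x \<in> T}}" by auto
    ultimately show "openin (topo (quotient_fspace X q)) {x \<in> U. h x \<in> T}"
      using H unfolding openin_quotient_fspace by auto
  next
    fix U n D c G
    assume H: "openin (topo (quotient_fspace X q)) U \<and> (\<forall>i<n. c i \<in> hol (quotient_fspace X q) U) \<and> openin (topo (Cspace n)) D \<and>
        G \<in> hol (Cspace n) D \<and> (\<forall>x \<in> U. vec n (\<lambda>i. c i x) \<in> D)"
    show "(\<lambda>x. G (vec n (\<lambda>i. c i x))) \<in> hol (quotient_fspace X q) U"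
      unfolding hol_quotient_fspace
      by (rule hol_compose[OF X op, of U n "\<lambda>k x. c k (q x)" D])
        (use H in \<open>auto simp: hol_quotient_fspace\<close>)
  qed
qed

section \<open>Projective space\<close>

lemma openin_punctured_Cn: "openin (topo (Cspace N)) (Cn N - {\<lambda>_. 0})"
proof -
  have "openin (topo (Cspace N)) (\<Union>i. {z \<in> Cn N. z i \<in> - {0}})"
    by (rule openin_Union) (use openin_Cspace_coordinate[of "- {0}" N] in blast)
  moreover have "(\<Union>i. {z \<in> Cn N. z i \<in> - {0}}) = Cn N - {\<lambda>_. 0}" by (auto simp: fun_eq_iff)
  ultimately show ?thesis by (simp only:)
qed

lemma analytic_Pspace: "analytic_fspace (Pspace N)"
  unfolding Pspace_def by (intro analytic_quotient_fspace analytic_sub_fspace analytic_Cspace)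

lemma openin_Pspace:
  "openin (topo (Pspace N)) V \<longleftrightarrow> V \<subseteq> proj_class ` (Cn N - {\<lambda>_. 0}) \<and>
     openin (topo (Cspace N)) {z \<in> Cn N - {\<lambda>_. 0}. proj_class z \<in> V}"
proof -
  have ts: "topspace (topo (sub_fspace (Cspace N) (Cn N - {\<lambda>_. 0}))) = Cn N - {\<lambda>_. 0}" by auto
  show ?thesis
    unfolding Pspace_def openin_quotient_fspace ts openin_sub_fspace_open[OF openin_punctured_Cn] by blast
qed

lemma hol_Pspace:
  assumes "openin (topo (Pspace N)) V"
  shows "h \<in> hol (Pspace N) V \<longleftrightarrow> (\<lambda>z. h (proj_class z)) \<in> hol (Cspace N) {z \<in> Cn N - {\<lambda>_. 0}. proj_class z \<in> V}"
proof -
  have ts: "topspace (topo (sub_fspace (Cspace N) (Cn N - {\<lambda>_. 0}))) = Cn N - {\<lambda>_. 0}" by auto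
  have "openin (topo (Cspace N)) {z \<in> Cn N - {\<lambda>_. 0}. proj_class z \<in> V}" using assms by (simp add: openin_Pspace)
  from hol_sub_fspace_open[OF analytic_sheaf[OF analytic_Cspace] openin_punctured_Cn this]
  have "hol (sub_fspace (Cspace N) (Cn N - {\<lambda>_. 0})) {z \<in> Cn N - {\<lambda>_. 0}. proj_class z \<in> V}
     = hol (Cspace N) {z \<in> Cn N - {\<lambda>_. 0}. proj_class z \<in> V}" by blast
  then show ?thesis unfolding Pspace_def hol_quotient_fspace ts by blast
qed

lemma topspace_Pspace: "topspace (topo (Pspace N)) = proj_class ` (Cn N - {\<lambda>_. 0})"
  unfolding Pspace_def topspace_quotient_fspace by auto

lemma proj_class_eq_iff: "proj_class z = proj_class w \<longleftrightarrow> (\<exists>c. c \<noteq> 0 \<and> w = (\<lambda>i. c * z i))"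
proof
  assume "proj_class z = proj_class w"
  moreover have "w \<in> proj_class w" by (auto simp: proj_class_def intro!: exI[of _ 1])
  ultimately show "\<exists>c. c \<noteq> 0 \<and> w = (\<lambda>i. c * z i)" by (auto simp: proj_class_def)
next
  assume "\<exists>c. c \<noteq> 0 \<and> w = (\<lambda>i. c * z i)"
  then obtain c where c: "c \<noteq> 0" "w = (\<lambda>i. c * z i)" by blast
  show "proj_class z = proj_class w"
  proof
    show "proj_class z \<subseteq> proj_class w"
    proof
      fix u assume "u \<in> proj_class z"
      then obtain d where "d \<noteq> 0" "u = (\<lambda>i. d * z i)" by (auto simp: proj_class_def)
      then show "u \<in> proj_class w" using c by (auto simp: proj_class_def fun_eq_iff intro!: exI[of _ "d / c"])
    qed
    show "proj_class w \<subseteq> proj_class z"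
    proof
      fix u assume "u \<in> proj_class w"
      then obtain d where "d \<noteq> 0" "u = (\<lambda>i. d * w i)" by (auto simp: proj_class_def)
      then show "u \<in> proj_class z" using c by (auto simp: proj_class_def fun_eq_iff intro!: exI[of _ "d * c"])
    qed
  qed
qed

lemma vec_scale: "(\<lambda>i. c * vec N z i) = vec N (\<lambda>i. c * z i)"
  by (auto simp: vec_def)

lemma proj_class_scale: "c \<noteq> 0 \<Longrightarrow> proj_class (vec N (\<lambda>i. c * z i)) = proj_class (vec N z)"
  by (subst eq_commute) (auto simp: proj_class_eq_iff vec_scale)

text \<open>An arbitrary representative, with no continuity in \<zeta>; it enters only expressions
  that do not change under scaling.\<close>

definition proj_rep :: "(nat \<Rightarrow> complex) set \<Rightarrow> nat \<Rightarrow> complex" where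
  "proj_rep \<zeta> = (SOME z. z \<in> \<zeta>)"

lemma proj_rep: "\<exists>c. c \<noteq> 0 \<and> proj_rep (proj_class z) = (\<lambda>i. c * z i)"
proof -
  have "z \<in> proj_class z" by (auto simp: proj_class_def intro!: exI[of _ 1])
  then have "proj_rep (proj_class z) \<in> proj_class z" unfolding proj_rep_def by (rule someI[where P = "\<lambda>w. w \<in> proj_class z"])
  then show ?thesis by (simp add: proj_class_def)
qed

definition proj_ratio :: "nat \<Rightarrow> nat \<Rightarrow> (nat \<Rightarrow> complex) set \<Rightarrow> complex" where
  "proj_ratio l i \<zeta> = proj_rep \<zeta> i / proj_rep \<zeta> l"

lemma proj_ratio_class: "proj_ratio l i (proj_class z) = z i / z l"
  using proj_rep[of z] by (auto simp: proj_ratio_def)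

definition proj_chart :: "nat \<Rightarrow> nat \<Rightarrow> (nat \<Rightarrow> complex) set set" where
  "proj_chart N l = proj_class ` {z \<in> Cn N. z l \<noteq> 0}"

lemma proj_class_in_chart: "z \<in> Cn N \<Longrightarrow> proj_class z \<in> proj_chart N l \<longleftrightarrow> z l \<noteq> 0"
  by (auto simp: proj_chart_def proj_class_eq_iff)

lemma openin_proj_chart: "openin (topo (Pspace N)) (proj_chart N l)"
proof -
  have "{z \<in> Cn N - {\<lambda>_. 0}. proj_class z \<in> proj_chart N l} = {z \<in> Cn N. z l \<in> - {0}}"
    by (auto simp: proj_class_in_chart)
  moreover have "openin (topo (Cspace N)) {z \<in> Cn N. z l \<in> - {0}}" by (rule openin_Cspace_coordinate) auto
  ultimately show ?thesis unfolding openin_Pspace by (auto simp: proj_chart_def simp del: topo_Cspace)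
qed

lemma proj_ratio_hol:
  assumes "i < N" "l < N"
  shows "proj_ratio l i \<in> hol (Pspace N) (proj_chart N l)"
proof -
  have "{z \<in> Cn N - {\<lambda>_. 0}. proj_class z \<in> proj_chart N l} = {z \<in> Cn N. z l \<in> - {0}}"
    by (auto simp: proj_class_in_chart)
  moreover have "openin (topo (Cspace N)) {z \<in> Cn N. z l \<in> - {0}}" by (rule openin_Cspace_coordinate) auto
  moreover have "(\<lambda>z. z i / z l) \<in> hol (Cspace N) {z \<in> Cn N. z l \<in> - {0}}"
    using assms \<open>openin (topo (Cspace N)) {z \<in> Cn N. z l \<in> - {0}}\<close>
    by (intro hol_divide[OF analytic_Cspace] coordinate_hol_Cspace) auto
  ultimately show ?thesis by (simp only: hol_Pspace[OF openin_proj_chart] proj_ratio_class)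
qed

lemma Pspace_point:
  assumes "\<zeta> \<in> topspace (topo (Pspace N))"
  obtains z l where "z \<in> Cn N" "\<zeta> = proj_class z" "l < N" "z l \<noteq> 0" "\<zeta> \<in> proj_chart N l"
proof -
  from assms obtain z where z: "z \<in> Cn N" "z \<noteq> (\<lambda>_. 0)" "\<zeta> = proj_class z" unfolding topspace_Pspace by blast
  then obtain l where "z l \<noteq> 0" by (auto simp: fun_eq_iff)
  moreover from this have "l < N" using z(1) by (auto simp: Cn_def intro: leI)
  ultimately show thesis using that z proj_class_in_chart by blast
qed

lemma vec_nonzero: "l < N \<Longrightarrow> z l \<noteq> 0 \<Longrightarrow> vec N z \<in> Cn N - {\<lambda>_. 0}"
  by (auto simp: vec_def Cn_def fun_eq_iff)

section \<open>Maps to projective space and the Hausdorff property\<close>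

lemma holomorphic_map_proj:
  assumes Y: "analytic_fspace Y" and U: "openin (topo Y) U" and c: "\<And>l. l < N \<Longrightarrow> c l \<in> hol Y U"
    and nz: "\<And>x. x \<in> U \<Longrightarrow> \<exists>l<N. c l x \<noteq> 0"
  shows "holomorphic_map (sub_fspace Y U) (Pspace N) (\<lambda>x. proj_class (vec N (\<lambda>l. c l x)))"
proof -
  have ts: "topspace (topo (sub_fspace Y U)) = U" using openin_subset[OF U] by auto
  have nz': "vec N (\<lambda>l. c l x) \<in> Cn N - {\<lambda>_. 0}" if "x \<in> U" for x
    using nz[OF that] vec_nonzero[of _ N "\<lambda>l. c l x"] by blast
  have op: "openin (topo Y) {x \<in> U. proj_class (vec N (\<lambda>l. c l x)) \<in> V}" if V: "openin (topo (Pspace N)) V" for V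
  proof -
    have "openin (topo Y) {x \<in> U. vec N (\<lambda>l. c l x) \<in> {z \<in> Cn N - {\<lambda>_. 0}. proj_class z \<in> V}}"
      using V by (intro openin_hol_vec_preimage[OF Y U c]) (auto simp: openin_Pspace simp del: topo_Cspace)
    moreover have "{x \<in> U. vec N (\<lambda>l. c l x) \<in> {z \<in> Cn N - {\<lambda>_. 0}. proj_class z \<in> V}} = {x \<in> U. proj_class (vec N (\<lambda>l. c l x)) \<in> V}"
      using nz' by auto
    ultimately show ?thesis by (simp only:)
  qed
  show ?thesis
  proof (rule holomorphic_mapI, unfold ts)
    show "(\<lambda>x. proj_class (vec N (\<lambda>l. c l x))) \<in> U \<rightarrow> topspace (topo (Pspace N))"
      unfolding topspace_Pspace using nz' by blast
  next
    fix V assume V: "openin (topo (Pspace N)) V"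
    from op[OF V] show "openin (topo (sub_fspace Y U)) {x \<in> U. proj_class (vec N (\<lambda>l. c l x)) \<in> V}"
      unfolding openin_sub_fspace_open[OF U] by blast
  next
    fix V h assume V: "openin (topo (Pspace N)) V" and h: "h \<in> hol (Pspace N) V"
    let ?V = "{x \<in> U. proj_class (vec N (\<lambda>l. c l x)) \<in> V}"
    have "(\<lambda>x. (\<lambda>z. h (proj_class z)) (vec N (\<lambda>l. c l x))) \<in> hol Y ?V"
    proof (rule hol_compose[OF Y op[OF V], of N c "{z \<in> Cn N - {\<lambda>_. 0}. proj_class z \<in> V}" "\<lambda>z. h (proj_class z)"])
      show "c i \<in> hol Y ?V" if "i < N" for i
        by (rule function_sheaf_mono[OF analytic_sheaf[OF Y] U op[OF V] _ c[OF that]]) blast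
      show "openin (topo (Cspace N)) {z \<in> Cn N - {\<lambda>_. 0}. proj_class z \<in> V}" using V by (simp add: openin_Pspace)
      show "(\<lambda>z. h (proj_class z)) \<in> hol (Cspace N) {z \<in> Cn N - {\<lambda>_. 0}. proj_class z \<in> V}"
        using h unfolding hol_Pspace[OF V] .
      show "vec N (\<lambda>l. c l x) \<in> {z \<in> Cn N - {\<lambda>_. 0}. proj_class z \<in> V}" if "x \<in> ?V" for x
        using nz' that by blast
    qed
    moreover have "hol (sub_fspace Y U) ?V = hol Y ?V"
      by (rule hol_sub_fspace_open[OF analytic_sheaf[OF Y] U op[OF V]]) blast
    ultimately show "(\<lambda>x. h (proj_class (vec N (\<lambda>l. c l x)))) \<in> hol (sub_fspace Y U) ?V" by simp
  qed
qed

text \<open>The entries z_i conj(z_j) / |z|^2 of the orthogonal projection onto a line are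
  continuous, invariant under scaling, and together separate lines; disjoint neighbourhoods are
  pulled back from the complex plane.\<close>

lemma Hausdorff_Pspace: "Hausdorff_space (topo (Pspace N))"
  unfolding Hausdorff_space_def
proof (intro allI impI, elim conjE)
  fix \<zeta> \<xi> assume \<zeta>: "\<zeta> \<in> topspace (topo (Pspace N))" and \<xi>: "\<xi> \<in> topspace (topo (Pspace N))" and ne: "\<zeta> \<noteq> \<xi>"
  define m where "m i j z = z i * cnj (z j) / (\<Sum>k<N. z k * cnj (z k))" for i j and z :: "nat \<Rightarrow> complex"
  define M where "M i j \<eta> = m i j (proj_rep \<eta>)" for i j \<eta>
  have M: "M i j (proj_class z) = m i j z" for i j z
  proof -
    obtain c where c: "c \<noteq> 0" "proj_rep (proj_class z) = (\<lambda>i. c * z i)" using proj_rep by blast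
    have "(\<Sum>k<N. (c * z k) * cnj (c * z k)) = c * cnj c * (\<Sum>k<N. z k * cnj (z k))"
      by (simp add: sum_distrib_left mult_ac)
    then show ?thesis unfolding M_def m_def c(2) using c(1) by (simp add: mult_ac)
  qed
  have pos: "(\<Sum>k<N. z k * cnj (z k)) \<noteq> 0" if z: "z \<in> Cn N - {\<lambda>_. 0}" for z
  proof -
    obtain l where l: "z l \<noteq> 0" using z by (auto simp: fun_eq_iff)
    then have "l < N" using z by (auto simp: Cn_def intro: leI)
    then have "0 < (\<Sum>k<N. (cmod (z k))\<^sup>2)" using l by (intro sum_pos2[of _ l]) auto
    moreover have "(\<Sum>k<N. z k * cnj (z k)) = complex_of_real (\<Sum>k<N. (cmod (z k))\<^sup>2)"
      unfolding of_real_sum complex_norm_square ..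
    ultimately show ?thesis by (metis of_real_eq_0_iff less_irrefl)
  qed
  have op: "openin (topo (Pspace N)) {\<eta> \<in> topspace (topo (Pspace N)). M i j \<eta> \<in> T}" if T: "open T" for i j T
  proof -
    have co: "continuous_on A (\<lambda>z :: nat \<Rightarrow> complex. z k)" for A k
      using continuous_on_id by (rule continuous_on_product_then_coordinatewise)
    have "continuous_on (Cn N - {\<lambda>_. 0}) (m i j)"
      unfolding m_def using pos
      by (intro continuous_on_divide continuous_on_mult continuous_on_cnj continuous_on_sum co) auto
    then have "openin (top_of_set (Cn N - {\<lambda>_. 0})) ((Cn N - {\<lambda>_. 0}) \<inter> m i j -` T)"
      using T by (simp add: continuous_openin_preimage_gen)
    from openin_trans[OF this openin_punctured_Cn[unfolded topo_Cspace]]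
    have "openin (topo (Cspace N)) ((Cn N - {\<lambda>_. 0}) \<inter> m i j -` T)" by simp
    moreover have "(Cn N - {\<lambda>_. 0}) \<inter> m i j -` T = {z \<in> Cn N - {\<lambda>_. 0}. proj_class z \<in> {\<eta> \<in> topspace (topo (Pspace N)). M i j \<eta> \<in> T}}"
      by (auto simp: M topspace_Pspace)
    ultimately show ?thesis unfolding openin_Pspace by (auto simp: topspace_Pspace)
  qed
  obtain z l where z: "z \<in> Cn N" "\<zeta> = proj_class z" "l < N" "z l \<noteq> 0" using Pspace_point[OF \<zeta>] by metis
  obtain w l' where w: "w \<in> Cn N" "\<xi> = proj_class w" "l' < N" "w l' \<noteq> 0" using Pspace_point[OF \<xi>] by metis
  have z0: "z \<in> Cn N - {\<lambda>_. 0}" and w0: "w \<in> Cn N - {\<lambda>_. 0}" using z w by (auto simp: fun_eq_iff)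
  have "\<exists>i j. M i j \<zeta> \<noteq> M i j \<xi>"
  proof (rule ccontr)
    assume "\<nexists>i j. M i j \<zeta> \<noteq> M i j \<xi>"
    then have eq: "m i j z = m i j w" for i j by (simp add: z(2) w(2) M)
    have "m l l z \<noteq> 0" using z pos[OF z0] by (simp add: m_def)
    then have wl: "w l \<noteq> 0" unfolding eq by (auto simp: m_def)
    \<comment> \<open>Column \<open>l\<close> of the projection matrix recovers all ratios to
      \<open>z l\<close>, hence the line.\<close>
    have "m i l z / m l l z = z i / z l" for i using z(4) pos[OF z0] by (simp add: m_def)
    moreover have "m i l w / m l l w = w i / w l" for i using wl pos[OF w0] by (simp add: m_def)
    ultimately have "w i = (w l / z l) * z i" for i using eq z(4) wl by (metis (no_types, lifting) nonzero_eq_divide_eq times_divide_eq_left mult.commute)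
    then have "w = (\<lambda>i. w l / z l * z i)" by (rule ext)
    moreover have "w l / z l \<noteq> 0" using wl z(4) by simp
    ultimately have "proj_class z = proj_class w" unfolding proj_class_eq_iff by blast
    then show False using ne z w by simp
  qed
  then obtain i j where ij: "M i j \<zeta> \<noteq> M i j \<xi>" by blast
  then obtain S T where ST: "open S" "open T" "M i j \<zeta> \<in> S" "M i j \<xi> \<in> T" "S \<inter> T = {}"
    using hausdorff[OF ij] by blast
  show "\<exists>U V. openin (topo (Pspace N)) U \<and> openin (topo (Pspace N)) V \<and> \<zeta> \<in> U \<and> \<xi> \<in> V \<and> disjnt U V"
  proof (intro exI conjI)
    show "openin (topo (Pspace N)) {\<eta> \<in> topspace (topo (Pspace N)). M i j \<eta> \<in> S}" by (rule op[OF ST(1)])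
    show "openin (topo (Pspace N)) {\<eta> \<in> topspace (topo (Pspace N)). M i j \<eta> \<in> T}" by (rule op[OF ST(2)])
    show "disjnt {\<eta> \<in> topspace (topo (Pspace N)). M i j \<eta> \<in> S} {\<eta> \<in> topspace (topo (Pspace N)). M i j \<eta> \<in> T}"
      using ST(5) unfolding disjnt_def by blast
  qed (use \<zeta> \<xi> ST(3,4) in blast)+
qed

section \<open>Taylor coefficients along the second factor of a product\<close>

text \<open>The divided difference at 0, which removes the constant term of a power series and
  shifts the others down by one. It is also meaningful far from 0, where no series need
  converge.\<close>

definition dq :: "(complex \<Rightarrow> complex) \<Rightarrow> complex \<Rightarrow> complex" where
  "dq u v = (if v = 0 then deriv u 0 else (u v - u 0) / v)"

text \<open>For \<open>u\<close> holomorphic near 0 this is the k-th derivative at 0 divided by k!.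
  Divided differences are used because they stay holomorphic in parameters.\<close>

definition taylor_coeff :: "nat \<Rightarrow> (complex \<Rightarrow> complex) \<Rightarrow> complex" where
  "taylor_coeff k u = (dq ^^ k) u 0"

lemma dq_eq: "u v = u 0 + v * dq u v"
  by (simp add: dq_def)

lemma dq_holomorphic:
  assumes "u holomorphic_on S" "open S"
  shows "dq u holomorphic_on S"
  using pole_lemma_open[OF assms, of 0] by (simp only: dq_def[abs_def] diff_zero)

lemma dq_funpow_holomorphic:
  assumes "u holomorphic_on S" "open S"
  shows "(dq ^^ k) u holomorphic_on S"
  by (induction k) (auto intro: assms dq_holomorphic)

lemma dq_funpow_isCont:
  assumes "u holomorphic_on S" "open S" "0 \<in> S"
  shows "isCont ((dq ^^ k) u) 0"
  using holomorphic_on_imp_continuous_on[OF dq_funpow_holomorphic[OF assms(1,2)]] assms(2,3)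
  by (simp add: continuous_on_eq_continuous_at)

text \<open>An exact identity for every \<open>v\<close>: each step uses only
  \<open>u v = u 0 + v * dq u v\<close> with a vanishing constant term.\<close>

lemma taylor_remainder:
  assumes "\<And>j. j < k \<Longrightarrow> taylor_coeff j u = 0"
  shows "u v = v ^ k * (dq ^^ k) u v"
  using assms
proof (induction k)
  case (Suc k)
  have "u v = v ^ k * (dq ^^ k) u v" using Suc by simp
  also have "(dq ^^ k) u v = v * dq ((dq ^^ k) u) v"
    using dq_eq[of "(dq ^^ k) u" v] Suc.prems[of k] by (simp add: taylor_coeff_def)
  finally show ?case by (simp add: mult_ac)
qed simp

text \<open>A factor that is continuous at 0 must be the divided difference, so \<open>dq u\<close>
  is identified without computing a derivative.\<close>

lemma eventually_dq_eq:
  assumes "\<forall>\<^sub>F v in nhds 0. u v = u 0 + v * w v" "isCont w 0"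
  shows "deriv u 0 = w 0" "\<forall>\<^sub>F v in nhds 0. dq u v = w v"
proof -
  have "\<forall>\<^sub>F v in at 0. w v = (u v - u 0) / (v - 0)"
    using eventually_nhds_conv_at[THEN iffD1, OF assms(1)]
    by (auto elim!: eventually_mono simp: eventually_at_filter)
  then have "((\<lambda>v. (u v - u 0) / (v - 0)) \<longlongrightarrow> w 0) (at 0)"
    by (rule Lim_transform_eventually[rotated]) (use assms(2) in \<open>simp add: isCont_def\<close>)
  then have "(u has_field_derivative w 0) (at 0)" by (simp add: has_field_derivative_iff)
  then show d: "deriv u 0 = w 0" by (rule DERIV_imp_deriv)
  show "\<forall>\<^sub>F v in nhds 0. dq u v = w v"
    using assms(1) by (auto elim!: eventually_mono simp: dq_def d)
qed

lemma eventually_dq_cong: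
  assumes "\<forall>\<^sub>F v in nhds 0. u v = u' v"
  shows "\<forall>\<^sub>F v in nhds 0. dq u v = dq u' v"
proof -
  have "u 0 = u' 0" using eventually_nhds_x_imp_x[OF assms] .
  moreover have "deriv u 0 = deriv u' 0" using assms by (rule deriv_cong_ev) simp
  ultimately show ?thesis using assms by (auto elim!: eventually_mono simp: dq_def)
qed

lemma eventually_dq_funpow_cong:
  assumes "\<forall>\<^sub>F v in nhds 0. u v = u' v"
  shows "\<forall>\<^sub>F v in nhds 0. (dq ^^ k) u v = (dq ^^ k) u' v"
  by (induction k) (use assms eventually_dq_cong in auto)

lemma taylor_coeff_cong:
  "\<forall>\<^sub>F v in nhds 0. u v = u' v \<Longrightarrow> taylor_coeff k u = taylor_coeff k u'"
  unfolding taylor_coeff_def using eventually_nhds_x_imp_x[OF eventually_dq_funpow_cong] by blast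

lemma dq_mult_ident:
  assumes "isCont w 0"
  shows "dq (\<lambda>v. v * w v) = w"
proof
  fix v
  have "deriv (\<lambda>v. v * w v) 0 = w 0" by (rule eventually_dq_eq(1)[OF _ assms]) simp
  then show "dq (\<lambda>v. v * w v) v = w v" by (simp add: dq_def)
qed

lemma dq_funpow_mult_power:
  assumes "isCont w 0"
  shows "(dq ^^ k) (\<lambda>v. v ^ k * w v) = w"
proof (induction k)
  case (Suc k)
  have "dq (\<lambda>v. v ^ Suc k * w v) = (\<lambda>v. v ^ k * w v)"
    using dq_mult_ident[of "\<lambda>v. v ^ k * w v"] assms by (simp add: mult.assoc)
  then show ?case using Suc by (simp add: funpow_swap1 del: power_Suc)
qed simp

text \<open>The main way to read off coefficients: near 0 it suffices to exhibit a power of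
  \<open>v\<close> times a factor continuous at 0. The factor may be a quotient or a sum whose own
  expansion is unknown.\<close>

lemma taylor_coeff_factor:
  assumes "\<forall>\<^sub>F v in nhds 0. u v = v ^ k * w v" "isCont w 0"
  shows "taylor_coeff k u = w 0" "j < k \<Longrightarrow> taylor_coeff j u = 0"
proof -
  show "taylor_coeff k u = w 0"
    unfolding taylor_coeff_cong[OF assms(1)] by (simp add: taylor_coeff_def dq_funpow_mult_power[OF assms(2)])
  assume j: "j < k"
  have "\<forall>\<^sub>F v in nhds 0. u v = v ^ j * (v ^ (k - j) * w v)"
    using assms(1) j by (auto elim!: eventually_mono simp flip: power_add mult.assoc)
  from taylor_coeff_cong[OF this] have "taylor_coeff j u = 0 ^ (k - j) * w 0"
    using assms(2) by (simp add: taylor_coeff_def dq_funpow_mult_power)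
  then show "taylor_coeff j u = 0" using j by simp
qed

lemma dq_scale:
  assumes "u holomorphic_on S" "open S" "0 \<in> S" "g \<noteq> 0"
  shows "dq (\<lambda>v. c * u (g * v)) = (\<lambda>v. c * g * dq u (g * v))"
proof
  fix v
  have "(u has_field_derivative deriv u 0) (at (g * 0))"
    using assms by (auto intro: holomorphic_derivI)
  from DERIV_chain2[where g = "\<lambda>v. g * v", OF this, of g UNIV]
  have "((\<lambda>v. u (g * v)) has_field_derivative deriv u 0 * g) (at 0)" by (auto intro!: derivative_eq_intros)
  from DERIV_cmult[OF this, of c] have "deriv (\<lambda>v. c * u (g * v)) 0 = c * (deriv u 0 * g)" by (rule DERIV_imp_deriv)
  then show "dq (\<lambda>v. c * u (g * v)) v = c * g * dq u (g * v)"
    using assms(4) by (auto simp: dq_def field_simps)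
qed

text \<open>A change of trivialisation multiplies the fibre coordinate by \<open>g\<close>; this
  homogeneity is what makes the k-th coefficients a section of the k-th power of the dual
  bundle.\<close>

lemma taylor_coeff_scale:
  assumes "u holomorphic_on S" "open S" "0 \<in> S" "g \<noteq> 0"
  shows "taylor_coeff k (\<lambda>v. u (g * v)) = g ^ k * taylor_coeff k u"
proof -
  have "(dq ^^ k) (\<lambda>v. u (g * v)) = (\<lambda>v. g ^ k * (dq ^^ k) u (g * v))"
  proof (induction k)
    case (Suc k)
    then show ?case
      using dq_scale[OF dq_funpow_holomorphic[OF assms(1,2)] assms(2-4), of "g ^ k" k] by (simp add: mult_ac)
  qed simp
  then show ?thesis by (simp add: taylor_coeff_def)
qed

text \<open>Either the value at 0 is nonzero, or the function is not constant on the ball and its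
  finite order at 0 gives the index.\<close>

lemma taylor_coeff_nonzero:
  assumes u: "u holomorphic_on ball 0 r" and v: "v \<in> ball 0 r" "u v \<noteq> 0"
  shows "\<exists>k. taylor_coeff k u \<noteq> 0"
proof (cases "u 0 = 0")
  case False
  then show ?thesis by (intro exI[of _ 0]) (simp add: taylor_coeff_def)
next
  case True
  have "0 < r" using v(1) by (metis ball_eq_empty empty_iff not_le)
  then have 0: "(0 :: complex) \<in> ball 0 r" by simp
  have nc: "\<not> u constant_on ball 0 r"
    using True v 0 unfolding constant_on_def by metis
  show ?thesis
  proof (rule holomorphic_factor_zero_nonconstant[OF u open_ball connected_ball 0 True nc])
    fix g s n
    assume s: "0 < s" and hol: "g holomorphic_on ball 0 s"
      and eq: "\<And>w. w \<in> ball 0 s \<Longrightarrow> u w = (w - 0) ^ n * g w" and nz: "\<And>w. w \<in> ball 0 s \<Longrightarrow> g w \<noteq> 0"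
    have "\<forall>\<^sub>F w in nhds 0. u w = w ^ n * g w"
      unfolding eventually_nhds using s eq by (intro exI[of _ "ball 0 s"]) auto
    moreover have "isCont g 0"
      using holomorphic_on_imp_continuous_on[OF hol] s by (simp add: continuous_on_eq_continuous_at)
    ultimately have "taylor_coeff n u = g 0" by (rule taylor_coeff_factor)
    then show ?thesis using s nz[of 0] by (intro exI[of _ n]) simp
  qed
qed

section \<open>Slices and divided differences on products with the complex line\<close>

lemma hol_prod_slice_snd:
  assumes X: "analytic_fspace X" and Y: "analytic_fspace Y" and h: "h \<in> hol (prod_fspace X Y) W"
  shows "(\<lambda>y. h (x, y)) \<in> hol Y {y. (x, y) \<in> W}"
proof (rule function_sheaf_localI[OF analytic_sheaf[OF Y]])
  fix y assume "y \<in> {y. (x, y) \<in> W}"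
  then have p: "(x, y) \<in> W" by simp
  from hol_prod_fspaceD[OF h p] obtain U V n c D G where
    1: "openin (topo X) U" "openin (topo Y) V" "(x, y) \<in> U \<times> V" "U \<times> V \<subseteq> W" "\<forall>i<n. c i \<in> prod_generators X Y U V"
    "openin (topo (Cspace n)) D" "G \<in> hol (Cspace n) D"
    "\<forall>w \<in> U \<times> V. vec n (\<lambda>i. c i w) \<in> D \<and> h w = G (vec n (\<lambda>i. c i w))" by blast
  have "(\<lambda>y. c i (x, y)) \<in> hol Y V" if "i < n" for i
    using 1(5)[rule_format, OF that] hol_const[OF Y 1(2)] unfolding prod_generators_def by (auto simp: comp_def)
  then have "(\<lambda>y. G (vec n (\<lambda>i. c i (x, y)))) \<in> hol Y V"
    by (rule hol_compose[OF Y 1(2) _ 1(6,7)]) (use 1(3,8) in auto)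
  then show "\<exists>V g. openin (topo Y) V \<and> y \<in> V \<and> V \<subseteq> {y. (x, y) \<in> W} \<and> g \<in> hol Y V \<and> (\<forall>y\<in>V. h (x, y) = g y)"
    using 1 by (intro exI[of _ V] exI[of _ "\<lambda>y. G (vec n (\<lambda>i. c i (x, y)))"]) auto
qed

lemma hol_prod_slice_fst:
  assumes X: "analytic_fspace X" and Y: "analytic_fspace Y" and h: "h \<in> hol (prod_fspace X Y) W"
  shows "(\<lambda>x. h (x, y)) \<in> hol X {x. (x, y) \<in> W}"
proof (rule function_sheaf_localI[OF analytic_sheaf[OF X]])
  fix x assume "x \<in> {x. (x, y) \<in> W}"
  then have p: "(x, y) \<in> W" by simp
  from hol_prod_fspaceD[OF h p] obtain U V n c D G where
    1: "openin (topo X) U" "openin (topo Y) V" "(x, y) \<in> U \<times> V" "U \<times> V \<subseteq> W" "\<forall>i<n. c i \<in> prod_generators X Y U V"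
    "openin (topo (Cspace n)) D" "G \<in> hol (Cspace n) D"
    "\<forall>w \<in> U \<times> V. vec n (\<lambda>i. c i w) \<in> D \<and> h w = G (vec n (\<lambda>i. c i w))" by blast
  have "(\<lambda>x. c i (x, y)) \<in> hol X U" if "i < n" for i
    using 1(5)[rule_format, OF that] hol_const[OF X 1(1)] unfolding prod_generators_def by (auto simp: comp_def)
  then have "(\<lambda>x. G (vec n (\<lambda>i. c i (x, y)))) \<in> hol X U"
    by (rule hol_compose[OF X 1(1) _ 1(6,7)]) (use 1(3,8) in auto)
  then show "\<exists>V g. openin (topo X) V \<and> x \<in> V \<and> V \<subseteq> {x. (x, y) \<in> W} \<and> g \<in> hol X V \<and> (\<forall>x\<in>V. h (x, y) = g x)"
    using 1 by (intro exI[of _ U] exI[of _ "\<lambda>x. G (vec n (\<lambda>i. c i (x, y)))"]) auto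
qed

lemma openin_prod_slice_snd:
  assumes "openin (prod_topology S T) W"
  shows "openin T {y. (x, y) \<in> W}"
proof (subst openin_subopen, intro ballI)
  fix y assume "y \<in> {y. (x, y) \<in> W}"
  then have "(x, y) \<in> W" by simp
  from assms[unfolded openin_prod_topology_alt, rule_format, OF this]
  obtain U V where "openin S U" "openin T V" "x \<in> U" "y \<in> V" "U \<times> V \<subseteq> W"
    by blast
  then show "\<exists>V. openin T V \<and> y \<in> V \<and> V \<subseteq> {y. (x, y) \<in> W}" by (intro exI[of _ V]) auto
qed

lemma openin_prod_slice_fst:
  assumes "openin (prod_topology S T) W"
  shows "openin S {x. (x, y) \<in> W}"
proof (subst openin_subopen, intro ballI)
  fix x assume "x \<in> {x. (x, y) \<in> W}"
  then have "(x, y) \<in> W" by simp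
  from assms[unfolded openin_prod_topology_alt, rule_format, OF this]
  obtain U V where "openin S U" "openin T V" "x \<in> U" "y \<in> V" "U \<times> V \<subseteq> W"
    by blast
  then show "\<exists>V. openin S V \<and> x \<in> V \<and> V \<subseteq> {x. (x, y) \<in> W}" by (intro exI[of _ U]) auto
qed

lemma topo_Cline [simp]: "topo Cline = euclidean"
  by (simp add: Cline_def)

lemma hol_Cline: "h \<in> hol Cline U \<longleftrightarrow> h holomorphic_on U"
  by (simp add: Cline_def)

context
  fixes X :: "'a fspace" and W :: "('a \<times> complex) set"
  assumes X: "analytic_fspace X" and W: "openin (topo (prod_fspace X Cline)) W"
    and W0: "\<And>x v. (x, v) \<in> W \<Longrightarrow> (x, 0) \<in> W"
begin

text \<open>Where v is nonzero this is an honest quotient. Near v = 0 the function is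
  \<open>G\<close> of generators from \<open>X\<close> and from the line; taking \<open>v\<close> as
  an additional ambient coordinate, Hadamard division is carried out in \<open>Cn (Suc n)\<close>
  and the quotient is pulled back, so that singularities of \<open>X\<close> do no harm.\<close>

lemma dq_hol_prod:
  assumes h: "h \<in> hol (prod_fspace X Cline) W"
  shows "(\<lambda>(x, v). dq (\<lambda>v. h (x, v)) v) \<in> hol (prod_fspace X Cline) W"
proof (rule function_sheaf_localI[OF analytic_sheaf[OF analytic_prod_fspace[OF X analytic_Cline]]])
  note P = analytic_prod_fspace[OF X analytic_Cline]
  note sheaf = analytic_sheaf[OF P]
  fix p assume p: "p \<in> W"
  obtain x0 v0 where p_eq: "p = (x0, v0)" by (cases p)
  show "\<exists>V g. openin (topo (prod_fspace X Cline)) V \<and> p \<in> V \<and> V \<subseteq> W \<and> g \<in> hol (prod_fspace X Cline) V \<and>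
      (\<forall>y\<in>V. (case y of (x, v) \<Rightarrow> dq (\<lambda>v. h (x, v)) v) = g y)"
  proof (cases "v0 = 0")
    case False
    let ?U = "{x. (x, 0) \<in> W}"
    have U: "openin (topo X) ?U" using openin_prod_slice_fst W by simp
    let ?V = "W \<inter> ?U \<times> (- {0})"
    have V: "openin (topo (prod_fspace X Cline)) ?V"
    proof (rule openin_Int[OF W])
      show "openin (topo (prod_fspace X Cline)) (?U \<times> (- {0}))"
        unfolding topo_prod_fspace openin_prod_Times_iff using U by auto
    qed
    have "(\<lambda>w. h (fst w, 0)) \<in> hol (prod_fspace X Cline) (?U \<times> UNIV)"
      by (rule hol_prod_fst[OF X analytic_Cline U]) (use hol_prod_slice_fst[OF X analytic_Cline h] in auto)
    then have 1: "(\<lambda>w. h (fst w, 0)) \<in> hol (prod_fspace X Cline) ?V"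
      by (rule function_sheaf_mono[OF sheaf _ V, rotated 2]) (use U in \<open>auto simp: openin_prod_Times_iff\<close>)
    have "(\<lambda>w. snd w) \<in> hol (prod_fspace X Cline) (?U \<times> UNIV)"
      by (rule hol_prod_snd[OF X analytic_Cline U]) (auto simp: hol_Cline)
    then have 2: "(\<lambda>w. snd w) \<in> hol (prod_fspace X Cline) ?V"
      by (rule function_sheaf_mono[OF sheaf _ V, rotated 2]) (use U in \<open>auto simp: openin_prod_Times_iff\<close>)
    have 3: "h \<in> hol (prod_fspace X Cline) ?V" by (rule function_sheaf_mono[OF sheaf W V _ h]) auto
    have "(\<lambda>w. (h w - h (fst w, 0)) / snd w) \<in> hol (prod_fspace X Cline) ?V"
      by (intro hol_divide[OF P V] hol_diff[OF P V] 1 2 3) auto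
    moreover have "\<forall>y\<in>?V. (case y of (x, v) \<Rightarrow> dq (\<lambda>v. h (x, v)) v) = (h y - h (fst y, 0)) / snd y"
      by (auto simp only: dq_def fst_conv snd_conv split: prod.split if_split)
    moreover have "p \<in> ?V" "?V \<subseteq> W" using p False W0 p_eq by auto
    ultimately show ?thesis using V by blast
  next
    case True
    from hol_prod_fspaceD[OF h p[unfolded p_eq True]] obtain U V n c D G where
      1: "openin (topo X) U" "openin (topo Cline) V" "x0 \<in> U" "0 \<in> V" "U \<times> V \<subseteq> W" "\<forall>i<n. c i \<in> prod_generators X Cline U V"
      "openin (topo (Cspace n)) D" "G \<in> hol (Cspace n) D"
      "\<And>w. w \<in> U \<times> V \<Longrightarrow> vec n (\<lambda>i. c i w) \<in> D" "\<And>w. w \<in> U \<times> V \<Longrightarrow> h w = G (vec n (\<lambda>i. c i w))" by auto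
    have oV: "open V" using 1(2) by simp
    have "\<exists>t a b. (t \<and> a \<in> hol X U \<and> c i = a \<circ> fst) \<or> (\<not> t \<and> b holomorphic_on V \<and> c i = b \<circ> snd)" if "i < n" for i
      using 1(6)[rule_format, OF that] unfolding prod_generators_def hol_Cline by blast
    then obtain t a b where tab: "\<And>i. i < n \<Longrightarrow> (t i \<and> a i \<in> hol X U \<and> c i = a i \<circ> fst) \<or> (\<not> t i \<and> b i holomorphic_on V \<and> c i = b i \<circ> snd)"
      by metis
    \<comment> \<open>Coordinate \<open>n\<close> is reserved for the fibre variable. Generators
      from the base become independent coordinates, those from the line functions of coordinate
      \<open>n\<close>.\<close>
    define \<gamma> where "\<gamma> i z = (if t i then z i else b i (z n))" for i and z :: "nat \<Rightarrow> complex"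
    let ?C = "Cspace (Suc n)"
    define B where "B = {z \<in> Cn (Suc n). z n \<in> V}"
    have B: "openin (topo ?C) B" unfolding B_def by (rule openin_Cspace_coordinate[OF oV])
    have BC: "B \<subseteq> Cn (Suc n)" by (auto simp: B_def)
    have \<gamma>: "\<gamma> i \<in> hol ?C B" if "i < n" for i
    proof (cases "t i")
      case True
      then show ?thesis using that coordinate_hol_Cspace[OF BC, of i] by (simp add: \<gamma>_def[abs_def])
    next
      case False
      then have "b i holomorphic_on V" using tab[OF that] by blast
      from hol_holomorphic[OF analytic_Cspace B this oV coordinate_hol_Cspace[OF BC, of n]] False
      show ?thesis by (simp add: \<gamma>_def[abs_def] B_def)
    qed
    define D' where "D' = {z \<in> B. vec n (\<lambda>i. \<gamma> i z) \<in> D}"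
    have D': "openin (topo ?C) D'"
      unfolding D'_def by (rule openin_hol_vec_preimage[OF analytic_Cspace B \<gamma> 1(7)])
    define G' where "G' z = G (vec n (\<lambda>i. \<gamma> i z))" for z
    have G': "G' \<in> hol ?C D'"
      unfolding G'_def[abs_def]
    proof (rule hol_compose[OF analytic_Cspace D' _ 1(7,8)])
      show "\<gamma> i \<in> hol ?C D'" if "i < n" for i
        by (rule function_sheaf_mono[OF analytic_sheaf[OF analytic_Cspace] B D' _ \<gamma>[OF that]]) (auto simp: D'_def)
    qed (auto simp: D'_def)
    \<comment> \<open>The ambient point of \<open>w\<close>: values of the base generators, then
      \<open>v\<close>. Slots of generators from the line are filled with 0, since
      \<open>\<gamma>\<close> does not read them.\<close>
    define \<zeta> where "\<zeta> w = vec (Suc n) (\<lambda>i. if i < n then (if t i then a i (fst w) else 0) else snd w)" for w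
    have \<gamma>\<zeta>: "vec n (\<lambda>i. \<gamma> i (\<zeta> w)) = vec n (\<lambda>i. c i w)" if "w \<in> U \<times> V" for w
    proof
      fix i show "vec n (\<lambda>i. \<gamma> i (\<zeta> w)) i = vec n (\<lambda>i. c i w) i"
        using tab[of i] by (cases "i < n") (auto simp: vec_def \<gamma>_def \<zeta>_def)
    qed
    have \<zeta>D: "\<zeta> w \<in> D'" "h w = G' (\<zeta> w)" if "w \<in> U \<times> V" for w
      using that \<gamma>\<zeta>[OF that] 1(9,10)[OF that] by (auto simp: D'_def B_def G'_def) (auto simp: \<zeta>_def vec_nth)
    define q where "q = \<zeta> (x0, 0)"
    have q: "q \<in> D'" "q n = 0" using \<zeta>D(1)[of "(x0, 0)"] 1(3,4) by (auto simp: q_def \<zeta>_def vec_nth)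
    have "\<And>z. z \<in> D' \<Longrightarrow> complex_differentiable_at (Suc n) G' z" using G' by (simp add: hol_Cspace)
    from hadamard[OF D'[unfolded topo_Cspace] this q(1), of n]
    obtain r H where rH: "r > 0" "polydisc (Suc n) q r \<subseteq> D'" "\<forall>z \<in> polydisc (Suc n) q r. complex_differentiable_at (Suc n) H z"
      "\<forall>z \<in> polydisc (Suc n) q r. G' z - G' (z(n := q n)) = (z n - q n) * H z" by auto
    have UV: "openin (topo (prod_fspace X Cline)) (U \<times> V)" using 1(1,2) by (simp add: openin_prod_Times_iff)
    have \<zeta>h: "(\<lambda>w. if i < n then (if t i then a i (fst w) else 0) else snd w) \<in> hol (prod_fspace X Cline) (U \<times> V)" for i
    proof -
      have "(\<lambda>w. snd w) \<in> hol (prod_fspace X Cline) (U \<times> V)"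
        by (rule hol_prod_snd[OF X analytic_Cline 1(1,2)]) (auto simp: hol_Cline)
      moreover have "(\<lambda>w. a i (fst w)) \<in> hol (prod_fspace X Cline) (U \<times> V)" if "i < n" "t i"
        by (rule hol_prod_fst[OF X analytic_Cline 1(1,2)]) (use tab[OF that(1)] that(2) in blast)
      ultimately show ?thesis using hol_const[OF P UV, of 0] by (cases "i < n"; cases "t i") auto
    qed
    define N where "N = {w \<in> U \<times> V. \<zeta> w \<in> polydisc (Suc n) q r}"
    have N: "openin (topo (prod_fspace X Cline)) N"
      unfolding N_def \<zeta>_def
      by (rule openin_hol_vec_preimage[OF P UV \<zeta>h]) (simp add: openin_polydisc)
    have NUV: "N \<subseteq> U \<times> V" by (auto simp: N_def)
    have H\<zeta>: "(\<lambda>w. H (\<zeta> w)) \<in> hol (prod_fspace X Cline) N"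
      unfolding \<zeta>_def
    proof (rule hol_compose[OF P N, of "Suc n" _ "polydisc (Suc n) q r"])
      show "(\<lambda>w. if i < n then (if t i then a i (fst w) else 0) else snd w) \<in> hol (prod_fspace X Cline) N" for i
        by (rule function_sheaf_mono[OF sheaf UV N NUV \<zeta>h])
    qed (use rH(3) in \<open>auto simp: openin_polydisc hol_Cspace N_def \<zeta>_def\<close>)
    have eq: "h (x, v) = h (x, 0) + v * H (\<zeta> (x, v))" if "(x, v) \<in> N" for x v
    proof -
      have w: "(x, v) \<in> U \<times> V" "(x, 0) \<in> U \<times> V" using that NUV 1(4) by auto
      have z: "\<zeta> (x, v) \<in> polydisc (Suc n) q r" using that by (simp add: N_def)
      \<comment> \<open>Erasing the last ambient coordinate is passing to v = 0 over the same base
        point, so Hadamard's formula becomes the defining formula of \<open>dq\<close>.\<close>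
      have "(\<zeta> (x, v))(n := 0) = \<zeta> (x, 0)" "\<zeta> (x, v) n = v" by (auto simp: \<zeta>_def vec_def fun_eq_iff)
      then show ?thesis using rH(4)[rule_format, OF z] \<zeta>D(2)[OF w(1)] \<zeta>D(2)[OF w(2)] q(2) by (simp add: algebra_simps)
    qed
    have dq: "dq (\<lambda>v. h (x, v)) v = H (\<zeta> (x, v))" if xv: "(x, v) \<in> N" for x v
    proof (cases "v = 0")
      case True
      have S: "open {v. (x, v) \<in> N}" using openin_prod_slice_snd[of "topo X" euclidean N x] N by simp
      have "(\<lambda>v. H (\<zeta> (x, v))) holomorphic_on {v. (x, v) \<in> N}"
        using hol_prod_slice_snd[OF X analytic_Cline H\<zeta>, of x] by (simp add: hol_Cline)
      then have "continuous_on {v. (x, v) \<in> N} (\<lambda>v. H (\<zeta> (x, v)))" by (rule holomorphic_on_imp_continuous_on)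
      then have "isCont (\<lambda>v. H (\<zeta> (x, v))) 0" using S xv True by (simp add: continuous_on_eq_continuous_at)
      moreover have "\<forall>\<^sub>F v in nhds 0. h (x, v) = h (x, 0) + v * H (\<zeta> (x, v))"
      proof (rule eventually_mono[OF eventually_nhds_in_open[OF S]])
        show "0 \<in> {v. (x, v) \<in> N}" using xv True by simp
      qed (use eq in blast)
      ultimately show ?thesis using eventually_dq_eq(1)[of "\<lambda>v. h (x, v)" "\<lambda>v. H (\<zeta> (x, v))"] True by (simp add: dq_def)
    next
      case False
      then show ?thesis using eq[OF xv] by (simp add: dq_def field_simps)
    qed
    have "p \<in> N" using rH(1) 1(3,4) q(1) BC by (auto simp: N_def p_eq True D'_def simp flip: q_def intro!: centre_in_polydisc)
    moreover have "N \<subseteq> W" using NUV 1(5) by blast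
    moreover have "\<forall>y\<in>N. (case y of (x, v) \<Rightarrow> dq (\<lambda>v. h (x, v)) v) = H (\<zeta> y)" using dq by auto
    ultimately show ?thesis using N H\<zeta> by blast
  qed
qed

lemma dq_funpow_hol_prod:
  assumes "h \<in> hol (prod_fspace X Cline) W"
  shows "(\<lambda>(x, v). (dq ^^ k) (\<lambda>v. h (x, v)) v) \<in> hol (prod_fspace X Cline) W"
proof (induction k)
  case (Suc k)
  from dq_hol_prod[OF this] show ?case by simp
qed (use assms in simp)

lemma taylor_coeff_hol:
  assumes "h \<in> hol (prod_fspace X Cline) W"
  shows "(\<lambda>x. taylor_coeff k (\<lambda>v. h (x, v))) \<in> hol X {x. (x, 0) \<in> W}"
  using hol_prod_slice_fst[OF X analytic_Cline dq_funpow_hol_prod[OF assms, of k], of 0]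
  by (simp add: taylor_coeff_def)

end

section \<open>Line bundles and their blow-down\<close>

locale line_bundle_over =
  fixes X :: "'a fspace" and L :: "('i, 'a) line_bundle"
  assumes X: "analytic_fspace X" and L: "holomorphic_line_bundle X L"
begin

abbreviation "E \<equiv> total_space X L"
abbreviation "I \<equiv> idx L"
abbreviation "U \<equiv> triv L"
abbreviation "g \<equiv> trans_fun L"
abbreviation "P i \<equiv> prod_fspace (sub_fspace X (U i)) Cline"
abbreviation "bp i x v \<equiv> bundle_point L (i, x, v)"

lemma openin_triv: "i \<in> I \<Longrightarrow> openin (topo X) (U i)"
  using L by (simp add: holomorphic_line_bundle_def)

lemma triv_cover: "x \<in> topspace (topo X) \<Longrightarrow> \<exists>i \<in> I. x \<in> U i"
  using L by (auto simp: holomorphic_line_bundle_def)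

lemma trans_hol: "i \<in> I \<Longrightarrow> j \<in> I \<Longrightarrow> g i j \<in> hol X (U i \<inter> U j)"
  using L by (simp add: holomorphic_line_bundle_def)

lemma trans_nonzero: "i \<in> I \<Longrightarrow> j \<in> I \<Longrightarrow> x \<in> U i \<Longrightarrow> x \<in> U j \<Longrightarrow> g i j x \<noteq> 0"
  using L by (simp add: holomorphic_line_bundle_def)

lemma trans_cocycle:
  "i \<in> I \<Longrightarrow> j \<in> I \<Longrightarrow> k \<in> I \<Longrightarrow> x \<in> U i \<Longrightarrow> x \<in> U j \<Longrightarrow> x \<in> U k \<Longrightarrow> g i j x * g j k x = g i k x"
  using L by (simp add: holomorphic_line_bundle_def)

lemma trans_self: "i \<in> I \<Longrightarrow> x \<in> U i \<Longrightarrow> g i i x = 1"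
  using trans_cocycle[of i i i x] trans_nonzero[of i i x] by simp

lemma trans_inverse: "i \<in> I \<Longrightarrow> j \<in> I \<Longrightarrow> x \<in> U i \<Longrightarrow> x \<in> U j \<Longrightarrow> inverse (g i j x) = g j i x"
  using trans_cocycle[of i j i x] trans_self[of i x] by (simp add: inverse_unique)

lemma bundle_point_mem: "(j, y, w) \<in> bp i x v \<longleftrightarrow> y = x \<and> j \<in> I \<and> x \<in> U j \<and> w = g j i x * v"
  by (auto simp: bundle_point_def)

lemma bundle_point_eq_iff:
  assumes "i \<in> I" "x \<in> U i" "j \<in> I" "y \<in> U j"
  shows "bp i x v = bp j y w \<longleftrightarrow> x = y \<and> v = g i j x * w"
proof
  assume eq: "bp i x v = bp j y w"
  have "(i, x, v) \<in> bp i x v" using assms by (simp add: bundle_point_mem trans_self)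
  then show "x = y \<and> v = g i j x * w" unfolding eq bundle_point_mem by simp
next
  assume a: "x = y \<and> v = g i j x * w"
  have *: "g k i x * (g i j x * w) = g k j x * w" if "k \<in> I" "x \<in> U k" for k
    using that a assms trans_cocycle[of k i j x] by (simp flip: mult.assoc)
  then have "(k, z, u) \<in> bp i x v \<longleftrightarrow> (k, z, u) \<in> bp j y w" for k z u
    unfolding bundle_point_mem using a * by metis
  then show "bp i x v = bp j y w" by (intro set_eqI) (metis prod_cases3)
qed

lemma bundle_point_change:
  assumes "i \<in> I" "x \<in> U i" "j \<in> I" "x \<in> U j"
  shows "bp i x v = bp j x (g j i x * v)"
  using bundle_point_eq_iff[OF assms, of v "g j i x * v"] trans_cocycle[of i j i x] trans_self[of i x] assms
  by (simp flip: mult.assoc)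

lemma analytic_P: "analytic_fspace (P i)"
  by (intro analytic_prod_fspace analytic_sub_fspace X analytic_Cline)

lemma topspace_P: "i \<in> I \<Longrightarrow> topspace (topo (P i)) = U i \<times> UNIV"
  using openin_subset[OF openin_triv] by (simp add: Int_absorb1)

lemma topspace_total: "topspace (topo E) = {bp i x v | i x v. i \<in> I \<and> x \<in> U i}"
proof -
  have "topspace (topo (sum_fspace P I)) = Sigma I (\<lambda>i. U i \<times> UNIV)"
    using topspace_P by (auto simp: topspace_sum_topology)
  then show ?thesis unfolding total_space_def topspace_quotient_fspace by (auto simp: image_iff)
qed

lemma total_point:
  assumes "p \<in> topspace (topo E)"
  obtains i x v where "i \<in> I" "x \<in> U i" "p = bp i x v"
  using assms unfolding topspace_total by blast

lemma bundle_point_in: "i \<in> I \<Longrightarrow> x \<in> U i \<Longrightarrow> bp i x v \<in> topspace (topo E)"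
  unfolding topspace_total by blast

abbreviation "preim i S \<equiv> {(x, v). x \<in> U i \<and> bp i x v \<in> S}"

lemma openin_total:
  "openin (topo E) S \<longleftrightarrow> S \<subseteq> topspace (topo E) \<and> (\<forall>i \<in> I. openin (topo (P i)) (preim i S))"
proof -
  have ts: "topspace (topo (sum_fspace P I)) = Sigma I (\<lambda>i. U i \<times> UNIV)"
    using topspace_P by (auto simp: topspace_sum_topology)
  have 1: "{x. (i, x) \<in> {t \<in> topspace (topo (sum_fspace P I)). bundle_point L t \<in> S}} = preim i S" if "i \<in> I" for i
    unfolding ts using that by auto
  have 2: "{t \<in> topspace (topo (sum_fspace P I)). bundle_point L t \<in> S} \<subseteq> Sigma I (topspace \<circ> (\<lambda>i. topo (P i)))"
    unfolding ts using topspace_P by auto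
  show ?thesis
    unfolding total_space_def openin_quotient_fspace topspace_quotient_fspace
    unfolding topo_sum_fspace openin_sum_topology
    using 1 2 by (simp add: topo_sum_fspace)
qed

lemma hol_total: "h \<in> hol E S \<longleftrightarrow> (\<forall>i \<in> I. (\<lambda>(x, v). h (bp i x v)) \<in> hol (P i) (preim i S))"
proof -
  have ts: "topspace (topo (sum_fspace P I)) = Sigma I (\<lambda>i. U i \<times> UNIV)"
    using topspace_P by (auto simp: topspace_sum_topology)
  have 1: "{x. (i, x) \<in> {t \<in> topspace (topo (sum_fspace P I)). bundle_point L t \<in> S}} = preim i S" if "i \<in> I" for i
    unfolding ts using that by auto
  have 2: "(\<lambda>y. h (bundle_point L (i, y))) = (\<lambda>(x, v). h (bp i x v))" for i by auto
  show ?thesis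
    unfolding total_space_def hol_quotient_fspace hol_sum_fspace using 1 2 by simp
qed

lemma analytic_total: "analytic_fspace E"
  unfolding total_space_def by (intro analytic_quotient_fspace analytic_sum_fspace analytic_P)

lemma hol_sub_triv:
  assumes "i \<in> I" "openin (topo X) S" "S \<subseteq> U i"
  shows "hol (sub_fspace X (U i)) S = hol X S"
  by (rule hol_sub_fspace_open[OF analytic_sheaf[OF X] openin_triv[OF assms(1)] assms(2,3)])

lemma openin_sub_triv:
  "i \<in> I \<Longrightarrow> openin (topo (sub_fspace X (U i))) S \<longleftrightarrow> openin (topo X) S \<and> S \<subseteq> U i"
  by (rule openin_sub_fspace_open[OF openin_triv])

lemma openin_P_Times:
  "i \<in> I \<Longrightarrow> openin (topo X) S \<Longrightarrow> S \<subseteq> U i \<Longrightarrow> open T \<Longrightarrow> openin (topo (P i)) (S \<times> T)"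
  unfolding topo_prod_fspace openin_prod_Times_iff by (simp add: openin_sub_triv del: topo_sub_fspace)

lemma hol_P_fst:
  assumes "i \<in> I" "openin (topo X) S" "S \<subseteq> U i" "a \<in> hol X S" "open T"
  shows "(\<lambda>(x, v). a x) \<in> hol (P i) (S \<times> T)"
  using hol_prod_fst[OF analytic_sub_fspace[OF X] analytic_Cline, of "U i" S T a] assms
  by (simp add: openin_sub_triv hol_sub_triv case_prod_unfold del: topo_sub_fspace)

lemma hol_P_snd:
  assumes "i \<in> I" "openin (topo X) S" "S \<subseteq> U i" "b holomorphic_on T" "open T"
  shows "(\<lambda>(x, v). b v) \<in> hol (P i) (S \<times> T)"
  using hol_prod_snd[OF analytic_sub_fspace[OF X] analytic_Cline, of "U i" S T b] assms
  by (simp add: openin_sub_triv hol_Cline case_prod_unfold del: topo_sub_fspace)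

lemma P_basis:
  assumes "i \<in> I" "openin (topo (P i)) S" "(x, v) \<in> S"
  obtains A B where "openin (topo X) A" "A \<subseteq> U i" "open B" "x \<in> A" "v \<in> B" "A \<times> B \<subseteq> S"
proof -
  from assms(2)[unfolded topo_prod_fspace openin_prod_topology_alt, rule_format, OF assms(3)]
  obtain A B where "openin (topo (sub_fspace X (U i))) A" "openin (topo Cline) B" "x \<in> A" "v \<in> B" "A \<times> B \<subseteq> S" by blast
  then show thesis
    using openin_sub_triv[OF assms(1)] by (intro that[of A B]) (auto simp del: topo_sub_fspace)
qed

text \<open>The gluing map is open, because in any other trivialisation the image pulls back to the
  preimage of \<open>S\<close> under the change of fibre coordinate.\<close>

lemma openin_bundle_point_image:
  assumes i: "i \<in> I" and S: "openin (topo (P i)) S"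
  shows "openin (topo E) ((\<lambda>(x, v). bp i x v) ` S)"
  unfolding openin_total
proof (intro conjI ballI)
  have SU: "S \<subseteq> U i \<times> UNIV" using openin_subset[OF S] topspace_P[OF i] by simp
  then show "(\<lambda>(x, v). bp i x v) ` S \<subseteq> topspace (topo E)" using bundle_point_in[OF i] by auto
  fix j assume j: "j \<in> I"
  let ?S = "(\<lambda>(x, v). bp i x v) ` S"
  have eq: "preim j ?S = {(y, w). y \<in> U i \<and> y \<in> U j \<and> (y, g i j y * w) \<in> S}"
  proof (intro set_eqI iffI)
    fix t assume "t \<in> preim j ?S"
    then obtain y w x v where "t = (y, w)" "y \<in> U j" "(x, v) \<in> S" "bp j y w = bp i x v" by auto
    moreover from this have "x \<in> U i" using SU by auto
    ultimately have "x = y" "v = g i j x * w" using bundle_point_eq_iff[OF i _ j, of x y v w] by auto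
    then show "t \<in> {(y, w). y \<in> U i \<and> y \<in> U j \<and> (y, g i j y * w) \<in> S}"
      using \<open>t = (y, w)\<close> \<open>y \<in> U j\<close> \<open>x \<in> U i\<close> \<open>(x, v) \<in> S\<close> by simp
  next
    fix t assume "t \<in> {(y, w). y \<in> U i \<and> y \<in> U j \<and> (y, g i j y * w) \<in> S}"
    then obtain y w where t: "t = (y, w)" "y \<in> U i" "y \<in> U j" "(y, g i j y * w) \<in> S" by blast
    have "bp j y w = bp i y (g i j y * w)" by (rule bundle_point_change[OF j t(3) i t(2)])
    then show "t \<in> preim j ?S" using t by force
  qed
  show "openin (topo (P j)) (preim j ?S)"
    unfolding eq
  proof (subst openin_subopen, intro ballI)
    fix t assume "t \<in> {(y, w). y \<in> U i \<and> y \<in> U j \<and> (y, g i j y * w) \<in> S}"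
    then obtain y w where t: "t = (y, w)" "y \<in> U i" "y \<in> U j" "(y, g i j y * w) \<in> S" by blast
    obtain A B where AB: "openin (topo X) A" "A \<subseteq> U i" "open B" "y \<in> A" "g i j y * w \<in> B" "A \<times> B \<subseteq> S"
      using P_basis[OF i S t(4)] .
    let ?A = "A \<inter> U j"
    have A: "openin (topo X) ?A" using AB(1) openin_triv[OF j] by blast
    have "openin (topo X) (U i \<inter> U j)" using openin_triv i j by blast
    from function_sheaf_mono[OF analytic_sheaf[OF X] this A _ trans_hol[OF i j]] AB(2)
    have gh: "g i j \<in> hol X ?A" by blast
    have op: "openin (topo (P j)) (?A \<times> UNIV)" using openin_P_Times[OF j A] by simp
    have "(\<lambda>t. (\<lambda>(x, v). g i j x) t * (\<lambda>(x, v). v) t) \<in> hol (P j) (?A \<times> UNIV)"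
      by (intro hol_mult[OF analytic_P op] hol_P_fst[OF j A] hol_P_snd[OF j A] gh) auto
    from analytic_openin[OF analytic_P op this AB(3)]
    have "openin (topo (P j)) {t \<in> ?A \<times> UNIV. (\<lambda>(x, v). g i j x) t * (\<lambda>(x, v). v) t \<in> B}" .
    then show "\<exists>T. openin (topo (P j)) T \<and> t \<in> T \<and> T \<subseteq> {(y, w). y \<in> U i \<and> y \<in> U j \<and> (y, g i j y * w) \<in> S}"
      using AB t by (intro exI[of _ "{t \<in> ?A \<times> UNIV. (\<lambda>(x, v). g i j x) t * (\<lambda>(x, v). v) t \<in> B}"]) auto
  qed
qed

text \<open>An arbitrary trivialisation and its coordinates. Whatever is defined through it has to
  be shown independent of this choice.\<close>

definition bundle_rep :: "('i \<times> 'a \<times> complex) set \<Rightarrow> 'i \<times> 'a \<times> complex" where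
  "bundle_rep p = (SOME t. t \<in> p)"

lemma bundle_rep:
  assumes "i \<in> I" "x \<in> U i"
  obtains j where "j \<in> I" "x \<in> U j" "bundle_rep (bp i x v) = (j, x, g j i x * v)"
proof -
  have "(i, x, v) \<in> bp i x v" using assms by (simp add: bundle_point_mem trans_self)
  then have "bundle_rep (bp i x v) \<in> bp i x v" unfolding bundle_rep_def by (rule someI[where P = "\<lambda>t. t \<in> bp i x v"])
  moreover obtain j y w where jyw: "bundle_rep (bp i x v) = (j, y, w)" by (cases "bundle_rep (bp i x v)") auto
  ultimately have "(j, y, w) \<in> bp i x v" by simp
  then show thesis using that[of j] jyw unfolding bundle_point_mem by simp
qed

definition bundle_proj :: "('i \<times> 'a \<times> complex) set \<Rightarrow> 'a" where
  "bundle_proj p = fst (snd (bundle_rep p))"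

lemma bundle_proj [simp]: "i \<in> I \<Longrightarrow> x \<in> U i \<Longrightarrow> bundle_proj (bp i x v) = x"
  by (rule bundle_rep[of i x v]) (auto simp: bundle_proj_def)

lemma holomorphic_map_bundle_proj: "holomorphic_map E X bundle_proj"
proof (rule holomorphic_mapI)
  show "bundle_proj \<in> topspace (topo E) \<rightarrow> topspace (topo X)"
    using subsetD[OF openin_subset[OF openin_triv]] by (auto elim!: total_point)
next
  fix V assume V: "openin (topo X) V"
  have tr: "preim i {p \<in> topspace (topo E). bundle_proj p \<in> V} = (U i \<inter> V) \<times> UNIV" if "i \<in> I" for i
    using that bundle_point_in by auto
  have op: "openin (topo X) (U i \<inter> V)" if "i \<in> I" for i using openin_triv[OF that] V by blast
  show "openin (topo E) {p \<in> topspace (topo E). bundle_proj p \<in> V}"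
    unfolding openin_total using tr openin_P_Times[OF _ op] by auto
  fix h assume h: "h \<in> hol X V"
  show "(\<lambda>p. h (bundle_proj p)) \<in> hol E {p \<in> topspace (topo E). bundle_proj p \<in> V}"
    unfolding hol_total
  proof
    fix i assume i: "i \<in> I"
    have "h \<in> hol X (U i \<inter> V)" by (rule function_sheaf_mono[OF analytic_sheaf[OF X] V op[OF i] _ h]) blast
    from hol_P_fst[OF i op[OF i] _ this, of UNIV]
    have "(\<lambda>(x, v). h x) \<in> hol (P i) ((U i \<inter> V) \<times> UNIV)" by simp
    then show "(\<lambda>(x, v). h (bundle_proj (bp i x v))) \<in> hol (P i) (preim i {p \<in> topspace (topo E). bundle_proj p \<in> V})"
      unfolding tr[OF i]
      by (rule function_sheaf_cong[OF analytic_sheaf[OF analytic_P], rotated]) (use i openin_P_Times[OF i op[OF i]] in auto)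
  qed
qed

lemma zero_section_eq: "zero_section L = {p \<in> topspace (topo E). \<exists>i x. i \<in> I \<and> x \<in> U i \<and> p = bp i x 0}"
  unfolding zero_section_def topspace_total by blast

lemma bundle_point_zero_section: "i \<in> I \<Longrightarrow> x \<in> U i \<Longrightarrow> bp i x v \<in> zero_section L \<longleftrightarrow> v = 0"
proof
  assume i: "i \<in> I" "x \<in> U i" and "bp i x v \<in> zero_section L"
  then obtain j y where "j \<in> I" "y \<in> U j" "bp i x v = bp j y 0" unfolding zero_section_def by blast
  then show "v = 0" using bundle_point_eq_iff[OF i] by simp
qed (auto simp: zero_section_def)

section \<open>Sections of dual powers and functions on the total space\<close>

abbreviation "dual_power k \<equiv> tensor_power k (dual_bundle L)"

lemma idx_dual_power [simp]: "idx (dual_power k) = I" and triv_dual_power [simp]: "triv (dual_power k) = U"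
  by (simp_all add: tensor_power_def dual_bundle_def)

lemma global_section_dual_power:
  "global_section X (dual_power k) s \<longleftrightarrow> (\<forall>i \<in> I. s i \<in> hol X (U i)) \<and>
     (\<forall>i \<in> I. \<forall>j \<in> I. \<forall>x \<in> U i \<inter> U j. s i x = g j i x ^ k * s j x)"
  unfolding global_section_def by (auto simp: tensor_power_def dual_bundle_def trans_inverse)

text \<open>A section of the k-th dual power is the same as a function on the total space that is
  homogeneous of degree \<open>k\<close> on each fibre.\<close>

definition section_fun :: "nat \<Rightarrow> ('i \<Rightarrow> 'a \<Rightarrow> complex) \<Rightarrow> ('i \<times> 'a \<times> complex) set \<Rightarrow> complex" where
  "section_fun k s p = (case bundle_rep p of (i, x, v) \<Rightarrow> s i x * v ^ k)"

lemma section_fun: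
  assumes s: "global_section X (dual_power k) s" and i: "i \<in> I" "x \<in> U i"
  shows "section_fun k s (bp i x v) = s i x * v ^ k"
proof -
  obtain j where j: "j \<in> I" "x \<in> U j" "bundle_rep (bp i x v) = (j, x, g j i x * v)" using bundle_rep[OF i] .
  have "s i x = g j i x ^ k * s j x" using s i j unfolding global_section_dual_power by blast
  then show ?thesis using j by (simp add: section_fun_def power_mult_distrib)
qed

lemma section_fun_hol:
  assumes s: "global_section X (dual_power k) s"
  shows "section_fun k s \<in> hol E (topspace (topo E))"
  unfolding hol_total
proof
  fix i assume i: "i \<in> I"
  have tr: "preim i (topspace (topo E)) = U i \<times> UNIV" using bundle_point_in[OF i] by auto
  have op: "openin (topo (P i)) (U i \<times> UNIV)" using openin_P_Times[OF i openin_triv[OF i]] by simp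
  have "s i \<in> hol X (U i)" using s i by (simp add: global_section_dual_power)
  then have "(\<lambda>t. (\<lambda>(x, v). s i x) t * (\<lambda>(x, v). v ^ k) t) \<in> hol (P i) (U i \<times> UNIV)"
    by (intro hol_mult[OF analytic_P op] hol_P_fst[OF i] hol_P_snd[OF i] openin_triv i) (auto intro!: holomorphic_intros)
  then show "(\<lambda>(x, v). section_fun k s (bp i x v)) \<in> hol (P i) (preim i (topspace (topo E)))"
    unfolding tr
    by (rule function_sheaf_cong[OF analytic_sheaf[OF analytic_P] op]) (use section_fun[OF s i] in auto)
qed

definition coeff_section :: "nat \<Rightarrow> (('i \<times> 'a \<times> complex) set \<Rightarrow> complex) \<Rightarrow> 'i \<Rightarrow> 'a \<Rightarrow> complex" where
  "coeff_section k h i x = taylor_coeff k (\<lambda>v. h (bp i x v))"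

context
  fixes S h
  assumes S: "openin (topo E) S" "zero_section L \<subseteq> S" and h: "h \<in> hol E S"
begin

lemma trace_zero: "i \<in> I \<Longrightarrow> x \<in> U i \<Longrightarrow> (x, 0) \<in> preim i S"
  using S(2) bundle_point_zero_section by auto

lemma openin_trace: "i \<in> I \<Longrightarrow> openin (topo (P i)) (preim i S)"
  using S(1) unfolding openin_total by blast

lemma trace_hol: "i \<in> I \<Longrightarrow> (\<lambda>(x, v). h (bp i x v)) \<in> hol (P i) (preim i S)"
  using h unfolding hol_total by blast

lemma fibre_holomorphic:
  assumes i: "i \<in> I" "x \<in> U i"
  shows "(\<lambda>v. h (bp i x v)) holomorphic_on {v. bp i x v \<in> S}" "open {v. bp i x v \<in> S}" "0 \<in> {v. bp i x v \<in> S}"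
proof -
  have eq: "{v. (x, v) \<in> preim i S} = {v. bp i x v \<in> S}" using i by auto
  from hol_prod_slice_snd[OF analytic_sub_fspace[OF X] analytic_Cline trace_hol[OF i(1)], of x]
  show "(\<lambda>v. h (bp i x v)) holomorphic_on {v. bp i x v \<in> S}" unfolding eq hol_Cline by simp
  from openin_prod_slice_snd[OF openin_trace[OF i(1), unfolded topo_prod_fspace], of x]
  show "open {v. bp i x v \<in> S}" unfolding eq by simp
  show "0 \<in> {v. bp i x v \<in> S}" using trace_zero[OF i] by simp
qed

lemma coeff_section_change:
  assumes "i \<in> I" "x \<in> U i" "j \<in> I" "x \<in> U j"
  shows "coeff_section k h i x = g j i x ^ k * coeff_section k h j x"
proof -
  have "(\<lambda>v. h (bp i x v)) = (\<lambda>v. h (bp j x (g j i x * v)))" using bundle_point_change[OF assms] by simp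
  then show ?thesis
    unfolding coeff_section_def
    using taylor_coeff_scale[OF fibre_holomorphic[OF assms(3,4)], of "g j i x" k] trans_nonzero assms by simp
qed

lemma trace_dq_hol:
  assumes i: "i \<in> I"
  shows "(\<lambda>(x, v). (dq ^^ k) (\<lambda>v. h (bp i x v)) v) \<in> hol (P i) (preim i S)"
  using dq_funpow_hol_prod[OF analytic_sub_fspace[OF X] openin_trace[OF i] _ trace_hol[OF i], of k] trace_zero[OF i]
  by simp

text \<open>Holomorphy is that of iterated divided differences, restricted to v = 0; the cocycle
  condition is their homogeneity under a change of trivialisation.\<close>

lemma global_section_coeff: "global_section X (dual_power k) (coeff_section k h)"
  unfolding global_section_dual_power
proof (intro conjI ballI)
  fix i assume i: "i \<in> I"
  have eq: "{x. (x, 0) \<in> preim i S} = U i" using trace_zero[OF i] by auto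
  from taylor_coeff_hol[OF analytic_sub_fspace[OF X] openin_trace[OF i] _ trace_hol[OF i], of k] trace_zero[OF i]
  have "(\<lambda>x. taylor_coeff k (\<lambda>v. h (bp i x v))) \<in> hol (sub_fspace X (U i)) (U i)" unfolding eq by simp
  then show "coeff_section k h i \<in> hol X (U i)"
    using hol_sub_triv[OF i openin_triv[OF i]] by (simp add: coeff_section_def[abs_def])
next
  fix i j x assume "i \<in> I" "j \<in> I" "x \<in> U i \<inter> U j"
  then show "coeff_section k h i x = g j i x ^ k * coeff_section k h j x" using coeff_section_change by blast
qed

end

end

locale blow_down = line_bundle_over X L
  for X :: "'a fspace" and L :: "('i, 'a) line_bundle" +
  fixes Z :: "'c fspace" and z0 :: 'c and f :: "('i \<times> 'a \<times> complex) set \<Rightarrow> 'c"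
  assumes blow_down: "grauert_blow_down X L Z z0 f"
begin

lemma analytic_Z: "analytic_fspace Z" and Z_space: "complex_space Z" and z0_in: "z0 \<in> topspace (topo Z)"
  using blow_down complex_space_analytic by (auto simp: grauert_blow_down_def)

lemma f_hol: "holomorphic_map E Z f"
  using blow_down by (simp add: grauert_blow_down_def)

lemma f_proper: "proper_map (topo E) (topo Z) f"
  using blow_down by (simp add: grauert_blow_down_def)

lemma f_zero_section: "f ` zero_section L = {z0}"
  using blow_down by (simp add: grauert_blow_down_def)

lemma f_biholomorphic:
  "biholomorphic_map (sub_fspace E (topspace (topo E) - zero_section L)) (sub_fspace Z (topspace (topo Z) - {z0})) f"
  using blow_down by (simp add: grauert_blow_down_def)

lemma descend:
  assumes "openin (topo Z) W" "h \<in> hol E {p \<in> topspace (topo E). f p \<in> W}"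
  shows "\<exists>k \<in> hol Z W. \<forall>p \<in> topspace (topo E). f p \<in> W \<longrightarrow> h p = k (f p)"
  using blow_down[unfolded grauert_blow_down_def, THEN conjunct2, THEN conjunct2, THEN conjunct2, THEN conjunct2,
      THEN conjunct2, THEN conjunct2, rule_format, of W h] assms by blast

lemma f_in: "p \<in> topspace (topo E) \<Longrightarrow> f p \<in> topspace (topo Z)"
  by (rule holomorphic_map_in[OF f_hol])

lemma f_eq_z0_iff: "p \<in> topspace (topo E) \<Longrightarrow> f p = z0 \<longleftrightarrow> p \<in> zero_section L"
proof
  assume p: "p \<in> topspace (topo E)" and eq: "f p = z0"
  show "p \<in> zero_section L"
  proof (rule ccontr)
    assume np: "p \<notin> zero_section L"
    have "holomorphic_map (sub_fspace E (topspace (topo E) - zero_section L)) (sub_fspace Z (topspace (topo Z) - {z0})) f"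
      using f_biholomorphic unfolding biholomorphic_map_def by blast
    from holomorphic_map_in[OF this, of p] have "f p \<in> topspace (topo (sub_fspace Z (topspace (topo Z) - {z0})))"
      using p np by simp
    then show False using eq by simp
  qed
next
  assume "p \<in> zero_section L"
  then show "f p = z0" using f_zero_section by blast
qed

lemma f_bundle_point: "i \<in> I \<Longrightarrow> x \<in> U i \<Longrightarrow> f (bp i x v) = z0 \<longleftrightarrow> v = 0"
  using f_eq_z0_iff[OF bundle_point_in] bundle_point_zero_section by blast

lemma nonempty: "\<exists>i x. i \<in> I \<and> x \<in> U i"
  using f_zero_section unfolding zero_section_def by blast

abbreviation "over W \<equiv> {p \<in> topspace (topo E). f p \<in> W}"

lemma openin_over: "openin (topo Z) W \<Longrightarrow> openin (topo E) (over W)"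
  by (rule holomorphic_map_openin[OF f_hol])

lemma pullback_hol: "openin (topo Z) W \<Longrightarrow> h \<in> hol Z W \<Longrightarrow> (\<lambda>p. h (f p)) \<in> hol E (over W)"
  by (rule holomorphic_map_hol[OF f_hol])

lemma zero_section_over: "z0 \<in> W \<Longrightarrow> zero_section L \<subseteq> over W"
  using f_eq_z0_iff zero_section_eq by auto

lemma pullback_fibre:
  assumes W: "openin (topo Z) W" "z0 \<in> W" and h: "h \<in> hol Z W" and ix: "i \<in> I" "x \<in> U i"
  shows "(\<lambda>v. h (f (bp i x v))) holomorphic_on {v. bp i x v \<in> over W}"
    "open {v. bp i x v \<in> over W}" "0 \<in> {v. bp i x v \<in> over W}"
  by (rule fibre_holomorphic[OF openin_over[OF W(1)] zero_section_over[OF W(2)] pullback_hol[OF W(1) h] ix])+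

lemma section_descend:
  assumes s: "global_section X (dual_power k) s" and k: "0 < k"
  shows "\<exists>\<sigma> \<in> hol Z (topspace (topo Z)). \<sigma> z0 = 0 \<and> (\<forall>i \<in> I. \<forall>x \<in> U i. \<forall>v. \<sigma> (f (bp i x v)) = s i x * v ^ k)"
proof -
  have "over (topspace (topo Z)) = topspace (topo E)" using f_in by blast
  then have "section_fun k s \<in> hol E (over (topspace (topo Z)))" using section_fun_hol[OF s] by simp
  from descend[OF openin_topspace this] obtain \<sigma> where
    \<sigma>: "\<sigma> \<in> hol Z (topspace (topo Z))" "\<forall>p \<in> topspace (topo E). f p \<in> topspace (topo Z) \<longrightarrow> section_fun k s p = \<sigma> (f p)" by blast
  have eq: "\<sigma> (f (bp i x v)) = s i x * v ^ k" if "i \<in> I" "x \<in> U i" for i x v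
    using \<sigma>(2)[rule_format, OF bundle_point_in[OF that] f_in[OF bundle_point_in[OF that]]] section_fun[OF s that] by simp
  obtain i x where ix: "i \<in> I" "x \<in> U i" using nonempty by blast
  have "\<sigma> z0 = 0" using eq[OF ix, of 0] f_bundle_point[OF ix, of 0] k by simp
  with \<sigma>(1) eq show ?thesis by blast
qed

abbreviation "k0 \<equiv> initial_order X (dual_bundle L)"

lemma section_below_k0:
  assumes "0 < j" "j < k0" "global_section X (dual_power j) s" "i \<in> I" "x \<in> U i"
  shows "s i x = 0"
proof (rule ccontr)
  assume "s i x \<noteq> 0"
  then have "0 < j \<and> has_nonzero_section X (dual_power j)"
    unfolding has_nonzero_section_def using assms by auto
  then have "k0 \<le> j" unfolding initial_order_def by (rule Least_le)
  then show False using assms(2) by simp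
qed

text \<open>Order 0 gives the value at \<open>z0\<close>. A coefficient of positive order
  \<open>j\<close> is a section of the j-th dual power, which is zero by minimality of
  \<open>k0\<close>.\<close>

lemma coeff_below_k0:
  assumes W: "openin (topo Z) W" "z0 \<in> W" and h: "h \<in> hol Z W" "h z0 = 0"
    and j: "j < k0" and ix: "i \<in> I" "x \<in> U i"
  shows "coeff_section j (\<lambda>p. h (f p)) i x = 0"
proof (cases "j = 0")
  case True
  then show ?thesis using f_bundle_point[OF ix, of 0] h(2) by (simp add: coeff_section_def taylor_coeff_def)
next
  case False
  then show ?thesis
    using section_below_k0[OF _ j global_section_coeff[OF openin_over[OF W(1)] zero_section_over[OF W(2)] pullback_hol[OF W(1) h(1)]] ix]
    by simp
qed

end

section \<open>Generators of the maximal ideal, pulled back to the fibres\<close>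

locale blow_down_generators = blow_down X L Z z0 f
  for X :: "'a fspace" and L :: "('i, 'a) line_bundle" and Z :: "'c fspace" and z0 f +
  fixes W :: "'c set" and N :: nat and \<gamma> :: "nat \<Rightarrow> 'c \<Rightarrow> complex"
  assumes gen: "generates_maximal_ideal Z z0 W N \<gamma>"
    and common_zero: "\<And>z. z \<in> W \<Longrightarrow> (\<And>k. k < N \<Longrightarrow> \<gamma> k z = 0) \<Longrightarrow> z = z0"
begin

lemma W: "openin (topo Z) W" and z0W: "z0 \<in> W"
  using gen by (auto simp: generates_maximal_ideal_def)

lemma \<gamma>_hol: "l < N \<Longrightarrow> \<gamma> l \<in> hol Z W" and \<gamma>_z0: "l < N \<Longrightarrow> \<gamma> l z0 = 0"
  using gen by (auto simp: generates_maximal_ideal_def)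

lemma generate:
  assumes "openin (topo Z) V" "z0 \<in> V" "h \<in> hol Z V" "h z0 = 0"
  shows "\<exists>V' c. openin (topo Z) V' \<and> z0 \<in> V' \<and> V' \<subseteq> V \<inter> W \<and> (\<forall>k < N. c k \<in> hol Z V') \<and>
           (\<forall>z \<in> V'. h z = (\<Sum>k<N. c k z * \<gamma> k z))"
  using gen[unfolded generates_maximal_ideal_def, THEN conjunct2, THEN conjunct2, THEN conjunct2, rule_format, of V h] assms
  by blast

abbreviation "coef l k \<equiv> coeff_section k (\<lambda>p. \<gamma> l (f p))"

lemmas coef_section = global_section_coeff[OF openin_over[OF W] zero_section_over[OF z0W] pullback_hol[OF W \<gamma>_hol]]
lemmas \<gamma>_fibre = pullback_fibre[OF W z0W \<gamma>_hol]

text \<open>Each fibre leaves the zero section inside \<open>over W\<close>, and there some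
  generator is nonzero because \<open>z0\<close> is their only common zero; that generator has a
  nonzero Taylor coefficient.\<close>

lemma coef_nonzero:
  assumes ix: "i \<in> I" "x \<in> U i"
  shows "\<exists>l<N. \<exists>k. coef l k i x \<noteq> 0"
proof -
  have "(\<lambda>_. 0) \<in> hol Z W" by (rule hol_const[OF analytic_Z W])
  from pullback_fibre(2,3)[OF W z0W this ix] obtain r where r: "r > 0" "ball 0 r \<subseteq> {v. bp i x v \<in> over W}"
    unfolding open_contains_ball by blast
  let ?v = "complex_of_real (r / 2)"
  have v: "?v \<in> ball 0 r" "?v \<noteq> 0" using r(1) by (auto simp: norm_of_real)
  then have "f (bp i x ?v) \<in> W" "f (bp i x ?v) \<noteq> z0" using subsetD[OF r(2) v(1)] f_bundle_point[OF ix, of ?v] v(2) by blast+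
  then obtain l where l: "l < N" "\<gamma> l (f (bp i x ?v)) \<noteq> 0" using common_zero by blast
  have "(\<lambda>v. \<gamma> l (f (bp i x v))) holomorphic_on ball 0 r"
    by (rule holomorphic_on_subset[OF \<gamma>_fibre(1)[OF l(1) ix] r(2)])
  from taylor_coeff_nonzero[OF this v(1) l(2)] show ?thesis using l(1) unfolding coeff_section_def by blast
qed

lemma coef_0: "l < N \<Longrightarrow> i \<in> I \<Longrightarrow> x \<in> U i \<Longrightarrow> coef l 0 i x = 0"
  using f_bundle_point[of i x 0] \<gamma>_z0 by (simp add: coeff_section_def taylor_coeff_def)

text \<open>\<open>LEAST\<close> carries information only once some positive power has a section; a
  nonzero coefficient of a generator is one.\<close>

lemma initial_order_section: "0 < k0" "has_nonzero_section X (dual_power k0)"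
proof -
  obtain i x where ix: "i \<in> I" "x \<in> U i" using nonempty by blast
  then obtain l k where l: "l < N" "coef l k i x \<noteq> 0" using coef_nonzero by blast
  then have "k \<noteq> 0" using coef_0 ix by metis
  moreover have "has_nonzero_section X (dual_power k)"
    unfolding has_nonzero_section_def using coef_section[OF l(1)] l(2) ix by auto
  ultimately have "\<exists>k. 0 < k \<and> has_nonzero_section X (dual_power k)" by blast
  then have "0 < k0 \<and> has_nonzero_section X (dual_power k0)" unfolding initial_order_def by (rule LeastI_ex)
  then show "0 < k0" "has_nonzero_section X (dual_power k0)" by auto
qed

lemma coef_below_k0: "l < N \<Longrightarrow> j < k0 \<Longrightarrow> i \<in> I \<Longrightarrow> x \<in> U i \<Longrightarrow> coef l j i x = 0"
  by (rule coeff_below_k0[OF W z0W \<gamma>_hol \<gamma>_z0])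

text \<open>Membership of the descended section in the maximal ideal near \<open>z0\<close>,
  recorded as an identity on the fibres. The coefficients \<open>c\<close> live on \<open>Z\<close>,
  so at v = 0 they take the same values \<open>c l z0\<close> over every point of
  \<open>X\<close>.\<close>

definition ideal_expansion :: "nat \<Rightarrow> ('i \<Rightarrow> 'a \<Rightarrow> complex) \<Rightarrow> 'c set \<Rightarrow> (nat \<Rightarrow> 'c \<Rightarrow> complex) \<Rightarrow> bool" where
  "ideal_expansion k s V c \<longleftrightarrow> openin (topo Z) V \<and> z0 \<in> V \<and> V \<subseteq> W \<and> (\<forall>l<N. c l \<in> hol Z V) \<and>
     (\<forall>i \<in> I. \<forall>x \<in> U i. \<forall>v. f (bp i x v) \<in> V \<longrightarrow>
        s i x * v ^ k = (\<Sum>l<N. c l (f (bp i x v)) * \<gamma> l (f (bp i x v))))"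

lemma section_expansion:
  assumes "global_section X (dual_power k) s" "0 < k"
  shows "\<exists>V c. ideal_expansion k s V c"
proof -
  obtain \<sigma> where \<sigma>: "\<sigma> \<in> hol Z (topspace (topo Z))" "\<sigma> z0 = 0"
    "\<forall>i \<in> I. \<forall>x \<in> U i. \<forall>v. \<sigma> (f (bp i x v)) = s i x * v ^ k" using section_descend[OF assms] by blast
  from generate[OF openin_topspace z0_in \<sigma>(1,2)] obtain V c where "openin (topo Z) V" "z0 \<in> V" "V \<subseteq> W"
    "\<forall>k<N. c k \<in> hol Z V" "\<forall>z \<in> V. \<sigma> z = (\<Sum>k<N. c k z * \<gamma> k z)" by auto
  then have "ideal_expansion k s V c" unfolding ideal_expansion_def using \<sigma>(3) by metis
  then show ?thesis by blast
qed

text \<open>If all generators vanish to order at least \<open>m\<close> on the fibre, the right side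
  is v^m times a continuous factor, and the coefficient of order \<open>k\<close> of both sides can
  be compared.\<close>

lemma expansion_leading:
  assumes e: "ideal_expansion k s V c" and ix: "i \<in> I" "x \<in> U i"
    and m: "\<And>l j. l < N \<Longrightarrow> j < m \<Longrightarrow> coef l j i x = 0"
  shows "k < m \<Longrightarrow> s i x = 0" "k = m \<Longrightarrow> s i x = (\<Sum>l<N. c l z0 * coef l m i x)"
proof -
  have V: "openin (topo Z) V" "z0 \<in> V" "V \<subseteq> W" and c: "\<And>l. l < N \<Longrightarrow> c l \<in> hol Z V"
    and eq: "\<And>v. f (bp i x v) \<in> V \<Longrightarrow> s i x * v ^ k = (\<Sum>l<N. c l (f (bp i x v)) * \<gamma> l (f (bp i x v)))"
    using e ix unfolding ideal_expansion_def by auto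
  let ?u = "\<lambda>l v. \<gamma> l (f (bp i x v))"
  let ?w = "\<lambda>v. \<Sum>l<N. c l (f (bp i x v)) * (dq ^^ m) (?u l) v"
  have rem: "?u l v = v ^ m * (dq ^^ m) (?u l) v" if "l < N" for l v
    using m[OF that] by (intro taylor_remainder) (simp add: coeff_section_def)
  have S: "open {v. bp i x v \<in> over V}" "0 \<in> {v. bp i x v \<in> over V}"
    using pullback_fibre(2,3)[OF V(1,2) hol_const[OF analytic_Z V(1)] ix] by auto
  have ev: "\<forall>\<^sub>F v in nhds 0. s i x * v ^ k = v ^ m * ?w v"
  proof (rule eventually_mono[OF eventually_nhds_in_open[OF S]])
    fix v assume "v \<in> {v. bp i x v \<in> over V}"
    then have "s i x * v ^ k = (\<Sum>l<N. c l (f (bp i x v)) * \<gamma> l (f (bp i x v)))" using eq by simp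
    also have "\<dots> = (\<Sum>l<N. v ^ m * (c l (f (bp i x v)) * (dq ^^ m) (?u l) v))"
    proof (rule sum.cong[OF refl])
      fix l assume "l \<in> {..<N}" then have l: "l < N" by simp
      show "c l (f (bp i x v)) * ?u l v = v ^ m * (c l (f (bp i x v)) * (dq ^^ m) (?u l) v)"
        by (subst rem[OF l, of v]) (rule mult.left_commute)
    qed
    finally show "s i x * v ^ k = v ^ m * ?w v" by (simp add: sum_distrib_left)
  qed
  have cont: "isCont ?w 0"
  proof (intro continuous_sum continuous_mult)
    fix l assume "l \<in> {..<N}" then have l: "l < N" by simp
    have "continuous_on {v. bp i x v \<in> over V} (\<lambda>v. c l (f (bp i x v)))"
      by (rule holomorphic_on_imp_continuous_on[OF pullback_fibre(1)[OF V(1,2) c[OF l] ix]])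
    then show "isCont (\<lambda>v. c l (f (bp i x v))) 0" using S by (simp add: continuous_on_eq_continuous_at)
    show "isCont ((dq ^^ m) (?u l)) 0" by (rule dq_funpow_isCont[OF \<gamma>_fibre[OF l ix]])
  qed
  have tc: "taylor_coeff k (\<lambda>v. s i x * v ^ k) = s i x"
    by (rule taylor_coeff_factor(1)[of _ _ "\<lambda>_. s i x"]) (simp_all add: mult.commute)
  show "s i x = 0" if "k < m" using taylor_coeff_factor(2)[OF ev cont that] tc by simp
  assume km: "k = m"
  have "s i x = ?w 0" using taylor_coeff_factor(1)[OF ev cont] tc km by simp
  moreover have "f (bp i x 0) = z0" using f_bundle_point[OF ix] by simp
  ultimately show "s i x = (\<Sum>l<N. c l z0 * coef l m i x)"
    by (simp add: coeff_section_def taylor_coeff_def)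
qed

end

section \<open>Holomorphic maps into subspaces and products\<close>

lemma hol_sub_fspace_restrict:
  assumes "openin (topo X) V" "h \<in> hol X V"
  shows "h \<in> hol (sub_fspace X A) (V \<inter> A)"
  using assms by (intro hol_sub_fspaceI) blast

lemma topspace_sub_fspace: "topspace (topo (sub_fspace X A)) = topspace (topo X) \<inter> A"
  by simp

lemma holomorphic_map_inclusion: "holomorphic_map (sub_fspace X A) X (\<lambda>x. x)"
proof (rule holomorphic_mapI)
  fix V assume V: "openin (topo X) V"
  have eq: "{x \<in> topspace (topo (sub_fspace X A)). x \<in> V} = V \<inter> A"
    using openin_subset[OF V] by auto
  show "openin (topo (sub_fspace X A)) {x \<in> topspace (topo (sub_fspace X A)). x \<in> V}"
    unfolding eq using V by (auto simp: openin_subtopology)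
  fix h assume "h \<in> hol X V"
  then show "h \<in> hol (sub_fspace X A) {x \<in> topspace (topo (sub_fspace X A)). x \<in> V}"
    unfolding eq by (rule hol_sub_fspace_restrict[OF V])
qed auto

lemma holomorphic_map_into_sub:
  assumes Y: "analytic_fspace Y" and X: "analytic_fspace X" and F: "holomorphic_map Y X F"
    and im: "\<And>y. y \<in> topspace (topo Y) \<Longrightarrow> F y \<in> A"
  shows "holomorphic_map Y (sub_fspace X A) F"
proof (rule holomorphic_mapI)
  show "F \<in> topspace (topo Y) \<rightarrow> topspace (topo (sub_fspace X A))"
    using holomorphic_map_in[OF F] im by auto
next
  fix V assume "openin (topo (sub_fspace X A)) V"
  then obtain T where T: "openin (topo X) T" "V = T \<inter> A" by (auto simp: openin_subtopology)
  then have "{y \<in> topspace (topo Y). F y \<in> V} = {y \<in> topspace (topo Y). F y \<in> T}" using im by auto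
  then show "openin (topo Y) {y \<in> topspace (topo Y). F y \<in> V}" using holomorphic_map_openin[OF F T(1)] by simp
  fix h assume h: "h \<in> hol (sub_fspace X A) V"
  show "(\<lambda>y. h (F y)) \<in> hol Y {y \<in> topspace (topo Y). F y \<in> V}"
  proof (rule function_sheaf_localI[OF analytic_sheaf[OF Y]])
    fix y assume y: "y \<in> {y \<in> topspace (topo Y). F y \<in> V}"
    then have "F y \<in> V" by simp
    from hol_sub_fspaceD[OF h this] obtain O' k where
      O': "openin (topo X) O'" "F y \<in> O'" "O' \<inter> A \<subseteq> V" "k \<in> hol X O'" "\<forall>x \<in> O' \<inter> A. h x = k x" by blast
    show "\<exists>S k. openin (topo Y) S \<and> y \<in> S \<and> S \<subseteq> {y \<in> topspace (topo Y). F y \<in> V} \<and> k \<in> hol Y S \<and> (\<forall>y\<in>S. h (F y) = k y)"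
    proof (intro exI conjI)
      show "openin (topo Y) {y \<in> topspace (topo Y). F y \<in> O'}" by (rule holomorphic_map_openin[OF F O'(1)])
      show "(\<lambda>y. k (F y)) \<in> hol Y {y \<in> topspace (topo Y). F y \<in> O'}" by (rule holomorphic_map_hol[OF F O'(1,4)])
    qed (use y O' im in auto)
  qed
qed

lemma holomorphic_map_snd:
  assumes X: "analytic_fspace X" and Y: "analytic_fspace Y"
  shows "holomorphic_map (prod_fspace X Y) Y snd"
proof (rule holomorphic_mapI)
  fix V assume V: "openin (topo Y) V"
  have eq: "{w \<in> topspace (topo (prod_fspace X Y)). snd w \<in> V} = topspace (topo X) \<times> V"
    using openin_subset[OF V] by auto
  show "openin (topo (prod_fspace X Y)) {w \<in> topspace (topo (prod_fspace X Y)). snd w \<in> V}"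
    unfolding eq using V by (simp add: openin_prod_Times_iff)
  fix h assume "h \<in> hol Y V"
  then show "(\<lambda>w. h (snd w)) \<in> hol (prod_fspace X Y) {w \<in> topspace (topo (prod_fspace X Y)). snd w \<in> V}"
    unfolding eq by (rule hol_prod_snd[OF X Y openin_topspace V])
qed auto

lemma holomorphic_map_pair:
  assumes S: "analytic_fspace S" and F: "holomorphic_map S X F" and G: "holomorphic_map S Y G"
  shows "holomorphic_map S (prod_fspace X Y) (\<lambda>s. (F s, G s))"
proof (rule holomorphic_mapI)
  show "(\<lambda>s. (F s, G s)) \<in> topspace (topo S) \<rightarrow> topspace (topo (prod_fspace X Y))"
    using holomorphic_map_in[OF F] holomorphic_map_in[OF G] by auto
next
  fix V assume V: "openin (topo (prod_fspace X Y)) V"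
  have "continuous_map (topo S) (prod_topology (topo X) (topo Y)) (\<lambda>s. (F s, G s))"
    using F G by (simp add: holomorphic_map_def continuous_map_paired)
  from openin_continuous_map_preimage[OF this, of V] V
  show op: "openin (topo S) {s \<in> topspace (topo S). (F s, G s) \<in> V}" by simp
  fix h assume h: "h \<in> hol (prod_fspace X Y) V"
  show "(\<lambda>s. h (F s, G s)) \<in> hol S {s \<in> topspace (topo S). (F s, G s) \<in> V}"
  proof (rule function_sheaf_localI[OF analytic_sheaf[OF S]])
    fix s assume s: "s \<in> {s \<in> topspace (topo S). (F s, G s) \<in> V}"
    then have p: "(F s, G s) \<in> V" by simp
    from hol_prod_fspaceD[OF h p] obtain A B n c D H where
      1: "openin (topo X) A" "openin (topo Y) B" "(F s, G s) \<in> A \<times> B" "A \<times> B \<subseteq> V" "\<forall>i<n. c i \<in> prod_generators X Y A B"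
      "openin (topo (Cspace n)) D" "H \<in> hol (Cspace n) D"
      "\<forall>w \<in> A \<times> B. vec n (\<lambda>i. c i w) \<in> D \<and> h w = H (vec n (\<lambda>i. c i w))" by blast
    define O' where "O' = {s \<in> topspace (topo S). F s \<in> A} \<inter> {s \<in> topspace (topo S). G s \<in> B}"
    have opA: "openin (topo S) {s \<in> topspace (topo S). F s \<in> A}" by (rule holomorphic_map_openin[OF F 1(1)])
    have opB: "openin (topo S) {s \<in> topspace (topo S). G s \<in> B}" by (rule holomorphic_map_openin[OF G 1(2)])
    have O': "openin (topo S) O'" unfolding O'_def using opA opB by blast
    have "(\<lambda>s. c i (F s, G s)) \<in> hol S O'" if i: "i < n" for i
      using 1(5)[rule_format, OF i] unfolding prod_generators_def
    proof (elim UnE CollectE exE conjE)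
      fix a assume a: "c i = a \<circ> fst" "a \<in> hol X A"
      have "(\<lambda>s. a (F s)) \<in> hol S O'"
        by (rule function_sheaf_mono[OF analytic_sheaf[OF S] opA O' _ holomorphic_map_hol[OF F 1(1) a(2)]]) (simp add: O'_def)
      then show ?thesis by (simp add: a(1))
    next
      fix b assume b: "c i = b \<circ> snd" "b \<in> hol Y B"
      have "(\<lambda>s. b (G s)) \<in> hol S O'"
        by (rule function_sheaf_mono[OF analytic_sheaf[OF S] opB O' _ holomorphic_map_hol[OF G 1(2) b(2)]]) (simp add: O'_def)
      then show ?thesis by (simp add: b(1))
    qed
    then have "(\<lambda>s. H (vec n (\<lambda>i. c i (F s, G s)))) \<in> hol S O'"
      by (rule hol_compose[OF S O' _ 1(6,7)]) (use 1(8) in \<open>auto simp: O'_def\<close>)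
    then show "\<exists>T k. openin (topo S) T \<and> s \<in> T \<and> T \<subseteq> {s \<in> topspace (topo S). (F s, G s) \<in> V} \<and> k \<in> hol S T \<and> (\<forall>s\<in>T. h (F s, G s) = k s)"
      using O' 1 s by (intro exI[of _ O'] exI[of _ "\<lambda>s. H (vec n (\<lambda>i. c i (F s, G s)))"]) (auto simp: O'_def)
  qed
qed

lemma holomorphic_map_const:
  assumes S: "analytic_fspace S" and z: "z \<in> topspace (topo X)"
  shows "holomorphic_map S X (\<lambda>s. z)"
proof (rule holomorphic_mapI)
  fix V :: "'b set"
  have op: "openin (topo S) {s \<in> topspace (topo S). z \<in> V}" by (cases "z \<in> V") auto
  then show "openin (topo S) {s \<in> topspace (topo S). z \<in> V}" .
  fix h :: "'b \<Rightarrow> complex"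
  show "(\<lambda>s. h z) \<in> hol S {s \<in> topspace (topo S). z \<in> V}" by (rule hol_const[OF S op])
qed (use z in auto)

lemma holomorphic_map_restrict:
  assumes "analytic_fspace Y" "holomorphic_map Y X F"
  shows "holomorphic_map (sub_fspace Y S) X F"
  using holomorphic_map_compose[OF analytic_sheaf[OF analytic_sub_fspace[OF assms(1)]] holomorphic_map_inclusion assms(2)] .

context line_bundle_over
begin

text \<open>The variant of \<open>fibre_holomorphic\<close> for open sets that need not contain the
  zero section.\<close>

lemma fibre_hol:
  assumes S: "openin (topo E) S" and h: "h \<in> hol E S" and ix: "i \<in> I" "x \<in> U i"
  shows "(\<lambda>v. h (bp i x v)) holomorphic_on {v. bp i x v \<in> S}" "open {v. bp i x v \<in> S}"
proof -
  have eq: "{v. (x, v) \<in> preim i S} = {v. bp i x v \<in> S}" using ix by auto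
  have "(\<lambda>(x, v). h (bp i x v)) \<in> hol (P i) (preim i S)" using h ix(1) unfolding hol_total by blast
  from hol_prod_slice_snd[OF analytic_sub_fspace[OF X] analytic_Cline this, of x]
  show "(\<lambda>v. h (bp i x v)) holomorphic_on {v. bp i x v \<in> S}" unfolding eq hol_Cline by simp
  have "openin (topo (P i)) (preim i S)" using S ix(1) unfolding openin_total by blast
  from openin_prod_slice_snd[OF this[unfolded topo_prod_fspace], of x]
  show "open {v. bp i x v \<in> S}" unfolding eq by simp
qed

lemma fibre_isCont:
  assumes "openin (topo E) S" "h \<in> hol E S" "i \<in> I" "x \<in> U i" "bp i x v0 \<in> S"
  shows "isCont (\<lambda>v. h (bp i x v)) v0"
  using holomorphic_on_imp_continuous_on[OF fibre_hol(1)[OF assms(1-4)]] fibre_hol(2)[OF assms(1-4)] assms(5)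
  by (simp add: continuous_on_eq_continuous_at)

lemma openin_zero_slice:
  assumes S: "openin (topo E) S" and i: "i \<in> I"
  shows "openin (topo X) {x \<in> U i. bp i x 0 \<in> S}"
proof -
  have "openin (topo (P i)) (preim i S)" using S i unfolding openin_total by blast
  from openin_prod_slice_fst[OF this[unfolded topo_prod_fspace], of 0]
  have "openin (topo (sub_fspace X (U i))) {x \<in> U i. bp i x 0 \<in> S}" by simp
  then show ?thesis unfolding openin_sub_triv[OF i] by blast
qed

definition zero_map :: "'a \<Rightarrow> ('i \<times> 'a \<times> complex) set" where
  "zero_map x = bp (SOME i. i \<in> I \<and> x \<in> U i) x 0"

lemma zero_map:
  assumes "i \<in> I" "x \<in> U i"
  shows "zero_map x = bp i x 0"
proof -
  have "(SOME i. i \<in> I \<and> x \<in> U i) \<in> I \<and> x \<in> U (SOME i. i \<in> I \<and> x \<in> U i)"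
    by (rule someI[where P = "\<lambda>i. i \<in> I \<and> x \<in> U i"]) (use assms in blast)
  then show ?thesis unfolding zero_map_def using bundle_point_eq_iff assms by simp
qed

lemma holomorphic_map_zero_map: "holomorphic_map X E zero_map"
proof (rule holomorphic_mapI)
  show "zero_map \<in> topspace (topo X) \<rightarrow> topspace (topo E)"
  proof
    fix x assume "x \<in> topspace (topo X)"
    then obtain i where i: "i \<in> I" "x \<in> U i" using triv_cover by blast
    then show "zero_map x \<in> topspace (topo E)" using zero_map[OF i] bundle_point_in[OF i] by simp
  qed
next
  fix S assume S: "openin (topo E) S"
  have loc: "\<exists>i \<in> I. x \<in> U i \<and> {x \<in> U i. bp i x 0 \<in> S} \<subseteq> {x \<in> topspace (topo X). zero_map x \<in> S} \<and> bp i x 0 \<in> S"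
    if x: "x \<in> {x \<in> topspace (topo X). zero_map x \<in> S}" for x
  proof -
    obtain i where i: "i \<in> I" "x \<in> U i" using triv_cover x by blast
    have "bp i x 0 \<in> S" using x zero_map[OF i] by simp
    moreover have "{x \<in> U i. bp i x 0 \<in> S} \<subseteq> {x \<in> topspace (topo X). zero_map x \<in> S}"
      using zero_map[OF i(1)] openin_subset[OF openin_triv[OF i(1)]] by auto
    ultimately show ?thesis using i by blast
  qed
  show "openin (topo X) {x \<in> topspace (topo X). zero_map x \<in> S}"
  proof (subst openin_subopen, intro ballI)
    fix x assume x: "x \<in> {x \<in> topspace (topo X). zero_map x \<in> S}"
    from loc[OF x] obtain i where i: "i \<in> I" "x \<in> U i" "{x \<in> U i. bp i x 0 \<in> S} \<subseteq> {x \<in> topspace (topo X). zero_map x \<in> S}" "bp i x 0 \<in> S"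
      by blast
    then show "\<exists>T. openin (topo X) T \<and> x \<in> T \<and> T \<subseteq> {x \<in> topspace (topo X). zero_map x \<in> S}"
      using openin_zero_slice[OF S i(1)] by (intro exI[of _ "{x \<in> U i. bp i x 0 \<in> S}"]) blast
  qed
  fix h assume h: "h \<in> hol E S"
  show "(\<lambda>x. h (zero_map x)) \<in> hol X {x \<in> topspace (topo X). zero_map x \<in> S}"
  proof (rule function_sheaf_localI[OF analytic_sheaf[OF X]])
    fix x assume x: "x \<in> {x \<in> topspace (topo X). zero_map x \<in> S}"
    from loc[OF x] obtain i where i: "i \<in> I" "x \<in> U i" "{x \<in> U i. bp i x 0 \<in> S} \<subseteq> {x \<in> topspace (topo X). zero_map x \<in> S}" "bp i x 0 \<in> S"
      by blast
    have "(\<lambda>(x, v). h (bp i x v)) \<in> hol (P i) (preim i S)" using h i(1) unfolding hol_total by blast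
    from hol_prod_slice_fst[OF analytic_sub_fspace[OF X] analytic_Cline this, of 0]
    have "(\<lambda>x. h (bp i x 0)) \<in> hol X {x \<in> U i. bp i x 0 \<in> S}"
      using hol_sub_triv[OF i(1) openin_zero_slice[OF S i(1)]] by auto
    then show "\<exists>T k. openin (topo X) T \<and> x \<in> T \<and> T \<subseteq> {x \<in> topspace (topo X). zero_map x \<in> S} \<and> k \<in> hol X T \<and> (\<forall>y\<in>T. h (zero_map y) = k y)"
      using openin_zero_slice[OF S i(1)] i zero_map[OF i(1)]
      by (intro exI[of _ "{x \<in> U i. bp i x 0 \<in> S}"] exI[of _ "\<lambda>x. h (bp i x 0)"]) simp
  qed
qed

definition fibre_coord :: "'i \<Rightarrow> ('i \<times> 'a \<times> complex) set \<Rightarrow> complex" where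
  "fibre_coord i p = (case bundle_rep p of (j, x, v) \<Rightarrow> g i j x * v)"

lemma fibre_coord:
  assumes "i \<in> I" "x \<in> U i" "j \<in> I" "x \<in> U j"
  shows "fibre_coord i (bp j x v) = g i j x * v"
proof -
  obtain k where k: "k \<in> I" "x \<in> U k" "bundle_rep (bp j x v) = (k, x, g k j x * v)" using bundle_rep[OF assms(3,4)] .
  then show ?thesis using trans_cocycle[of i k j x] assms by (simp add: fibre_coord_def flip: mult.assoc)
qed

lemma fibre_coord_self [simp]: "i \<in> I \<Longrightarrow> x \<in> U i \<Longrightarrow> fibre_coord i (bp i x v) = v"
  using fibre_coord[of i x i v] trans_self[of i x] by simp

abbreviation "bundle_over i \<equiv> {p \<in> topspace (topo E). bundle_proj p \<in> U i}"

lemma openin_bundle_over: "i \<in> I \<Longrightarrow> openin (topo E) (bundle_over i)"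
  by (rule holomorphic_map_openin[OF holomorphic_map_bundle_proj openin_triv])

lemma fibre_coord_hol:
  assumes i: "i \<in> I"
  shows "fibre_coord i \<in> hol E (bundle_over i)"
  unfolding hol_total
proof
  fix j assume j: "j \<in> I"
  let ?A = "U i \<inter> U j"
  have A: "openin (topo X) ?A" using openin_triv i j by blast
  have op: "openin (topo (P j)) (?A \<times> UNIV)" using openin_P_Times[OF j A] by simp
  have tr: "preim j (bundle_over i) = ?A \<times> UNIV" using j bundle_point_in by auto
  have "(\<lambda>t. (\<lambda>(x, v). g i j x) t * (\<lambda>(x, v). v) t) \<in> hol (P j) (?A \<times> UNIV)"
    by (intro hol_mult[OF analytic_P op] hol_P_fst[OF j A] hol_P_snd[OF j A] trans_hol i j) auto
  then show "(\<lambda>(x, v). fibre_coord i (bp j x v)) \<in> hol (P j) (preim j (bundle_over i))"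
    unfolding tr by (rule function_sheaf_cong[OF analytic_sheaf[OF analytic_P] op]) (use fibre_coord[OF i _ j] in auto)
qed

end

section \<open>The blow-up of \<open>W\<close> as a closed subset of a product\<close>

context blow_down_generators
begin

abbreviation "ZW \<equiv> sub_fspace Z W"
abbreviation "ZP \<equiv> prod_fspace ZW (Pspace N)"
abbreviation "\<Gamma> \<equiv> {(z, proj_class (vec N (\<lambda>k. \<gamma> k z))) | z. z \<in> topspace (topo ZW) \<and> z \<noteq> z0}"
abbreviation "BS \<equiv> topo ZP closure_of \<Gamma>"
abbreviation "EW \<equiv> sub_fspace E (over W)"

lemma blow_up_eq: "blow_up ZW z0 N \<gamma> = sub_fspace ZP BS"
  by (simp add: blow_up_def)

lemma analytic_ZW: "analytic_fspace ZW" and analytic_ZP: "analytic_fspace ZP" and analytic_EW: "analytic_fspace EW"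
  by (intro analytic_prod_fspace analytic_sub_fspace analytic_Pspace analytic_Z analytic_total)+

lemma topspace_ZW: "topspace (topo ZW) = W"
  using openin_subset[OF W] by auto

lemma topspace_EW: "topspace (topo EW) = over W"
  by auto

lemma topspace_ZP: "topspace (topo ZP) = W \<times> topspace (topo (Pspace N))"
  unfolding topo_prod_fspace topspace_prod_topology topspace_ZW ..

lemma hol_ZW: "openin (topo Z) S \<Longrightarrow> S \<subseteq> W \<Longrightarrow> hol ZW S = hol Z S"
  by (rule hol_sub_fspace_open[OF analytic_sheaf[OF analytic_Z] W])

lemma hol_EW: "openin (topo E) S \<Longrightarrow> S \<subseteq> over W \<Longrightarrow> hol EW S = hol E S"
  by (rule hol_sub_fspace_open[OF analytic_sheaf[OF analytic_total] openin_over[OF W]])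

lemma openin_EW: "openin (topo EW) S \<longleftrightarrow> openin (topo E) S \<and> S \<subseteq> over W"
  by (rule openin_sub_fspace_open[OF openin_over[OF W]])

lemma \<gamma>_vec: "z \<in> W \<Longrightarrow> z \<noteq> z0 \<Longrightarrow> vec N (\<lambda>k. \<gamma> k z) \<in> Cn N - {\<lambda>_. 0}"
  using common_zero vec_nonzero[of _ N "\<lambda>k. \<gamma> k z"] by blast

text \<open>The relation holds on the graph, where both sides are given by the same homogeneous
  coordinates, and it is a closed condition over the chart, so it passes to the closure. It says
  that \<open>\<gamma> l\<close> divides all generators there.\<close>

lemma blow_up_relation:
  assumes B: "(z, \<zeta>) \<in> BS" and l: "l < N" and i: "i < N" and \<zeta>: "\<zeta> \<in> proj_chart N l"
  shows "\<gamma> i z = proj_ratio l i \<zeta> * \<gamma> l z"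
proof (rule ccontr)
  assume ne: "\<gamma> i z \<noteq> proj_ratio l i \<zeta> * \<gamma> l z"
  have W': "openin (topo ZW) W" using openin_topspace[of "topo ZW"] unfolding topspace_ZW .
  have op: "openin (topo ZP) (W \<times> proj_chart N l)"
    unfolding topo_prod_fspace openin_prod_Times_iff using W' openin_proj_chart by blast
  have \<gamma>': "\<gamma> k \<in> hol ZW W" if "k < N" for k using \<gamma>_hol[OF that] hol_ZW[OF W] by blast
  have "(\<lambda>w. \<gamma> i (fst w) - proj_ratio l i (snd w) * \<gamma> l (fst w)) \<in> hol ZP (W \<times> proj_chart N l)"
    by (intro hol_diff[OF analytic_ZP op] hol_mult[OF analytic_ZP op] hol_prod_fst[OF analytic_ZW analytic_Pspace W' openin_proj_chart]
        hol_prod_snd[OF analytic_ZW analytic_Pspace W' openin_proj_chart] \<gamma>' proj_ratio_hol l i)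
  from analytic_openin[OF analytic_ZP op this, of "- {0}"]
  have "openin (topo ZP) {w \<in> W \<times> proj_chart N l. \<gamma> i (fst w) - proj_ratio l i (snd w) * \<gamma> l (fst w) \<in> - {0}}" (is "openin _ ?O") by blast
  moreover have "z \<in> W" using B closure_of_subset_topspace[of "topo ZP" \<Gamma>] unfolding topspace_ZP by blast
  then have "(z, \<zeta>) \<in> ?O" using \<zeta> ne by simp
  ultimately have "\<exists>w. w \<in> \<Gamma> \<and> w \<in> ?O"
    using B[unfolded in_closure_of, THEN conjunct2, rule_format, of ?O] by blast
  then obtain w where w: "w \<in> \<Gamma>" "w \<in> W \<times> proj_chart N l" "\<gamma> i (fst w) - proj_ratio l i (snd w) * \<gamma> l (fst w) \<noteq> 0"
    by blast
  then obtain z' where z': "w = (z', proj_class (vec N (\<lambda>k. \<gamma> k z')))" by blast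
  then have "vec N (\<lambda>k. \<gamma> k z') l \<noteq> 0" using w(2) proj_class_in_chart[OF vec_in_Cn] by simp
  then show False using w(3) z' l i by (simp add: proj_ratio_class vec_nth)
qed

lemma fibre_remainder:
  assumes "\<And>l j. l < N \<Longrightarrow> j < m \<Longrightarrow> coef l j i x = 0" "l < N"
  shows "\<gamma> l (f (bp i x v)) = v ^ m * (dq ^^ m) (\<lambda>v. \<gamma> l (f (bp i x v))) v"
  by (rule taylor_remainder) (use assms in \<open>simp add: coeff_section_def\<close>)

lemma coef_k0_change:
  assumes "l < N" "i \<in> I" "x \<in> U i" "j \<in> I" "x \<in> U j" "coef l k0 j x \<noteq> 0"
  shows "coef l k0 i x \<noteq> 0"
proof -
  have "coef l k0 i x = g j i x ^ k0 * coef l k0 j x"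
    using coef_section[OF assms(1), of k0] assms unfolding global_section_dual_power by blast
  then show ?thesis using assms trans_nonzero by simp
qed

end

section \<open>Sections obtained from the quadratic transform\<close>

locale quadratic_transform = blow_down_generators X L Z z0 f W N \<gamma>
  for X :: "'a fspace" and L :: "('i, 'a) line_bundle" and Z :: "'c fspace" and z0 f W N \<gamma> +
  fixes F :: "('i \<times> 'a \<times> complex) set \<Rightarrow> 'c \<times> (nat \<Rightarrow> complex) set"
  assumes F_biholomorphic: "biholomorphic_map (sub_fspace (total_space X L) {p \<in> topspace (topo (total_space X L)). f p \<in> W})
        (blow_up (sub_fspace Z W) z0 N \<gamma>) F"
    and F_fst: "\<And>p. p \<in> topspace (topo (total_space X L)) \<Longrightarrow> f p \<in> W \<Longrightarrow> fst (F p) = f p"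
    and connected: "connected_space (topo X)"
begin

lemma F_hol: "holomorphic_map EW (sub_fspace ZP BS) F"
  using F_biholomorphic unfolding biholomorphic_map_def blow_up_eq by blast

lemma F_in: "p \<in> over W \<Longrightarrow> F p \<in> BS"
  using holomorphic_map_in[OF F_hol, of p] unfolding topspace_EW by simp

lemma F_inverse: "\<exists>\<psi>. holomorphic_map (sub_fspace ZP BS) EW \<psi> \<and> (\<forall>p \<in> over W. \<psi> (F p) = p) \<and> (\<forall>y \<in> BS. F (\<psi> y) = y)"
proof -
  have ts: "topspace (topo (sub_fspace ZP BS)) = BS"
    unfolding topspace_sub_fspace[of ZP BS] using closure_of_subset_topspace[of "topo ZP" \<Gamma>] by (rule Int_absorb1)
  show ?thesis using F_biholomorphic unfolding biholomorphic_map_def blow_up_eq topspace_EW ts by (rule conjunct2)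
qed

abbreviation "\<Phi> p \<equiv> snd (F p)"

lemma F_eq: "p \<in> over W \<Longrightarrow> F p = (f p, \<Phi> p)"
  using F_fst[of p] by (simp add: prod_eq_iff)

lemma \<Phi>_hol: "holomorphic_map EW (Pspace N) (\<lambda>p. \<Phi> p)"
proof -
  have "holomorphic_map EW ZP F"
    using holomorphic_map_compose[OF analytic_sheaf[OF analytic_EW] F_hol holomorphic_map_inclusion] .
  from holomorphic_map_compose[OF analytic_sheaf[OF analytic_EW] this holomorphic_map_snd[OF analytic_ZW analytic_Pspace]]
  show ?thesis .
qed

abbreviation "chart_dom l \<equiv> {p \<in> over W. \<Phi> p \<in> proj_chart N l}"
abbreviation "ratio l i p \<equiv> proj_ratio l i (\<Phi> p)"

lemma openin_chart_dom: "openin (topo E) (chart_dom l)"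
  using holomorphic_map_openin[OF \<Phi>_hol openin_proj_chart, of l] unfolding topspace_EW openin_EW by blast

lemma ratio_hol: "l < N \<Longrightarrow> i < N \<Longrightarrow> ratio l i \<in> hol E (chart_dom l)"
  using holomorphic_map_hol[OF \<Phi>_hol openin_proj_chart proj_ratio_hol, of i l] hol_EW[OF openin_chart_dom, of l]
  unfolding topspace_EW by auto

lemma ratio_eq:
  assumes "p \<in> chart_dom l" "l < N" "i < N"
  shows "\<gamma> i (f p) = ratio l i p * \<gamma> l (f p)"
  using blow_up_relation[of "f p" "\<Phi> p" l i] F_in[of p] F_eq[of p] assms by simp

lemma in_chart_dom: "p \<in> over W \<Longrightarrow> \<exists>l<N. p \<in> chart_dom l"
proof -
  assume p: "p \<in> over W"
  then have "\<Phi> p \<in> topspace (topo (Pspace N))" using holomorphic_map_in[OF \<Phi>_hol, of p] unfolding topspace_EW by blast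
  then show ?thesis
  proof (rule Pspace_point)
    fix z l assume "l < N" "\<Phi> p \<in> proj_chart N l"
    then show ?thesis using p by (intro exI[of _ l]) simp
  qed
qed

lemma zero_over: "i \<in> I \<Longrightarrow> x \<in> U i \<Longrightarrow> bp i x 0 \<in> over W"
  using bundle_point_in f_bundle_point[of i x 0] z0W by simp

text \<open>When all generators vanish to order at least \<open>m\<close> on the fibre, the
  divisibility relation may be divided by v^m, and evaluating at v = 0 compares the
  coefficients.\<close>

lemma coef_ratio:
  assumes ix: "i \<in> I" "x \<in> U i" and l: "l < N" "bp i x 0 \<in> chart_dom l" and l': "l' < N"
    and low: "\<And>l j. l < N \<Longrightarrow> j < m \<Longrightarrow> coef l j i x = 0"
  shows "coef l' m i x = ratio l l' (bp i x 0) * coef l m i x"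
proof -
  let ?w = "\<lambda>v. ratio l l' (bp i x v) * (dq ^^ m) (\<lambda>v. \<gamma> l (f (bp i x v))) v"
  have "\<forall>\<^sub>F v in nhds 0. \<gamma> l' (f (bp i x v)) = v ^ m * ?w v"
  proof (rule eventually_mono[OF eventually_nhds_in_open[OF fibre_hol(2)[OF openin_chart_dom ratio_hol[OF l(1) l'] ix]]])
    show "0 \<in> {v. bp i x v \<in> chart_dom l}" using l(2) by blast
    fix v assume "v \<in> {v. bp i x v \<in> chart_dom l}"
    then have "\<gamma> l' (f (bp i x v)) = ratio l l' (bp i x v) * \<gamma> l (f (bp i x v))"
      using ratio_eq[OF _ l(1) l'] by blast
    also have "\<gamma> l (f (bp i x v)) = v ^ m * (dq ^^ m) (\<lambda>v. \<gamma> l (f (bp i x v))) v"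
      by (rule fibre_remainder[OF low l(1)])
    finally show "\<gamma> l' (f (bp i x v)) = v ^ m * ?w v" by (simp add: mult.left_commute)
  qed
  moreover have "isCont ?w 0"
    using fibre_isCont[OF openin_chart_dom ratio_hol[OF l(1) l'] ix l(2)] dq_funpow_isCont[OF \<gamma>_fibre[OF l(1) ix]]
    by (rule isCont_mult)
  ultimately have "taylor_coeff m (\<lambda>v. \<gamma> l' (f (bp i x v))) = ?w 0" by (rule taylor_coeff_factor(1))
  then show ?thesis by (simp add: coeff_section_def taylor_coeff_def)
qed

text \<open>If \<open>m\<close> is the order of vanishing of the pulled-back maximal ideal along the fibre over \<open>x0\<close>, then
  \<open>v\<^sup>m\<close> times the leading coefficient of the generator \<open>\<gamma> l\<close> lies in the ideal again, hence is a
  multiple \<open>e \<gamma> l\<close>.  Comparing leading terms gives \<open>e = 1\<close> at \<open>x0\<close>, so that \<open>\<gamma> l\<close> vanishes to order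
  at least \<open>m\<close> on all nearby fibres.\<close>

lemma higher_order_open:
  assumes ix: "i \<in> I" "x0 \<in> U i" and vanish: "\<And>l. l < N \<Longrightarrow> coef l k0 i x0 = 0"
  shows "\<exists>T. openin (topo X) T \<and> x0 \<in> T \<and> T \<subseteq> U i \<and> (\<forall>x \<in> T. \<forall>l<N. coef l k0 i x = 0)"
proof -
  let ?Q = "\<lambda>m. \<exists>l<N. coef l m i x0 \<noteq> 0"
  define m where "m = (LEAST m. ?Q m)"
  have "\<exists>m. ?Q m" using coef_nonzero[OF ix] by blast
  then have "?Q m" unfolding m_def by (rule LeastI_ex)
  then obtain l' where l': "l' < N" "coef l' m i x0 \<noteq> 0" by blast
  have low: "coef l j i x0 = 0" if "l < N" "j < m" for l j
    using not_less_Least[of j ?Q] that unfolding m_def by blast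
  \<comment> \<open>Orders below \<open>k0\<close> carry no sections, and order \<open>k0\<close> is
    excluded by \<open>vanish\<close>.\<close>
  have "k0 < m"
  proof (rule ccontr)
    assume "\<not> k0 < m"
    then have "m < k0 \<or> m = k0" by linarith
    then show False using l' coef_below_k0[OF l'(1) _ ix] vanish[OF l'(1)] by blast
  qed
  then have m0: "0 < m" by simp
  obtain l where l: "l < N" "bp i x0 0 \<in> chart_dom l" using in_chart_dom[OF zero_over[OF ix]] by blast
  \<comment> \<open>All coefficients of order \<open>m\<close> at \<open>x0\<close> are multiples of
    the one belonging to the chart index \<open>l\<close>, so that one cannot vanish.\<close>
  have lm: "coef l m i x0 \<noteq> 0" using coef_ratio[OF ix l l'(1) low] l'(2) by auto
  let ?s = "coef l m"
  obtain V c where e: "ideal_expansion m ?s V c" using section_expansion[OF coef_section[OF l(1)] m0] by blast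
  then have V: "openin (topo Z) V" "z0 \<in> V" "V \<subseteq> W" and c: "\<And>l. l < N \<Longrightarrow> c l \<in> hol Z V"
    and ex: "\<And>x v. x \<in> U i \<Longrightarrow> f (bp i x v) \<in> V \<Longrightarrow> ?s i x * v ^ m = (\<Sum>l<N. c l (f (bp i x v)) * \<gamma> l (f (bp i x v)))"
    using ix(1) unfolding ideal_expansion_def by auto
  let ?S = "over V \<inter> chart_dom l"
  have S: "openin (topo E) ?S" using openin_over[OF V(1)] openin_chart_dom by blast
  \<comment> \<open>Replacing every \<open>\<gamma> k\<close> by \<open>ratio l k\<close> times
    \<open>\<gamma> l\<close> turns the expansion into a multiple of \<open>\<gamma> l\<close> with
    this factor.\<close>
  define h where "h p = (\<Sum>k<N. c k (f p) * ratio l k p)" for p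
  have ratio_S: "ratio l k \<in> hol E ?S" if "k < N" for k
    by (rule function_sheaf_mono[OF analytic_sheaf[OF analytic_total] openin_chart_dom S _ ratio_hol[OF l(1) that]]) blast
  have c_S: "(\<lambda>p. c k (f p)) \<in> hol E ?S" if "k < N" for k
    by (rule function_sheaf_mono[OF analytic_sheaf[OF analytic_total] openin_over[OF V(1)] S _ pullback_hol[OF V(1) c[OF that]]]) blast
  have h: "h \<in> hol E ?S"
    unfolding h_def[abs_def] using ratio_S c_S
    by (intro hol_sum[OF analytic_total S] hol_mult[OF analytic_total S]) auto
  have eq: "?s i x * v ^ m = h (bp i x v) * \<gamma> l (f (bp i x v))" if "x \<in> U i" "bp i x v \<in> ?S" for x v
  proof -
    have "(\<Sum>k<N. c k (f (bp i x v)) * \<gamma> k (f (bp i x v))) = (\<Sum>k<N. c k (f (bp i x v)) * (ratio l k (bp i x v) * \<gamma> l (f (bp i x v))))"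
      using ratio_eq[OF _ l(1)] that by (intro sum.cong refl) simp
    then show ?thesis using ex[of x v] that by (simp add: h_def sum_distrib_right mult.assoc)
  qed
  have p0: "bp i x0 0 \<in> ?S" using l(2) bundle_point_in[OF ix] f_bundle_point[OF ix, of 0] V(2) by simp
  \<comment> \<open>The expansion at order \<open>m\<close>, rewritten by \<open>coef_ratio\<close>,
    reads s = h s at \<open>x0\<close>; as s is nonzero there, h = 1.\<close>
  have "?s i x0 = (\<Sum>k<N. c k z0 * coef k m i x0)" by (rule expansion_leading(2)[OF e ix low refl])
  also have "\<dots> = (\<Sum>k<N. c k z0 * (ratio l k (bp i x0 0) * ?s i x0))"
  proof (rule sum.cong[OF refl])
    fix k assume "k \<in> {..<N}" then have k: "k < N" by simp
    show "c k z0 * coef k m i x0 = c k z0 * (ratio l k (bp i x0 0) * ?s i x0)"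
      by (subst coef_ratio[OF ix l k low]) auto
  qed
  also have "\<dots> = h (bp i x0 0) * ?s i x0"
    using f_bundle_point[OF ix, of 0] by (simp add: h_def sum_distrib_right mult.assoc)
  finally have h0: "h (bp i x0 0) = 1" using lm by simp
  \<comment> \<open>Where \<open>h\<close> has no zero, \<open>\<gamma> l\<close> is v^m times the
    regular factor \<open>?s i x / h\<close>, and every other generator is a multiple of it. Hence
    all have order at least \<open>m\<close>, which exceeds \<open>k0\<close>, on the neighbouring
    fibres.\<close>
  let ?Q = "{p \<in> ?S. h p \<in> - {0}}"
  have Q: "openin (topo E) ?Q" by (rule analytic_openin[OF analytic_total S h]) auto
  have hQ: "h \<in> hol E ?Q" by (rule function_sheaf_mono[OF analytic_sheaf[OF analytic_total] S Q _ h]) blast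
  have ratio_Q: "ratio l k \<in> hol E ?Q" if "k < N" for k
    by (rule function_sheaf_mono[OF analytic_sheaf[OF analytic_total] S Q _ ratio_S[OF that]]) blast
  let ?T = "{x \<in> U i. bp i x 0 \<in> ?Q}"
  have "coef k k0 i x = 0" if x: "x \<in> ?T" and k: "k < N" for x k
  proof -
    have xi: "x \<in> U i" and x0: "bp i x 0 \<in> ?Q" using x by auto
    let ?w = "\<lambda>v. ratio l k (bp i x v) * (?s i x / h (bp i x v))"
    have "\<forall>\<^sub>F v in nhds 0. \<gamma> k (f (bp i x v)) = v ^ m * ?w v"
    proof (rule eventually_mono[OF eventually_nhds_in_open[OF fibre_hol(2)[OF Q hQ ix(1) xi]]])
      show "0 \<in> {v. bp i x v \<in> ?Q}" using x0 by blast
      fix v assume v: "v \<in> {v. bp i x v \<in> ?Q}"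
      then have "bp i x v \<in> ?S" and nz: "h (bp i x v) \<noteq> 0" by auto
      from eq[OF xi this(1)] nz have "\<gamma> l (f (bp i x v)) = v ^ m * (?s i x / h (bp i x v))" by (simp add: field_simps)
      moreover have "\<gamma> k (f (bp i x v)) = ratio l k (bp i x v) * \<gamma> l (f (bp i x v))"
        using ratio_eq[OF _ l(1) k, of "bp i x v"] v by blast
      ultimately show "\<gamma> k (f (bp i x v)) = v ^ m * ?w v" by (simp only: mult.left_commute)
    qed
    moreover have "isCont ?w 0"
    proof (rule isCont_mult[OF fibre_isCont[OF Q ratio_Q[OF k] ix(1) xi x0] isCont_divide])
      show "isCont (\<lambda>v. h (bp i x v)) 0" by (rule fibre_isCont[OF Q hQ ix(1) xi x0])
      show "h (bp i x 0) \<noteq> 0" using x0 by simp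
    qed simp
    ultimately have "taylor_coeff k0 (\<lambda>v. \<gamma> k (f (bp i x v))) = 0" using \<open>k0 < m\<close> by (rule taylor_coeff_factor(2))
    then show ?thesis by (simp add: coeff_section_def)
  qed
  moreover have "openin (topo X) ?T" by (rule openin_zero_slice[OF Q ix(1)])
  moreover have "x0 \<in> ?T" using ix p0 h0 by simp
  ultimately show ?thesis by (intro exI[of _ ?T]) blast
qed

text \<open>The set of base points with a nonzero coefficient of order \<open>k0\<close> is open by
  continuity, its complement is open by \<open>higher_order_open\<close>, and it is not empty;
  connectedness of \<open>X\<close> finishes.\<close>

lemma coef_k0_nonzero:
  assumes ix: "i \<in> I" "x \<in> U i"
  shows "\<exists>l<N. coef l k0 i x \<noteq> 0"
proof -
  define A where "A = {x \<in> topspace (topo X). \<exists>i \<in> I. x \<in> U i \<and> (\<exists>l<N. coef l k0 i x \<noteq> 0)}"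
  have A_iff: "x \<in> A \<longleftrightarrow> (\<exists>l<N. coef l k0 i x \<noteq> 0)" if "i \<in> I" "x \<in> U i" for i x
    using that coef_k0_change[of _ i x] openin_subset[OF openin_triv[OF that(1)]] unfolding A_def by blast
  have openA: "openin (topo X) A"
  proof (subst openin_subopen, intro ballI)
    fix x assume "x \<in> A"
    then obtain i l where il: "i \<in> I" "x \<in> U i" "l < N" "coef l k0 i x \<noteq> 0" unfolding A_def by blast
    have "coef l k0 i \<in> hol X (U i)" using coef_section[OF il(3)] il(1) unfolding global_section_dual_power by blast
    from analytic_openin[OF X openin_triv[OF il(1)] this, of "- {0}"]
    have "openin (topo X) {y \<in> U i. coef l k0 i y \<in> - {0}}" by blast
    moreover have "{y \<in> U i. coef l k0 i y \<in> - {0}} \<subseteq> A"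
      using A_iff[OF il(1)] il(3) by blast
    moreover have "x \<in> {y \<in> U i. coef l k0 i y \<in> - {0}}" using il(2,4) by simp
    ultimately show "\<exists>T. openin (topo X) T \<and> x \<in> T \<and> T \<subseteq> A" by (intro exI conjI)
  qed
  have "openin (topo X) (topspace (topo X) - A)"
  proof (subst openin_subopen, intro ballI)
    fix x assume x: "x \<in> topspace (topo X) - A"
    then obtain i where i: "i \<in> I" "x \<in> U i" using triv_cover by blast
    then have "\<And>l. l < N \<Longrightarrow> coef l k0 i x = 0" using A_iff x by blast
    from higher_order_open[OF i this] obtain T where T: "openin (topo X) T" "x \<in> T" "T \<subseteq> U i" "\<forall>x \<in> T. \<forall>l<N. coef l k0 i x = 0"
      by blast
    then have "T \<subseteq> topspace (topo X) - A" using A_iff[OF i(1)] openin_subset[OF T(1)] by blast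
    then show "\<exists>T. openin (topo X) T \<and> x \<in> T \<and> T \<subseteq> topspace (topo X) - A" using T by blast
  qed
  then have "closedin (topo X) A" using openA openin_subset by (auto simp: closedin_def)
  then have "A = {} \<or> A = topspace (topo X)"
    using connected openA unfolding connected_space_clopen_in by blast
  \<comment> \<open>A nonzero section of order \<open>k0\<close> exists by definition of
    \<open>k0\<close>. At a point where it does not vanish, the generators cannot all have order
    greater than \<open>k0\<close>, since its expansion would force it to be zero there.\<close>
  moreover have "A \<noteq> {}"
  proof -
    obtain s i x where s: "global_section X (dual_power k0) s" "i \<in> I" "x \<in> U i" "s i x \<noteq> 0"
      using initial_order_section(2) unfolding has_nonzero_section_def by auto
    obtain V c where e: "ideal_expansion k0 s V c" using section_expansion[OF s(1) initial_order_section(1)] by blast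
    have "\<exists>l<N. coef l k0 i x \<noteq> 0"
    proof (rule ccontr)
      assume a: "\<not> (\<exists>l<N. coef l k0 i x \<noteq> 0)"
      have "coef l j i x = 0" if "l < N" "j < Suc k0" for l j
        using a coef_below_k0[OF that(1) _ s(2,3), of j] that by (cases "j = k0") auto
      from expansion_leading(1)[OF e s(2,3), of "Suc k0"] this show False using s(4) by simp
    qed
    then show ?thesis using A_iff[OF s(2,3)] by blast
  qed
  ultimately have "A = topspace (topo X)" by blast
  then show ?thesis using A_iff[OF ix] ix openin_subset[OF openin_triv] by blast
qed

text \<open>In a chart containing the point, both sides have the same ratios to the l-th coordinate,
  by \<open>coef_ratio\<close> with m = \<open>k0\<close>.\<close>

lemma \<Phi>_zero_section:
  assumes ix: "i \<in> I" "x \<in> U i"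
  shows "\<Phi> (bp i x 0) = proj_class (vec N (\<lambda>l. coef l k0 i x))"
proof -
  obtain l where l: "l < N" "bp i x 0 \<in> chart_dom l" using in_chart_dom[OF zero_over[OF ix]] by blast
  have r: "coef l' k0 i x = ratio l l' (bp i x 0) * coef l k0 i x" if "l' < N" for l'
    by (rule coef_ratio[OF ix l that coef_below_k0[OF _ _ ix]])
  have nz: "coef l k0 i x \<noteq> 0" using coef_k0_nonzero[OF ix] r by fastforce
  obtain z where z: "z \<in> Cn N" "\<Phi> (bp i x 0) = proj_class z" "z l \<noteq> 0" using l(2) unfolding proj_chart_def by blast
  have "coef l' k0 i x = (coef l k0 i x / z l) * z l'" if "l' < N" for l'
    using r[OF that] by (simp add: z(2) proj_ratio_class)
  then have "vec N (\<lambda>l. coef l k0 i x) = vec N (\<lambda>l'. (coef l k0 i x / z l) * z l')" by (auto simp: vec_def fun_eq_iff)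
  then have "proj_class (vec N (\<lambda>l. coef l k0 i x)) = proj_class (vec N z)"
    using proj_class_scale[of "coef l k0 i x / z l" N z] nz z(3) by simp
  then show ?thesis using z(1,2) by (simp add: vec_Cn)
qed

lemma \<Phi>_off_zero:
  assumes p: "p \<in> over W" "f p \<noteq> z0"
  shows "\<Phi> p = proj_class (vec N (\<lambda>k. \<gamma> k (f p)))"
proof -
  obtain l where l: "l < N" "p \<in> chart_dom l" using in_chart_dom[OF p(1)] by blast
  note r = ratio_eq[OF l(2,1)]
  have nz: "\<gamma> l (f p) \<noteq> 0"
  proof
    assume "\<gamma> l (f p) = 0"
    then have "\<gamma> k (f p) = 0" if "k < N" for k using r[OF that] by simp
    then show False using common_zero[of "f p"] p by blast
  qed
  obtain z where z: "z \<in> Cn N" "\<Phi> p = proj_class z" "z l \<noteq> 0" using l(2) unfolding proj_chart_def by blast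
  have "\<gamma> k (f p) = (\<gamma> l (f p) / z l) * z k" if "k < N" for k
    using r[OF that] by (simp add: z(2) proj_ratio_class)
  then have "vec N (\<lambda>k. \<gamma> k (f p)) = vec N (\<lambda>k. (\<gamma> l (f p) / z l) * z k)" by (auto simp: vec_def fun_eq_iff)
  then have "proj_class (vec N (\<lambda>k. \<gamma> k (f p))) = proj_class (vec N z)"
    using proj_class_scale[of "\<gamma> l (f p) / z l" N z] nz z(3) by simp
  then show ?thesis using z(1,2) by (simp add: vec_Cn)
qed

text \<open>One formula for homogeneous coordinates on the whole fibre, obtained by cancelling the
  common factor v^k0. It can be differentiated at v = 0.\<close>

lemma \<Phi>_fibre:
  assumes ix: "i \<in> I" "x \<in> U i" and v: "bp i x v \<in> over W"
  shows "\<Phi> (bp i x v) = proj_class (vec N (\<lambda>l. (dq ^^ k0) (\<lambda>v. \<gamma> l (f (bp i x v))) v))"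
proof (cases "v = 0")
  case True
  then show ?thesis using \<Phi>_zero_section[OF ix] by (simp add: coeff_section_def taylor_coeff_def)
next
  case False
  have "vec N (\<lambda>l. \<gamma> l (f (bp i x v))) = vec N (\<lambda>l. v ^ k0 * (dq ^^ k0) (\<lambda>v. \<gamma> l (f (bp i x v))) v)"
    unfolding vec_def by (intro ext if_cong refl) (rule fibre_remainder[OF coef_below_k0[OF _ _ ix]])
  then show ?thesis
    using \<Phi>_off_zero[OF v] f_bundle_point[OF ix, of v] False
      proj_class_scale[of "v ^ k0" N "\<lambda>l. (dq ^^ k0) (\<lambda>v. \<gamma> l (f (bp i x v))) v"] by simp
qed

end

lemma holomorphic_map_ident: "holomorphic_map X X (\<lambda>x. x)"
proof (rule holomorphic_mapI)
  fix V assume V: "openin (topo X) V"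
  have eq: "{x \<in> topspace (topo X). x \<in> V} = V" using openin_subset[OF V] by auto
  show "openin (topo X) {x \<in> topspace (topo X). x \<in> V}" unfolding eq by (rule V)
  fix h assume "h \<in> hol X V"
  then show "h \<in> hol X {x \<in> topspace (topo X). x \<in> V}" unfolding eq .
qed auto

context line_bundle_over
begin

lemma global_section_scale:
  assumes s: "global_section X (dual_power k) s"
  shows "global_section X (dual_power k) (\<lambda>i x. a * s i x)"
  unfolding global_section_dual_power
proof (intro conjI ballI)
  fix i assume i: "i \<in> I"
  then have "s i \<in> hol X (U i)" using s unfolding global_section_dual_power by blast
  then show "(\<lambda>x. a * s i x) \<in> hol X (U i)"
    by (intro hol_mult[OF X openin_triv[OF i]] hol_const[OF X openin_triv[OF i]])
next
  fix i j x assume "i \<in> I" "j \<in> I" "x \<in> U i \<inter> U j"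
  then have "s i x = g j i x ^ k * s j x" using s unfolding global_section_dual_power by blast
  then show "a * s i x = g j i x ^ k * (a * s j x)" by simp
qed

lemma global_section_square:
  assumes s: "global_section X (dual_power k) s"
  shows "global_section X (dual_power (k + k)) (\<lambda>i x. s i x * s i x)"
  unfolding global_section_dual_power
proof (intro conjI ballI)
  fix i assume i: "i \<in> I"
  then have "s i \<in> hol X (U i)" using s unfolding global_section_dual_power by blast
  then show "(\<lambda>x. s i x * s i x) \<in> hol X (U i)" by (intro hol_mult[OF X openin_triv[OF i]])
next
  fix i j x assume "i \<in> I" "j \<in> I" "x \<in> U i \<inter> U j"
  then have "s i x = g j i x ^ k * s j x" using s unfolding global_section_dual_power by blast
  then show "s i x * s i x = g j i x ^ (k + k) * (s j x * s j x)" by (simp add: power_add)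
qed

lemma globally_generatedI:
  assumes "\<And>i x. i \<in> I \<Longrightarrow> x \<in> U i \<Longrightarrow> \<exists>s. global_section X (dual_power k) s \<and> s i x \<noteq> 0"
  shows "globally_generated X (dual_power k)"
  unfolding globally_generated_def idx_dual_power triv_dual_power
proof (intro ballI allI)
  fix i x v assume "i \<in> I" "x \<in> U i"
  from assms[OF this] obtain s where s: "global_section X (dual_power k) s" "s i x \<noteq> 0" by blast
  show "\<exists>s. global_section X (dual_power k) s \<and> s i x = v"
    using global_section_scale[OF s(1), of "v / s i x"] s(2) by (intro exI[of _ "\<lambda>i' x'. v / s i x * s i' x'"]) simp
qed

end

section \<open>Very ampleness and global generation\<close>

context quadratic_transform
begin

lemma zero_map_over:
  assumes "x \<in> topspace (topo X)"
  shows "zero_map x \<in> over W"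
proof -
  obtain i where i: "i \<in> I" "x \<in> U i" using triv_cover[OF assms] by blast
  show ?thesis unfolding zero_map[OF i] by (rule zero_over[OF i])
qed

lemma zero_map_hol_EW: "holomorphic_map X EW zero_map"
  by (rule holomorphic_map_into_sub[OF X analytic_total holomorphic_map_zero_map zero_map_over])

lemma F_bundle_point_zero: "i \<in> I \<Longrightarrow> x \<in> U i \<Longrightarrow> (z0, \<Phi> (bp i x 0)) = F (bp i x 0)"
  using F_fst[OF bundle_point_in[of i x 0]] zero_over[of i x] f_bundle_point[of i x 0] by (simp add: prod_eq_iff)

lemma F_zero_map:
  assumes "x \<in> topspace (topo X)"
  shows "(z0, \<Phi> (zero_map x)) = F (zero_map x)"
proof -
  obtain i where i: "i \<in> I" "x \<in> U i" using triv_cover[OF assms] by blast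
  show ?thesis unfolding zero_map[OF i] by (rule F_bundle_point_zero[OF i])
qed

text \<open>Only the zero section lies over \<open>z0\<close>, so \<open>F\<close> maps it onto the
  fibre of the blow-up over \<open>z0\<close>. That fibre is a slice of a closed set, which makes
  the image closed.\<close>

lemma zero_embedding_image:
  "(\<lambda>x. \<Phi> (zero_map x)) ` topspace (topo X) = {\<zeta> \<in> topspace (topo (Pspace N)). (z0, \<zeta>) \<in> BS}" (is "?im = ?R")
proof
  show "?im \<subseteq> ?R"
  proof
    fix \<zeta> assume "\<zeta> \<in> ?im"
    then obtain x where x: "x \<in> topspace (topo X)" "\<zeta> = \<Phi> (zero_map x)" by blast
    have B: "(z0, \<zeta>) \<in> BS" unfolding x(2) F_zero_map[OF x(1)] by (rule F_in[OF zero_map_over[OF x(1)]])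
    then have "(z0, \<zeta>) \<in> topspace (topo ZP)" using closure_of_subset_topspace[of "topo ZP" \<Gamma>] by blast
    then show "\<zeta> \<in> ?R" using B unfolding topspace_ZP by blast
  qed
  show "?R \<subseteq> ?im"
  proof
    fix \<zeta> assume "\<zeta> \<in> ?R"
    then have B: "(z0, \<zeta>) \<in> BS" by blast
    obtain G where G: "holomorphic_map (sub_fspace ZP BS) EW G" "\<forall>y \<in> BS. F (G y) = y" using F_inverse by blast
    have "(z0, \<zeta>) \<in> topspace (topo (sub_fspace ZP BS))"
      unfolding topspace_sub_fspace[of ZP BS] using B closure_of_subset_topspace[of "topo ZP" \<Gamma>] by blast
    from holomorphic_map_in[OF G(1) this] have p: "G (z0, \<zeta>) \<in> over W" unfolding topspace_EW .
    have Fp: "F (G (z0, \<zeta>)) = (z0, \<zeta>)" using G(2) B by blast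
    then have "f (G (z0, \<zeta>)) = z0" using F_fst[of "G (z0, \<zeta>)"] p by simp
    then have "G (z0, \<zeta>) \<in> zero_section L" using f_eq_z0_iff p by blast
    then obtain i x where ix: "i \<in> I" "x \<in> U i" "G (z0, \<zeta>) = bp i x 0" unfolding zero_section_def by blast
    then have "\<zeta> = \<Phi> (zero_map x)" using zero_map[OF ix(1,2)] Fp by simp
    moreover have "x \<in> topspace (topo X)" using ix openin_subset[OF openin_triv] by blast
    ultimately show "\<zeta> \<in> ?im" by blast
  qed
qed

text \<open>The inverse is a composite of holomorphic maps: insert \<open>z0\<close> as first
  component, apply the inverse of \<open>F\<close>, project to the base.\<close>

lemma zero_embedding: "closed_embedding X (Pspace N) (\<lambda>x. \<Phi> (zero_map x))"
proof -
  let ?\<Psi> = "\<lambda>x. \<Phi> (zero_map x)"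
  let ?im = "?\<Psi> ` topspace (topo X)"
  have \<Psi>: "holomorphic_map X (Pspace N) ?\<Psi>"
    using holomorphic_map_compose[OF analytic_sheaf[OF X] zero_map_hol_EW \<Phi>_hol] .
  have z0': "z0 \<in> topspace (topo ZW)" unfolding topspace_ZW by (rule z0W)
  have j: "holomorphic_map (Pspace N) ZP (\<lambda>\<zeta>. (z0, \<zeta>))"
    by (rule holomorphic_map_pair[OF analytic_Pspace holomorphic_map_const[OF analytic_Pspace z0'] holomorphic_map_ident])
  have imB: "(z0, \<zeta>) \<in> BS" if "\<zeta> \<in> ?im" for \<zeta> using that unfolding zero_embedding_image by blast
  have closed: "closedin (topo (Pspace N)) ?im"
  proof -
    have "continuous_map (topo (Pspace N)) (topo ZP) (\<lambda>\<zeta>. (z0, \<zeta>))" using j unfolding holomorphic_map_def by blast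
    from closedin_continuous_map_preimage[OF this closedin_closure_of[of _ \<Gamma>]] show ?thesis
      unfolding zero_embedding_image .
  qed
  have ts: "topspace (topo (sub_fspace (Pspace N) ?im)) = ?im"
    unfolding topspace_sub_fspace[of "Pspace N" ?im] using closedin_subset[OF closed] by blast
  obtain G where G: "holomorphic_map (sub_fspace ZP BS) EW G" "\<forall>p \<in> over W. G (F p) = p" using F_inverse by blast
  have sP: "analytic_fspace (sub_fspace (Pspace N) ?im)" by (rule analytic_sub_fspace[OF analytic_Pspace])
  have "holomorphic_map (sub_fspace (Pspace N) ?im) (sub_fspace ZP BS) (\<lambda>\<zeta>. (z0, \<zeta>))"
    by (rule holomorphic_map_into_sub[OF sP analytic_ZP holomorphic_map_restrict[OF analytic_Pspace j]])
      (use imB ts in blast)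
  from holomorphic_map_compose[OF analytic_sheaf[OF sP] this G(1)]
  have "holomorphic_map (sub_fspace (Pspace N) ?im) EW (\<lambda>\<zeta>. G (z0, \<zeta>))" .
  from holomorphic_map_compose[OF analytic_sheaf[OF sP] this holomorphic_map_inclusion]
  have "holomorphic_map (sub_fspace (Pspace N) ?im) E (\<lambda>\<zeta>. G (z0, \<zeta>))" .
  from holomorphic_map_compose[OF analytic_sheaf[OF sP] this holomorphic_map_bundle_proj]
  have inv: "holomorphic_map (sub_fspace (Pspace N) ?im) X (\<lambda>\<zeta>. bundle_proj (G (z0, \<zeta>)))" .
  have left: "bundle_proj (G (z0, ?\<Psi> x)) = x" if x: "x \<in> topspace (topo X)" for x
  proof -
    obtain i where i: "i \<in> I" "x \<in> U i" using triv_cover x by blast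
    have "G (z0, ?\<Psi> x) = zero_map x" unfolding F_zero_map[OF x] using G(2) zero_map_over[OF x] by blast
    then show ?thesis using zero_map[OF i] i by simp
  qed
  have right: "?\<Psi> (bundle_proj (G (z0, \<zeta>))) = \<zeta>" if "\<zeta> \<in> ?im" for \<zeta> using that left by auto
  have "holomorphic_map X (sub_fspace (Pspace N) ?im) ?\<Psi>"
    by (rule holomorphic_map_into_sub[OF X analytic_Pspace \<Psi>]) blast
  then have "biholomorphic_map X (sub_fspace (Pspace N) ?im) ?\<Psi>"
    unfolding biholomorphic_map_def ts using inv left right by blast
  with closed show ?thesis unfolding closed_embedding_def by blast
qed

lemma very_ample_k0: "very_ample X (dual_power k0)"
  unfolding very_ample_def idx_dual_power triv_dual_power
proof (intro exI[of _ N] exI[of _ "\<lambda>l. coef l k0"] exI[of _ "\<lambda>x. \<Phi> (zero_map x)"] conjI)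
  show "\<forall>l<N. global_section X (dual_power k0) (coef l k0)" using coef_section by blast
  show "\<forall>i \<in> I. \<forall>x \<in> U i. (\<exists>k<N. coef k k0 i x \<noteq> 0) \<and> \<Phi> (zero_map x) = proj_class (vec N (\<lambda>k. coef k k0 i x))"
  proof (intro ballI conjI)
    fix i x assume ix: "i \<in> I" "x \<in> U i"
    show "\<exists>k<N. coef k k0 i x \<noteq> 0" by (rule coef_k0_nonzero[OF ix])
    show "\<Phi> (zero_map x) = proj_class (vec N (\<lambda>k. coef k k0 i x))"
      unfolding zero_map[OF ix] by (rule \<Phi>_zero_section[OF ix])
  qed
qed (rule zero_embedding)

text \<open>\<open>a - a z0\<close> lies in the maximal ideal, so its pull-back has no coefficient
  of order 1 when 1 < \<open>k0\<close>.\<close>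

lemma pullback_derivative_zero:
  assumes k: "1 < k0" and A: "openin (topo Z) A" "z0 \<in> A" and a: "a \<in> hol Z A" and ix: "i \<in> I" "x \<in> U i"
  shows "((\<lambda>v. a (f (bp i x v))) has_field_derivative 0) (at 0)"
proof -
  let ?u = "\<lambda>v. a (f (bp i x v))"
  have d: "(?u has_field_derivative deriv ?u 0) (at 0)"
    by (rule holomorphic_derivI[OF pullback_fibre[OF A a ix]])
  have "(\<lambda>z. a z - a z0) \<in> hol Z A" by (intro hol_diff[OF analytic_Z A(1)] a hol_const[OF analytic_Z A(1)])
  from coeff_below_k0[OF A this _ k ix]
  have "deriv (\<lambda>v. ?u v - a z0) 0 = 0" by (simp add: coeff_section_def taylor_coeff_def dq_def)
  moreover have "((\<lambda>v. ?u v - a z0) has_field_derivative deriv ?u 0 - 0) (at 0)"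
    by (rule DERIV_diff[OF d DERIV_const])
  ultimately have "deriv ?u 0 = 0" using DERIV_imp_deriv by fastforce
  with d show ?thesis by simp
qed

text \<open>For \<open>k0 \<ge> 2\<close> the functions on \<open>Z\<close> are constant to first order along the fibres, and so are the
  projective coordinates if all coefficients of order \<open>k0 + 1\<close> vanish.  The fibre coordinate is
  a function of these, but has derivative one.\<close>

lemma coef_Suc_k0_nonzero:
  assumes k: "1 < k0" and ix: "i \<in> I" "x \<in> U i"
  shows "\<exists>l<N. coef l (Suc k0) i x \<noteq> 0"
proof (rule ccontr)
  assume "\<not> (\<exists>l<N. coef l (Suc k0) i x \<noteq> 0)"
  then have vanish: "coef l (Suc k0) i x = 0" if "l < N" for l using that by blast
  obtain G where G: "holomorphic_map (sub_fspace ZP BS) EW G" "\<forall>p \<in> over W. G (F p) = p" using F_inverse by blast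
  have tsB: "topspace (topo (sub_fspace ZP BS)) = BS"
    unfolding topspace_sub_fspace[of ZP BS] using closure_of_subset_topspace[of "topo ZP" \<Gamma>] by (rule Int_absorb1)
  let ?S = "bundle_over i \<inter> over W"
  have S: "openin (topo E) ?S" using openin_bundle_over[OF ix(1)] openin_over[OF W] by blast
  have "fibre_coord i \<in> hol E ?S"
    by (rule function_sheaf_mono[OF analytic_sheaf[OF analytic_total] openin_bundle_over[OF ix(1)] S _ fibre_coord_hol[OF ix(1)]]) blast
  then have hS: "fibre_coord i \<in> hol EW ?S" using hol_EW[OF S] by blast
  have SEW: "openin (topo EW) ?S" unfolding openin_EW using S by blast
  have hG: "(\<lambda>y. fibre_coord i (G y)) \<in> hol (sub_fspace ZP BS) {y \<in> BS. G y \<in> ?S}"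
    using holomorphic_map_hol[OF G(1) SEW hS] unfolding tsB .
  let ?p = "\<lambda>v. bp i x v"
  have p0: "?p 0 \<in> over W" by (rule zero_over[OF ix])
  have "?p 0 \<in> ?S" using p0 ix bundle_point_in[OF ix] by simp
  then have "F (?p 0) \<in> {y \<in> BS. G y \<in> ?S}" using F_in[OF p0] G(2) p0 by simp
  \<comment> \<open>\<open>b\<close> extends the fibre coordinate, regarded as a function on the
    blow-up, to an open subset of the product, where it is a holomorphic expression \<open>H\<close>
    in functions of the two factors.\<close>
  from hol_sub_fspaceD[OF hG this] obtain V b where
    V: "openin (topo ZP) V" "F (?p 0) \<in> V" "b \<in> hol ZP V" "\<forall>y \<in> V \<inter> BS. fibre_coord i (G y) = b y" by blast
  from hol_prod_fspaceD[OF V(3,2)] obtain A B n c D H where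
    AB: "openin (topo ZW) A" "openin (topo (Pspace N)) B" "F (?p 0) \<in> A \<times> B" "A \<times> B \<subseteq> V"
    "\<forall>k<n. c k \<in> prod_generators ZW (Pspace N) A B" "openin (topo (Cspace n)) D" "H \<in> hol (Cspace n) D"
    "\<forall>w \<in> A \<times> B. vec n (\<lambda>k. c k w) \<in> D \<and> b w = H (vec n (\<lambda>k. c k w))" by (elim exE conjE)
  have A: "openin (topo Z) A" "A \<subseteq> W" using AB(1) openin_sub_fspace_open[OF W] by blast+
  have "(z0, \<Phi> (?p 0)) \<in> A \<times> B" unfolding F_bundle_point_zero[OF ix] by (rule AB(3))
  then have z0A: "z0 \<in> A" and \<zeta>B: "\<Phi> (?p 0) \<in> B" by blast+
  have S0: "open {v. ?p v \<in> over W}" "0 \<in> {v. ?p v \<in> over W}"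
    by (rule fibre_hol(2)[OF openin_over[OF W] hol_const[OF analytic_total openin_over[OF W]] ix])
      (use p0 in \<open>simp only: mem_Collect_eq simp_thms\<close>)
  \<comment> \<open>Homogeneous coordinates of \<open>\<Phi>\<close> on the fibre; their derivatives
    at 0 are the coefficients of order k0 + 1.\<close>
  let ?D = "\<lambda>l. (dq ^^ k0) (\<lambda>v. \<gamma> l (f (?p v)))"
  have dD: "(?D l has_field_derivative 0) (at 0)" if l: "l < N" for l
  proof -
    have "(?D l has_field_derivative deriv (?D l) 0) (at 0)"
      by (rule holomorphic_derivI[OF dq_funpow_holomorphic[OF \<gamma>_fibre(1,2)[OF l ix]] \<gamma>_fibre(2,3)[OF l ix]])
    moreover have "deriv (?D l) 0 = coef l (Suc k0) i x" by (simp add: coeff_section_def taylor_coeff_def dq_def)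
    ultimately show ?thesis using vanish[OF l] by simp
  qed
  have dc: "((\<lambda>v. c k (F (?p v))) has_field_derivative 0) (at 0)" if kn: "k < n" for k
    using AB(5)[rule_format, OF kn] unfolding prod_generators_def
  proof (elim UnE CollectE exE conjE)
    fix a assume a: "c k = a \<circ> fst" "a \<in> hol ZW A"
    have "a \<in> hol Z A" using a(2) hol_ZW[OF A] by blast
    from pullback_derivative_zero[OF k A(1) z0A this ix]
    show ?thesis
      by (rule has_field_derivative_transform_within_open[OF _ S0]) (use F_fst in \<open>simp add: a(1)\<close>)
  next
    fix b' assume b': "c k = b' \<circ> snd" "b' \<in> hol (Pspace N) B"
    let ?q = "vec N (\<lambda>l. ?D l 0)"
    obtain l where l: "l < N" "coef l k0 i x \<noteq> 0" using coef_k0_nonzero[OF ix] by blast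
    then have "?q \<in> Cn N - {\<lambda>_. 0}" by (intro vec_nonzero[OF l(1)]) (simp add: coeff_section_def taylor_coeff_def)
    moreover have "proj_class ?q \<in> B" using \<Phi>_fibre[OF ix p0] \<zeta>B by simp
    \<comment> \<open>A function on projective space is differentiated on the cone above it, along
      the curve of homogeneous coordinates \<open>?D\<close>.\<close>
    ultimately have "complex_differentiable_at N (\<lambda>z. b' (proj_class z)) ?q"
      using b'(2) unfolding hol_Pspace[OF AB(2)] hol_Cspace by blast
    from complex_differentiable_curve[OF this vec_in_Cn] obtain a where
      a: "\<And>c d t0. vec N (\<lambda>l. c l t0) = ?q \<Longrightarrow> (\<And>l. l < N \<Longrightarrow> (c l has_field_derivative d l) (at t0)) \<Longrightarrow>
       ((\<lambda>t. b' (proj_class (vec N (\<lambda>l. c l t)))) has_field_derivative (\<Sum>l<N. a l * d l)) (at t0)" by blast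
    have "((\<lambda>t. b' (proj_class (vec N (\<lambda>l. ?D l t)))) has_field_derivative (\<Sum>l<N. a l * 0)) (at 0)"
      by (rule a[of ?D 0 "\<lambda>_. 0", OF refl dD])
    then have "((\<lambda>t. b' (proj_class (vec N (\<lambda>l. ?D l t)))) has_field_derivative 0) (at 0)" by simp
    then show ?thesis
      by (rule has_field_derivative_transform_within_open[OF _ S0]) (use \<Phi>_fibre[OF ix] in \<open>simp add: b'(1)\<close>)
  qed
  have "complex_differentiable_at n H (vec n (\<lambda>k. c k (F (?p 0))))"
    using AB(7)[unfolded hol_Cspace] AB(8)[rule_format, OF AB(3)] by simp
  from complex_differentiable_curve[OF this vec_in_Cn] obtain a where
    a: "\<And>c' d t0. vec n (\<lambda>k. c' k t0) = vec n (\<lambda>k. c k (F (?p 0))) \<Longrightarrow> (\<And>k. k < n \<Longrightarrow> (c' k has_field_derivative d k) (at t0)) \<Longrightarrow>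
       ((\<lambda>t. H (vec n (\<lambda>k. c' k t))) has_field_derivative (\<Sum>k<n. a k * d k)) (at t0)" by blast
  have "((\<lambda>v. H (vec n (\<lambda>k. c k (F (?p v))))) has_field_derivative (\<Sum>k<n. a k * 0)) (at 0)"
    by (rule a[of "\<lambda>k v. c k (F (?p v))" 0 "\<lambda>_. 0", OF refl dc])
  then have d0: "((\<lambda>v. H (vec n (\<lambda>k. c k (F (?p v))))) has_field_derivative 0) (at 0)" by simp
  have FZP: "holomorphic_map EW ZP F"
    using holomorphic_map_compose[OF analytic_sheaf[OF analytic_EW] F_hol holomorphic_map_inclusion] .
  have "openin (topo ZP) (A \<times> B)" unfolding topo_prod_fspace openin_prod_Times_iff using AB(1,2) by blast
  from holomorphic_map_openin[OF FZP this] have Q: "openin (topo E) {p \<in> over W. F p \<in> A \<times> B}"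
    unfolding topspace_EW openin_EW by blast
  have S1: "open {v. ?p v \<in> {p \<in> over W. F p \<in> A \<times> B}}"
    by (rule fibre_hol(2)[OF Q hol_const[OF analytic_total Q] ix])
  have S2: "0 \<in> {v. ?p v \<in> {p \<in> over W. F p \<in> A \<times> B}}"
    using p0 AB(3) by (simp only: mem_Collect_eq simp_thms)
  have "((\<lambda>v. v) has_field_derivative 0) (at (0 :: complex))"
  proof (rule has_field_derivative_transform_within_open[OF d0 S1 S2])
    fix v assume v: "v \<in> {v. ?p v \<in> {p \<in> over W. F p \<in> A \<times> B}}"
    then have FA: "F (?p v) \<in> A \<times> B" and pv: "?p v \<in> over W" by blast+
    have "H (vec n (\<lambda>k. c k (F (?p v)))) = b (F (?p v))" using AB(8)[rule_format, OF FA] by simp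
    also have "\<dots> = fibre_coord i (G (F (?p v)))"
      by (rule V(4)[rule_format, OF IntI[OF subsetD[OF AB(4) FA] F_in[OF pv]], symmetric])
    also have "\<dots> = v" using G(2)[rule_format, OF pv] ix by simp
    finally show "H (vec n (\<lambda>k. c k (F (?p v)))) = v" .
  qed
  from DERIV_unique[OF this DERIV_ident] show False by simp
qed

lemma globally_generated_Suc_k0: "globally_generated X (dual_power (k0 + 1))"
proof (rule globally_generatedI)
  fix i x assume ix: "i \<in> I" "x \<in> U i"
  show "\<exists>s. global_section X (dual_power (k0 + 1)) s \<and> s i x \<noteq> 0"
  proof (cases "k0 = 1")
    \<comment> \<open>Here k0 + 1 = k0 + k0, so the square of a section that does not vanish at the
      point is the one required.\<close>
    case True
    obtain l where l: "l < N" "coef l k0 i x \<noteq> 0" using coef_k0_nonzero[OF ix] by blast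
    then show ?thesis using global_section_square[OF coef_section[OF l(1), of k0]] True
      by (intro exI[of _ "\<lambda>i x. coef l k0 i x * coef l k0 i x"]) simp
  next
    case False
    then have "1 < k0" using initial_order_section(1) by linarith
    from coef_Suc_k0_nonzero[OF this ix] obtain l where l: "l < N" "coef l (Suc k0) i x \<noteq> 0" by blast
    then show ?thesis using coef_section[OF l(1), of "Suc k0"] by (intro exI[of _ "coef l (Suc k0)"]) simp
  qed
qed

end

section \<open>Existence of generators of the maximal ideal\<close>

context blow_down
begin

text \<open>The generators are the coordinates of a chart of \<open>Z\<close>, centred at
  \<open>z0\<close>. A function vanishing at \<open>z0\<close> extends to the ambient space of the
  chart, where \<open>hadamard_all\<close> divides it, and the coefficients are pulled back. The
  chart is injective, so \<open>z0\<close> is the only common zero.\<close>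

lemma exists_generators:
  "\<exists>W N \<gamma>. generates_maximal_ideal Z z0 W N \<gamma> \<and> (\<forall>z \<in> W. (\<forall>k<N. \<gamma> k z = 0) \<longrightarrow> z = z0)"
proof -
  obtain S n A \<phi> where S: "openin (topo Z) S" "z0 \<in> S"
    and bi: "biholomorphic_map (sub_fspace Z S) (sub_fspace (Cspace n) A) \<phi>"
    using Z_space z0_in unfolding complex_space_def by blast
  have tsS: "topspace (topo (sub_fspace Z S)) = S" using openin_subset[OF S(1)] by auto
  have tsA: "topspace (topo (sub_fspace (Cspace n) A)) = Cn n \<inter> A" by auto
  from bi obtain \<psi> where \<phi>: "holomorphic_map (sub_fspace Z S) (sub_fspace (Cspace n) A) \<phi>"
    and \<psi>: "holomorphic_map (sub_fspace (Cspace n) A) (sub_fspace Z S) \<psi>"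
    and \<psi>\<phi>: "\<forall>z \<in> S. \<psi> (\<phi> z) = z"
    unfolding biholomorphic_map_def tsS by blast
  have \<phi>_in: "\<phi> z \<in> Cn n \<inter> A" if "z \<in> S" for z using holomorphic_map_in[OF \<phi>, of z] that unfolding tsS tsA by blast
  let ?p = "\<phi> z0"
  let ?\<gamma> = "\<lambda>k z. \<phi> z k - ?p k"
  have pull: "openin (topo Z) {z \<in> S. \<phi> z \<in> B} \<and> (\<lambda>z. k (\<phi> z)) \<in> hol Z {z \<in> S. \<phi> z \<in> B}"
    if B: "openin (topo (Cspace n)) B" and k: "k \<in> hol (Cspace n) B" for B k
  proof -
    have BA: "openin (topo (sub_fspace (Cspace n) A)) (B \<inter> A)" using B by (auto simp: openin_subtopology)
    have eq: "{z \<in> S. \<phi> z \<in> B \<inter> A} = {z \<in> S. \<phi> z \<in> B}" using \<phi>_in by blast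
    have op: "openin (topo Z) {z \<in> S. \<phi> z \<in> B}"
      using holomorphic_map_openin[OF \<phi> BA] unfolding tsS eq openin_sub_fspace_open[OF S(1)] by blast
    have "(\<lambda>z. k (\<phi> z)) \<in> hol (sub_fspace Z S) {z \<in> S. \<phi> z \<in> B}"
      using holomorphic_map_hol[OF \<phi> BA hol_sub_fspace_restrict[OF B k]] unfolding tsS eq .
    then show ?thesis using op hol_sub_fspace_open[OF analytic_sheaf[OF analytic_Z] S(1) op] by blast
  qed
  have \<gamma>: "?\<gamma> k \<in> hol Z S" if "k < n" for k
  proof -
    have "openin (topo (Cspace n)) (Cn n)" by simp
    from pull[OF this coordinate_hol_Cspace[OF order_refl that]] \<phi>_in
    have "(\<lambda>z. \<phi> z k) \<in> hol Z {z \<in> S. \<phi> z \<in> Cn n}" by blast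
    moreover have "{z \<in> S. \<phi> z \<in> Cn n} = S" using \<phi>_in by blast
    ultimately have "(\<lambda>z. \<phi> z k) \<in> hol Z S" by simp
    then show ?thesis by (intro hol_diff[OF analytic_Z S(1)] hol_const[OF analytic_Z S(1)])
  qed
  have zero: "z = z0" if z: "z \<in> S" and k: "\<forall>k<n. ?\<gamma> k z = 0" for z
  proof -
    have "\<phi> z k = ?p k" for k
      using k \<phi>_in[OF z] \<phi>_in[OF S(2)] by (cases "k < n") (auto simp: Cn_def)
    then have "\<phi> z = ?p" by (rule ext)
    then show ?thesis using \<psi>\<phi> z S(2) by metis
  qed
  have gen: "\<exists>V' c. openin (topo Z) V' \<and> z0 \<in> V' \<and> V' \<subseteq> V \<inter> S \<and> (\<forall>k<n. c k \<in> hol Z V') \<and>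
      (\<forall>z \<in> V'. h z = (\<Sum>k<n. c k z * ?\<gamma> k z))"
    if V: "openin (topo Z) V" "z0 \<in> V" and h: "h \<in> hol Z V" "h z0 = 0" for V h
  proof -
    let ?V = "V \<inter> S"
    have oV: "openin (topo Z) ?V" using V(1) S(1) by blast
    have "h \<in> hol Z ?V" by (rule function_sheaf_mono[OF analytic_sheaf[OF analytic_Z] V(1) oV _ h(1)]) blast
    then have hS: "h \<in> hol (sub_fspace Z S) ?V" using hol_sub_fspace_open[OF analytic_sheaf[OF analytic_Z] S(1) oV] by blast
    have oVS: "openin (topo (sub_fspace Z S)) ?V" unfolding openin_sub_fspace_open[OF S(1)] using oV by blast
    let ?T = "{y \<in> Cn n \<inter> A. \<psi> y \<in> ?V}"
    have hT: "(\<lambda>y. h (\<psi> y)) \<in> hol (sub_fspace (Cspace n) A) ?T"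
      using holomorphic_map_hol[OF \<psi> oVS hS] unfolding tsA .
    have pT: "?p \<in> ?T" using \<phi>_in[OF S(2)] \<psi>\<phi> S(2) V(2) by simp
    from hol_sub_fspaceD[OF hT pT] obtain O' k where
      O': "openin (topo (Cspace n)) O'" "?p \<in> O'" "O' \<inter> A \<subseteq> ?T" "k \<in> hol (Cspace n) O'" "\<forall>y \<in> O' \<inter> A. h (\<psi> y) = k y"
      by (elim exE conjE)
    have kd: "complex_differentiable_at n k z" if "z \<in> O'" for z using O'(4) that unfolding hol_Cspace by blast
    have "\<exists>r>0. \<exists>C. polydisc n ?p r \<subseteq> O' \<and> (\<forall>i<n. \<forall>z \<in> polydisc n ?p r. complex_differentiable_at n (C i) z) \<and>
        (\<forall>z \<in> polydisc n ?p r. k z = k ?p + (\<Sum>i<n. C i z * (z i - ?p i)))"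
      by (rule hadamard_all[OF O'(1)[unfolded topo_Cspace] kd O'(2)])
    then obtain r where r: "r > 0" and "\<exists>C. polydisc n ?p r \<subseteq> O' \<and> (\<forall>i<n. \<forall>z \<in> polydisc n ?p r. complex_differentiable_at n (C i) z) \<and>
        (\<forall>z \<in> polydisc n ?p r. k z = k ?p + (\<Sum>i<n. C i z * (z i - ?p i)))"
      by (rule exE) (erule conjE, rule that)
    from this(2) obtain C where rO: "polydisc n ?p r \<subseteq> O'" and C: "\<forall>i<n. \<forall>z \<in> polydisc n ?p r. complex_differentiable_at n (C i) z"
      and kC: "\<forall>z \<in> polydisc n ?p r. k z = k ?p + (\<Sum>i<n. C i z * (z i - ?p i))"
      by (elim exE conjE)
    let ?B = "polydisc n ?p r"
    have B: "openin (topo (Cspace n)) ?B" by (simp add: openin_polydisc)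
    let ?V' = "{z \<in> S. \<phi> z \<in> ?B}"
    have CB: "C i \<in> hol (Cspace n) ?B" if "i < n" for i using C that unfolding hol_Cspace by blast
    \<comment> \<open>The ambient extension has no constant term because it agrees with
      \<open>h\<close> at the point of the model corresponding to \<open>z0\<close>.\<close>
    have kp: "k ?p = 0" using O'(2,5) \<phi>_in[OF S(2)] \<psi>\<phi> S(2) h(2) by (metis IntD2 IntI)
    have V'T: "\<phi> z \<in> O' \<inter> A" if "z \<in> ?V'" for z using that rO \<phi>_in by blast
    show ?thesis
    proof (intro exI[of _ ?V'] exI[of _ "\<lambda>i z. C i (\<phi> z)"] conjI allI impI ballI)
      show "openin (topo Z) ?V'" using pull[OF B hol_const[OF analytic_Cspace B]] by blast
      show "z0 \<in> ?V'" using S(2) r \<phi>_in[OF S(2)] centre_in_polydisc by blast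
      show "?V' \<subseteq> V \<inter> S"
      proof
        fix z assume z: "z \<in> ?V'"
        then have "\<psi> (\<phi> z) \<in> ?V" using V'T[OF z] O'(3) by blast
        then show "z \<in> V \<inter> S" using \<psi>\<phi> z by simp
      qed
      show "(\<lambda>z. C i (\<phi> z)) \<in> hol Z ?V'" if "i < n" for i using pull[OF B CB[OF that]] by blast
      fix z assume z: "z \<in> ?V'"
      then have "h z = h (\<psi> (\<phi> z))" using \<psi>\<phi> by simp
      also have "\<dots> = k (\<phi> z)" by (rule O'(5)[rule_format, OF V'T[OF z]])
      also have "\<dots> = (\<Sum>i<n. C i (\<phi> z) * (\<phi> z i - ?p i))" using kC kp z by simp
      finally show "h z = (\<Sum>i<n. C i (\<phi> z) * ?\<gamma> i z)" .
    qed
  qed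
  have "generates_maximal_ideal Z z0 S n ?\<gamma>"
    unfolding generates_maximal_ideal_def
  proof (intro conjI allI impI S)
    fix k assume "k < n"
    then show "?\<gamma> k \<in> hol Z S" by (rule \<gamma>)
    show "\<phi> z0 k - \<phi> z0 k = 0" by simp
  next
    fix V h assume "openin (topo Z) V \<and> z0 \<in> V \<and> h \<in> hol Z V \<and> h z0 = 0"
    then show "\<exists>V' c. openin (topo Z) V' \<and> z0 \<in> V' \<and> V' \<subseteq> V \<inter> S \<and> (\<forall>k<n. c k \<in> hol Z V') \<and>
      (\<forall>z \<in> V'. h z = (\<Sum>k<n. c k z * ?\<gamma> k z))"
      by (elim conjE) (rule gen)
  qed
  with zero show ?thesis by blast
qed

end

section \<open>The quadratic transform obtained from sections\<close>

text \<open>The sections \<open>s\<close> of the embedding \<Psi> and the generators \<gamma> are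
  chosen independently; expansions of the descended sections in the ideal are the only link between
  them.\<close>

locale ample_blow_down = blow_down_generators X L Z z0 f W N \<gamma>
  for X :: "'a fspace" and L :: "('i, 'a) line_bundle" and Z :: "'c fspace" and z0 f W N \<gamma> +
  fixes M :: nat and s :: "nat \<Rightarrow> 'i \<Rightarrow> 'a \<Rightarrow> complex" and \<Psi> :: "'a \<Rightarrow> (nat \<Rightarrow> complex) set"
  assumes s: "\<And>k. k < M \<Longrightarrow> global_section X (tensor_power (initial_order X (dual_bundle L)) (dual_bundle L)) (s k)"
    and s_nonzero: "\<And>i x. i \<in> idx L \<Longrightarrow> x \<in> triv L i \<Longrightarrow> \<exists>k<M. s k i x \<noteq> 0"
    and \<Psi>: "\<And>i x. i \<in> idx L \<Longrightarrow> x \<in> triv L i \<Longrightarrow> \<Psi> x = proj_class (vec M (\<lambda>k. s k i x))"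
    and embedding: "closed_embedding X (Pspace M) \<Psi>"
    and generated: "globally_generated X (tensor_power (initial_order X (dual_bundle L) + 1) (dual_bundle L))"
begin

text \<open>The quotient of \<open>\<gamma> l\<close> by v^k0, extended across v = 0. These are the
  homogeneous coordinates of the second component of \<open>F\<close>.\<close>

abbreviation "D l i x \<equiv> (dq ^^ k0) (\<lambda>v. \<gamma> l (f (bp i x v)))"

lemma \<gamma>_eq: "l < N \<Longrightarrow> i \<in> I \<Longrightarrow> x \<in> U i \<Longrightarrow> \<gamma> l (f (bp i x v)) = v ^ k0 * D l i x v"
  by (rule fibre_remainder[OF coef_below_k0])

lemma D_zero: "D l i x 0 = coef l k0 i x"
  by (simp add: coeff_section_def taylor_coeff_def)

lemma D_isCont: "l < N \<Longrightarrow> i \<in> I \<Longrightarrow> x \<in> U i \<Longrightarrow> isCont (D l i x) 0"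
  by (rule dq_funpow_isCont[OF \<gamma>_fibre])

text \<open>Both sides are continuous in \<open>v\<close>, so that the expansion may be divided by \<open>v\<^sup>k\<^sup>0\<close>.\<close>

lemma expansion_quotient:
  assumes e: "ideal_expansion (k0 + d) \<sigma> V c" and ix: "i \<in> I" "x \<in> U i" and v: "bp i x v \<in> over V"
  shows "\<sigma> i x * v ^ d = (\<Sum>l<N. c l (f (bp i x v)) * D l i x v)"
proof -
  have V: "openin (topo Z) V" "z0 \<in> V" and c: "\<And>l. l < N \<Longrightarrow> c l \<in> hol Z V"
    and eq: "\<And>v. f (bp i x v) \<in> V \<Longrightarrow> \<sigma> i x * v ^ (k0 + d) = (\<Sum>l<N. c l (f (bp i x v)) * \<gamma> l (f (bp i x v)))"
    using e ix unfolding ideal_expansion_def by auto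
  let ?R = "\<lambda>v. \<Sum>l<N. c l (f (bp i x v)) * D l i x v"
  have off: "\<sigma> i x * v ^ d = ?R v" if "f (bp i x v) \<in> V" "v \<noteq> 0" for v
  proof -
    have "v ^ k0 * (\<sigma> i x * v ^ d) = (\<Sum>l<N. c l (f (bp i x v)) * \<gamma> l (f (bp i x v)))"
      using eq[OF that(1)] by (simp add: power_add mult_ac)
    also have "\<dots> = (\<Sum>l<N. v ^ k0 * (c l (f (bp i x v)) * D l i x v))"
    proof (rule sum.cong[OF refl])
      fix l assume "l \<in> {..<N}" then have l: "l < N" by simp
      show "c l (f (bp i x v)) * \<gamma> l (f (bp i x v)) = v ^ k0 * (c l (f (bp i x v)) * D l i x v)"
        by (subst \<gamma>_eq[OF l ix, of v]) (rule mult.left_commute)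
    qed
    finally show ?thesis using that(2) by (simp flip: sum_distrib_left)
  qed
  show ?thesis
  proof (cases "v = 0")
    case False
    then show ?thesis using off v by blast
  next
    case True
    have op: "open {v. bp i x v \<in> over V}" "0 \<in> {v. bp i x v \<in> over V}"
      using pullback_fibre(2,3)[OF V hol_const[OF analytic_Z V(1)] ix] by auto
    have "\<forall>\<^sub>F v in at 0. bp i x v \<in> over V"
      using eventually_at_in_open'[OF op] by simp
    moreover have "\<forall>\<^sub>F v :: complex in at 0. v \<noteq> 0" by (simp add: eventually_at_filter)
    ultimately have ev: "\<forall>\<^sub>F v in at 0. \<sigma> i x * v ^ d = ?R v"
      by eventually_elim (use off in blast)
    have c0: "isCont (\<lambda>v. c l (f (bp i x v))) 0" if "l < N" for l
      by (rule fibre_isCont[OF openin_over[OF V(1)] pullback_hol[OF V(1) c[OF that]] ix]) (use op in blast)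
    have "(?R \<longlongrightarrow> ?R 0) (at 0)"
      using c0 D_isCont[OF _ ix] unfolding isCont_def by (intro tendsto_sum tendsto_mult) auto
    moreover have "((\<lambda>v. \<sigma> i x * v ^ d) \<longlongrightarrow> \<sigma> i x * 0 ^ d) (at 0)" by (intro tendsto_intros)
    then have "(?R \<longlongrightarrow> \<sigma> i x * 0 ^ d) (at 0)" by (rule Lim_transform_eventually) (rule ev)
    ultimately have "?R 0 = \<sigma> i x * 0 ^ d" by (intro tendsto_unique[of "at (0 :: complex)"]) auto
    then show ?thesis unfolding True by simp
  qed
qed

lemma s_expansion: "k < M \<Longrightarrow> \<exists>V c. ideal_expansion k0 (s k) V c"
  by (rule section_expansion[OF s initial_order_section(1)])

text \<open>For nonzero \<open>v\<close> the generators have no common zero. At v = 0 a section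
  \<open>s k\<close> that does not vanish at \<open>x\<close> is a combination of the leading
  coefficients, so these cannot all vanish.\<close>

lemma D_nonzero:
  assumes ix: "i \<in> I" "x \<in> U i" and v: "bp i x v \<in> over W"
  shows "\<exists>l<N. D l i x v \<noteq> 0"
proof (cases "v = 0")
  case True
  obtain k where k: "k < M" "s k i x \<noteq> 0" using s_nonzero[OF ix] by blast
  obtain V c where e: "ideal_expansion k0 (s k) V c" using s_expansion[OF k(1)] by blast
  from expansion_leading(2)[OF e ix coef_below_k0[OF _ _ ix] refl] k(2)
  have "(\<Sum>l<N. c l z0 * coef l k0 i x) \<noteq> 0" by simp
  then obtain l where "l < N" "c l z0 * coef l k0 i x \<noteq> 0" by (meson lessThan_iff sum.not_neutral_contains_not_neutral)
  then show ?thesis unfolding True D_zero by (intro exI[of _ l]) simp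
next
  case False
  then have "f (bp i x v) \<noteq> z0" using f_bundle_point[OF ix] by blast
  then obtain l where l: "l < N" "\<gamma> l (f (bp i x v)) \<noteq> 0" using common_zero[of "f (bp i x v)"] v by blast
  have "v ^ k0 * D l i x v \<noteq> 0" using l(2) \<gamma>_eq[OF l(1) ix, of v] by argo
  then have "D l i x v \<noteq> 0" by simp
  then show ?thesis using l(1) by blast
qed

text \<open>The factor does not depend on \<open>l\<close>, so the point of projective space is
  independent of the trivialisation.\<close>

lemma D_change:
  assumes "l < N" "i \<in> I" "x \<in> U i" "j \<in> I" "x \<in> U j"
  shows "D l i x v = g j i x ^ k0 * D l j x (g j i x * v)"
proof (cases "v = 0")
  case True
  have "coef l k0 i x = g j i x ^ k0 * coef l k0 j x"
    using coef_section[OF assms(1), of k0] assms unfolding global_section_dual_power by blast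
  then show ?thesis by (simp add: True D_zero)
next
  case False
  have "v ^ k0 * D l i x v = \<gamma> l (f (bp i x v))" by (rule \<gamma>_eq[OF assms(1-3), symmetric])
  also have "bp i x v = bp j x (g j i x * v)" by (rule bundle_point_change[OF assms(2-5)])
  also have "\<gamma> l (f \<dots>) = (g j i x * v) ^ k0 * D l j x (g j i x * v)" by (rule \<gamma>_eq[OF assms(1,4,5)])
  finally show ?thesis using False by (simp add: power_mult_distrib)
qed

definition \<Phi> :: "('i \<times> 'a \<times> complex) set \<Rightarrow> (nat \<Rightarrow> complex) set" where
  "\<Phi> p = (case bundle_rep p of (i, x, v) \<Rightarrow> proj_class (vec N (\<lambda>l. D l i x v)))"

lemma \<Phi>_bundle_point:
  assumes ix: "i \<in> I" "x \<in> U i"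
  shows "\<Phi> (bp i x v) = proj_class (vec N (\<lambda>l. D l i x v))"
proof -
  obtain j where j: "j \<in> I" "x \<in> U j" "bundle_rep (bp i x v) = (j, x, g j i x * v)" using bundle_rep[OF ix] .
  have "vec N (\<lambda>l. D l i x v) = vec N (\<lambda>l. g j i x ^ k0 * D l j x (g j i x * v))"
    unfolding vec_def by (intro ext if_cong refl) (rule D_change[OF _ ix j(1,2)])
  then show ?thesis
    using proj_class_scale[of "g j i x ^ k0" N "\<lambda>l. D l j x (g j i x * v)"] trans_nonzero[OF j(1) ix(1) j(2) ix(2)]
    by (simp add: \<Phi>_def j(3))
qed

lemma \<Phi>_hol: "holomorphic_map EW (Pspace N) \<Phi>"
proof -
  have chart: "holomorphic_map (sub_fspace (P i) (preim i (over W))) (Pspace N) (\<lambda>t. proj_class (vec N (\<lambda>l. (\<lambda>(x, v). D l i x v) t)))"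
    and opP: "openin (topo (P i)) (preim i (over W))" if i: "i \<in> I" for i
  proof -
    show op: "openin (topo (P i)) (preim i (over W))" using openin_over[OF W] i unfolding openin_total by blast
    show "holomorphic_map (sub_fspace (P i) (preim i (over W))) (Pspace N) (\<lambda>t. proj_class (vec N (\<lambda>l. (\<lambda>(x, v). D l i x v) t)))"
    proof (rule holomorphic_map_proj[OF analytic_P op])
      show "(\<lambda>(x, v). D l i x v) \<in> hol (P i) (preim i (over W))" if "l < N" for l
        by (rule trace_dq_hol[OF openin_over[OF W] zero_section_over[OF z0W] pullback_hol[OF W \<gamma>_hol[OF that]] i])
      show "\<exists>l<N. (\<lambda>(x, v). D l i x v) t \<noteq> 0" if "t \<in> preim i (over W)" for t
        using D_nonzero[OF i] that by (cases t) auto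
    qed
  qed
  have ts: "topspace (topo (sub_fspace (P i) (preim i (over W)))) = preim i (over W)" if "i \<in> I" for i
    unfolding topspace_sub_fspace[of "P i"] using openin_subset[OF opP[OF that]] by (rule Int_absorb1)
  have eqv: "{t \<in> preim i (over W). proj_class (vec N (\<lambda>l. (\<lambda>(x, v). D l i x v) t)) \<in> V} = preim i {p \<in> over W. \<Phi> p \<in> V}" if "i \<in> I" for i V
    using \<Phi>_bundle_point[OF that] by auto
  have op: "openin (topo E) {p \<in> over W. \<Phi> p \<in> V}" if V: "openin (topo (Pspace N)) V" for V
    unfolding openin_total
  proof (intro conjI ballI)
    fix i assume i: "i \<in> I"
    from holomorphic_map_openin[OF chart[OF i] V] show "openin (topo (P i)) (preim i {p \<in> over W. \<Phi> p \<in> V})"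
      unfolding ts[OF i] eqv[OF i] openin_sub_fspace_open[OF opP[OF i]] by (rule conjunct1)
  qed blast
  show ?thesis
  proof (rule holomorphic_mapI, unfold topspace_EW)
    show "\<Phi> \<in> over W \<rightarrow> topspace (topo (Pspace N))"
    proof
      fix p assume p: "p \<in> over W"
      then obtain i x v where ix: "i \<in> I" "x \<in> U i" "p = bp i x v" using total_point by blast
      then obtain l where "l < N" "D l i x v \<noteq> 0" using D_nonzero p by blast
      from vec_nonzero[of l N "\<lambda>l. D l i x v", OF this] show "\<Phi> p \<in> topspace (topo (Pspace N))"
        unfolding ix(3) \<Phi>_bundle_point[OF ix(1,2)] topspace_Pspace by blast
    qed
  next
    fix V assume V: "openin (topo (Pspace N)) V"
    show "openin (topo EW) {p \<in> over W. \<Phi> p \<in> V}" unfolding openin_EW using op[OF V] by blast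
    fix h assume h: "h \<in> hol (Pspace N) V"
    have "(\<lambda>p. h (\<Phi> p)) \<in> hol E {p \<in> over W. \<Phi> p \<in> V}"
      unfolding hol_total
    proof
      fix i assume i: "i \<in> I"
      have opi: "openin (topo (P i)) (preim i {p \<in> over W. \<Phi> p \<in> V})" using op[OF V] i unfolding openin_total by blast
      from holomorphic_map_hol[OF chart[OF i] V h]
      have "(\<lambda>t. h (proj_class (vec N (\<lambda>l. (\<lambda>(x, v). D l i x v) t)))) \<in> hol (sub_fspace (P i) (preim i (over W))) (preim i {p \<in> over W. \<Phi> p \<in> V})"
        unfolding ts[OF i] eqv[OF i] .
      then have "(\<lambda>t. h (proj_class (vec N (\<lambda>l. (\<lambda>(x, v). D l i x v) t)))) \<in> hol (P i) (preim i {p \<in> over W. \<Phi> p \<in> V})"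
        using hol_sub_fspace_open[OF analytic_sheaf[OF analytic_P] opP[OF i] opi] by auto
      then show "(\<lambda>(x, v). h (\<Phi> (bp i x v))) \<in> hol (P i) (preim i {p \<in> over W. \<Phi> p \<in> V})"
        by (rule function_sheaf_cong[OF analytic_sheaf[OF analytic_P] opi]) (use \<Phi>_bundle_point[OF i] in auto)
    qed
    then show "(\<lambda>p. h (\<Phi> p)) \<in> hol EW {p \<in> over W. \<Phi> p \<in> V}" using hol_EW[OF op[OF V]] by blast
  qed
qed

section \<open>The map to the blow-up and its bijectivity\<close>

definition F :: "('i \<times> 'a \<times> complex) set \<Rightarrow> 'c \<times> (nat \<Rightarrow> complex) set" where
  "F p = (f p, \<Phi> p)"

lemma f_hol_EW: "holomorphic_map EW ZW f"
  by (rule holomorphic_map_into_sub[OF analytic_EW analytic_Z holomorphic_map_restrict[OF analytic_total f_hol]])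
    (use topspace_EW in blast)

lemma F_hol_ZP: "holomorphic_map EW ZP F"
  unfolding F_def[abs_def] by (rule holomorphic_map_pair[OF analytic_EW f_hol_EW \<Phi>_hol])

lemma F_off_zero:
  assumes p: "p \<in> over W" "f p \<noteq> z0"
  shows "F p = (f p, proj_class (vec N (\<lambda>k. \<gamma> k (f p))))"
proof -
  obtain i x v where ix: "i \<in> I" "x \<in> U i" "p = bp i x v" using total_point p by blast
  have v: "v \<noteq> 0" using p(2) f_bundle_point[OF ix(1,2)] ix(3) by blast
  have "vec N (\<lambda>k. \<gamma> k (f p)) = vec N (\<lambda>l. v ^ k0 * D l i x v)"
    unfolding vec_def ix(3) by (intro ext if_cong refl) (rule \<gamma>_eq[OF _ ix(1,2)])
  then show ?thesis
    using proj_class_scale[of "v ^ k0" N "\<lambda>l. D l i x v"] v \<Phi>_bundle_point[OF ix(1,2), of v] by (simp add: F_def ix(3))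
qed

lemma \<Gamma>_subset: "\<Gamma> \<subseteq> topspace (topo ZP)"
  unfolding topspace_ZP topspace_Pspace topspace_ZW using \<gamma>_vec by blast

text \<open>A point of the zero section is approached along its own fibre by points off the zero
  section, whose images lie on the graph.\<close>

lemma F_BS: "p \<in> over W \<Longrightarrow> F p \<in> BS"
proof (cases "f p = z0")
  case False
  assume p: "p \<in> over W"
  then have "F p \<in> \<Gamma>" unfolding F_off_zero[OF p False] topspace_ZW using False by blast
  then show ?thesis using closure_of_subset[OF \<Gamma>_subset] by blast
next
  case True
  assume p: "p \<in> over W"
  then have "p \<in> zero_section L" using True f_eq_z0_iff by blast
  then obtain i x where ix: "i \<in> I" "x \<in> U i" "p = bp i x 0" unfolding zero_section_def by blast
  show ?thesis
    unfolding in_closure_of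
  proof (intro conjI allI impI)
    show "F p \<in> topspace (topo ZP)" using holomorphic_map_in[OF F_hol_ZP, of p] p unfolding topspace_EW by blast
    fix T assume T: "F p \<in> T \<and> openin (topo ZP) T"
    then have Q: "openin (topo E) {p \<in> over W. F p \<in> T}"
      using holomorphic_map_openin[OF F_hol_ZP, of T] unfolding topspace_EW openin_EW by blast
    have "open {v. bp i x v \<in> {p \<in> over W. F p \<in> T}}"
      by (rule fibre_hol(2)[OF Q hol_const[OF analytic_total Q] ix(1,2)])
    moreover have "0 \<in> {v. bp i x v \<in> {p \<in> over W. F p \<in> T}}" using p T ix(3) by simp
    ultimately obtain r where r: "r > 0" "ball 0 r \<subseteq> {v. bp i x v \<in> {p \<in> over W. F p \<in> T}}"
      unfolding open_contains_ball by blast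
    let ?v = "complex_of_real (r / 2)"
    have v: "?v \<in> ball 0 r" "?v \<noteq> 0" using r(1) by (auto simp: norm_of_real)
    have b: "bp i x ?v \<in> over W" "F (bp i x ?v) \<in> T" using subsetD[OF r(2) v(1)] by blast+
    have ne: "f (bp i x ?v) \<noteq> z0" using f_bundle_point[OF ix(1,2)] v(2) by blast
    have "F (bp i x ?v) \<in> \<Gamma>" unfolding F_off_zero[OF b(1) ne] topspace_ZW using b(1) ne by blast
    then show "\<exists>y. y \<in> \<Gamma> \<and> y \<in> T" using b(2) by blast
  qed
qed

text \<open>\<open>f\<close> is proper, and pairing it with a continuous map into a Hausdorff space
  keeps it proper. This yields both surjectivity onto the closure and continuity of the
  inverse.\<close>

lemma F_closed: "closed_map (topo EW) (topo ZP) F"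
proof -
  have "proper_map (topo EW) (topo ZW) f"
    unfolding topo_sub_fspace by (rule proper_map_restriction[OF f_proper]) blast
  moreover have "continuous_map (topo EW) (topo (Pspace N)) \<Phi>" using \<Phi>_hol unfolding holomorphic_map_def by blast
  ultimately have "proper_map (topo EW) (prod_topology (topo ZW) (topo (Pspace N))) (\<lambda>p. (f p, \<Phi> p))"
    using Hausdorff_Pspace by (intro proper_map_paired) blast
  then show ?thesis unfolding topo_prod_fspace F_def[abs_def] by (rule proper_imp_closed_map)
qed

lemma f_inverse:
  "\<exists>\<theta>. holomorphic_map (sub_fspace Z (topspace (topo Z) - {z0})) (sub_fspace E (topspace (topo E) - zero_section L)) \<theta> \<and>
    (\<forall>p \<in> topspace (topo E) - zero_section L. \<theta> (f p) = p) \<and> (\<forall>z \<in> topspace (topo Z) - {z0}. f (\<theta> z) = z)"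
proof -
  have 1: "topspace (topo (sub_fspace E (topspace (topo E) - zero_section L))) = topspace (topo E) - zero_section L" by auto
  have 2: "topspace (topo (sub_fspace Z (topspace (topo Z) - {z0}))) = topspace (topo Z) - {z0}" by auto
  show ?thesis using f_biholomorphic unfolding biholomorphic_map_def 1 2 by (rule conjunct2)
qed

text \<open>The image is closed and contains the graph, which is reached through the inverse of
  \<open>f\<close> off \<open>z0\<close>; hence it contains the closure.\<close>

lemma F_image: "F ` over W = BS"
proof
  show "F ` over W \<subseteq> BS" using F_BS by blast
  have "closedin (topo ZP) (F ` over W)"
    using F_closed closedin_topspace[of "topo EW"] unfolding closed_map_def topspace_EW by blast
  moreover have "\<Gamma> \<subseteq> F ` over W"
  proof
    fix y assume "y \<in> \<Gamma>"
    then obtain z where z: "z \<in> W" "z \<noteq> z0" "y = (z, proj_class (vec N (\<lambda>k. \<gamma> k z)))" unfolding topspace_ZW by blast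
    obtain \<theta> where \<theta>: "holomorphic_map (sub_fspace Z (topspace (topo Z) - {z0})) (sub_fspace E (topspace (topo E) - zero_section L)) \<theta>"
      "\<forall>z \<in> topspace (topo Z) - {z0}. f (\<theta> z) = z" using f_inverse by blast
    have zZ: "z \<in> topspace (topo Z) - {z0}" using z(1,2) openin_subset[OF W] by blast
    then have "\<theta> z \<in> topspace (topo E)" using holomorphic_map_in[OF \<theta>(1), of z] by simp
    moreover have fz: "f (\<theta> z) = z" using \<theta>(2) zZ by blast
    ultimately have p: "\<theta> z \<in> over W" using z(1) by simp
    have "F (\<theta> z) = y" using F_off_zero[OF p] fz z(2,3) by simp
    then show "y \<in> F ` over W" using p by blast
  qed
  ultimately show "BS \<subseteq> F ` over W" by (intro closure_of_minimal)
qed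

lemma \<Psi>_inj: "inj_on \<Psi> (topspace (topo X))"
proof -
  obtain \<theta> where "\<forall>x \<in> topspace (topo X). \<theta> (\<Psi> x) = x"
    using embedding unfolding closed_embedding_def biholomorphic_map_def by blast
  then show ?thesis by (intro inj_on_inverseI[of _ \<theta>]) blast
qed

text \<open>Off the zero section \<open>f\<close> is already injective. On it, equal values of
  \<Phi> mean proportional leading coefficients; these determine the \<open>s k\<close> up to the
  same factor, and \<Psi> is injective.\<close>

lemma F_inj: "inj_on F (over W)"
proof (rule inj_onI)
  fix p q assume p: "p \<in> over W" and q: "q \<in> over W" and eq: "F p = F q"
  then have feq: "f p = f q" and \<Phi>eq: "\<Phi> p = \<Phi> q" by (simp_all add: F_def)
  show "p = q"
  proof (cases "f p = z0")
    case False
    then have "f q \<noteq> z0" using feq by simp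
    with False have "p \<in> topspace (topo E) - zero_section L" "q \<in> topspace (topo E) - zero_section L"
      using p q f_eq_z0_iff[of p] f_eq_z0_iff[of q] by blast+
    moreover obtain \<theta> where "\<forall>p \<in> topspace (topo E) - zero_section L. \<theta> (f p) = p" using f_inverse by blast
    ultimately have "\<theta> (f p) = p" "\<theta> (f q) = q" by blast+
    then show ?thesis by (rule box_equals[OF arg_cong[OF feq, of \<theta>]])
  next
    case True
    then have "f q = z0" using feq by simp
    with True have "p \<in> zero_section L" "q \<in> zero_section L"
      using p q f_eq_z0_iff[of p] f_eq_z0_iff[of q] by blast+
    then obtain i x j y where ix: "i \<in> I" "x \<in> U i" "p = bp i x 0" and jy: "j \<in> I" "y \<in> U j" "q = bp j y 0"
      unfolding zero_section_def by blast
    have "proj_class (vec N (\<lambda>l. coef l k0 i x)) = proj_class (vec N (\<lambda>l. coef l k0 j y))"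
      using \<Phi>eq unfolding ix(3) jy(3) \<Phi>_bundle_point[OF ix(1,2)] \<Phi>_bundle_point[OF jy(1,2)] D_zero .
    then obtain a where a: "a \<noteq> 0" "vec N (\<lambda>l. coef l k0 j y) = (\<lambda>l. a * vec N (\<lambda>l. coef l k0 i x) l)"
      unfolding proj_class_eq_iff by blast
    have ca: "coef l k0 j y = a * coef l k0 i x" if "l < N" for l
      using fun_cong[OF a(2), of l] that by (simp add: vec_nth)
    \<comment> \<open>The constants \<open>c l z0\<close> are the same at both base points, because
      the expansion coefficients live on \<open>Z\<close>.\<close>
    have sa: "s k j y = a * s k i x" if k: "k < M" for k
    proof -
      obtain V c where e: "ideal_expansion k0 (s k) V c" using s_expansion[OF k] by blast
      have "s k j y = (\<Sum>l<N. c l z0 * coef l k0 j y)" by (rule expansion_leading(2)[OF e jy(1,2) coef_below_k0[OF _ _ jy(1,2)] refl])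
      also have "\<dots> = (\<Sum>l<N. a * (c l z0 * coef l k0 i x))" by (intro sum.cong refl) (simp add: ca)
      also have "\<dots> = a * s k i x"
        by (simp only: sum_distrib_left[symmetric] expansion_leading(2)[OF e ix(1,2) coef_below_k0[OF _ _ ix(1,2)] refl])
      finally show ?thesis .
    qed
    have "vec M (\<lambda>k. s k j y) = vec M (\<lambda>k. a * s k i x)" using sa by (auto simp: vec_def fun_eq_iff)
    then have "\<Psi> y = \<Psi> x" unfolding \<Psi>[OF ix(1,2)] \<Psi>[OF jy(1,2)] using proj_class_scale[OF a(1)] by simp
    moreover have "x \<in> topspace (topo X)" "y \<in> topspace (topo X)"
      using subsetD[OF openin_subset[OF openin_triv]] ix(1,2) jy(1,2) by blast+
    ultimately have "x = y" using inj_onD[OF \<Psi>_inj, of y x] by simp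
    then show ?thesis unfolding ix(3) jy(3) using bundle_point_eq_iff[OF ix(1,2) jy(1,2)] by simp
  qed
qed

text \<open>An injective closed map is open onto its image: complements are mapped to
  complements.\<close>

lemma F_open_image:
  assumes S: "openin (topo E) S" "S \<subseteq> over W"
  shows "\<exists>V. openin (topo ZP) V \<and> F ` S = V \<inter> BS"
proof -
  have "openin (topo EW) S" unfolding openin_EW using S by blast
  from closedin_diff[OF closedin_topspace this] have "closedin (topo EW) (over W - S)" unfolding topspace_EW .
  then have c: "closedin (topo ZP) (F ` (over W - S))" using F_closed unfolding closed_map_def by blast
  have "F ` S = F ` over W - F ` (over W - S)" using inj_on_image_set_diff[OF F_inj, of "over W" "over W - S"] S(2) by (simp add: double_diff)
  also have "\<dots> = (topspace (topo ZP) - F ` (over W - S)) \<inter> BS"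
    unfolding F_image using closure_of_subset_topspace[of "topo ZP" \<Gamma>] by blast
  finally show ?thesis using openin_diff[OF openin_topspace c] by blast
qed

text \<open>The germ of \<open>h\<close> at \<open>p0\<close> is the pull-back by \<open>F\<close>
  of a germ on the ambient product, in the form in which functions on a subspace are defined. If all
  holomorphic germs lift, the inverse of \<open>F\<close> is holomorphic.\<close>

definition lift :: "('i \<times> 'a \<times> complex) set \<Rightarrow> (('i \<times> 'a \<times> complex) set \<Rightarrow> complex) \<Rightarrow> bool" where
  "lift p0 h \<longleftrightarrow> (\<exists>V b S. openin (topo ZP) V \<and> F p0 \<in> V \<and> b \<in> hol ZP V \<and> openin (topo E) S \<and> p0 \<in> S \<and>
     S \<subseteq> over W \<and> (\<forall>p \<in> S. F p \<in> V \<and> h p = b (F p)))"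

lemma openin_F_preimage: "openin (topo ZP) V \<Longrightarrow> openin (topo E) {p \<in> over W. F p \<in> V}"
  using holomorphic_map_openin[OF F_hol_ZP, of V] unfolding topspace_EW openin_EW by blast

lemma liftI:
  assumes "openin (topo ZP) V" "F p0 \<in> V" "b \<in> hol ZP V" "openin (topo E) S" "p0 \<in> S" "p0 \<in> over W"
    "\<And>p. p \<in> S \<Longrightarrow> p \<in> over W \<Longrightarrow> F p \<in> V \<Longrightarrow> h p = b (F p)"
  shows "lift p0 h"
  unfolding lift_def
proof (intro exI[of _ V] exI[of _ b] exI[of _ "S \<inter> {p \<in> over W. F p \<in> V}"] conjI ballI)
  show "openin (topo E) (S \<inter> {p \<in> over W. F p \<in> V})" using assms(4) openin_F_preimage[OF assms(1)] by (rule openin_Int)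
qed (use assms in blast)+

lemma liftE:
  assumes "lift p0 h"
  obtains V b S where "openin (topo ZP) V" "F p0 \<in> V" "b \<in> hol ZP V" "openin (topo E) S" "p0 \<in> S" "S \<subseteq> over W"
    "\<forall>p \<in> S. F p \<in> V \<and> h p = b (F p)"
  using assms unfolding lift_def by (elim exE conjE)

lemma lift_cong:
  assumes "lift p0 h" "openin (topo E) T" "p0 \<in> T" "\<And>p. p \<in> T \<Longrightarrow> p \<in> over W \<Longrightarrow> h' p = h p"
  shows "lift p0 h'"
proof (rule liftE[OF assms(1)])
  fix V b S assume *: "openin (topo ZP) V" "F p0 \<in> V" "b \<in> hol ZP V" "openin (topo E) S" "p0 \<in> S" "S \<subseteq> over W"
    "\<forall>p \<in> S. F p \<in> V \<and> h p = b (F p)"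
  show ?thesis
  proof (rule liftI[OF *(1-3)])
    show "openin (topo E) (S \<inter> T)" using *(4) assms(2) by (rule openin_Int)
    show "h' p = b (F p)" if "p \<in> S \<inter> T" "p \<in> over W" for p
    proof -
      have "h' p = h p" using assms(4) that by blast
      also have "h p = b (F p)" using *(7) that(1) by blast
      finally show ?thesis .
    qed
  qed (use * assms in blast)+
qed

lemma lift_common:
  fixes n :: nat
  assumes p0: "p0 \<in> over W" and "\<And>k. k < n \<Longrightarrow> lift p0 (c k)"
  shows "\<exists>V b S. openin (topo ZP) V \<and> F p0 \<in> V \<and> (\<forall>k<n. b k \<in> hol ZP V) \<and> openin (topo E) S \<and> p0 \<in> S \<and>
     S \<subseteq> over W \<and> (\<forall>p \<in> S. F p \<in> V \<and> (\<forall>k<n. c k p = b k (F p)))"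
  using assms(2)
proof (induction n)
  case 0
  have "F p0 \<in> topspace (topo ZP)" using holomorphic_map_in[OF F_hol_ZP, of p0] p0 unfolding topspace_EW by blast
  moreover have "\<forall>p \<in> over W. F p \<in> topspace (topo ZP)" using holomorphic_map_in[OF F_hol_ZP] unfolding topspace_EW by blast
  ultimately show ?case using p0 openin_over[OF W]
    by (intro exI[of _ "topspace (topo ZP)"] exI[of _ "\<lambda>_ _. 0"] exI[of _ "over W"]) blast
next
  case (Suc n)
  have "\<exists>V b S. openin (topo ZP) V \<and> F p0 \<in> V \<and> (\<forall>k<n. b k \<in> hol ZP V) \<and> openin (topo E) S \<and> p0 \<in> S \<and>
     S \<subseteq> over W \<and> (\<forall>p \<in> S. F p \<in> V \<and> (\<forall>k<n. c k p = b k (F p)))"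
    by (rule Suc.IH) (rule Suc.prems, simp)
  then obtain V b S where 1: "openin (topo ZP) V" "F p0 \<in> V" "\<forall>k<n. b k \<in> hol ZP V" "openin (topo E) S" "p0 \<in> S"
     "S \<subseteq> over W" "\<forall>p \<in> S. F p \<in> V \<and> (\<forall>k<n. c k p = b k (F p))" by (elim exE conjE)
  have "lift p0 (c n)" using Suc.prems by simp
  then obtain V' b' S' where 2: "openin (topo ZP) V'" "F p0 \<in> V'" "b' \<in> hol ZP V'" "openin (topo E) S'" "p0 \<in> S'" "S' \<subseteq> over W"
    "\<forall>p \<in> S'. F p \<in> V' \<and> c n p = b' (F p)" unfolding lift_def by (elim exE conjE)
  have V: "openin (topo ZP) (V \<inter> V')" using 1(1) 2(1) by (rule openin_Int)
  show ?case
  proof (intro exI[of _ "V \<inter> V'"] exI[of _ "b(n := b')"] exI[of _ "S \<inter> S'"] conjI allI impI ballI V)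
    show "openin (topo E) (S \<inter> S')" using 1(4) 2(4) by (rule openin_Int)
    show "(b(n := b')) k \<in> hol ZP (V \<inter> V')" if "k < Suc n" for k
    proof (cases "k = n")
      case True
      then show ?thesis using function_sheaf_mono[OF analytic_sheaf[OF analytic_ZP] 2(1) V _ 2(3)] by simp
    next
      case False
      then have "b k \<in> hol ZP V" using that 1(3) by simp
      then show ?thesis using False function_sheaf_mono[OF analytic_sheaf[OF analytic_ZP] 1(1) V] by simp
    qed
    show "c k p = (b(n := b')) k (F p)" if "p \<in> S \<inter> S'" "k < Suc n" for p k
      using that 1(7) 2(7) by (cases "k = n") auto
  qed (use 1 2 in blast)+
qed

text \<open>Germs that lift are closed under holomorphic substitution, so only enough germs to
  express all others have to be lifted.\<close>

lemma lift_compose: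
  assumes p0: "p0 \<in> over W" and c: "\<And>k. k < n \<Longrightarrow> lift p0 (c k)" and Q: "openin (topo (Cspace n)) Q" and H: "H \<in> hol (Cspace n) Q"
    and pD: "vec n (\<lambda>k. c k p0) \<in> Q"
  shows "lift p0 (\<lambda>p. H (vec n (\<lambda>k. c k p)))"
proof -
  have "\<exists>V b S. openin (topo ZP) V \<and> F p0 \<in> V \<and> (\<forall>k<n. b k \<in> hol ZP V) \<and> openin (topo E) S \<and> p0 \<in> S \<and>
     S \<subseteq> over W \<and> (\<forall>p \<in> S. F p \<in> V \<and> (\<forall>k<n. c k p = b k (F p)))"
    by (rule lift_common[OF p0 c])
  then obtain V b S where 1: "openin (topo ZP) V" "F p0 \<in> V" "\<forall>k<n. b k \<in> hol ZP V" "openin (topo E) S" "p0 \<in> S"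
     "S \<subseteq> over W" "\<forall>p \<in> S. F p \<in> V \<and> (\<forall>k<n. c k p = b k (F p))" by (elim exE conjE)
  have eq: "vec n (\<lambda>k. c k p) = vec n (\<lambda>k. b k (F p))" if "p \<in> S" for p
    unfolding vec_def using 1(7) that by (intro ext if_cong refl) blast
  let ?V = "{w \<in> V. vec n (\<lambda>k. b k w) \<in> Q}"
  have V: "openin (topo ZP) ?V"
    by (rule openin_hol_vec_preimage[OF analytic_ZP 1(1) _ Q]) (use 1(3) in blast)
  show ?thesis
  proof (rule liftI[OF V _ _ 1(4,5) p0])
    show "F p0 \<in> ?V" using 1(2) pD eq[OF 1(5)] by simp
    show "(\<lambda>w. H (vec n (\<lambda>k. b k w))) \<in> hol ZP ?V"
    proof (rule hol_compose[OF analytic_ZP V _ Q H])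
      show "b k \<in> hol ZP ?V" if "k < n" for k
        by (rule function_sheaf_mono[OF analytic_sheaf[OF analytic_ZP] 1(1) V]) (use 1(3) that in blast)+
    qed blast
    show "H (vec n (\<lambda>k. c k p)) = H (vec n (\<lambda>k. b k (F p)))" if "p \<in> S" for p unfolding eq[OF that] ..
  qed
qed

lemma lift_mult:
  assumes "p0 \<in> over W" "lift p0 h1" "lift p0 h2"
  shows "lift p0 (\<lambda>p. h1 p * h2 p)"
proof -
  have op: "openin (topo (Cspace 2)) (Cn 2)" by simp
  have "(\<lambda>z. z 0 * z 1) \<in> hol (Cspace 2) (Cn 2)"
    by (intro hol_mult[OF analytic_Cspace op] coordinate_hol_Cspace) auto
  from lift_compose[OF assms(1) _ op this, of "\<lambda>k. if k = 0 then h1 else h2"] assms(2,3)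
  show ?thesis by (simp add: vec_nth)
qed

lemma lift_divide:
  assumes "p0 \<in> over W" "lift p0 h1" "lift p0 h2" "h2 p0 \<noteq> 0"
  shows "lift p0 (\<lambda>p. h1 p / h2 p)"
proof -
  have op: "openin (topo (Cspace 2)) {z \<in> Cn 2. z 1 \<in> - {0}}" by (rule openin_Cspace_coordinate) auto
  have "(\<lambda>z. z 0 / z 1) \<in> hol (Cspace 2) {z \<in> Cn 2. z 1 \<in> - {0}}"
    by (intro hol_divide[OF analytic_Cspace op] coordinate_hol_Cspace) auto
  from lift_compose[OF assms(1) _ op this, of "\<lambda>k. if k = 0 then h1 else h2"] assms(2-4)
  show ?thesis by (simp add: vec_nth)
qed

lemma lift_sum:
  fixes n :: nat
  assumes "p0 \<in> over W" "\<And>k. k < n \<Longrightarrow> lift p0 (c k)"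
  shows "lift p0 (\<lambda>p. \<Sum>k<n. c k p)"
proof -
  have op: "openin (topo (Cspace n)) (Cn n)" by simp
  have "(\<lambda>z. \<Sum>k<n. z k) \<in> hol (Cspace n) (Cn n)"
    by (intro hol_sum[OF analytic_Cspace op] coordinate_hol_Cspace) auto
  from lift_compose[OF assms(1,2) op this] show ?thesis by (simp add: vec_nth)
qed

lemma lift_pullback:
  assumes p0: "p0 \<in> over W" and A: "openin (topo Z) A" "f p0 \<in> A" and a: "a \<in> hol Z A"
  shows "lift p0 (\<lambda>p. a (f p))"
proof -
  have AW: "openin (topo Z) (A \<inter> W)" using A(1) W by (rule openin_Int)
  have "a \<in> hol Z (A \<inter> W)" by (rule function_sheaf_mono[OF analytic_sheaf[OF analytic_Z] A(1) AW _ a]) blast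
  then have aW: "a \<in> hol ZW (A \<inter> W)" using hol_ZW[OF AW] by blast
  have AZW: "openin (topo ZW) (A \<inter> W)" unfolding openin_sub_fspace_open[OF W] using AW by blast
  have F0: "F p0 \<in> (A \<inter> W) \<times> topspace (topo (Pspace N))"
    using holomorphic_map_in[OF F_hol_ZP, of p0] p0 A(2) unfolding topspace_EW topspace_ZP F_def by blast
  show ?thesis
  proof (rule liftI[OF _ F0 hol_prod_fst[OF analytic_ZW analytic_Pspace AZW openin_topspace aW] openin_over[OF W] p0 p0])
    show "openin (topo ZP) ((A \<inter> W) \<times> topspace (topo (Pspace N)))"
      unfolding topo_prod_fspace openin_prod_Times_iff using AZW openin_topspace by blast
  qed (simp add: F_def)
qed

lemma lift_ratio:
  assumes p0: "p0 \<in> over W" and "l < N" "i < N" and \<Phi>0: "\<Phi> p0 \<in> proj_chart N l"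
  shows "lift p0 (\<lambda>p. proj_ratio l i (\<Phi> p))"
proof -
  have W': "openin (topo ZW) W" using openin_topspace[of "topo ZW"] unfolding topspace_ZW .
  have F0: "F p0 \<in> W \<times> proj_chart N l" using p0 \<Phi>0 by (simp add: F_def)
  show ?thesis
  proof (rule liftI[OF _ F0 hol_prod_snd[OF analytic_ZW analytic_Pspace W' openin_proj_chart proj_ratio_hol[OF assms(3,2)]] openin_over[OF W] p0 p0])
    show "openin (topo ZP) (W \<times> proj_chart N l)"
      unfolding topo_prod_fspace openin_prod_Times_iff using W' openin_proj_chart by blast
  qed (simp add: F_def)
qed

lemma bundle_over_point:
  assumes "p \<in> bundle_over i" "i \<in> I"
  shows "p = bp i (bundle_proj p) (fibre_coord i p)" "bundle_proj p \<in> U i"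
proof -
  obtain j x v where j: "j \<in> I" "x \<in> U j" "p = bp j x v" using total_point assms(1) by blast
  then have x: "x \<in> U i" using assms(1) by simp
  have "p = bp i x (g i j x * v)" unfolding j(3) by (rule bundle_point_change[OF j(1,2) assms(2) x])
  then show "p = bp i (bundle_proj p) (fibre_coord i p)" using assms(2) x by simp
  show "bundle_proj p \<in> U i" using assms(1) by blast
qed

lemma zero_point: "i \<in> I \<Longrightarrow> x \<in> U i \<Longrightarrow> bp i x 0 \<in> over W"
  using bundle_point_in f_bundle_point[of i x 0] z0W by simp

context
  fixes i x0
  assumes ix: "i \<in> I" "x0 \<in> U i"
begin

abbreviation "p0 \<equiv> bp i x0 0"

text \<open>Dividing the expansion by v^k0 and by \<open>D l0\<close> leaves the sum of
  \<open>c l\<close> times the affine coordinate \<open>l\<close> in the chart \<open>l0\<close>: a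
  function on \<open>Z\<close> times a function on projective space in each term, all of which
  lift.\<close>

lemma lift_quotient:
  assumes e: "ideal_expansion (k0 + d) \<sigma> V c" and l0: "l0 < N" "D l0 i x0 0 \<noteq> 0"
  shows "lift p0 (\<lambda>p. \<sigma> i (bundle_proj p) * fibre_coord i p ^ d / D l0 i (bundle_proj p) (fibre_coord i p))"
proof -
  have V: "openin (topo Z) V" "z0 \<in> V" "V \<subseteq> W" and c: "\<And>l. l < N \<Longrightarrow> c l \<in> hol Z V"
    using e unfolding ideal_expansion_def by auto
  have p0: "p0 \<in> over W" by (rule zero_point[OF ix])
  have chart: "\<Phi> (bp i x v) \<in> proj_chart N l0 \<longleftrightarrow> D l0 i x v \<noteq> 0" if "x \<in> U i" for x v
    unfolding \<Phi>_bundle_point[OF ix(1) that] proj_class_in_chart[OF vec_in_Cn] using l0(1) by (simp add: vec_nth)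
  have \<Phi>0: "\<Phi> p0 \<in> proj_chart N l0" using chart[OF ix(2)] l0(2) by blast
  have f0: "f p0 \<in> V" using f_bundle_point[OF ix, of 0] V(2) by simp
  have R: "lift p0 (\<lambda>p. \<Sum>l<N. c l (f p) * proj_ratio l0 l (\<Phi> p))"
    by (intro lift_sum[OF p0] lift_mult[OF p0] lift_pullback[OF p0 V(1) f0 c] lift_ratio[OF p0 l0(1) _ \<Phi>0])
  let ?S = "over V \<inter> bundle_over i \<inter> {p \<in> over W. \<Phi> p \<in> proj_chart N l0}"
  show ?thesis
  proof (rule lift_cong[OF R])
    have "openin (topo E) {p \<in> over W. \<Phi> p \<in> proj_chart N l0}"
      using holomorphic_map_openin[OF \<Phi>_hol openin_proj_chart, of l0] unfolding topspace_EW openin_EW by blast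
    then show "openin (topo E) ?S" by (intro openin_Int openin_over[OF V(1)] openin_bundle_over[OF ix(1)])
    show "p0 \<in> ?S" using f0 p0 \<Phi>0 bundle_point_in[OF ix] ix by simp
    fix p assume p: "p \<in> ?S"
    let ?x = "bundle_proj p" and ?v = "fibre_coord i p"
    have pb: "p \<in> bundle_over i" using p by blast
    note px = bundle_over_point[OF pb ix(1)]
    have over: "bp i ?x ?v \<in> over V" unfolding px(1)[symmetric] using p by blast
    have "\<Phi> (bp i ?x ?v) \<in> proj_chart N l0" unfolding px(1)[symmetric] using p by blast
    then have nz: "D l0 i ?x ?v \<noteq> 0" using chart[OF px(2)] by blast
    have "proj_ratio l0 l (\<Phi> p) = D l i ?x ?v / D l0 i ?x ?v" if "l < N" for l
      by (subst px(1)) (simp add: \<Phi>_bundle_point[OF ix(1) px(2)] proj_ratio_class vec_nth that l0(1))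
    then have "(\<Sum>l<N. c l (f p) * proj_ratio l0 l (\<Phi> p)) = (\<Sum>l<N. c l (f p) * D l i ?x ?v) / D l0 i ?x ?v"
      unfolding sum_divide_distrib by (intro sum.cong refl) simp
    also have "(\<Sum>l<N. c l (f p) * D l i ?x ?v) = \<sigma> i ?x * ?v ^ d"
      using expansion_quotient[OF e ix(1) px(2) over] unfolding px(1)[symmetric] by (rule sym)
    finally show "\<sigma> i ?x * ?v ^ d / D l0 i ?x ?v = (\<Sum>l<N. c l (f p) * proj_ratio l0 l (\<Phi> p))" by (rule sym)
  qed
qed

text \<open>\<open>lift_quotient\<close> lifts sections only after division by \<open>D l0\<close>,
  which is not itself shown to lift. In the quotient of two such germs it cancels.\<close>

lemma lift_section_ratio:
  assumes e: "ideal_expansion (k0 + d) \<sigma> V c" and j: "j < M" "s j i x0 \<noteq> 0"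
  shows "lift p0 (\<lambda>p. \<sigma> i (bundle_proj p) * fibre_coord i p ^ d / s j i (bundle_proj p))"
proof -
  have p0: "p0 \<in> over W" by (rule zero_point[OF ix])
  \<comment> \<open>Some chart of the target contains the point; its index \<open>l0\<close> among
    the generators has nothing to do with the index \<open>j\<close> among the sections.\<close>
  obtain l0 where l0: "l0 < N" "D l0 i x0 0 \<noteq> 0" using D_nonzero[OF ix p0] by blast
  obtain V' c' where "ideal_expansion k0 (s j) V' c'" using s_expansion[OF j(1)] by blast
  then have e': "ideal_expansion (k0 + 0) (s j) V' c'" by simp
  have base: "bundle_proj p0 = x0" "fibre_coord i p0 = 0" using ix by simp_all
  have "s j i (bundle_proj p0) * fibre_coord i p0 ^ 0 / D l0 i (bundle_proj p0) (fibre_coord i p0) \<noteq> 0"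
    unfolding base using j(2) l0(2) by simp
  from lift_divide[OF p0 lift_quotient[OF e l0] lift_quotient[OF e' l0] this]
  have R: "lift p0 (\<lambda>p. \<sigma> i (bundle_proj p) * fibre_coord i p ^ d / D l0 i (bundle_proj p) (fibre_coord i p) /
      (s j i (bundle_proj p) * fibre_coord i p ^ 0 / D l0 i (bundle_proj p) (fibre_coord i p)))" .
  let ?S = "bundle_over i \<inter> {p \<in> over W. \<Phi> p \<in> proj_chart N l0}"
  have chart: "\<Phi> (bp i x v) \<in> proj_chart N l0 \<longleftrightarrow> D l0 i x v \<noteq> 0" if "x \<in> U i" for x v
    unfolding \<Phi>_bundle_point[OF ix(1) that] proj_class_in_chart[OF vec_in_Cn] using l0(1) by (simp add: vec_nth)
  show ?thesis
  proof (rule lift_cong[OF R])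
    have "openin (topo E) {p \<in> over W. \<Phi> p \<in> proj_chart N l0}"
      using holomorphic_map_openin[OF \<Phi>_hol openin_proj_chart, of l0] unfolding topspace_EW openin_EW by blast
    then show "openin (topo E) ?S" by (intro openin_Int openin_bundle_over[OF ix(1)])
    show "p0 \<in> ?S" using p0 chart[OF ix(2), of 0] l0(2) bundle_point_in[OF ix] ix by simp
    fix p assume p: "p \<in> ?S"
    have pb: "p \<in> bundle_over i" using p by blast
    note px = bundle_over_point[OF pb ix(1)]
    have "\<Phi> (bp i (bundle_proj p) (fibre_coord i p)) \<in> proj_chart N l0" unfolding px(1)[symmetric] using p by blast
    then have "D l0 i (bundle_proj p) (fibre_coord i p) \<noteq> 0" using chart[OF px(2)] by blast
    then show "\<sigma> i (bundle_proj p) * fibre_coord i p ^ d / s j i (bundle_proj p) =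
      \<sigma> i (bundle_proj p) * fibre_coord i p ^ d / D l0 i (bundle_proj p) (fibre_coord i p) /
      (s j i (bundle_proj p) * fibre_coord i p ^ 0 / D l0 i (bundle_proj p) (fibre_coord i p))" by simp
  qed
qed

lemma openin_section_nonzero:
  assumes "global_section X (dual_power k) \<sigma>"
  shows "openin (topo E) {p \<in> topspace (topo E). bundle_proj p \<in> {x \<in> U i. \<sigma> i x \<in> - {0}}}"
proof (rule holomorphic_map_openin[OF holomorphic_map_bundle_proj])
  have "\<sigma> i \<in> hol X (U i)" using assms ix(1) unfolding global_section_dual_power by blast
  then show "openin (topo X) {x \<in> U i. \<sigma> i x \<in> - {0}}" by (rule analytic_openin[OF X openin_triv[OF ix(1)]]) auto
qed

text \<open>Since \<Psi> is a closed embedding, \<open>a\<close> is near \<open>x0\<close> a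
  function \<open>k\<close> on projective space evaluated at \<Psi>. The homogeneous coordinates of
  \<Psi>, normalised by \<open>s j\<close>, lift by \<open>lift_section_ratio\<close>, hence so does
  \<open>a\<close>.\<close>

lemma lift_base:
  assumes A: "openin (topo X) A" "x0 \<in> A" and a: "a \<in> hol X A"
  shows "lift p0 (\<lambda>p. a (bundle_proj p))"
proof -
  have p0: "p0 \<in> over W" by (rule zero_point[OF ix])
  have base: "bundle_proj p0 = x0" "fibre_coord i p0 = 0" using ix by simp_all
  obtain j where j: "j < M" "s j i x0 \<noteq> 0" using s_nonzero[OF ix] by blast
  let ?im = "\<Psi> ` topspace (topo X)"
  have ts: "topspace (topo (sub_fspace (Pspace M) ?im)) = ?im"
    unfolding topspace_sub_fspace[of "Pspace M"] using embedding closedin_subset unfolding closed_embedding_def by blast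
  obtain \<theta> where \<Psi>_hol: "holomorphic_map X (sub_fspace (Pspace M) ?im) \<Psi>"
    and \<theta>: "holomorphic_map (sub_fspace (Pspace M) ?im) X \<theta>" "\<forall>x \<in> topspace (topo X). \<theta> (\<Psi> x) = x"
    using embedding unfolding closed_embedding_def biholomorphic_map_def by blast
  have x0X: "x0 \<in> topspace (topo X)" using A openin_subset by blast
  have a\<theta>: "(\<lambda>\<zeta>. a (\<theta> \<zeta>)) \<in> hol (sub_fspace (Pspace M) ?im) {\<zeta> \<in> ?im. \<theta> \<zeta> \<in> A}"
    using holomorphic_map_hol[OF \<theta>(1) A(1) a] unfolding ts .
  have "\<Psi> x0 \<in> {\<zeta> \<in> ?im. \<theta> \<zeta> \<in> A}" using x0X \<theta>(2) A(2) by simp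
  from hol_sub_fspaceD[OF a\<theta> this] obtain V k where V: "openin (topo (Pspace M)) V" "\<Psi> x0 \<in> V"
    "V \<inter> ?im \<subseteq> {\<zeta> \<in> ?im. \<theta> \<zeta> \<in> A}" "k \<in> hol (Pspace M) V" "\<forall>\<zeta> \<in> V \<inter> ?im. a (\<theta> \<zeta>) = k \<zeta>"
    by (elim exE conjE)
  \<comment> \<open>The exponent 0 keeps the shape of \<open>lift_section_ratio\<close> for d =
    0.\<close>
  let ?c = "\<lambda>m p. s m i (bundle_proj p) * fibre_coord i p ^ 0 / s j i (bundle_proj p)"
  let ?D = "{z \<in> Cn M - {\<lambda>_. 0}. proj_class z \<in> V}"
  have c: "lift p0 (?c m)" if m: "m < M" for m
  proof -
    obtain V c where "ideal_expansion k0 (s m) V c" using s_expansion[OF m] by blast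
    then have "ideal_expansion (k0 + 0) (s m) V c" by simp
    from lift_section_ratio[OF this j] show ?thesis .
  qed
  have pc: "proj_class (vec M (\<lambda>m. ?c m p)) = \<Psi> (bundle_proj p)" if "bundle_proj p \<in> U i" "s j i (bundle_proj p) \<noteq> 0" for p
  proof -
    have "vec M (\<lambda>m. ?c m p) = vec M (\<lambda>m. inverse (s j i (bundle_proj p)) * s m i (bundle_proj p))"
      by (simp add: vec_def divide_inverse mult.commute)
    then show ?thesis
      using proj_class_scale[of "inverse (s j i (bundle_proj p))" M "\<lambda>m. s m i (bundle_proj p)"] that(2) \<Psi>[OF ix(1) that(1)] by simp
  qed
  have "vec M (\<lambda>m. ?c m p0) \<in> ?D"
  proof -
    have "vec M (\<lambda>m. ?c m p0) \<in> Cn M - {\<lambda>_. 0}" by (rule vec_nonzero[OF j(1)]) (unfold base, use j(2) in simp)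
    moreover have "proj_class (vec M (\<lambda>m. ?c m p0)) \<in> V" using pc[of p0] j(2) ix V(2) unfolding base by simp
    ultimately show ?thesis by blast
  qed
  moreover have "openin (topo (Cspace M)) ?D" using V(1) unfolding openin_Pspace by (rule conjunct2)
  moreover have "(\<lambda>z. k (proj_class z)) \<in> hol (Cspace M) ?D" using V(4) unfolding hol_Pspace[OF V(1)] .
  ultimately have R: "lift p0 (\<lambda>p. k (proj_class (vec M (\<lambda>m. ?c m p))))"
    by (intro lift_compose[OF p0 c, of M "\<lambda>m. m" ?D "\<lambda>z. k (proj_class z)"]) auto
  let ?S = "{p \<in> topspace (topo E). bundle_proj p \<in> {x \<in> U i. s j i x \<in> - {0}}} \<inter>
     {p \<in> topspace (topo E). bundle_proj p \<in> {x \<in> topspace (topo X). \<Psi> x \<in> V \<inter> ?im}}"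
  show ?thesis
  proof (rule lift_cong[OF R])
    have "openin (topo (sub_fspace (Pspace M) ?im)) (V \<inter> ?im)" using V(1) by (auto simp: openin_subtopology)
    from holomorphic_map_openin[OF \<Psi>_hol this]
    show "openin (topo E) ?S"
      by (intro openin_Int openin_section_nonzero[OF s[OF j(1)]] holomorphic_map_openin[OF holomorphic_map_bundle_proj])
    show "p0 \<in> ?S" using bundle_point_in[OF ix] j(2) ix(2) x0X V(2) by (simp add: base)
    fix p assume p: "p \<in> ?S"
    then have px: "bundle_proj p \<in> U i" "s j i (bundle_proj p) \<noteq> 0" "bundle_proj p \<in> topspace (topo X)" "\<Psi> (bundle_proj p) \<in> V \<inter> ?im"
      by blast+
    have "k (\<Psi> (bundle_proj p)) = a (\<theta> (\<Psi> (bundle_proj p)))" by (rule V(5)[rule_format, OF px(4), symmetric])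
    then show "a (bundle_proj p) = k (proj_class (vec M (\<lambda>m. ?c m p)))"
      unfolding pc[OF px(1,2)] using \<theta>(2) px(3) by simp
  qed
qed

text \<open>Take a section \<open>t\<close> of the power k0 + 1 with value 1 at \<open>x0\<close>.
  Then t v / s_j lifts as a section ratio with d = 1, t / s_j lifts as a function on the base, and
  the quotient of the two is v. Only here is global generation used.\<close>

lemma lift_fibre_coord: "lift p0 (fibre_coord i)"
proof -
  have p0: "p0 \<in> over W" by (rule zero_point[OF ix])
  have base: "bundle_proj p0 = x0" using ix by simp
  obtain j where j: "j < M" "s j i x0 \<noteq> 0" using s_nonzero[OF ix] by blast
  obtain t where t: "global_section X (dual_power (k0 + 1)) t" "t i x0 = 1"
    using generated ix unfolding globally_generated_def idx_dual_power triv_dual_power by blast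
  obtain V c where e: "ideal_expansion (k0 + 1) t V c" using section_expansion[OF t(1)] by auto
  let ?A = "{x \<in> U i. s j i x \<in> - {0}}"
  have sj: "s j i \<in> hol X (U i)" and ti: "t i \<in> hol X (U i)"
    using s[OF j(1)] t(1) ix(1) unfolding global_section_dual_power by blast+
  have A: "openin (topo X) ?A" by (rule analytic_openin[OF X openin_triv[OF ix(1)] sj]) auto
  have "(\<lambda>x. t i x / s j i x) \<in> hol X ?A"
  proof (rule hol_divide[OF X A])
    show "t i \<in> hol X ?A" "s j i \<in> hol X ?A"
      by (rule function_sheaf_mono[OF analytic_sheaf[OF X] openin_triv[OF ix(1)] A]; use sj ti in blast)+
  qed blast
  from lift_base[OF A _ this] j(2) ix(2)
  have B: "lift p0 (\<lambda>p. t i (bundle_proj p) / s j i (bundle_proj p))" by simp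
  have "t i (bundle_proj p0) / s j i (bundle_proj p0) \<noteq> 0" unfolding base using t(2) j(2) by simp
  from lift_divide[OF p0 lift_section_ratio[OF e j] B this]
  have R: "lift p0 (\<lambda>p. t i (bundle_proj p) * fibre_coord i p ^ 1 / s j i (bundle_proj p) / (t i (bundle_proj p) / s j i (bundle_proj p)))" .
  let ?S = "{p \<in> topspace (topo E). bundle_proj p \<in> {x \<in> U i. s j i x \<in> - {0}}} \<inter> {p \<in> topspace (topo E). bundle_proj p \<in> {x \<in> U i. t i x \<in> - {0}}}"
  show ?thesis
  proof (rule lift_cong[OF R])
    show "openin (topo E) ?S" by (intro openin_Int openin_section_nonzero[OF s[OF j(1)]] openin_section_nonzero[OF t(1)])
    show "p0 \<in> ?S" using bundle_point_in[OF ix] j(2) t(2) ix(2) by (simp add: base)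
    fix p assume "p \<in> ?S"
    then have "s j i (bundle_proj p) \<noteq> 0" "t i (bundle_proj p) \<noteq> 0" by blast+
    then show "fibre_coord i p = t i (bundle_proj p) * fibre_coord i p ^ 1 / s j i (bundle_proj p) / (t i (bundle_proj p) / s j i (bundle_proj p))"
      by simp
  qed
qed

text \<open>In a trivialisation every holomorphic function is locally an expression in functions of
  the base and of the fibre coordinate, and both kinds lift.\<close>

lemma lift_zero_section:
  assumes S: "openin (topo E) S" "p0 \<in> S" and h: "h \<in> hol E S"
  shows "lift p0 h"
proof -
  have p0: "p0 \<in> over W" by (rule zero_point[OF ix])
  have base: "bundle_proj p0 = x0" "fibre_coord i p0 = 0" using ix by simp_all
  have hP: "(\<lambda>(x, v). h (bp i x v)) \<in> hol (P i) (preim i S)" using h ix(1) unfolding hol_total by blast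
  have "(x0, 0) \<in> preim i S" using S(2) ix(2) by simp
  from hol_prod_fspaceD[OF hP this] obtain A B n c Q H where
    AB: "openin (topo (sub_fspace X (U i))) A" "openin (topo Cline) B" "(x0, 0) \<in> A \<times> B" "A \<times> B \<subseteq> preim i S"
    "\<forall>k<n. c k \<in> prod_generators (sub_fspace X (U i)) Cline A B" "openin (topo (Cspace n)) Q" "H \<in> hol (Cspace n) Q"
    "\<forall>w \<in> A \<times> B. vec n (\<lambda>k. c k w) \<in> Q \<and> (case w of (x, v) \<Rightarrow> h (bp i x v)) = H (vec n (\<lambda>k. c k w))"
    by (elim exE conjE)
  have A: "openin (topo X) A" "A \<subseteq> U i" "x0 \<in> A" using AB(1,3) unfolding openin_sub_triv[OF ix(1)] by blast+
  have B: "open B" "0 \<in> B" using AB(2,3) by simp_all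
  have c: "lift p0 (\<lambda>p. c k (bundle_proj p, fibre_coord i p))" if k: "k < n" for k
    using AB(5)[rule_format, OF k] unfolding prod_generators_def
  proof (elim UnE CollectE exE conjE)
    fix a assume a: "c k = a \<circ> fst" "a \<in> hol (sub_fspace X (U i)) A"
    have "a \<in> hol X A" using a(2) hol_sub_triv[OF ix(1) A(1,2)] by blast
    from lift_base[OF A(1,3) this] show ?thesis by (simp add: a(1))
  next
    fix b assume b: "c k = b \<circ> snd" "b \<in> hol Cline B"
    have op: "openin (topo (Cspace 1)) {z \<in> Cn 1. z 0 \<in> B}" by (rule openin_Cspace_coordinate[OF B(1)])
    have bh: "b holomorphic_on B" using b(2) by (simp add: hol_Cline)
    have "(\<lambda>z. b (z 0)) \<in> hol (Cspace 1) {z \<in> Cn 1. z 0 \<in> B}"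
      by (rule hol_holomorphic[OF analytic_Cspace op bh B(1) coordinate_hol_Cspace]) auto
    from lift_compose[OF p0 _ op this, of "\<lambda>_. fibre_coord i"] lift_fibre_coord base(2) B(2)
    show ?thesis by (simp add: b(1) vec_nth)
  qed
  have "vec n (\<lambda>k. c k (bundle_proj p0, fibre_coord i p0)) \<in> Q" unfolding base using AB(3,8) by blast
  from lift_compose[OF p0 c AB(6,7) this]
  have R: "lift p0 (\<lambda>p. H (vec n (\<lambda>k. c k (bundle_proj p, fibre_coord i p))))" .
  let ?T = "(\<lambda>(x, v). bp i x v) ` (A \<times> B)"
  show ?thesis
  proof (rule lift_cong[OF R])
    show "openin (topo E) ?T" by (rule openin_bundle_point_image[OF ix(1) openin_P_Times[OF ix(1) A(1,2) B(1)]])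
    show "p0 \<in> ?T" using AB(3) by force
    fix p assume "p \<in> ?T"
    then obtain x v where xv: "(x, v) \<in> A \<times> B" "p = bp i x v" by auto
    then have xU: "x \<in> U i" using A(2) by blast
    have "h p = H (vec n (\<lambda>k. c k (x, v)))" using AB(8)[rule_format, OF xv(1)] by (simp add: xv(2))
    then show "h p = H (vec n (\<lambda>k. c k (bundle_proj p, fibre_coord i p)))" using xv(2) ix(1) xU by simp
  qed
qed

end

text \<open>Off the zero section \<open>h\<close> factors through \<open>f\<close>, the first
  component of \<open>F\<close>, because \<open>f\<close> is biholomorphic there.\<close>

lemma lift_hol:
  assumes S: "openin (topo E) S" "S \<subseteq> over W" "p \<in> S" and h: "h \<in> hol E S"
  shows "lift p h"
proof (cases "f p = z0")
  case True
  then have "p \<in> zero_section L" using S f_eq_z0_iff by blast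
  then obtain i x where ix: "i \<in> I" "x \<in> U i" "p = bp i x 0" unfolding zero_section_def by blast
  show ?thesis using lift_zero_section[OF ix(1,2) S(1) _ h] S(3) unfolding ix(3) by blast
next
  case False
  have p: "p \<in> over W" using S by blast
  let ?Z = "topspace (topo Z) - {z0}" and ?E = "topspace (topo E) - zero_section L"
  obtain \<theta> where \<theta>: "holomorphic_map (sub_fspace Z ?Z) (sub_fspace E ?E) \<theta>" "\<forall>p \<in> ?E. \<theta> (f p) = p" using f_inverse by blast
  have Zop: "openin (topo Z) ?Z"
  proof -
    have "closedin (topo Z) {z0}" using Z_space z0_in unfolding complex_space_def by (intro closedin_Hausdorff_singleton) blast+
    then show ?thesis by (rule openin_diff[OF openin_topspace])
  qed
  have tsZ: "topspace (topo (sub_fspace Z ?Z)) = ?Z" by auto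
  have "holomorphic_map (sub_fspace Z ?Z) E \<theta>"
    using holomorphic_map_compose[OF analytic_sheaf[OF analytic_sub_fspace[OF analytic_Z]] \<theta>(1) holomorphic_map_inclusion] .
  note \<theta>E = holomorphic_map_openin[OF this S(1), unfolded tsZ] holomorphic_map_hol[OF this S(1) h, unfolded tsZ]
  let ?A = "{z \<in> ?Z. \<theta> z \<in> S}"
  have A: "openin (topo Z) ?A" using \<theta>E(1) unfolding openin_sub_fspace_open[OF Zop] by (rule conjunct1)
  have a: "(\<lambda>z. h (\<theta> z)) \<in> hol Z ?A"
    using \<theta>E(2) hol_sub_fspace_open[OF analytic_sheaf[OF analytic_Z] Zop A] by blast
  have pE: "p \<in> ?E" using False f_eq_z0_iff[of p] p by blast
  have "f p \<in> ?A" using pE \<theta>(2) S(3) False f_in[of p] p by simp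
  from lift_pullback[OF p A this a] have R: "lift p (\<lambda>p. h (\<theta> (f p)))" .
  show ?thesis
  proof (rule lift_cong[OF R])
    have "openin (topo E) (over ?Z)" by (rule openin_over[OF Zop])
    then show "openin (topo E) (over ?Z)" .
    show "p \<in> over ?Z" using p False f_in[of p] by blast
    fix q assume "q \<in> over ?Z"
    then have "q \<in> ?E" using f_eq_z0_iff[of q] by blast
    then show "h q = h (\<theta> (f q))" using \<theta>(2) by simp
  qed
qed

text \<open>The inverse exists by injectivity and \<open>F_image\<close>, is continuous by
  \<open>F_open_image\<close>, and is holomorphic because every germ lifts.\<close>

lemma F_biholomorphic: "biholomorphic_map EW (blow_up ZW z0 N \<gamma>) F"
proof -
  have tsB: "topspace (topo (sub_fspace ZP BS)) = BS"
    unfolding topspace_sub_fspace[of ZP BS] using closure_of_subset_topspace[of "topo ZP" \<Gamma>] by (rule Int_absorb1)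
  define G where "G = inv_into (over W) F"
  have GF: "G (F p) = p" if "p \<in> over W" for p unfolding G_def by (rule inv_into_f_f[OF F_inj that])
  have FG: "F (G y) = y" "G y \<in> over W" if "y \<in> BS" for y
    using that f_inv_into_f[of y F "over W"] inv_into_into[of y F "over W"] unfolding G_def F_image by blast+
  have pre: "{y \<in> BS. G y \<in> S} = F ` S" if S: "S \<subseteq> over W" for S
  proof
    show "{y \<in> BS. G y \<in> S} \<subseteq> F ` S"
    proof clarify
      fix y assume "y \<in> BS" "G y \<in> S"
      then show "y \<in> F ` S" using FG(1)[symmetric] by (intro image_eqI[of y F "G y"])
    qed
    show "F ` S \<subseteq> {y \<in> BS. G y \<in> S}"
    proof (intro subsetI CollectI conjI; elim imageE)
      fix y p assume "y = F p" "p \<in> S"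
      then show "y \<in> BS" using F_BS S by blast
    next
      fix y p assume p: "y = F p" "p \<in> S"
      then have "G y = p" using GF S by blast
      with p(2) show "G y \<in> S" by simp
    qed
  qed
  have G: "holomorphic_map (sub_fspace ZP BS) EW G"
  proof (rule holomorphic_mapI, unfold tsB topspace_EW)
    show "G \<in> BS \<rightarrow> over W" using FG(2) by blast
  next
    fix S assume "openin (topo EW) S"
    then have S: "openin (topo E) S" "S \<subseteq> over W" unfolding openin_EW by blast+
    obtain V0 where V0: "openin (topo ZP) V0" "F ` S = V0 \<inter> BS" using F_open_image[OF S] by blast
    show "openin (topo (sub_fspace ZP BS)) {y \<in> BS. G y \<in> S}"
      unfolding pre[OF S(2)] V0(2) topo_sub_fspace[of ZP] openin_subtopology using V0(1) by blast
    fix h assume "h \<in> hol EW S"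
    then have h: "h \<in> hol E S" using hol_EW[OF S] by blast
    show "(\<lambda>y. h (G y)) \<in> hol (sub_fspace ZP BS) {y \<in> BS. G y \<in> S}"
      unfolding pre[OF S(2)]
    proof (rule hol_sub_fspaceI)
      fix y assume "y \<in> F ` S"
      then obtain p where p: "p \<in> S" "y = F p" by blast
      from lift_hol[OF S p(1) h] obtain V b T where V: "openin (topo ZP) V" "F p \<in> V" "b \<in> hol ZP V" "openin (topo E) T" "p \<in> T"
        "T \<subseteq> over W" "\<forall>q \<in> T. F q \<in> V \<and> h q = b (F q)" unfolding lift_def by (elim exE conjE)
      have ST: "openin (topo E) (S \<inter> T)" "S \<inter> T \<subseteq> over W" using S V(4) by (auto intro: openin_Int)
      \<comment> \<open>\<open>b\<close> represents \<open>h\<close> only on \<open>T\<close>.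
        Intersecting with \<open>V1\<close> ensures that the points of the blow-up in the
        neighbourhood come from \<open>T\<close>.\<close>
      obtain V1 where V1: "openin (topo ZP) V1" "F ` (S \<inter> T) = V1 \<inter> BS" using F_open_image[OF ST] by blast
      let ?V = "V \<inter> V1"
      have oV: "openin (topo ZP) ?V" using V(1) V1(1) by (rule openin_Int)
      show "\<exists>V g. openin (topo ZP) V \<and> y \<in> V \<and> V \<inter> BS \<subseteq> F ` S \<and> g \<in> hol ZP V \<and> (\<forall>y\<in>V \<inter> BS. h (G y) = g y)"
      proof (intro exI[of _ ?V] exI[of _ b] conjI ballI oV)
        have "F p \<in> F ` (S \<inter> T)" using p(1) V(5) by blast
        then show "y \<in> ?V" unfolding V1(2) p(2) using V(2) by blast
        show "?V \<inter> BS \<subseteq> F ` S" using V1(2) by blast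
        show "b \<in> hol ZP ?V" by (rule function_sheaf_mono[OF analytic_sheaf[OF analytic_ZP] V(1) oV _ V(3)]) blast
        fix w assume "w \<in> ?V \<inter> BS"
        then have "w \<in> F ` (S \<inter> T)" unfolding V1(2) by blast
        then obtain q where q: "q \<in> S" "q \<in> T" "w = F q" by blast
        have "G w = q" unfolding q(3) using GF q(2) V(6) by blast
        then have "h (G w) = h q" by (rule arg_cong)
        also have "h q = b (F q)" using V(7) q(2) by simp
        finally show "h (G w) = b w" unfolding q(3) .
      qed
    qed
  qed
  have "holomorphic_map EW (sub_fspace ZP BS) F"
    by (rule holomorphic_map_into_sub[OF analytic_EW analytic_ZP F_hol_ZP]) (use F_BS topspace_EW in blast)
  with G show ?thesis
    unfolding biholomorphic_map_def blow_up_eq tsB topspace_EW using GF FG(1) by blast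
qed

end

text \<open>The quadratic transform hides a choice of generators. In one direction they are handed
  over and arbitrary; in the other any choice will do, and a chart of \<open>Z\<close> supplies
  one.\<close>

lemma (in blow_down) quadratic_transform_iff:
  assumes "connected_space (topo X)"
  shows "is_quadratic_transform E f Z z0 \<longleftrightarrow> very_ample X (dual_power k0) \<and> globally_generated X (dual_power (k0 + 1))"
proof (intro iffI conjI)
  assume "is_quadratic_transform E f Z z0"
  then obtain W N \<gamma> F where F: "generates_maximal_ideal Z z0 W N \<gamma>" "\<forall>z \<in> W. (\<forall>k < N. \<gamma> k z = 0) \<longrightarrow> z = z0"
    "biholomorphic_map (sub_fspace E (over W)) (blow_up (sub_fspace Z W) z0 N \<gamma>) F"
    "\<forall>p \<in> topspace (topo E). f p \<in> W \<longrightarrow> fst (F p) = f p"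
    unfolding is_quadratic_transform_def by (elim exE conjE)
  interpret quadratic_transform X L Z z0 f W N \<gamma> F
  proof unfold_locales
    show "z = z0" if "z \<in> W" "\<And>k. k < N \<Longrightarrow> \<gamma> k z = 0" for z using F(2) that by simp
  qed (use F(1,3,4) assms in simp_all)
  show "very_ample X (dual_power k0)" by (rule very_ample_k0)
  show "globally_generated X (dual_power (k0 + 1))" by (rule globally_generated_Suc_k0)
next
  assume "very_ample X (dual_power k0) \<and> globally_generated X (dual_power (k0 + 1))"
  then have va: "very_ample X (dual_power k0)" and gg: "globally_generated X (dual_power (k0 + 1))" by (rule conjunct1, rule conjunct2)
  obtain W N \<gamma> where gens: "generates_maximal_ideal Z z0 W N \<gamma>" "\<forall>z \<in> W. (\<forall>k<N. \<gamma> k z = 0) \<longrightarrow> z = z0"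
    using exists_generators by blast
  obtain M s \<Psi> where sec: "\<forall>k < M. global_section X (dual_power k0) (s k)"
    "\<forall>i \<in> I. \<forall>x \<in> U i. (\<exists>k < M. s k i x \<noteq> 0) \<and> \<Psi> x = proj_class (vec M (\<lambda>k. s k i x))"
    "closed_embedding X (Pspace M) \<Psi>"
    using va unfolding very_ample_def idx_dual_power triv_dual_power by (elim exE conjE)
  interpret ample_blow_down X L Z z0 f W N \<gamma> M s \<Psi>
  proof unfold_locales
    show "z = z0" if "z \<in> W" "\<And>k. k < N \<Longrightarrow> \<gamma> k z = 0" for z using gens(2) that by simp
    fix i x assume "i \<in> I" "x \<in> U i"
    note * = bspec[OF bspec[OF sec(2) this(1)] this(2)]
    show "\<exists>k<M. s k i x \<noteq> 0" by (rule conjunct1[OF *])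
    show "\<Psi> x = proj_class (vec M (\<lambda>k. s k i x))" by (rule conjunct2[OF *])
  qed (use sec(1,3) gens(1) gg in simp_all)
  have "{p \<in> topspace (topo E). f p \<noteq> z0} = topspace (topo E) - zero_section L" using f_eq_z0_iff by blast
  then have "biholomorphic_map (sub_fspace E {p \<in> topspace (topo E). f p \<noteq> z0}) (sub_fspace Z (topspace (topo Z) - {z0})) f"
    using f_biholomorphic by simp
  moreover have "\<forall>p \<in> topspace (topo E). f p \<in> W \<longrightarrow> fst (F p) = f p" by (simp add: F_def)
  ultimately show "is_quadratic_transform E f Z z0"
    unfolding is_quadratic_transform_def
    by (intro conjI exI[of _ W] exI[of _ N] exI[of _ \<gamma>] exI[of _ F] f_hol gens(1) F_biholomorphic)
      (use gens(2) in simp_all)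
qed

theorem theorem1p1:
  fixes X :: "'a fspace"
    and L :: "('i, 'a) line_bundle"
    and Z :: "'c fspace"
    and z0 :: 'c
    and f :: "('i \<times> 'a \<times> complex) set \<Rightarrow> 'c"
    and k0 :: nat
  assumes "complex_space X" and "compact_space (topo X)"
    and "holomorphic_line_bundle X L" and "negative_line_bundle X L"
    and "grauert_blow_down X L Z z0 f"
    and "k0 = initial_order X (dual_bundle L)"
  shows "is_quadratic_transform (total_space X L) f Z z0 \<longleftrightarrow>
           very_ample X (tensor_power k0 (dual_bundle L)) \<and>
           globally_generated X (tensor_power (k0 + 1) (dual_bundle L))"
proof -
  interpret blow_down X L Z z0 f
    by unfold_locales (use assms complex_space_analytic in blast)+
  have "connected_space (topo X)" using assms(1) by (simp add: complex_space_def)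
  from quadratic_transform_iff[OF this] show ?thesis unfolding assms(6) .
qed

end
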